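(* Let $\mathfrak g=\mathrm{osp}(1|2n)$ and let $\int$ be the Haar functional on $\mathcal T_q(\mathfrak g)$ given by $\int 1=1$ and $\int t^{(\lambda)}_{ij}=0$ for all $0\ne\lambda\in\mathcal P_+$ and all $i,j$. Then for all $\lambda,\mu\in\mathcal P_+$, all $i,j\in\{1,\dots,d_\lambda\}$ and all $r,s\in\{1,\dots,d_\mu\}$, $$\int t^{(\lambda)}_{ij}\,\tilde t^{(\mu)}_{rs}\,(-1)^{[j][r]+[i]+[j]}=\delta_{ir}\,\delta_{\lambda\mu}\,\frac{t^{(\lambda)}_{sj}(K_{2\rho})}{\mathrm{SD}_q(\lambda)},$$ $$\int \tilde t^{(\lambda)}_{ij}\,t^{(\mu)}_{rs}\,(-1)^{[j][r]}=\delta_{js}\,\delta_{\lambda\mu}\,\frac{\tilde t^{(\lambda)}_{ir}(K_{2\rho})}{\mathrm{SD}_q(\lambda)}.$$ (The right-hand sides are $0$ when $\lambda\ne\mu$.)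
   Context: **The quantum superalgebra.** $n\ge 1$; $q\in\mathbb C^{*}$ is generic (not a root of unity). Algebras, modules and maps are $\mathbb Z_2$-graded over $\mathbb C$; $[x]\in\{0,1\}$ is the parity of a homogeneous $x$; the usual sign rule $(a\otimes b)(c\otimes d)=(-1)^{[b][c]}ac\otimes bd$ holds. Let $\epsilon_1,\dots,\epsilon_n$ be an orthonormal basis of an $n$-dimensional Euclidean space $E$, $\alpha_i=\epsilon_i-\epsilon_{i+1}$ ($i<n$), $\alpha_n=\epsilon_n$, $a_{ij}=2(\alpha_i,\alpha_j)/(\alpha_i,\alpha_i)$. $\mathrm U_q(\mathfrak g)$, $\mathfrak g=\mathrm{osp}(1|2n)$, is the $\mathbb Z_2$-graded unital associative algebra generated by $k_i^{\pm1},e_i,f_i$ ($1\le i\le n$), all even except $e_n,f_n$ which are odd, with relations $k_ik_i^{-1}=1$, $k_ik_j=k_jk_i$, $k_ie_j=q^{(\alpha_i,\alpha_j)}e_jk_i$, $k_if_j=q^{-(\alpha_i,\alpha_j)}f_jk_i$, $e_if_j-(-1)^{[e_i][f_j]}f_je_i=\delta_{ij}\frac{k_i-k_i^{-1}}{q-q^{-1}}$, and $(\mathrm{Ad}\,e_i)^{1-a_{ij}}(e_j)=0=(\mathrm{Ad}\,f_i)^{1-a_{ij}}(f_j)$ for $i\ne j$, where $\mathrm{Ad}\,e_i(x)=e_ix-(-1)^{[e_i][x]}k_ixk_i^{-1}e_i$ and $\mathrm{Ad}\,f_i(x)=f_ix-(-1)^{[f_i][x]}k_ixk_i^{-1}f_i$.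 It is a $\mathbb Z_2$-graded Hopf algebra with $\Delta(k_i^{\pm1})=k_i^{\pm1}\otimes k_i^{\pm1}$, $\Delta(e_i)=e_i\otimes k_i+1\otimes e_i$, $\Delta(f_i)=f_i\otimes 1+k_i^{-1}\otimes f_i$, $\epsilon(k_i)=1$, $\epsilon(e_i)=\epsilon(f_i)=0$, $S(k_i)=k_i^{-1}$, $S(e_i)=-e_ik_i^{-1}$, $S(f_i)=-k_if_i$ ($S$ is a graded anti-automorphism). **Modules.** $\mathcal P=\{\mu\in E: 2(\mu,\alpha_i)/(\alpha_i,\alpha_i)\in\mathbb Z\ (i<n),\ (\mu,\alpha_n)/(\alpha_n,\alpha_n)\in\mathbb Z\}$; $\mathcal P_+\subset\mathcal P$ is the subset where all these integers are $\ge0$. Finite-dimensional $\mathrm U_q(\mathfrak g)$-modules are understood to be $\mathbb Z_2$-graded with a homogeneous basis of vectors on which each $k_i$ acts by $q^{(\mu,\alpha_i)}$ for some $\mu\in\mathcal P$ (the weight). $W(\lambda)$, $\lambda\in\mathcal P_+$, is the irreducible finite-dimensional module with highest weight $\lambda$: it is generated by $v_+$ with $e_iv_+=0$, $k_iv_+=q^{(\lambda,\alpha_i)}v_+$. For each $\lambda$ fix a homogeneous basis $w_1,\dots,w_{d_\lambda}$ of $W(\lambda)$; $[i]$ denotes the parity of $w_i$ (indices belonging to $\lambda$ or $\mu$ refer to the corresponding basis); $xw_j=\sum_i t^{(\lambda)}_{ij}(x)w_i$ defines $t^{(\lambda)}_{ij}\in(\mathrm U_q(\mathfrak g))^*$.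 **Functions on $\mathrm{OSP}_q(1|2n)$.** The finite dual $(\mathrm U_q(\mathfrak g))^0$ (functionals whose kernel contains a graded two-sided ideal of finite codimension) is a $\mathbb Z_2$-graded Hopf algebra with unit $\epsilon$, product $\langle fg,a\rangle=\sum_{(a)}(-1)^{[g][a_{(1)}]}\langle f,a_{(1)}\rangle\langle g,a_{(2)}\rangle$, coproduct determined by $\langle f,ab\rangle=\sum_{(f)}(-1)^{[f_{(1)}][f_{(2)}]}\langle f_{(1)},a\rangle\langle f_{(2)},b\rangle$, counit $f\mapsto\langle f,1\rangle$, antipode $\langle S(f),a\rangle=\langle f,S(a)\rangle$. $\mathcal T_q(\mathfrak g)$ is its $\mathbb Z_2$-graded Hopf subalgebra generated by the matrix elements of the vector representation, i.e. of $W(\epsilon_1)$ (dimension $2n+1$, even highest weight vector). The $t^{(\lambda)}_{ij}$, $\lambda\in\mathcal P_+$, $1\le i,j\le d_\lambda$, form a basis of $\mathcal T_q(\mathfrak g)$. The matrix elements of the dual module $W(\lambda)^*$ in the dual basis are $\tilde t^{(\lambda)}_{ji}=(-1)^{[i]([i]+[j])}S(t^{(\lambda)}_{ij})\in\mathcal T_q(\mathfrak g)$. **Haar functional.** A Haar functional on a $\mathbb Z_2$-graded Hopf algebra $A$ is an even $\int\in A^*$ with $(\int\otimes\mathrm{id})\Delta(x)=(\mathrm{id}\otimes\int)\Delta(x)=(\int x)1_A$ for all $x\in A$ and $\int1_A=1$; the functional in the claim is one. **$K_{2\rho}$ and $\mathrm{SD}_q$.** $2\rho$ is the (graded) sum of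 the positive roots of $\mathfrak g$, i.e. the sum of the even positive roots minus the sum of the odd positive roots, so that $(2\rho,\alpha_i)=(\alpha_i,\alpha_i)$ for all $i$; $K_{2\rho}$ is the product of powers of the $k_i^{\pm1}$ with $K_{2\rho}e_iK_{2\rho}^{-1}=q^{(2\rho,\alpha_i)}e_i$ for all $i$; it satisfies $S^2(x)=K_{2\rho}xK_{2\rho}^{-1}$ for all $x\in\mathrm U_q(\mathfrak g)$. The quantum superdimension is $\mathrm{SD}_q(\lambda)=\mathrm{Str}\,t^{(\lambda)}(K_{2\rho})=\sum_i(-1)^{[i]}t^{(\lambda)}_{ii}(K_{2\rho})$, which is nonzero for every $\lambda\in\mathcal P_+$. *)

theory Defs
  imports "HOL-Analysis.Analysis" "HOL-Library.Poly_Mapping"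
begin

text \<open>
  The rank is \<open>n = CARD('n)\<close>; the linear order on the index type \<open>'n\<close> plays the role of
  \<open>1 < \<dots> < n\<close>, so \<open>Min UNIV\<close> is 1, \<open>Max UNIV\<close> is \<open>n\<close> and \<open>Min {i<..}\<close> is \<open>i + 1\<close>.
  The Euclidean space \<open>E\<close> is \<open>real ^ 'n\<close>, with \<open>\<epsilon>\<^sub>i = axis i 1\<close>.
\<close>

type_synonym 'n euclid = "(real, 'n) vec"

definition eps :: "'n::finite \<Rightarrow> 'n euclid" where
  "eps i = axis i 1"

definition simple_root :: "'n::{finite,linorder} \<Rightarrow> 'n euclid" where
  "simple_root i = (if i = Max UNIV then eps i else eps i - eps (Min {i<..}))"

definition cartan :: "'n::{finite,linorder} \<Rightarrow> 'n \<Rightarrow> real" where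
  "cartan i j = 2 * (simple_root i \<bullet> simple_root j) / (simple_root i \<bullet> simple_root i)"

definition weight_label :: "'n::{finite,linorder} euclid \<Rightarrow> 'n \<Rightarrow> real" where
  "weight_label \<mu> i =
     (if i = Max UNIV then (\<mu> \<bullet> simple_root i) / (simple_root i \<bullet> simple_root i)
      else 2 * (\<mu> \<bullet> simple_root i) / (simple_root i \<bullet> simple_root i))"

definition weight_lattice :: "'n::{finite,linorder} euclid set" where
  "weight_lattice = {\<mu>. \<forall>i. weight_label \<mu> i \<in> \<int>}"

definition dominant_weights :: "'n::{finite,linorder} euclid set" where
  "dominant_weights = {\<mu> \<in> weight_lattice. \<forall>i. weight_label \<mu> i \<ge> 0}"

definition even_pos_roots :: "'n::{finite,linorder} euclid set" where
  "even_pos_roots = {eps i - eps j | i j. i < j} \<union> {eps i + eps j | i j. i < j}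
     \<union> {2 *\<^sub>R eps i | i. True}"

definition odd_pos_roots :: "'n::{finite,linorder} euclid set" where
  "odd_pos_roots = {eps i | i. True}"

definition two_rho :: "'n::{finite,linorder} euclid" where
  "two_rho = (\<Sum>\<beta>\<in>even_pos_roots. \<beta>) - (\<Sum>\<beta>\<in>odd_pos_roots. \<beta>)"

text \<open>
  Every exponent of \<open>q\<close> below is an inner product of two elements of the weight lattice,
  hence an integer; the floor only changes its type.
\<close>

definition qpow :: "complex \<Rightarrow> real \<Rightarrow> complex" where
  "qpow q x = q powi \<lfloor>x\<rfloor>"

datatype 'n gen = KGen 'n | KInvGen 'n | EGen 'n | FGen 'n

fun gpar :: "'n::{finite,linorder} gen \<Rightarrow> nat" where
  "gpar (KGen i) = 0"
| "gpar (KInvGen i) = 0"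
| "gpar (EGen i) = (if i = Max UNIV then 1 else 0)"
| "gpar (FGen i) = (if i = Max UNIV then 1 else 0)"

text \<open>
  With concatenation as the monoid operation on words, the convolution product of
  \<^theory>\<open>HOL-Library.Poly_Mapping\<close> makes \<open>'n gen list \<Rightarrow>\<^sub>0 complex\<close> the free unital
  associative complex algebra on \<open>'n gen\<close>.
\<close>

instantiation list :: (type) monoid_add
begin

definition zero_list :: "'a list" where "zero_list = []"

definition plus_list :: "'a list \<Rightarrow> 'a list \<Rightarrow> 'a list" where "plus_list = (@)"

instance
  by standard (simp_all add: zero_list_def plus_list_def)

end

type_synonym 'n falg = "'n gen list \<Rightarrow>\<^sub>0 complex"

definition wrd :: "'n gen list \<Rightarrow> 'n falg" where
  "wrd u = Poly_Mapping.single u 1"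

definition scl :: "complex \<Rightarrow> 'n falg" where
  "scl c = Poly_Mapping.single [] c"

abbreviation kk :: "'n \<Rightarrow> 'n falg" where "kk i \<equiv> wrd [KGen i]"
abbreviation kinv :: "'n \<Rightarrow> 'n falg" where "kinv i \<equiv> wrd [KInvGen i]"
abbreviation ee :: "'n \<Rightarrow> 'n falg" where "ee i \<equiv> wrd [EGen i]"
abbreviation ff :: "'n \<Rightarrow> 'n falg" where "ff i \<equiv> wrd [FGen i]"

lemma wrd_mult: "wrd u * wrd v = wrd (u @ v)"
  by (simp add: wrd_def mult_single plus_list_def)

lemma wrd_Nil: "wrd [] = 1"
  by (simp add: wrd_def flip: single_one zero_list_def)

definition wpar :: "'n::{finite,linorder} gen list \<Rightarrow> nat" where
  "wpar u = (\<Sum>g\<leftarrow>u. gpar g) mod 2"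

definition component :: "nat \<Rightarrow> 'n::{finite,linorder} falg \<Rightarrow> 'n falg" where
  "component p x = (\<Sum>u\<in>{u \<in> Poly_Mapping.keys x. wpar u = p}. scl (Poly_Mapping.lookup x u) * wrd u)"

text \<open>\<open>twist p\<close> is the linear map with \<open>x \<mapsto> (-1)\<^bsup>p [x]\<^esup> x\<close> for homogeneous \<open>x\<close>.\<close>

definition twist :: "nat \<Rightarrow> 'n::{finite,linorder} falg \<Rightarrow> 'n falg" where
  "twist p x = component 0 x + scl ((-1) ^ p) * component 1 x"

definition Ad_e :: "'n::{finite,linorder} \<Rightarrow> 'n falg \<Rightarrow> 'n falg" where
  "Ad_e i x = ee i * x - kk i * twist (gpar (EGen i)) x * kinv i * ee i"

definition Ad_f :: "'n::{finite,linorder} \<Rightarrow> 'n falg \<Rightarrow> 'n falg" where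
  "Ad_f i x = ff i * x - kk i * twist (gpar (FGen i)) x * kinv i * ff i"

definition uq_relations :: "complex \<Rightarrow> 'n::{finite,linorder} falg set" where
  "uq_relations q =
     {kk i * kinv i - 1 | i. True} \<union> {kinv i * kk i - 1 | i. True} \<union>
     {kk i * kk j - kk j * kk i | i j. True} \<union>
     {kk i * ee j - scl (qpow q (simple_root i \<bullet> simple_root j)) * ee j * kk i | i j. True} \<union>
     {kk i * ff j - scl (qpow q (- (simple_root i \<bullet> simple_root j))) * ff j * kk i | i j. True} \<union>
     {ee i * ff j - scl ((-1) ^ (gpar (EGen i) * gpar (FGen j))) * ff j * ee i
        - (if i = j then scl (1 / (q - inverse q)) * (kk i - kinv i) else 0) | i j. True} \<union>
     {(Ad_e i ^^ nat \<lfloor>1 - cartan i j\<rfloor>) (ee j) | i j. i \<noteq> j} \<union>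
     {(Ad_f i ^^ nat \<lfloor>1 - cartan i j\<rfloor>) (ff j) | i j. i \<noteq> j}"

text \<open>
  \<open>uq_ideal q\<close> is the two-sided ideal generated by the relations, so that the quantum
  superalgebra is \<open>U = 'n falg / uq_ideal q\<close>.  Objects attached to \<open>U\<close> are described on the
  free algebra: an element of \<open>U\<close> by a representative, with \<open>x = y\<close> in \<open>U\<close> meaning
  \<open>x - y \<in> uq_ideal q\<close>; a functional on \<open>U\<close> by a functional on the free algebra vanishing on
  \<open>uq_ideal q\<close>; a \<open>U\<close>-module by a module over the free algebra annihilated by \<open>uq_ideal q\<close>;
  and the structure maps \<open>\<Delta>\<close>, \<open>\<epsilon>\<close>, \<open>S\<close> of \<open>U\<close> by their lifts to the free algebra,
  which are determined by the same values on the generators.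
\<close>

inductive_set uq_ideal :: "complex \<Rightarrow> 'n::{finite,linorder} falg set" for q where
  rel: "x \<in> uq_relations q \<Longrightarrow> x \<in> uq_ideal q"
| zero: "0 \<in> uq_ideal q"
| add: "x \<in> uq_ideal q \<Longrightarrow> y \<in> uq_ideal q \<Longrightarrow> x + y \<in> uq_ideal q"
| left: "x \<in> uq_ideal q \<Longrightarrow> a * x \<in> uq_ideal q"
| right: "x \<in> uq_ideal q \<Longrightarrow> x * a \<in> uq_ideal q"

fun counit_gen :: "'n gen \<Rightarrow> complex" where
  "counit_gen (KGen i) = 1"
| "counit_gen (KInvGen i) = 1"
| "counit_gen (EGen i) = 0"
| "counit_gen (FGen i) = 0"

definition counit :: "'n falg \<Rightarrow> complex" where
  "counit x = (\<Sum>u\<in>Poly_Mapping.keys x. Poly_Mapping.lookup x u * (\<Prod>g\<leftarrow>u. counit_gen g))"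

fun antipode_gen :: "'n gen \<Rightarrow> 'n falg" where
  "antipode_gen (KGen i) = kinv i"
| "antipode_gen (KInvGen i) = kk i"
| "antipode_gen (EGen i) = - (ee i * kinv i)"
| "antipode_gen (FGen i) = - (kk i * ff i)"

text \<open>Graded anti-automorphism: \<open>S(ab) = (-1)\<^bsup>[a][b]\<^esup> S(b) S(a)\<close>.\<close>

fun antipode_word :: "'n::{finite,linorder} gen list \<Rightarrow> 'n falg" where
  "antipode_word [] = 1"
| "antipode_word (g # u) = scl ((-1) ^ (gpar g * wpar u)) * antipode_word u * antipode_gen g"

definition antipode :: "'n::{finite,linorder} falg \<Rightarrow> 'n falg" where
  "antipode x = (\<Sum>u\<in>Poly_Mapping.keys x. scl (Poly_Mapping.lookup x u) * antipode_word u)"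

text \<open>
  The tensor square of the free algebra has the pairs of words \<open>(a, b)\<close>, standing for
  \<open>a \<otimes> b\<close>, as a basis, with product \<open>(a \<otimes> b)(c \<otimes> d) = (-1)\<^bsup>[b][c]\<^esup> ac \<otimes> bd\<close>.
\<close>

type_synonym 'n ftens = "('n gen list \<times> 'n gen list) \<Rightarrow>\<^sub>0 complex"

definition tmult :: "'n::{finite,linorder} ftens \<Rightarrow> 'n ftens \<Rightarrow> 'n ftens" where
  "tmult X Y = (\<Sum>(a, b)\<in>Poly_Mapping.keys X. \<Sum>(c, d)\<in>Poly_Mapping.keys Y.
     Poly_Mapping.single (a @ c, b @ d)
       ((-1) ^ (wpar b * wpar c) * Poly_Mapping.lookup X (a, b) * Poly_Mapping.lookup Y (c, d)))"

fun coproduct_gen :: "'n gen \<Rightarrow> 'n ftens" where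
  "coproduct_gen (KGen i) = Poly_Mapping.single ([KGen i], [KGen i]) 1"
| "coproduct_gen (KInvGen i) = Poly_Mapping.single ([KInvGen i], [KInvGen i]) 1"
| "coproduct_gen (EGen i) =
     Poly_Mapping.single ([EGen i], [KGen i]) 1 + Poly_Mapping.single ([], [EGen i]) 1"
| "coproduct_gen (FGen i) =
     Poly_Mapping.single ([FGen i], []) 1 + Poly_Mapping.single ([KInvGen i], [FGen i]) 1"

fun coproduct_word :: "'n::{finite,linorder} gen list \<Rightarrow> 'n ftens" where
  "coproduct_word [] = Poly_Mapping.single ([], []) 1"
| "coproduct_word (g # u) = tmult (coproduct_gen g) (coproduct_word u)"

type_synonym 'n functional = "'n falg \<Rightarrow> complex"

definition linear_functional :: "'n functional \<Rightarrow> bool" where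
  "linear_functional f \<longleftrightarrow>
     (\<forall>x y. f (x + y) = f x + f y) \<and> (\<forall>c x. f (scl c * x) = c * f x)"

text \<open>
  Graded two-sided ideals of \<open>U\<close> correspond to those of the free algebra containing
  \<open>uq_ideal q\<close>, with the same codimension.
\<close>

definition graded_ideal :: "'n::{finite,linorder} falg set \<Rightarrow> bool" where
  "graded_ideal J \<longleftrightarrow> 0 \<in> J \<and> (\<forall>x\<in>J. \<forall>y\<in>J. x + y \<in> J) \<and>
     (\<forall>x\<in>J. \<forall>a. a * x \<in> J \<and> x * a \<in> J) \<and> (\<forall>x\<in>J. \<forall>p\<in>{0, 1}. component p x \<in> J)"

definition finite_codim :: "'n falg set \<Rightarrow> bool" where
  "finite_codim J \<longleftrightarrow> (\<exists>B. finite B \<and> (\<forall>x. \<exists>c. x - (\<Sum>b\<in>B. scl (c b) * b) \<in> J))"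

definition finite_dual :: "complex \<Rightarrow> 'n::{finite,linorder} functional set" where
  "finite_dual q = {f. linear_functional f \<and>
     (\<exists>J. graded_ideal J \<and> uq_ideal q \<subseteq> J \<and> finite_codim J \<and> (\<forall>x\<in>J. f x = 0))}"

definition functional_component :: "nat \<Rightarrow> 'n::{finite,linorder} functional \<Rightarrow> 'n functional" where
  "functional_component p f = (\<lambda>x. f (component p x))"

definition homogeneous_functional :: "nat \<Rightarrow> 'n::{finite,linorder} functional \<Rightarrow> bool" where
  "homogeneous_functional p f \<longleftrightarrow> (\<forall>u. wpar u \<noteq> p \<longrightarrow> f (wrd u) = 0)"

text \<open>
  The product \<open>\<langle>fg, a\<rangle> = \<Sum> (-1)\<^bsup>[g][a\<^sub>1]\<^esup> \<langle>f, a\<^sub>1\<rangle> \<langle>g, a\<^sub>2\<rangle>\<close> extended bilinearly to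
  inhomogeneous \<open>g\<close>: a homogeneous \<open>g\<close> only sees terms with \<open>[a\<^sub>2] = [g]\<close>, so the sign can be
  written as \<open>(-1)\<^bsup>[a\<^sub>2][a\<^sub>1]\<^esup>\<close>.
\<close>

definition fmult :: "'n::{finite,linorder} functional \<Rightarrow> 'n functional \<Rightarrow> 'n functional" where
  "fmult f g = (\<lambda>x. \<Sum>u\<in>Poly_Mapping.keys x. Poly_Mapping.lookup x u *
     (\<Sum>(a, b)\<in>Poly_Mapping.keys (coproduct_word u).
        Poly_Mapping.lookup (coproduct_word u) (a, b) *
        (-1) ^ (wpar b * wpar a) * f (wrd a) * g (wrd b)))"

definition fantipode :: "'n::{finite,linorder} functional \<Rightarrow> 'n functional" where
  "fantipode f = (\<lambda>x. f (antipode x))"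

text \<open>
  \<open>is_fcoproduct f L\<close> says \<open>\<Delta>(f) = \<Sum>(g, h)\<leftarrow>L. g \<otimes> h\<close>, i.e.
  \<open>\<langle>f, ab\<rangle> = \<Sum> (-1)\<^bsup>[g][h]\<^esup> \<langle>g, a\<rangle> \<langle>h, b\<rangle>\<close>, again with \<open>[g] = [a]\<close> and \<open>[h] = [b]\<close> in
  all nonzero terms with homogeneous \<open>g\<close>, \<open>h\<close>.
\<close>

definition is_fcoproduct ::
  "'n::{finite,linorder} functional \<Rightarrow> ('n functional \<times> 'n functional) list \<Rightarrow> bool" where
  "is_fcoproduct f L \<longleftrightarrow> (\<forall>a b. f (wrd a * wrd b) =
     (\<Sum>(g, h)\<leftarrow>L. (-1) ^ (wpar a * wpar b) * g (wrd a) * h (wrd b)))"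

definition hopf_subalgebra :: "complex \<Rightarrow> 'n::{finite,linorder} functional set \<Rightarrow> bool" where
  "hopf_subalgebra q H \<longleftrightarrow> H \<subseteq> finite_dual q \<and>
     (\<forall>f\<in>H. \<forall>g\<in>H. (\<lambda>x. f x + g x) \<in> H) \<and> (\<forall>c. \<forall>f\<in>H. (\<lambda>x. c * f x) \<in> H) \<and>
     (\<forall>f\<in>H. \<forall>p\<in>{0, 1}. functional_component p f \<in> H) \<and>
     counit \<in> H \<and> (\<forall>f\<in>H. \<forall>g\<in>H. fmult f g \<in> H) \<and>
     (\<forall>f\<in>H. \<exists>L. set L \<subseteq> H \<times> H \<and> is_fcoproduct f L) \<and>
     (\<forall>f\<in>H. fantipode f \<in> H)"

text \<open>The unit of a Hopf subalgebra of the finite dual is the counit of \<open>U\<close>.\<close>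

definition haar_functional ::
  "'n::{finite,linorder} functional set \<Rightarrow> ('n functional \<Rightarrow> complex) \<Rightarrow> bool" where
  "haar_functional A I \<longleftrightarrow>
     (\<forall>f\<in>A. \<forall>g\<in>A. I (\<lambda>x. f x + g x) = I f + I g) \<and>
     (\<forall>c. \<forall>f\<in>A. I (\<lambda>x. c * f x) = c * I f) \<and>
     (\<forall>f\<in>A. homogeneous_functional 1 f \<longrightarrow> I f = 0) \<and>
     (\<forall>f\<in>A. \<forall>L. set L \<subseteq> A \<times> A \<and> is_fcoproduct f L \<longrightarrow>
        (\<forall>x. (\<Sum>(g, h)\<leftarrow>L. I g * h x) = I f * counit x) \<and>
        (\<forall>x. (\<Sum>(g, h)\<leftarrow>L. g x * I h) = I f * counit x)) \<and>
     I counit = 1"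

text \<open>
  A module lives on a subspace of an ambient complex vector space \<open>'v\<close> with scalar
  multiplication \<open>sc\<close>; \<open>part M 0\<close> and \<open>part M 1\<close> are its even and odd subspaces.
\<close>

record ('n, 'v) supermodule =
  part :: "nat \<Rightarrow> 'v set"
  action :: "'n falg \<Rightarrow> 'v \<Rightarrow> 'v"

definition mcarrier :: "('n, 'v::ab_group_add) supermodule \<Rightarrow> 'v set" where
  "mcarrier M = {v + w | v w. v \<in> part M 0 \<and> w \<in> part M 1}"

definition vpar :: "('n, 'v) supermodule \<Rightarrow> 'v \<Rightarrow> nat" where
  "vpar M v = (if v \<in> part M 0 then 0 else 1)"

definition weight_vector ::
  "complex \<Rightarrow> (complex \<Rightarrow> 'v \<Rightarrow> 'v) \<Rightarrow> ('n::{finite,linorder}, 'v) supermodule \<Rightarrow> 'n euclid \<Rightarrow> 'v \<Rightarrow> bool"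
where
  "weight_vector q sc M \<mu> v \<longleftrightarrow> (\<forall>i. action M (kk i) v = sc (qpow q (\<mu> \<bullet> simple_root i)) v)"

definition uq_module ::
  "complex \<Rightarrow> (complex \<Rightarrow> 'v::ab_group_add \<Rightarrow> 'v) \<Rightarrow> ('n::{finite,linorder}, 'v) supermodule \<Rightarrow> bool"
where
  "uq_module q sc M \<longleftrightarrow>
     module.subspace sc (part M 0) \<and> module.subspace sc (part M 1) \<and>
     part M 0 \<inter> part M 1 = {0} \<and>
     (\<forall>x. \<forall>v\<in>mcarrier M. action M x v \<in> mcarrier M) \<and>
     (\<forall>x. \<forall>v\<in>mcarrier M. \<forall>w\<in>mcarrier M. action M x (v + w) = action M x v + action M x w) \<and>
     (\<forall>x c. \<forall>v\<in>mcarrier M. action M x (sc c v) = sc c (action M x v)) \<and>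
     (\<forall>x y. \<forall>v\<in>mcarrier M. action M (x + y) v = action M x v + action M y v) \<and>
     (\<forall>c x. \<forall>v\<in>mcarrier M. action M (scl c * x) v = sc c (action M x v)) \<and>
     (\<forall>x y. \<forall>v\<in>mcarrier M. action M (x * y) v = action M x (action M y v)) \<and>
     (\<forall>v\<in>mcarrier M. action M 1 v = v) \<and>
     (\<forall>x\<in>uq_ideal q. \<forall>v\<in>mcarrier M. action M x v = 0) \<and>
     (\<forall>g. \<forall>p\<in>{0, 1}. \<forall>v\<in>part M p. action M (wrd [g]) v \<in> part M ((gpar g + p) mod 2)) \<and>
     (\<exists>B. finite B \<and> B \<subseteq> part M 0 \<union> part M 1 \<and> \<not> module.dependent sc B \<and>
        module.span sc B = mcarrier M \<and>
        (\<forall>b\<in>B. \<exists>\<mu>\<in>weight_lattice. weight_vector q sc M \<mu> b))"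

text \<open>Irreducibility is meant in the \<open>\<int>\<^sub>2\<close>-graded category: it refers to graded submodules.\<close>

definition graded_submodule ::
  "(complex \<Rightarrow> 'v::ab_group_add \<Rightarrow> 'v) \<Rightarrow> ('n, 'v) supermodule \<Rightarrow> 'v set \<Rightarrow> bool" where
  "graded_submodule sc M N \<longleftrightarrow> module.subspace sc N \<and>
     N = {v + w | v w. v \<in> N \<inter> part M 0 \<and> w \<in> N \<inter> part M 1} \<and>
     (\<forall>x. \<forall>v\<in>N. action M x v \<in> N)"

definition irreducible_module ::
  "(complex \<Rightarrow> 'v::ab_group_add \<Rightarrow> 'v) \<Rightarrow> ('n, 'v) supermodule \<Rightarrow> bool" where
  "irreducible_module sc M \<longleftrightarrow> mcarrier M \<noteq> {0} \<and>
     (\<forall>N. graded_submodule sc M N \<longrightarrow> N = {0} \<or> N = mcarrier M)"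

definition highest_weight_generator ::
  "complex \<Rightarrow> (complex \<Rightarrow> 'v::ab_group_add \<Rightarrow> 'v) \<Rightarrow> ('n::{finite,linorder}, 'v) supermodule \<Rightarrow>
     'n euclid \<Rightarrow> 'v \<Rightarrow> bool"
where
  "highest_weight_generator q sc M l v \<longleftrightarrow>
     v \<noteq> 0 \<and> v \<in> part M 0 \<union> part M 1 \<and> (\<forall>i. action M (ee i) v = 0) \<and>
     weight_vector q sc M l v \<and> mcarrier M = {action M x v | x. True}"

definition irreducible_highest_weight ::
  "complex \<Rightarrow> (complex \<Rightarrow> 'v::ab_group_add \<Rightarrow> 'v) \<Rightarrow> ('n::{finite,linorder}, 'v) supermodule \<Rightarrow>
     'n euclid \<Rightarrow> bool"
where
  "irreducible_highest_weight q sc M l \<longleftrightarrow>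
     uq_module q sc M \<and> irreducible_module sc M \<and> (\<exists>v. highest_weight_generator q sc M l v)"

definition homogeneous_basis ::
  "(complex \<Rightarrow> 'v::ab_group_add \<Rightarrow> 'v) \<Rightarrow> ('n, 'v) supermodule \<Rightarrow> nat \<Rightarrow> (nat \<Rightarrow> 'v) \<Rightarrow> bool" where
  "homogeneous_basis sc M d w \<longleftrightarrow>
     inj_on w {1..d} \<and> w ` {1..d} \<subseteq> part M 0 \<union> part M 1 \<and>
     \<not> module.dependent sc (w ` {1..d}) \<and> module.span sc (w ` {1..d}) = mcarrier M"

text \<open>\<open>x w\<^sub>j = \<Sum>\<^sub>i t\<^sub>i\<^sub>j(x) w\<^sub>i\<close> for the basis \<open>w\<^sub>1, \<dots>, w\<^sub>d\<close> of \<open>M\<close>.\<close>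

definition mat_elem ::
  "(complex \<Rightarrow> 'v::ab_group_add \<Rightarrow> 'v) \<Rightarrow> ('n, 'v) supermodule \<Rightarrow> nat \<Rightarrow> (nat \<Rightarrow> 'v) \<Rightarrow>
     nat \<Rightarrow> nat \<Rightarrow> 'n functional"
where
  "mat_elem sc M d w i j =
     (\<lambda>x. module.representation sc (w ` {1..d}) (action M x (w j)) (w i))"

text \<open>
  The matrix elements of the dual module, in the basis dual to \<open>w\<^sub>1, \<dots>, w\<^sub>d\<close>; the dual
  module carries the action \<open>\<langle>x \<phi>, v\<rangle> = (-1)\<^bsup>[x][\<phi>]\<^esup> \<langle>\<phi>, S(x) v\<rangle>\<close>, which is where the sign
  comes from.
\<close>

definition dual_mat_elem ::
  "(complex \<Rightarrow> 'v::ab_group_add \<Rightarrow> 'v) \<Rightarrow> ('n::{finite,linorder}, 'v) supermodule \<Rightarrow> nat \<Rightarrow>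
     (nat \<Rightarrow> 'v) \<Rightarrow> nat \<Rightarrow> nat \<Rightarrow> 'n functional"
where
  "dual_mat_elem sc M d w j i =
     (\<lambda>x. (-1) ^ (vpar M (w i) * (vpar M (w i) + vpar M (w j))) *
        fantipode (mat_elem sc M d w i j) x)"

definition Tq ::
  "complex \<Rightarrow> (complex \<Rightarrow> 'v::ab_group_add \<Rightarrow> 'v) \<Rightarrow> ('n::{finite,linorder}, 'v) supermodule \<Rightarrow>
     nat \<Rightarrow> (nat \<Rightarrow> 'v) \<Rightarrow> 'n functional set"
where
  "Tq q sc V d w = \<Inter>{H. hopf_subalgebra q H \<and>
     (\<forall>i\<in>{1..d}. \<forall>j\<in>{1..d}. mat_elem sc V d w i j \<in> H)}"

definition kpow :: "'n \<Rightarrow> int \<Rightarrow> 'n falg" where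
  "kpow i m = (if m \<ge> 0 then kk i ^ nat m else kinv i ^ nat (- m))"

text \<open>\<open>K e\<^sub>i K\<^sup>-\<^sup>1 = q\<^bsup>(2\<rho>,\<alpha>\<^sub>i)\<^esup> e\<^sub>i\<close> in \<open>U\<close>, written without the inverse of \<open>K\<close>.\<close>

definition is_K2rho :: "complex \<Rightarrow> 'n::{finite,linorder} falg \<Rightarrow> bool" where
  "is_K2rho q K \<longleftrightarrow>
     (\<exists>m. K = prod_list (map (\<lambda>i. kpow i (m i)) (sorted_list_of_set UNIV))) \<and>
     (\<forall>i. K * ee i - scl (qpow q (two_rho \<bullet> simple_root i)) * ee i * K \<in> uq_ideal q)"

definition SDq ::
  "(complex \<Rightarrow> 'v::ab_group_add \<Rightarrow> 'v) \<Rightarrow> ('n, 'v) supermodule \<Rightarrow> nat \<Rightarrow> (nat \<Rightarrow> 'v) \<Rightarrow>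
     'n falg \<Rightarrow> complex"
where
  "SDq sc M d w K = (\<Sum>i=1..d. (-1) ^ vpar M (w i) * mat_elem sc M d w i i K)"

end

(* Write t_{A,v}(x) = A(x v) and s_{B,u}(x) = B(S(x) u) for functionals A, B on irreducible modules.
   Invariance of the Haar functional makes (v, B) |-> int t_{A,v} s_{B,u} and
   (u, A) |-> int s_{B,u} t_{A,v} invariant pairings, up to S^2 = Ad K_{2 rho}. By Schur's lemma they
   vanish for different highest weights, and otherwise
     int t_{A,v} s_{B,u} = c (-1)^[A] A(u) B(K_{2 rho} v),
     int s_{B,u} t_{A,v} = c' (-1)^[B] B(v) A(K_{2 rho}^{-1} u).
   The antipode axiom gives c SD_q = 1. Reflections in the rank one subalgebras show that the lowest
   weight is minus the highest one, so that a matrix element between highest weight vectors is also the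
   antipode of one between lowest weight vectors; this yields c = c'.

   Invariance is only available on T_q, so the matrix elements of W(lambda) have to be placed there. A
   functional that is annihilated by right translation by the e_i, has weight lambda on both sides and
   takes the value 1 at 1 is unique; products of such extremal functionals are extremal, and those of
   fundamental weight are quantum minors of the vector representation. *)
theory Submission
  imports Defs
begin

section \<open>Functionals on the free algebra and the coproduct\<close>

text \<open>Uniqueness of extremal functionals is the triangular decomposition read on words: a
  raising letter can be moved to the right end, where the functional vanishes, so only words of
  lowering letters matter, and comparing weights leaves the empty word. It rests on the relations
  collected in \<open>basic_rels\<close>, which can also be verified directly for x |-> B(S(x) u);
  this is what allows a matrix element to be identified with the antipode of another one.

  Each integral depends on two pairs of arguments, (v, B) and (u, A). Schur's lemma is applied to
  each pair with the other one fixed, and together the two answers leave one scalar. For one of the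
  pairs, moving a generator across meets S twice; S^2 multiplies e_i and f_i by powers of q, and
  K_{2 rho} or its inverse inside one argument cancels them.

  The antipode axiom with the factors in the other order would express c' through the supertrace of
  K_{2 rho}^{-1}; that this is the same scalar is a statement about weights and their negatives,
  hence the reflections.\<close>

definition lin_ext :: "('k \<Rightarrow> complex) \<Rightarrow> ('k \<Rightarrow>\<^sub>0 complex) \<Rightarrow> complex" where
  "lin_ext h X = (\<Sum>k\<in>Poly_Mapping.keys X. Poly_Mapping.lookup X k * h k)"

lemma lin_ext_superset:
  "finite S \<Longrightarrow> Poly_Mapping.keys X \<subseteq> S \<Longrightarrow> lin_ext h X = (\<Sum>k\<in>S. Poly_Mapping.lookup X k * h k)"
  unfolding lin_ext_def by (rule sum.mono_neutral_left) (auto simp: in_keys_iff)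

lemma lin_ext_add: "lin_ext h (X + Y) = lin_ext h X + lin_ext h Y"
proof -
  let ?S = "Poly_Mapping.keys X \<union> Poly_Mapping.keys Y"
  have "lin_ext h Z = (\<Sum>k\<in>?S. Poly_Mapping.lookup Z k * h k)" if "Z \<in> {X, Y, X + Y}" for Z
    using that keys_add[of X Y] by (intro lin_ext_superset) auto
  then show ?thesis
    by (simp add: lookup_add distrib_right sum.distrib)
qed

lemma lin_ext_single [simp]: "lin_ext h (Poly_Mapping.single k c) = c * h k"
  by (simp add: lin_ext_def)

lemma lin_ext_zero [simp]: "lin_ext h 0 = 0"
  by (simp add: lin_ext_def)

lemma lin_ext_sum: "lin_ext h (\<Sum>i\<in>I. f i) = (\<Sum>i\<in>I. lin_ext h (f i))"
  by (induction I rule: infinite_finite_induct) (simp_all add: lin_ext_add)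

lemma lin_ext_fun_add: "lin_ext (\<lambda>k. h k + h' k) X = lin_ext h X + lin_ext h' X"
  by (simp add: lin_ext_def distrib_left sum.distrib)

lemma lin_ext_fun_mult: "lin_ext (\<lambda>k. c * h k) X = c * lin_ext h X"
  by (simp add: lin_ext_def sum_distrib_left ac_simps)

lemma single_eq_scl_wrd: "Poly_Mapping.single u c = scl c * wrd u"
  by (simp add: scl_def wrd_def mult_single plus_list_def)

lemma poly_mapping_sum_single:
  "X = (\<Sum>k\<in>Poly_Mapping.keys X. Poly_Mapping.single k (Poly_Mapping.lookup X k))"
proof (rule poly_mapping_eqI)
  fix k
  have "Poly_Mapping.lookup (\<Sum>k\<in>Poly_Mapping.keys X. Poly_Mapping.single k (Poly_Mapping.lookup X k)) k
      = (\<Sum>j\<in>Poly_Mapping.keys X. if j = k then Poly_Mapping.lookup X k else 0)"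
    by (auto simp: lookup_sum lookup_single when_def intro!: sum.cong)
  then show "Poly_Mapping.lookup X k
      = Poly_Mapping.lookup (\<Sum>k\<in>Poly_Mapping.keys X. Poly_Mapping.single k (Poly_Mapping.lookup X k)) k"
    by (auto simp: in_keys_iff)
qed

lemma falg_sum_words:
  "x = (\<Sum>u\<in>Poly_Mapping.keys x. scl (Poly_Mapping.lookup x u) * wrd u)"
  using poly_mapping_sum_single[of x] by (simp add: single_eq_scl_wrd)

lemma falg_induct [case_names zero word add]:
  assumes "P 0" "\<And>c u. P (scl c * wrd u)" "\<And>x y. P x \<Longrightarrow> P y \<Longrightarrow> P (x + y)"
  shows "P (x :: 'n falg)"
proof -
  have "P (\<Sum>u\<in>S. scl (f u) * wrd u)" if "finite S" for S f
    using that by induction (use assms in auto)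
  from this[of "Poly_Mapping.keys x" "Poly_Mapping.lookup x"] show ?thesis
    by (simp flip: falg_sum_words)
qed

lemma scl_mult: "scl a * scl b = scl (a * b)"
  by (simp add: scl_def mult_single plus_list_def)

lemma scl_1: "scl 1 = 1"
  by (simp add: scl_def flip: single_one zero_list_def)

lemma scl_commute: "x * scl c = scl c * (x :: 'n falg)"
proof (induction x rule: falg_induct)
  case (word a u)
  show ?case
    by (simp add: scl_def wrd_def mult_single plus_list_def mult.commute)
qed (simp_all add: algebra_simps)

lemma linear_functional_lin_ext:
  assumes "linear_functional f"
  shows "f x = lin_ext (\<lambda>u. f (wrd u)) x"
proof (induction x rule: falg_induct)
  case zero
  have "f (scl 0 * 0) = 0 * f 0"
    using assms unfolding linear_functional_def by blast
  then show ?case by simp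
next
  case (word c u)
  then show ?case
    using assms by (simp add: linear_functional_def flip: single_eq_scl_wrd)
       (simp add: linear_functional_def single_eq_scl_wrd)
next
  case (add x y)
  then show ?case using assms by (simp add: linear_functional_def lin_ext_add)
qed

lemma linear_functional_lin_ext_words: "linear_functional (lin_ext h)"
proof -
  have "lin_ext h (scl c * x) = c * lin_ext h x" for c x
  proof (induction x rule: falg_induct)
    case (word a u)
    have "scl c * (scl a * wrd u) = Poly_Mapping.single u (c * a)"
      by (simp add: scl_mult single_eq_scl_wrd flip: mult.assoc)
    then show ?case
      by (simp flip: single_eq_scl_wrd)
  qed (simp_all add: distrib_left lin_ext_add)
  then show ?thesis
    by (simp add: linear_functional_def lin_ext_add)
qed

lemma linear_functional_eqI:
  assumes "linear_functional f" "linear_functional g" "\<And>u. f (wrd u) = g (wrd u)"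
  shows "f = g"
  using linear_functional_lin_ext[OF assms(1)] linear_functional_lin_ext[OF assms(2)] assms(3)
  by (metis ext)

lemma lin_ext_wrd [simp]: "lin_ext h (wrd u) = h u"
  by (simp add: wrd_def)

lemma linear_functional_add:
  "linear_functional f \<Longrightarrow> linear_functional g \<Longrightarrow> linear_functional (\<lambda>x. f x + g x)"
  by (simp add: linear_functional_def algebra_simps)

lemma linear_functional_cmult:
  "linear_functional f \<Longrightarrow> linear_functional (\<lambda>x. c * f x)"
  by (simp add: linear_functional_def algebra_simps)

lemma linear_functional_right_translate:
  "linear_functional f \<Longrightarrow> linear_functional (\<lambda>x. f (x * a))"
  by (simp add: linear_functional_def algebra_simps)

lemma linear_functional_left_translate:
  "linear_functional f \<Longrightarrow> linear_functional (\<lambda>x. f (a * x))"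
  unfolding linear_functional_def by (simp add: distrib_left scl_commute flip: mult.assoc) (simp add: mult.assoc)

lemma linear_functional_0: "linear_functional f \<Longrightarrow> f 0 = 0"
  using linear_functional_lin_ext[of f 0] by simp

lemma linear_functional_diff: "linear_functional f \<Longrightarrow> f (x - y) = f x - f y"
  by (metis add_diff_cancel_right' diff_add_cancel linear_functional_def)

lemma counit_eq_lin_ext: "counit = lin_ext (\<lambda>u. \<Prod>g\<leftarrow>u. counit_gen g)"
  by (simp add: counit_def lin_ext_def fun_eq_iff)

lemma counit_linear: "linear_functional counit"
  by (simp add: counit_eq_lin_ext linear_functional_lin_ext_words)

lemma counit_wrd: "counit (wrd u) = (\<Prod>g\<leftarrow>u. counit_gen g)"
  by (simp add: counit_eq_lin_ext)

section \<open>Parities of words and evaluation of the coproduct\<close>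

lemma wpar_cases: "wpar u = 0 \<or> wpar u = 1"
  by (auto simp: wpar_def)

lemma wpar_Nil [simp]: "wpar [] = 0"
  by (simp add: wpar_def)

lemma wpar_append: "wpar (u @ v) = (wpar u + wpar v) mod 2"
  by (simp add: wpar_def mod_add_eq)

lemma wpar_Cons: "wpar (g # u) = (gpar g + wpar u) mod 2"
  by (simp add: wpar_def mod_add_right_eq)

lemma gpar_cases: "gpar g = 0 \<or> gpar g = 1"
  by (cases g) auto

lemma gpar_mod [simp]: "gpar g mod 2 = gpar g"
  using gpar_cases[of g] by auto

lemma wpar_mod [simp]: "wpar u mod 2 = wpar u"
  by (simp add: wpar_def)

lemma neg_one_power_mod [simp]:
  "(- 1 :: complex) ^ (a mod 2 * b) = (- 1) ^ (a * b)"
  "(- 1 :: complex) ^ (b * (a mod 2)) = (- 1) ^ (a * b)"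
  "(- 1 :: complex) ^ (a mod 2) = (- 1) ^ a"
  by (auto simp: minus_one_power_iff even_mult_iff)

lemma component_lin_ext:
  "lin_ext h (component p x) = lin_ext (\<lambda>u. if wpar u = p then h u else 0) x"
proof -
  have "lin_ext h (component p x)
      = (\<Sum>u\<in>{u \<in> Poly_Mapping.keys x. wpar u = p}. Poly_Mapping.lookup x u * h u)"
    unfolding component_def single_eq_scl_wrd[symmetric] lin_ext_sum lin_ext_single ..
  also have "\<dots> = lin_ext (\<lambda>u. if wpar u = p then h u else 0) x"
    unfolding lin_ext_def by (subst sum.inter_filter) (auto intro: sum.cong)
  finally show ?thesis .
qed

lemma neg_one_power_cancel: "(- 1 :: complex) ^ k * ((- 1) ^ k * z) = z"
  by (cases "even k") simp_all

text \<open>The value at the coproduct of \<open>u\<close> of the bilinear extension of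
  \<open>\<phi>\<close>. Computations with the coproduct become recursions on the letters of
  \<open>u\<close> for arbitrary \<open>\<phi>\<close>, which keeps the basis expansion of
  \<open>coproduct_word\<close> out of sight.\<close>

definition Dev :: "('n gen list \<Rightarrow> 'n gen list \<Rightarrow> complex) \<Rightarrow> 'n::{finite,linorder} gen list \<Rightarrow> complex" where
  "Dev \<phi> u = lin_ext (\<lambda>(a, b). \<phi> a b) (coproduct_word u)"

text \<open>\<open>\<Delta>(X) = X \<otimes> lgr X + lgl X \<otimes> X\<close> with group-like words \<open>lgr X\<close>, \<open>lgl X\<close>, for \<open>X\<close> among
  \<open>e\<^sub>i\<close>, \<open>f\<^sub>i\<close>.\<close>

fun lgr :: "'n gen \<Rightarrow> 'n gen list" where
  "lgr (EGen i) = [KGen i]"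
| "lgr _ = []"

fun lgl :: "'n gen \<Rightarrow> 'n gen list" where
  "lgl (FGen i) = [KInvGen i]"
| "lgl _ = []"

fun is_EF :: "'n gen \<Rightarrow> bool" where
  "is_EF (EGen i) = True"
| "is_EF (FGen i) = True"
| "is_EF _ = False"

lemma wpar_lgr [simp]: "wpar (lgr X) = 0"
  by (cases X) (simp_all add: wpar_Cons)

lemma wpar_lgl [simp]: "wpar (lgl X) = 0"
  by (cases X) (simp_all add: wpar_Cons)

lemma gpar_not_EF: "\<not> is_EF X \<Longrightarrow> gpar X = 0"
  by (cases X) auto

lemma lin_ext_tmult:
  "lin_ext h (tmult X Y) =
     lin_ext (\<lambda>(a, b). lin_ext (\<lambda>(c, d). (-1) ^ (wpar b * wpar c) * h (a @ c, b @ d)) Y) X"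
  unfolding tmult_def
  by (simp add: lin_ext_sum case_prod_unfold)
     (simp add: lin_ext_def sum_distrib_left case_prod_unfold ac_simps)

lemma Dev_Nil [simp]: "Dev \<phi> [] = \<phi> [] []"
  by (simp add: Dev_def)

lemma Dev_Cons_K: "\<not> is_EF g \<Longrightarrow> Dev \<phi> (g # u) = Dev (\<lambda>a b. \<phi> (g # a) (g # b)) u"
  by (cases g) (simp_all add: Dev_def lin_ext_tmult wpar_Cons)

text \<open>The sign arises because \<open>X\<close> in the second tensor factor has to pass
  \<open>a\<close>. The other term has none, since \<open>lgr X\<close> is even.\<close>

lemma Dev_Cons_EF:
  assumes "is_EF X"
  shows "Dev \<phi> (X # u) = Dev (\<lambda>a b. \<phi> (X # a) (lgr X @ b)) u
           + Dev (\<lambda>a b. (-1) ^ (gpar X * wpar a) * \<phi> (lgl X @ a) (X # b)) u"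
  using assms by (cases X) (simp_all add: Dev_def lin_ext_tmult lin_ext_add wpar_Cons)

lemma Dev_cmult: "Dev (\<lambda>a b. c * \<phi> a b) u = c * Dev \<phi> u"
  by (simp add: Dev_def case_prod_unfold lin_ext_fun_mult)

lemma Dev_add: "Dev (\<lambda>a b. \<phi> a b + \<psi> a b) u = Dev \<phi> u + Dev \<psi> u"
  by (simp add: Dev_def case_prod_unfold lin_ext_fun_add)

lemma Dev_zero [simp]: "Dev (\<lambda>a b. 0) u = 0"
  using Dev_cmult[of 0 "\<lambda>a b. 0" u] by simp

lemma Dev_sum: "Dev (\<lambda>a b. \<Sum>i\<in>I. \<phi> i a b) u = (\<Sum>i\<in>I. Dev (\<phi> i) u)"
  by (induction I rule: infinite_finite_induct) (simp_all add: Dev_add)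

text \<open>Parity bookkeeping for the two terms of \<open>Dev_Cons_EF\<close>, in the shape in
  which the rewriting in \<open>Dev_cong\<close> leaves it; each \<open>0\<close> is the parity of
  \<open>lgr\<close> or \<open>lgl\<close>.\<close>

lemma add_mod2_cong:
  "(a + b) mod 2 = u \<Longrightarrow> ((g + a) mod 2 + (0 + b) mod 2) mod 2 = (g + u) mod (2::nat)"
  "(a + b) mod 2 = u \<Longrightarrow> ((0 + a) mod 2 + (g + b) mod 2) mod 2 = (g + u) mod (2::nat)"
proof -
  assume *: "(a + b) mod 2 = u"
  have "((g + a) mod 2 + (0 + b) mod 2) mod 2 = (g + (a + b)) mod 2"
       "((0 + a) mod 2 + (g + b) mod 2) mod 2 = (g + (a + b)) mod 2"
    by (simp_all only: mod_add_eq add_0 ac_simps)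
  moreover have "(g + (a + b)) mod 2 = (g + u) mod 2"
    unfolding *[symmetric] by (simp only: mod_add_right_eq)
  ultimately show "((g + a) mod 2 + (0 + b) mod 2) mod 2 = (g + u) mod 2"
       "((0 + a) mod 2 + (g + b) mod 2) mod 2 = (g + u) mod 2"
    by simp_all
qed

text \<open>The coproduct is even, so it contains only pairs whose parities add up to that of
  \<open>u\<close>. This is what allows products of homogeneous functionals to be handled by
  parities alone.\<close>

lemma Dev_cong:
  "(\<And>a b. (wpar a + wpar b) mod 2 = wpar u \<Longrightarrow> \<phi> a b = \<psi> a b) \<Longrightarrow> Dev \<phi> u = Dev \<psi> u"
proof (induction u arbitrary: \<phi> \<psi>)
  case (Cons g u)
  show ?case
  proof (cases "is_EF g")
    case True
    have "Dev (\<lambda>a b. \<phi> (g # a) (lgr g @ b)) u = Dev (\<lambda>a b. \<psi> (g # a) (lgr g @ b)) u"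
      by (rule Cons.IH, rule Cons.prems, simp only: wpar_Cons wpar_append wpar_lgr add_mod2_cong)
    moreover have "Dev (\<lambda>a b. (-1) ^ (gpar g * wpar a) * \<phi> (lgl g @ a) (g # b)) u
        = Dev (\<lambda>a b. (-1) ^ (gpar g * wpar a) * \<psi> (lgl g @ a) (g # b)) u"
      by (rule Cons.IH, rule arg_cong[where f = "\<lambda>x. _ * x"], rule Cons.prems,
            simp only: wpar_Cons wpar_append wpar_lgl add_mod2_cong)
    ultimately show ?thesis
      by (simp add: Dev_Cons_EF[OF True])
  next
    case False
    then show ?thesis
      by (simp add: Dev_Cons_K) (rule Cons.IH, rule Cons.prems, simp add: wpar_Cons gpar_not_EF)
  qed
qed simp

lemma neg_one_wpar_append:
  "(- 1 :: complex) ^ (wpar (u @ v) * c) = (- 1) ^ (wpar u * c) * (- 1) ^ (wpar v * c)"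
  "(- 1 :: complex) ^ (c * wpar (u @ v)) = (- 1) ^ (c * wpar u) * (- 1) ^ (c * wpar v)"
  "(- 1 :: complex) ^ (wpar (g # v) * c) = (- 1) ^ (gpar g * c) * (- 1) ^ (wpar v * c)"
  "(- 1 :: complex) ^ (c * wpar (g # v)) = (- 1) ^ (c * gpar g) * (- 1) ^ (c * wpar v)"
  by (simp_all add: wpar_append wpar_Cons add_mult_distrib add_mult_distrib2 power_add ac_simps)

text \<open>Multiplicativity of the coproduct; the sign is that of the product in the tensor
  square.\<close>

lemma Dev_append:
  "Dev \<phi> (u @ v) = Dev (\<lambda>a b. Dev (\<lambda>c d. (-1) ^ (wpar b * wpar c) * \<phi> (a @ c) (b @ d)) v) u"
proof (induction u arbitrary: \<phi>)
  case (Cons g u)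
  show ?case
  proof (cases "is_EF g")
    case True
    show ?thesis
      by (simp add: Dev_Cons_EF[OF True] Cons.IH neg_one_wpar_append flip: Dev_cmult)
         (simp add: ac_simps)
  next
    case False
    then show ?thesis
      by (simp add: Dev_Cons_K Cons.IH neg_one_wpar_append gpar_not_EF)
  qed
qed simp

text \<open>The convolution product on plain functions of words: by \<open>fmult_wrd\<close> it
  computes \<open>fmult\<close> on words. Its arguments may be translates such as
  \<open>\<lambda>a. f (X # a)\<close> that have not been recognized as functionals on the
  algebra.\<close>

definition fm :: "('n gen list \<Rightarrow> complex) \<Rightarrow> ('n gen list \<Rightarrow> complex) \<Rightarrow> 'n::{finite,linorder} gen list \<Rightarrow> complex" where
  "fm f g = Dev (\<lambda>a b. (-1) ^ (wpar b * wpar a) * f a * g b)"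

lemma fmult_lin_ext: "fmult f g = lin_ext (fm (\<lambda>u. f (wrd u)) (\<lambda>u. g (wrd u)))"
  by (simp add: fmult_def fun_eq_iff fm_def Dev_def lin_ext_def case_prod_unfold ac_simps)

lemma fmult_wrd: "fmult f g (wrd u) = fm (\<lambda>u. f (wrd u)) (\<lambda>u. g (wrd u)) u"
  by (simp add: fmult_lin_ext)

lemma fmult_linear: "linear_functional (fmult f g)"
  by (simp add: fmult_lin_ext linear_functional_lin_ext_words)

lemma fm_Nil: "fm f g [] = f [] * g []"
  by (simp add: fm_def)

lemma fm_Cons_K: "\<not> is_EF X \<Longrightarrow> fm f g (X # x) = fm (\<lambda>a. f (X # a)) (\<lambda>b. g (X # b)) x"
  by (simp add: fm_def Dev_Cons_K neg_one_wpar_append gpar_not_EF)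

lemma fm_snoc_K: "\<not> is_EF X \<Longrightarrow> fm f g (x @ [X]) = fm (\<lambda>a. f (a @ [X])) (\<lambda>b. g (b @ [X])) x"
  by (simp add: fm_def Dev_append Dev_Cons_K neg_one_wpar_append gpar_not_EF)

text \<open>In the second term the sign of \<open>Dev_Cons_EF\<close> cancels against the one built
  into \<open>fm\<close>. In the first, \<open>X\<close> enlarges the left factor and leaves
  (-1)^([X][b]), which is charged to \<open>g\<close>.\<close>

lemma fm_Cons_EF:
  assumes "is_EF X"
  shows "fm f g (X # x) = fm (\<lambda>a. f (X # a)) (\<lambda>b. (-1) ^ (gpar X * wpar b) * g (lgr X @ b)) x
           + fm (\<lambda>a. f (lgl X @ a)) (\<lambda>b. g (X # b)) x"
  by (simp add: fm_def Dev_Cons_EF[OF assms] neg_one_wpar_append mult.assoc)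
     (simp add: ac_simps neg_one_power_cancel)

text \<open>Mirror image of \<open>fm_Cons_EF\<close>: now the first term is free of signs, and in
  the second the sign is charged to \<open>f\<close>.\<close>

lemma fm_snoc_EF:
  assumes "is_EF X"
  shows "fm f g (x @ [X]) = fm (\<lambda>a. f (a @ [X])) (\<lambda>b. g (b @ lgr X)) x
           + fm (\<lambda>a. (-1) ^ (gpar X * wpar a) * f (a @ lgl X)) (\<lambda>b. g (b @ [X])) x"
  by (simp add: fm_def Dev_append Dev_Cons_EF[OF assms] neg_one_wpar_append mult.assoc Dev_add)
     (simp add: ac_simps neg_one_power_cancel)

lemma fm_add_left: "fm (\<lambda>a. f a + f' a) g u = fm f g u + fm f' g u"
  by (simp add: fm_def algebra_simps Dev_add)

lemma fm_add_right: "fm f (\<lambda>b. g b + g' b) u = fm f g u + fm f g' u"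
  by (simp add: fm_def algebra_simps Dev_add)

lemma fm_cmult_left: "fm (\<lambda>a. c * f a) g u = c * fm f g u"
  by (simp add: fm_def ac_simps flip: Dev_cmult)

lemma fm_cmult_right: "fm f (\<lambda>b. c * g b) u = c * fm f g u"
  by (simp add: fm_def ac_simps flip: Dev_cmult)

lemma fm_zero [simp]: "fm (\<lambda>a. 0) g u = 0" "fm f (\<lambda>b. 0) u = 0"
  by (simp_all add: fm_def)

lemma fm_homogeneous:
  fixes f g :: "'n::{finite,linorder} gen list \<Rightarrow> complex"
  assumes "\<And>a. wpar a \<noteq> p \<Longrightarrow> f a = 0" "\<And>b. wpar b \<noteq> r \<Longrightarrow> g b = 0" "wpar u \<noteq> (p + r) mod 2"
  shows "fm f g u = 0"
proof -
  have "fm f g u = Dev (\<lambda>a b. 0) u"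
    unfolding fm_def
  proof (rule Dev_cong)
    fix a b :: "'n gen list" assume "(wpar a + wpar b) mod 2 = wpar u"
    then have "wpar a \<noteq> p \<or> wpar b \<noteq> r"
      using assms(3) by auto
    then show "(-1) ^ (wpar b * wpar a) * f a * g b = 0"
      using assms by auto
  qed
  then show ?thesis by simp
qed

section \<open>Weights\<close>

text \<open>The index i + 1. At \<open>Max UNIV\<close> it is the minimum of the empty set and
  carries no information, hence the guards \<open>i \<noteq> Max UNIV\<close> everywhere.\<close>

definition nxt :: "'n::{finite,linorder} \<Rightarrow> 'n" where
  "nxt i = Min {i<..}"

lemma less_nxt: "i \<noteq> Max UNIV \<Longrightarrow> (i::'n::{finite,linorder}) < nxt i"
  and nxt_le: "i < k \<Longrightarrow> nxt i \<le> k"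
proof -
  show "nxt i \<le> k" if "i < k" for k
    using that by (simp add: nxt_def)
  assume "i \<noteq> Max UNIV"
  then have "i < Max UNIV"
    by (simp add: less_le)
  then have "{i<..} \<noteq> {}"
    by auto
  then show "i < nxt i"
    using Min_in[of "{i<..}"] by (simp add: nxt_def)
qed

lemma le_last: "(i::'n::{finite,linorder}) \<le> Max UNIV"
  by simp

lemma downward_induct [case_names last step]:
  fixes j :: "'n::{finite,linorder}"
  assumes "P (Max UNIV)" "\<And>i. i \<noteq> Max UNIV \<Longrightarrow> P (nxt i) \<Longrightarrow> P i"
  shows "P j"
proof (rule ccontr)
  assume "\<not> P j"
  define i where "i = Max {i. \<not> P i}"
  have "i \<in> {i. \<not> P i}"
    unfolding i_def using \<open>\<not> P j\<close> by (intro Max_in) auto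
  then have i: "\<not> P i" by simp
  then have "i \<noteq> Max UNIV" using assms(1) by metis
  then have "\<not> P (nxt i)" "i < nxt i" using assms(2) i less_nxt by auto
  moreover have "nxt i \<le> i" unfolding i_def[symmetric]
    using \<open>\<not> P (nxt i)\<close> unfolding i_def by (intro Max_ge) auto
  ultimately show False by simp
qed

lemma antitone_nxt:
  fixes f :: "'n::{finite,linorder} \<Rightarrow> real"
  assumes "\<And>i. i \<noteq> Max UNIV \<Longrightarrow> f (nxt i) \<le> f i" "i \<le> j"
  shows "f j \<le> f i"
proof -
  have "\<forall>j\<ge>i. f j \<le> f i"
  proof (induction i rule: downward_induct)
    case last
    then show ?case using le_last by (metis antisym order_refl)
  next
    case (step i)
    show ?case
    proof (intro allI impI)
      fix j assume "i \<le> j"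
      then consider "j = i" | "nxt i \<le> j" using nxt_le by force
      then show "f j \<le> f i"
        using step assms(1)[OF step(1)] by cases (auto intro: order_trans)
    qed
  qed
  then show ?thesis using assms(2) by simp
qed

lemma simple_root_nxt: "simple_root i = (if i = Max UNIV then eps i else eps i - eps (nxt i))"
  by (simp add: simple_root_def nxt_def)

lemma inner_eps: "\<mu> \<bullet> eps i = \<mu> $ i"
  by (simp add: eps_def inner_axis)

lemma eps_nth: "eps i $ j = (if i = j then 1 else 0)"
  by (simp add: eps_def axis_def)

lemma inner_simple_root: "\<mu> \<bullet> simple_root i = \<mu> $ i - (if i = Max UNIV then 0 else \<mu> $ nxt i)"
  by (simp add: simple_root_nxt inner_eps inner_diff_right)

lemma simple_root_norm: "simple_root i \<bullet> simple_root i = (if i = Max UNIV then 1 else 2)"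
proof -
  have "simple_root i \<bullet> simple_root i
      = simple_root i $ i - (if i = Max UNIV then 0 else simple_root i $ nxt i)"
    by (rule inner_simple_root)
  then show ?thesis
    using less_nxt[of i] by (simp add: simple_root_nxt eps_nth split: if_splits)
qed

text \<open>The squared lengths are 2 for i < n and 1 for i = n, so both normalizations of the label
  come out as the plain inner product.\<close>

lemma weight_label_eq: "weight_label \<mu> i = \<mu> \<bullet> simple_root i"
  unfolding weight_label_def simple_root_norm by simp

text \<open>The last label is the last coordinate, and every other label is a difference of
  neighbouring coordinates, so integrality spreads downwards from the last index.\<close>

lemma weight_lattice_iff: "\<mu> \<in> weight_lattice \<longleftrightarrow> (\<forall>i. \<mu> $ i \<in> \<int>)"
proof
  assume *: "\<mu> \<in> weight_lattice"
  show "\<forall>i. \<mu> $ i \<in> \<int>"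
  proof
    fix i show "\<mu> $ i \<in> \<int>"
    proof (induction i rule: downward_induct)
      case last
      have "weight_label \<mu> (Max UNIV) \<in> \<int>" using * by (simp add: weight_lattice_def)
      then show ?case by (simp add: weight_label_eq inner_simple_root)
    next
      case (step i)
      have "weight_label \<mu> i \<in> \<int>" using * by (simp add: weight_lattice_def)
      then have "\<mu> $ i - \<mu> $ nxt i \<in> \<int>" using step(1) by (simp add: weight_label_eq inner_simple_root)
      then have "(\<mu> $ i - \<mu> $ nxt i) + \<mu> $ nxt i \<in> \<int>" using step(2) by (rule Ints_add)
      then show ?case by simp
    qed
  qed
qed (simp add: weight_lattice_def weight_label_eq inner_simple_root Ints_diff)

text \<open>Dominant weights thus are partitions with at most n parts, the shape on which
  \<open>dominant_extremal\<close> inducts.\<close>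

lemma dominant_weights_iff:
  "\<mu> \<in> dominant_weights \<longleftrightarrow>
     (\<forall>i. \<mu> $ i \<in> \<int>) \<and> (\<forall>i j. i \<le> j \<longrightarrow> \<mu> $ j \<le> \<mu> $ i) \<and> (\<forall>i. \<mu> $ i \<ge> 0)"
proof
  assume *: "\<mu> \<in> dominant_weights"
  have lab: "\<mu> $ i - (if i = Max UNIV then 0 else \<mu> $ nxt i) \<ge> 0" for i
    using * by (auto simp: dominant_weights_def weight_label_eq inner_simple_root)
  have anti: "\<mu> $ j \<le> \<mu> $ i" if "i \<le> j" for i j
    by (rule antitone_nxt[OF _ that]) (use lab in \<open>metis diff_ge_0_iff_ge\<close>)
  have "\<mu> $ Max UNIV \<ge> 0" using lab[of "Max UNIV"] by simp
  then have "\<mu> $ i \<ge> 0" for i using anti[OF le_last, of i] by linarith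
  then show "(\<forall>i. \<mu> $ i \<in> \<int>) \<and> (\<forall>i j. i \<le> j \<longrightarrow> \<mu> $ j \<le> \<mu> $ i) \<and> (\<forall>i. \<mu> $ i \<ge> 0)"
    using * anti by (simp add: dominant_weights_def weight_lattice_iff)
next
  assume *: "(\<forall>i. \<mu> $ i \<in> \<int>) \<and> (\<forall>i j. i \<le> j \<longrightarrow> \<mu> $ j \<le> \<mu> $ i) \<and> (\<forall>i. \<mu> $ i \<ge> 0)"
  have "\<mu> $ nxt i \<le> \<mu> $ i" if "i \<noteq> Max UNIV" for i
    using * less_nxt[OF that] by simp
  then show "\<mu> \<in> dominant_weights"
    using * by (simp add: dominant_weights_def weight_lattice_iff weight_label_eq inner_simple_root)
qed

lemma eps_lattice: "eps i \<in> weight_lattice"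
  by (simp add: weight_lattice_iff eps_nth)

lemma lattice_0: "0 \<in> weight_lattice"
  by (simp add: weight_lattice_iff)

lemma lattice_add: "\<mu> \<in> weight_lattice \<Longrightarrow> \<nu> \<in> weight_lattice \<Longrightarrow> \<mu> + \<nu> \<in> weight_lattice"
  by (simp add: weight_lattice_iff)

lemma lattice_diff: "\<mu> \<in> weight_lattice \<Longrightarrow> \<nu> \<in> weight_lattice \<Longrightarrow> \<mu> - \<nu> \<in> weight_lattice"
  by (simp add: weight_lattice_iff Ints_diff)

lemma lattice_uminus: "\<mu> \<in> weight_lattice \<Longrightarrow> - \<mu> \<in> weight_lattice"
  by (simp add: weight_lattice_iff)

lemma lattice_scaleR: "\<mu> \<in> weight_lattice \<Longrightarrow> c \<in> \<int> \<Longrightarrow> c *\<^sub>R \<mu> \<in> weight_lattice"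
  by (simp add: weight_lattice_iff)

lemma simple_root_lattice: "simple_root i \<in> weight_lattice"
  by (simp add: simple_root_nxt eps_lattice lattice_diff)

lemma lattice_sum_list: "(\<And>x. x \<in> set xs \<Longrightarrow> f x \<in> weight_lattice) \<Longrightarrow> (\<Sum>x\<leftarrow>xs. f x) \<in> weight_lattice"
  by (induction xs) (simp_all add: lattice_0 lattice_add)

lemma inner_lattice_Ints: "\<mu> \<in> weight_lattice \<Longrightarrow> \<nu> \<in> weight_lattice \<Longrightarrow> \<mu> \<bullet> \<nu> \<in> \<int>"
  by (simp add: weight_lattice_iff inner_vec_def Ints_sum)

lemma inner_simple_roots_eqI:
  assumes "\<And>i. \<mu> \<bullet> simple_root i = \<nu> \<bullet> simple_root i"
  shows "\<mu> = \<nu>"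
proof -
  have "\<mu> $ i = \<nu> $ i" for i
  proof (induction i rule: downward_induct)
    case last
    then show ?case using assms[of "Max UNIV"] by (simp add: inner_simple_root)
  next
    case (step i)
    then show ?case using assms[of i] by (simp add: inner_simple_root)
  qed
  then show ?thesis by (simp add: vec_eq_iff)
qed

text \<open>For i < j the roots \<open>eps i - eps j\<close> and \<open>eps i + eps j\<close> add up
  to \<open>2 *\<^sub>R eps i\<close>; the roots \<open>2 *\<^sub>R eps i\<close> minus the odd
  roots contribute one more \<open>eps i\<close> each.\<close>

lemma two_rho_nth: "two_rho $ k = 2 * real (card {j. k < j}) + 1"
proof -
  define P where "P = {(i::'a, j). i < j}"
  define A where "A = {eps i - eps j | i j :: 'a. i < j}"
  define B where "B = {eps i + eps j | i j :: 'a. i < j}"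
  define C where "C = {2 *\<^sub>R eps i | i :: 'a. True}"
  have fin: "finite P" by simp
  have A: "A = (\<lambda>(i, j). eps i - eps j) ` P" and B: "B = (\<lambda>(i, j). eps i + eps j) ` P"
    and C: "C = range (\<lambda>i. 2 *\<^sub>R eps i)"
    by (auto simp: A_def B_def C_def P_def)
  have injA: "inj_on (\<lambda>(i, j). eps i - eps j) P"
  proof (rule inj_onI, clarsimp simp: P_def)
    fix i j i' j' :: 'a assume *: "i < j" "i' < j'" "eps i - eps j = eps i' - eps j'"
    have "(eps i - eps j) $ k = (eps i' - eps j') $ k" for k using *(3) by simp
    from this[of i] this[of j] this[of i'] this[of j'] *(1,2) show "i = i' \<and> j = j'"
      by (auto simp: eps_nth split: if_splits)
  qed
  have injB: "inj_on (\<lambda>(i, j). eps i + eps j) P"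
  proof (rule inj_onI, clarsimp simp: P_def)
    fix i j i' j' :: 'a assume *: "i < j" "i' < j'" "eps i + eps j = eps i' + eps j'"
    have "(eps i + eps j) $ k = (eps i' + eps j') $ k" for k using *(3) by simp
    from this[of i] this[of j] this[of i'] this[of j'] *(1,2) show "i = i' \<and> j = j'"
      by (auto simp: eps_nth split: if_splits)
  qed
  have injE: "inj (eps :: 'a \<Rightarrow> _)"
    by (rule injI) (metis eps_nth zero_neq_one)
  \<comment> \<open>The three families are disjoint: the coordinate sum separates the differences
    from the rest, and a coordinate equal to 2 separates \<open>C\<close> from
    \<open>B\<close>.\<close>
  have sA: "(\<Sum>k\<in>UNIV. x $ k) = 0" if "x \<in> A" for x
    using that by (auto simp: A_def sum_subtractf eps_nth)
  have sB: "(\<Sum>k\<in>UNIV. x $ k) = 2 \<and> (\<forall>k. x $ k \<le> 1)" if "x \<in> B" for x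
    using that by (auto simp: B_def sum.distrib eps_nth)
  have sC: "(\<Sum>k\<in>UNIV. x $ k) = 2 \<and> (\<exists>k. x $ k = 2)" if "x \<in> C" for x
    using that by (auto simp: C_def eps_nth simp flip: sum_distrib_left)
  have disj: "A \<inter> B = {}" "(A \<union> B) \<inter> C = {}"
    subgoal using sA sB by force
    subgoal
    proof (rule equals0I, elim IntE UnE)
      fix x assume "x \<in> A" "x \<in> C"
      then show False using sA sC by force
    next
      fix x assume "x \<in> B" "x \<in> C"
      then obtain k where "x $ k = 2" "x $ k \<le> 1" using sB sC by blast
      then show False by simp
    qed
    done
  have fins: "finite A" "finite B" "finite C"
    unfolding A B C using fin by auto
  have "\<Sum>(even_pos_roots :: 'a euclid set) = \<Sum>A + \<Sum>B + \<Sum>C"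
    unfolding even_pos_roots_def A_def[symmetric] B_def[symmetric] C_def[symmetric]
    using disj fins by (simp add: sum.union_disjoint)
  also have "\<Sum>A = (\<Sum>(i, j)\<in>P. eps i - eps j)"
    unfolding A by (subst sum.reindex[OF injA]) (simp add: case_prod_unfold)
  also have "\<Sum>B = (\<Sum>(i, j)\<in>P. eps i + eps j)"
    unfolding B by (subst sum.reindex[OF injB]) (simp add: case_prod_unfold)
  also have "(\<Sum>(i, j)\<in>P. eps i - eps j) + (\<Sum>(i, j)\<in>P. eps i + eps j) = (\<Sum>(i, j)\<in>P. 2 *\<^sub>R eps i)"
    by (simp add: case_prod_unfold scaleR_2 flip: sum.distrib)
  also have "\<Sum>C = (\<Sum>i\<in>UNIV. 2 *\<^sub>R eps i)"
    unfolding C by (subst sum.reindex) (auto intro!: injI dest: injD[OF injE])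
  finally have ev: "\<Sum>(even_pos_roots :: 'a euclid set) = (\<Sum>(i, j)\<in>P. 2 *\<^sub>R eps i) + (\<Sum>i\<in>UNIV. 2 *\<^sub>R eps i)" .
  have od: "\<Sum>(odd_pos_roots :: 'a euclid set) = (\<Sum>i\<in>UNIV. eps i)"
  proof -
    have "odd_pos_roots = range (eps :: 'a \<Rightarrow> _)" by (auto simp: odd_pos_roots_def)
    then show ?thesis by (metis sum.reindex_cong[OF injE])
  qed
  have "two_rho $ k = (\<Sum>(i, j)\<in>P. 2 * eps i $ k) + (\<Sum>i\<in>UNIV. 2 * eps i $ k) - (\<Sum>i\<in>UNIV. eps i $ k)"
    unfolding two_rho_def ev od by (simp add: case_prod_unfold)
  also have "(\<Sum>(i, j)\<in>P. 2 * eps i $ k) = 2 * real (card {j. k < j})"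
  proof -
    have "(\<Sum>(i, j)\<in>P. 2 * eps i $ k) = (\<Sum>p\<in>P. if fst p = k then 2 else 0 :: real)"
      by (auto simp: eps_nth intro!: sum.cong)
    also have "\<dots> = (\<Sum>p\<in>{p \<in> P. fst p = k}. 2)"
      by (rule sum.inter_filter[OF fin, symmetric])
    also have "{p \<in> P. fst p = k} = Pair k ` {j. k < j}"
      by (auto simp: P_def)
    finally show ?thesis by (simp add: card_image inj_on_def)
  qed
  also have "(\<Sum>i\<in>UNIV. 2 * eps i $ k) = 2"
    by (simp add: eps_nth flip: sum_distrib_left)
  also have "(\<Sum>i\<in>UNIV. eps i $ k) = 1"
    by (simp add: eps_nth flip: sum_distrib_left)
  finally show ?thesis by simp
qed

text \<open>Neighbouring coordinates of \<open>two_rho\<close> differ by 2 and the last one is 1;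
  these are the squared lengths of the simple roots.\<close>

lemma two_rho_simple_root: "two_rho \<bullet> simple_root i = simple_root i \<bullet> simple_root i"
proof (cases "i = Max UNIV")
  case True
  have "{j. i < j} = {}" using le_last[where ?'n = 'a] unfolding True by (auto simp: not_less)
  then show ?thesis
    using True by (simp add: inner_simple_root[of two_rho] simple_root_norm two_rho_nth)
next
  case False
  have "{j. i < j} = insert (nxt i) {j. nxt i < j}"
    using less_nxt[OF False] nxt_le[of i] by (auto simp: le_less)
  then have "card {j. i < j} = Suc (card {j. nxt i < j})"
    by simp
  then show ?thesis
    using False by (simp add: inner_simple_root[of two_rho] simple_root_norm two_rho_nth)
qed

lemma two_rho_lattice: "two_rho \<in> weight_lattice"
  by (simp add: weight_lattice_iff two_rho_nth)

lemma simple_root_norm_pos: "simple_root i \<bullet> simple_root i > 0"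
  by (simp add: simple_root_norm)

lemma two_rho_sum_list: "two_rho \<bullet> (\<Sum>j\<leftarrow>js. simple_root j) = (\<Sum>j\<leftarrow>js. simple_root j \<bullet> simple_root j)"
  by (induction js) (simp_all add: inner_add_right two_rho_simple_root)

text \<open>Pairing with \<open>two_rho\<close> serves as a height function. It shows that a
  nonempty sum of simple roots is not zero, the fact with which the comparisons of weights
  end.\<close>

lemma two_rho_sum_list_pos: "js \<noteq> [] \<Longrightarrow> two_rho \<bullet> (\<Sum>j\<leftarrow>js. simple_root j) > 0"
proof (cases js)
  case (Cons j js')
  have "(\<Sum>j\<leftarrow>js'. simple_root j \<bullet> simple_root j) \<ge> 0"
    by (auto intro!: sum_list_nonneg)
  then show ?thesis
    unfolding two_rho_sum_list Cons using add_pos_nonneg[OF simple_root_norm_pos[of j]] by simp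
qed simp

section \<open>Powers of a generic q\<close>

locale generic_q =
  fixes q :: complex
  assumes q_nonzero: "q \<noteq> 0" and q_generic: "\<And>m::nat. m > 0 \<Longrightarrow> q ^ m \<noteq> 1"
begin

lemma q_powi_eq_1: "q powi m = 1 \<longleftrightarrow> m = 0"
proof
  assume *: "q powi m = 1"
  show "m = 0"
  proof (rule ccontr)
    assume "m \<noteq> 0"
    have "q ^ nat \<bar>m\<bar> = 1"
      using * by (auto simp: power_int_def power_inverse split: if_splits)
    then show False using q_generic[of "nat \<bar>m\<bar>"] \<open>m \<noteq> 0\<close> by simp
  qed
qed simp

lemma qpow_nonzero [simp]: "qpow q x \<noteq> 0"
  by (simp add: qpow_def q_nonzero)

lemma qpow_0 [simp]: "qpow q 0 = 1"
  by (simp add: qpow_def)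

lemma qpow_add: "x \<in> \<int> \<Longrightarrow> y \<in> \<int> \<Longrightarrow> qpow q (x + y) = qpow q x * qpow q y"
  by (auto simp: qpow_def power_int_add q_nonzero elim!: Ints_cases)

lemma qpow_minus: "x \<in> \<int> \<Longrightarrow> qpow q (- x) = inverse (qpow q x)"
  by (auto simp: qpow_def power_int_minus elim!: Ints_cases)

lemma qpow_inj: "x \<in> \<int> \<Longrightarrow> y \<in> \<int> \<Longrightarrow> qpow q x = qpow q y \<Longrightarrow> x = y"
proof -
  assume *: "x \<in> \<int>" "y \<in> \<int>" "qpow q x = qpow q y"
  have "qpow q (x + - y) = 1"
    using * by (simp add: qpow_add qpow_minus del: add_uminus_conv_diff)
  with * show "x = y"
    by (auto simp: qpow_def q_powi_eq_1 elim!: Ints_cases)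
qed

lemma qpow_1: "qpow q 1 = q"
  by (simp add: qpow_def)

lemma q_diff_nonzero: "q - inverse q \<noteq> 0"
proof
  assume "q - inverse q = 0"
  then have "q ^ 2 = 1" using q_nonzero by (simp add: power2_eq_square field_simps)
  then show False using q_generic[of 2] by simp
qed

text \<open>The eigenvalues of the \<open>k_i\<close> determine the integers (mu, alpha_i) because q
  is not a root of unity, and these determine mu.\<close>

lemma weight_eqI:
  assumes "\<mu> \<in> weight_lattice" "\<nu> \<in> weight_lattice"
    "\<And>i. qpow q (\<mu> \<bullet> simple_root i) = qpow q (\<nu> \<bullet> simple_root i)"
  shows "\<mu> = \<nu>"
  by (rule inner_simple_roots_eqI)
     (use assms in \<open>auto intro!: qpow_inj inner_lattice_Ints simple_root_lattice\<close>)

end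

section \<open>Extremal functionals\<close>

text \<open>The relations of \<open>U\<^sub>q\<close> other than the Serre relations, for a functional given by its values on
  words.\<close>

definition basic_rels :: "complex \<Rightarrow> ('n::{finite,linorder} gen list \<Rightarrow> complex) \<Rightarrow> bool" where
  "basic_rels q h \<longleftrightarrow>
     (\<forall>x y i. h (x @ KInvGen i # KGen i # y) = h (x @ y)) \<and>
     (\<forall>x y i j. h (x @ KGen i # EGen j # y) =
        qpow q (simple_root i \<bullet> simple_root j) * h (x @ EGen j # KGen i # y)) \<and>
     (\<forall>x y i j. h (x @ KGen i # FGen j # y) =
        qpow q (- (simple_root i \<bullet> simple_root j)) * h (x @ FGen j # KGen i # y)) \<and>
     (\<forall>x y i j. h (x @ EGen i # FGen j # y) =
        (-1) ^ (gpar (EGen i) * gpar (FGen j)) * h (x @ FGen j # EGen i # y) +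
        (if i = j then (h (x @ KGen i # y) - h (x @ KInvGen i # y)) / (q - inverse q) else 0))"

text \<open>\<open>XG True\<close> and \<open>XG False\<close> are the raising and the lowering generators; arguments that are
  symmetric under exchanging the two are carried out for \<open>XG o'\<close>.\<close>

fun XG :: "bool \<Rightarrow> 'n \<Rightarrow> 'n gen" where
  "XG True i = EGen i"
| "XG False i = FGen i"

definition osg :: "bool \<Rightarrow> real" where
  "osg o' = (if o' then 1 else -1)"

lemma osg_simps [simp]: "osg True = 1" "osg False = -1" "osg (\<not> o') = - osg o'"
  by (simp_all add: osg_def)

lemma osg_Ints [simp]: "osg o' \<in> \<int>"
  by (simp add: osg_def)

lemma is_EF_XG [simp]: "is_EF (XG o' i)"
  by (cases o') auto

lemma gen_exhaust_XG: obtains (X) o' i where "g = XG o' i" | (K) i where "g = KGen i" | (KI) i where "g = KInvGen i"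
  by (cases g) (metis XG.simps)+

lemma basic_rels_K: "basic_rels q h \<Longrightarrow> h (x @ KGen i # XG o' j # y) =
    qpow q (osg o' * (simple_root i \<bullet> simple_root j)) * h (x @ XG o' j # KGen i # y)"
  by (cases o') (simp_all add: basic_rels_def)

lemma basic_rels_KInv: "basic_rels q h \<Longrightarrow> h (x @ KInvGen i # KGen i # y) = h (x @ y)"
  by (simp add: basic_rels_def)

text \<open>What matters is that \<open>c\<close> and \<open>d\<close> do not depend on the
  surrounding words. For a lowering letter in front of a raising one the relation for e_i f_j is
  solved for f_j e_i, using that its sign squares to 1.\<close>

lemma basic_rels_XX:
  assumes "basic_rels q h"
  shows "\<exists>c d. \<forall>x y. h (x @ XG o' i # XG (\<not> o') j # y) =
    c * h (x @ XG (\<not> o') j # XG o' i # y) + d * (h (x @ KGen i # y) - h (x @ KInvGen i # y))"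
proof -
  define s :: complex where "s = (-1) ^ (gpar (EGen (if o' then i else j)) * gpar (FGen (if o' then j else i)))"
  have s: "s * (s * z) = z" for z by (simp add: s_def neg_one_power_cancel)
  have ef: "h (x @ EGen (if o' then i else j) # FGen (if o' then j else i) # y) =
        s * h (x @ FGen (if o' then j else i) # EGen (if o' then i else j) # y) +
        (if i = j then (h (x @ KGen i # y) - h (x @ KInvGen i # y)) / (q - inverse q) else 0)" for x y
    using assms by (auto simp: basic_rels_def s_def)
  show ?thesis
  proof (cases o')
    case True
    with ef show ?thesis
      by (intro exI[of _ s] exI[of _ "if i = j then 1 / (q - inverse q) else 0"]) simp
  next
    case False
    have fe: "h (x @ FGen i # EGen j # y) = s * h (x @ EGen j # FGen i # y)
      - s * (if i = j then (h (x @ KGen i # y) - h (x @ KInvGen i # y)) / (q - inverse q) else 0)" for x y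
      using ef[of x y] False by (simp add: algebra_simps s)
    show ?thesis
      unfolding XG.simps by (intro exI[of _ s] exI[of _ "if i = j then - s / (q - inverse q) else 0"])
        (use False in \<open>simp add: fe diff_divide_distrib right_diff_distrib\<close>)
  qed
qed

lemma basic_rels_diff:
  "basic_rels q h \<Longrightarrow> basic_rels q h' \<Longrightarrow> basic_rels q (\<lambda>u. h u - h' u)"
  unfolding basic_rels_def by (simp add: algebra_simps diff_divide_distrib add_divide_distrib)

context generic_q
begin

text \<open>Each letter passed contributes a power of q, and at the right end \<open>k_i\<close>
  acts by the weight \<open>l\<close>.\<close>

lemma K_past_word:
  assumes "basic_rels q h" "\<And>x i. h (x @ [KGen i]) = qpow q (l \<bullet> simple_root i) * h x" "l \<in> weight_lattice"
  shows "h (x @ KGen i # map (XG o') js) =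
    qpow q ((l + osg o' *\<^sub>R (\<Sum>j\<leftarrow>js. simple_root j)) \<bullet> simple_root i) * h (x @ map (XG o') js)"
proof (induction js arbitrary: x)
  case Nil
  then show ?case using assms(2) by simp
next
  case (Cons j js)
  define s where "s = (\<Sum>j\<leftarrow>js. simple_root j)"
  have s: "s \<in> weight_lattice" unfolding s_def by (intro lattice_sum_list simple_root_lattice)
  have "h (x @ KGen i # map (XG o') (j # js)) =
     qpow q (osg o' * (simple_root i \<bullet> simple_root j)) * h ((x @ [XG o' j]) @ KGen i # map (XG o') js)"
    using basic_rels_K[OF assms(1), of x i o' j "map (XG o') js"] by simp
  also have "\<dots> = qpow q (osg o' * (simple_root i \<bullet> simple_root j)) *
      qpow q ((l + osg o' *\<^sub>R s) \<bullet> simple_root i) * h (x @ map (XG o') (j # js))"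
    by (subst Cons.IH) (simp add: s_def)
  also have "qpow q (osg o' * (simple_root i \<bullet> simple_root j)) * qpow q ((l + osg o' *\<^sub>R s) \<bullet> simple_root i)
     = qpow q (osg o' * (simple_root i \<bullet> simple_root j) + (l + osg o' *\<^sub>R s) \<bullet> simple_root i)"
    using s assms(3) by (intro qpow_add[symmetric] Ints_mult inner_lattice_Ints lattice_add lattice_scaleR
        simple_root_lattice) auto
  also have "osg o' * (simple_root i \<bullet> simple_root j) + (l + osg o' *\<^sub>R s) \<bullet> simple_root i
     = (l + osg o' *\<^sub>R (\<Sum>j\<leftarrow>j # js. simple_root j)) \<bullet> simple_root i"
    by (simp add: s_def inner_add_left inner_add_right algebra_simps inner_commute)
  finally show ?case .
qed

text \<open>Induction on a prefix \<open>x\<close>, with the claim for all words of opposite letters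
  behind it. The last letter of the prefix is moved to the right end: a letter
  \<open>XG o' i\<close> dies there, producing only \<open>k_i\<close> and its inverse on the way,
  and these act by scalars.\<close>

lemma extremal_vanish:
  assumes rels: "basic_rels q h" and X: "\<And>x i. h (x @ [XG o' i]) = 0"
    and K: "\<And>x i. h (x @ [KGen i]) = qpow q (l \<bullet> simple_root i) * h x" and l: "l \<in> weight_lattice"
    and zero: "\<And>js. h (map (XG (\<not> o')) js) = 0"
  shows "h u = 0"
proof -
  have "\<forall>js. h (x @ map (XG (\<not> o')) js) = 0" for x
  proof (induction x rule: rev_induct)
    case Nil
    then show ?case using zero by simp
  next
    case (snoc g x)
    have Kw: "h (x @ KGen i # map (XG (\<not> o')) js) = 0" for i js
      using snoc K_past_word[OF rels K l, of x i "\<not> o'" js] by simp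
    \<comment> \<open>Placing \<open>k_i\<close> behind its inverse gives the value without either,
      which is 0 by induction; pulling \<open>k_i\<close> out through the word gives a nonzero
      multiple of the wanted value.\<close>
    have KIw: "h (x @ KInvGen i # map (XG (\<not> o')) js) = 0" for i js
    proof -
      have "h ((x @ [KInvGen i]) @ KGen i # map (XG (\<not> o')) js) = 0"
        using basic_rels_KInv[OF rels] snoc by simp
      then show ?thesis
        by (subst (asm) K_past_word[OF rels K l]) simp
    qed
    \<comment> \<open>\<open>is\<close> collects the letters already passed, because every exchange
      transfers the head of \<open>js\<close> to the left of the moving letter.\<close>
    have Xw: "h (x @ map (XG (\<not> o')) is @ XG o' i # map (XG (\<not> o')) js) = 0" for i "is" js
    proof (induction js arbitrary: "is")
      case Nil
      then show ?case using X[of "x @ map (XG (\<not> o')) is"] by simp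
    next
      case (Cons j js)
      obtain c d where "\<And>x y. h (x @ XG o' i # XG (\<not> o') j # y) =
          c * h (x @ XG (\<not> o') j # XG o' i # y) + d * (h (x @ KGen i # y) - h (x @ KInvGen i # y))"
        using basic_rels_XX[OF rels, of o' i j] by blast
      from this[of "x @ map (XG (\<not> o')) is" "map (XG (\<not> o')) js"]
      have "h (x @ map (XG (\<not> o')) is @ XG o' i # map (XG (\<not> o')) (j # js)) =
          c * h (x @ map (XG (\<not> o')) (is @ [j]) @ XG o' i # map (XG (\<not> o')) js)
          + d * (h ((x @ map (XG (\<not> o')) is) @ KGen i # map (XG (\<not> o')) js)
             - h ((x @ map (XG (\<not> o')) is) @ KInvGen i # map (XG (\<not> o')) js))"
        by simp
      moreover have "h ((x @ map (XG (\<not> o')) is) @ KGen i # map (XG (\<not> o')) js) = 0"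
        using snoc[rule_format, of "is @ js"] by (subst K_past_word[OF rels K l]) simp
      moreover have "h ((x @ map (XG (\<not> o')) is) @ KInvGen i # map (XG (\<not> o')) js) = 0"
      proof -
        have "h (((x @ map (XG (\<not> o')) is) @ [KInvGen i]) @ KGen i # map (XG (\<not> o')) js) = 0"
          using basic_rels_KInv[OF rels, of "x @ map (XG (\<not> o')) is"] snoc[rule_format, of "is @ js"] by simp
        then show ?thesis
          by (subst (asm) K_past_word[OF rels K l]) simp
      qed
      ultimately show ?case using Cons.IH[of "is @ [j]"] by simp
    qed
    show ?case
    proof
      fix js
      show "h ((x @ [g]) @ map (XG (\<not> o')) js) = 0"
      proof (cases g rule: gen_exhaust_XG)
        case (X o'' i)
        show ?thesis
        proof (cases "o'' = o'")
          case True
          then show ?thesis using X Xw[of "[]" i js] by simp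
        next
          case False
          then have "o'' = (\<not> o')" by simp
          then show ?thesis using X snoc[rule_format, of "i # js"] by simp
        qed
      qed (use Kw KIw in auto)
    qed
  qed
  from this[of u] show ?thesis by (metis append_Nil2 list.map(1))
qed

text \<open>Moving \<open>k_i\<close> through \<open>js\<close> from the left gives the eigenvalue
  of the weight of \<open>js\<close> shifted by \<open>l\<close>; the assumption on the left gives
  that of \<open>\<mu>\<close>. Where \<open>h\<close> does not vanish, the two weights
  agree.\<close>

lemma extremal_nonvanishing_word:
  assumes "basic_rels q h" "\<And>x i. h (x @ [XG o' i]) = 0"
    "\<And>x i. h (x @ [KGen i]) = qpow q (l \<bullet> simple_root i) * h x" "l \<in> weight_lattice"
    "\<And>x i. h (KGen i # x) = qpow q (\<mu> \<bullet> simple_root i) * h x" "\<mu> \<in> weight_lattice"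
    "h u \<noteq> 0"
  obtains js where "h (map (XG (\<not> o')) js) \<noteq> 0" "\<mu> = l - osg o' *\<^sub>R (\<Sum>j\<leftarrow>js. simple_root j)"
proof -
  obtain js where js: "h (map (XG (\<not> o')) js) \<noteq> 0"
    using extremal_vanish[OF assms(1-4)] assms(7) by blast
  have "qpow q (\<mu> \<bullet> simple_root i) =
      qpow q ((l + osg (\<not> o') *\<^sub>R (\<Sum>j\<leftarrow>js. simple_root j)) \<bullet> simple_root i)" for i
    using K_past_word[OF assms(1,3,4), of "[]" i "\<not> o'" js] js assms(5)[of i "map (XG (\<not> o')) js"] by simp
  then have "\<mu> = l + osg (\<not> o') *\<^sub>R (\<Sum>j\<leftarrow>js. simple_root j)"
    by (intro weight_eqI assms lattice_add lattice_scaleR lattice_sum_list simple_root_lattice) auto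
  with js show ?thesis by (intro that) auto
qed

text \<open>Abstracts x |-> A(x v) for a highest (\<open>True\<close>) or lowest
  (\<open>False\<close>) weight vector v of weight \<open>l\<close> and a covector A of the same
  weight with A(v) = 1.\<close>

definition extremal :: "bool \<Rightarrow> 'n euclid \<Rightarrow> ('n::{finite,linorder} gen list \<Rightarrow> complex) \<Rightarrow> bool" where
  "extremal o' l h \<longleftrightarrow> basic_rels q h \<and> (\<forall>x i. h (x @ [XG o' i]) = 0) \<and>
     (\<forall>x i. h (x @ [KGen i]) = qpow q (l \<bullet> simple_root i) * h x) \<and>
     (\<forall>x i. h (KGen i # x) = qpow q (l \<bullet> simple_root i) * h x) \<and> h [] = 1"

text \<open>The difference has weight \<open>l\<close> on both sides, so a word of opposite letters
  on which it is nonzero has weight 0, hence is empty; but at the empty word both functions are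
  1.\<close>

lemma extremal_unique:
  assumes "extremal o' l h" "extremal o' l h'" "l \<in> weight_lattice"
  shows "h = h'"
proof
  fix u
  have "h u - h' u = 0"
  proof (rule ccontr)
    assume nz: "h u - h' u \<noteq> 0"
    have "basic_rels q (\<lambda>u. h u - h' u)"
      using assms by (intro basic_rels_diff) (auto simp: extremal_def)
    then obtain js where js: "h (map (XG (\<not> o')) js) - h' (map (XG (\<not> o')) js) \<noteq> 0"
      "l = l - osg o' *\<^sub>R (\<Sum>j\<leftarrow>js. simple_root j)"
      using assms nz
      by (elim extremal_nonvanishing_word[where l = l and \<mu> = l and u = u])
         (auto simp: extremal_def algebra_simps)
    then have "(\<Sum>j\<leftarrow>js. simple_root j) = 0" by (auto simp: osg_def split: if_splits)
    then have "js = []" using two_rho_sum_list_pos[of js] by auto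
    with js(1) assms show False by (simp add: extremal_def)
  qed
  then show "h u = h' u" by simp
qed

end

section \<open>Modules\<close>

lemma component_add_components: "component 0 x + component 1 x = x"
proof -
  let ?K = "Poly_Mapping.keys x"
  have "?K = {u \<in> ?K. wpar u = 0} \<union> {u \<in> ?K. wpar u = 1}"
    using wpar_cases by auto
  then have "(\<Sum>u\<in>?K. scl (Poly_Mapping.lookup x u) * wrd u) = component 0 x + component 1 x"
    unfolding component_def by (subst sum.union_disjoint[symmetric]) auto
  then show ?thesis by (simp flip: falg_sum_words)
qed

lemma basic_rels_ideal:
  fixes f :: "'n::{finite,linorder} functional"
  assumes f: "linear_functional f" and I: "\<And>x. x \<in> uq_ideal q \<Longrightarrow> f x = 0"
  shows "basic_rels q (\<lambda>u. f (wrd u))"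
proof -
  have *: "f (wrd x * r * wrd y) = 0" if "r \<in> uq_relations q" for x y r
    by (intro I uq_ideal.left uq_ideal.right uq_ideal.rel that)
  have sclw: "wrd x * (scl c * z) * wrd y = scl c * (wrd x * z * wrd y)" for c x y and z :: "'n falg"
    by (simp only: mult.assoc[symmetric] scl_commute[of "wrd x"])
  have fscl: "f (scl c * z) = c * f z" for c z
    using f by (simp add: linear_functional_def)
  note fdiff = linear_functional_diff[OF f]
  show ?thesis
    unfolding basic_rels_def
  proof (intro conjI allI)
    fix x y and i :: 'n
    have "f (wrd x * (kinv i * kk i - 1) * wrd y) = 0"
      by (rule *) (auto simp: uq_relations_def)
    then show "f (wrd (x @ KInvGen i # KGen i # y)) = f (wrd (x @ y))"
      by (simp add: algebra_simps wrd_mult fdiff)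
  next
    fix x y and i j :: 'n
    have "f (wrd x * (kk i * ee j - scl (qpow q (simple_root i \<bullet> simple_root j)) * ee j * kk i) * wrd y) = 0"
      by (rule *) (auto simp: uq_relations_def)
    then show "f (wrd (x @ KGen i # EGen j # y)) =
        qpow q (simple_root i \<bullet> simple_root j) * f (wrd (x @ EGen j # KGen i # y))"
      by (simp add: left_diff_distrib right_diff_distrib wrd_mult fdiff fscl sclw mult.assoc[of "scl _"])
  next
    fix x y and i j :: 'n
    have "f (wrd x * (kk i * ff j - scl (qpow q (- (simple_root i \<bullet> simple_root j))) * ff j * kk i) * wrd y) = 0"
      by (rule *) (auto simp: uq_relations_def)
    then show "f (wrd (x @ KGen i # FGen j # y)) =
        qpow q (- (simple_root i \<bullet> simple_root j)) * f (wrd (x @ FGen j # KGen i # y))"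
      by (simp add: left_diff_distrib right_diff_distrib wrd_mult fdiff fscl sclw mult.assoc[of "scl _"])
  next
    fix x y and i j :: 'n
    define s :: complex where "s = (-1) ^ (gpar (EGen i) * gpar (FGen j))"
    define r where "r = (if i = j then scl (1 / (q - inverse q)) * (kk i - kinv i) else 0)"
    have a: "f (wrd x * (ee i * ff j - scl s * ff j * ee i - r) * wrd y) = 0"
    proof (rule *)
      have "ee i * ff j - scl s * ff j * ee i - r \<in> {ee i * ff j - scl ((-1) ^ (gpar (EGen i) * gpar (FGen j))) * ff j * ee i
        - (if i = j then scl (1 / (q - inverse q)) * (kk i - kinv i) else 0) | i j. True}"
        unfolding s_def r_def by (rule CollectI, rule exI[of _ i], rule exI[of _ j], rule conjI[OF refl TrueI])
      then show "ee i * ff j - scl s * ff j * ee i - r \<in> uq_relations q"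
        unfolding uq_relations_def by (intro UnI1 UnI2)
    qed
    have b: "wrd x * (ee i * ff j - scl s * ff j * ee i - r) * wrd y
      = wrd (x @ EGen i # FGen j # y) - scl s * wrd (x @ FGen j # EGen i # y) - wrd x * r * wrd y"
      by (simp add: left_diff_distrib right_diff_distrib wrd_mult sclw mult.assoc[of "scl _"])
    have c: "f (wrd x * r * wrd y)
      = (if i = j then (f (wrd (x @ KGen i # y)) - f (wrd (x @ KInvGen i # y))) / (q - inverse q) else 0)"
      by (simp add: r_def sclw fscl left_diff_distrib right_diff_distrib wrd_mult fdiff linear_functional_0[OF f]
           diff_divide_distrib)
    show "f (wrd (x @ EGen i # FGen j # y)) =
        (-1) ^ (gpar (EGen i) * gpar (FGen j)) * f (wrd (x @ FGen j # EGen i # y)) +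
        (if i = j then (f (wrd (x @ KGen i # y)) - f (wrd (x @ KInvGen i # y))) / (q - inverse q) else 0)"
      using a unfolding s_def[symmetric] b fdiff fscl c by (simp only: algebra_simps add_0)
  qed
qed

locale uq_mod = generic_q q for q :: complex +
  fixes sc :: "complex \<Rightarrow> 'v::ab_group_add \<Rightarrow> 'v" and M :: "('n::{finite,linorder}, 'v) supermodule"
  assumes vs: "vector_space sc" and uqm: "uq_module q sc M"
begin

sublocale V: vector_space sc by (rule vs)

abbreviation "C \<equiv> mcarrier M"
abbreviation "act \<equiv> action M"

lemma sub_part: "p < 2 \<Longrightarrow> V.subspace (part M p)"
  using uqm by (auto simp: uq_module_def less_2_cases_iff)

lemma part_int: "v \<in> part M 0 \<Longrightarrow> v \<in> part M 1 \<Longrightarrow> v = 0"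
  using uqm by (auto simp: uq_module_def)

lemma part_in_C: "p < 2 \<Longrightarrow> v \<in> part M p \<Longrightarrow> v \<in> C"
proof -
  assume *: "p < 2" "v \<in> part M p"
  have "0 \<in> part M 0" "0 \<in> part M 1" using sub_part by (auto simp: V.subspace_0)
  then have "\<exists>a b. v = a + b \<and> a \<in> part M 0 \<and> b \<in> part M 1"
    using * by (metis add_0 add.right_neutral less_2_cases_iff One_nat_def)
  then show ?thesis by (simp add: mcarrier_def)
qed

lemma C_decomp: "v \<in> C \<Longrightarrow> \<exists>a\<in>part M 0. \<exists>b\<in>part M 1. v = a + b"
  by (auto simp: mcarrier_def)

lemma sub_C: "V.subspace C"
  using uqm V.subspace_span unfolding uq_module_def by metis

lemma C_0 [simp]: "0 \<in> C" by (rule V.subspace_0[OF sub_C])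
lemma C_add [simp]: "v \<in> C \<Longrightarrow> w \<in> C \<Longrightarrow> v + w \<in> C" by (rule V.subspace_add[OF sub_C])
lemma C_diff [simp]: "v \<in> C \<Longrightarrow> w \<in> C \<Longrightarrow> v - w \<in> C" by (rule V.subspace_diff[OF sub_C])
lemma C_sc [simp]: "v \<in> C \<Longrightarrow> sc c v \<in> C" by (rule V.subspace_scale[OF sub_C])
lemma C_sum: "(\<And>i. i \<in> I \<Longrightarrow> f i \<in> C) \<Longrightarrow> sum f I \<in> C" by (rule V.subspace_sum[OF sub_C])

lemma act_C [simp]: "v \<in> C \<Longrightarrow> act x v \<in> C"
  using uqm by (simp add: uq_module_def)
lemma act_add_vec: "v \<in> C \<Longrightarrow> w \<in> C \<Longrightarrow> act x (v + w) = act x v + act x w"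
  using uqm by (simp add: uq_module_def)
lemma act_sc: "v \<in> C \<Longrightarrow> act x (sc c v) = sc c (act x v)"
  using uqm by (simp add: uq_module_def)
lemma act_add: "v \<in> C \<Longrightarrow> act (x + y) v = act x v + act y v"
  using uqm by (simp add: uq_module_def)
lemma act_scl: "v \<in> C \<Longrightarrow> act (scl c * x) v = sc c (act x v)"
  using uqm unfolding uq_module_def by blast
lemma act_mult: "v \<in> C \<Longrightarrow> act (x * y) v = act x (act y v)"
  using uqm by (simp add: uq_module_def)
lemma act_1: "v \<in> C \<Longrightarrow> act 1 v = v"
  using uqm by (simp add: uq_module_def)
lemma act_ideal: "x \<in> uq_ideal q \<Longrightarrow> v \<in> C \<Longrightarrow> act x v = 0"
  using uqm by (simp add: uq_module_def)
lemma act_gen_part: "p < 2 \<Longrightarrow> v \<in> part M p \<Longrightarrow> act (wrd [g]) v \<in> part M ((gpar g + p) mod 2)"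
proof -
  assume "p < 2" "v \<in> part M p"
  moreover from this have "p \<in> {0, 1}" by auto
  ultimately show ?thesis using uqm unfolding uq_module_def by blast
qed

lemma act_0_vec [simp]: "act x 0 = 0"
  using act_sc[of 0 x 0] by simp
lemma act_0 [simp]: "v \<in> C \<Longrightarrow> act 0 v = 0"
  using act_add[of v 0 0] by simp
lemma act_uminus: "v \<in> C \<Longrightarrow> act (- x) v = - act x v"
  using act_add[of v x "- x"] by (simp add: eq_neg_iff_add_eq_0 add.commute)
lemma act_diff: "v \<in> C \<Longrightarrow> act (x - y) v = act x v - act y v"
  using act_add[of v x "- y"] by (simp add: act_uminus)
lemma act_uminus_vec: "v \<in> C \<Longrightarrow> act x (- v) = - act x v"
  using act_sc[of v x "- 1"] by simp
lemma act_sum: "v \<in> C \<Longrightarrow> act (sum f I) v = (\<Sum>i\<in>I. act (f i) v)"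
  by (induction I rule: infinite_finite_induct) (simp_all add: act_add)
lemma act_Nil: "v \<in> C \<Longrightarrow> act (wrd []) v = v"
  by (simp add: wrd_Nil act_1)
lemma act_append: "v \<in> C \<Longrightarrow> act (wrd (x @ y)) v = act (wrd x) (act (wrd y) v)"
  by (simp add: act_mult flip: wrd_mult)
lemma act_Cons: "v \<in> C \<Longrightarrow> act (wrd (g # y)) v = act (wrd [g]) (act (wrd y) v)"
  using act_append[of v "[g]" y] by simp

lemma act_word_part: "p < 2 \<Longrightarrow> v \<in> part M p \<Longrightarrow> act (wrd u) v \<in> part M ((wpar u + p) mod 2)"
proof (induction u)
  case Nil
  then show ?case using part_in_C by (simp add: act_Nil)
next
  case (Cons g u)
  then have "act (wrd [g]) (act (wrd u) v) \<in> part M ((gpar g + (wpar u + p) mod 2) mod 2)"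
    by (intro act_gen_part) auto
  then show ?case
    using Cons part_in_C by (simp add: act_Cons[of v g u] wpar_Cons mod_simps add.assoc)
qed

lemma act_component_part:
  assumes "p < 2" "r < 2" "v \<in> part M r"
  shows "act (component p x) v \<in> part M ((p + r) mod 2)"
proof -
  have "act (component p x) v = (\<Sum>u\<in>{u \<in> Poly_Mapping.keys x. wpar u = p}.
      sc (Poly_Mapping.lookup x u) (act (wrd u) v))"
    unfolding component_def using assms part_in_C by (simp add: act_sum act_scl)
  also have "\<dots> \<in> part M ((p + r) mod 2)"
    using act_word_part[OF assms(2,3)]
    by (intro V.subspace_sum V.subspace_scale sub_part) auto
  finally show ?thesis .
qed

text \<open>Linearity is asked on \<open>C\<close> only, since the module axioms constrain the
  action nowhere else in the ambient space; covectors matter only through their values on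
  \<open>C\<close>.\<close>

definition covec :: "('v \<Rightarrow> complex) \<Rightarrow> bool" where
  "covec A \<longleftrightarrow> (\<forall>v\<in>C. \<forall>w\<in>C. A (v + w) = A v + A w) \<and> (\<forall>c. \<forall>v\<in>C. A (sc c v) = c * A v)"

lemma covec_add: "covec A \<Longrightarrow> v \<in> C \<Longrightarrow> w \<in> C \<Longrightarrow> A (v + w) = A v + A w"
  by (simp add: covec_def)
lemma covec_sc: "covec A \<Longrightarrow> v \<in> C \<Longrightarrow> A (sc c v) = c * A v"
  by (simp add: covec_def)
lemma covec_0: "covec A \<Longrightarrow> A 0 = 0"
  using covec_sc[of A 0 0] by simp
lemma covec_uminus: "covec A \<Longrightarrow> v \<in> C \<Longrightarrow> A (- v) = - A v"
  using covec_sc[of A v "- 1"] by simp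
lemma covec_diff: "covec A \<Longrightarrow> v \<in> C \<Longrightarrow> w \<in> C \<Longrightarrow> A (v - w) = A v - A w"
  using covec_add[of A "v - w" w] by simp
lemma covec_sum: "covec A \<Longrightarrow> (\<And>i. i \<in> I \<Longrightarrow> f i \<in> C) \<Longrightarrow> A (sum f I) = (\<Sum>i\<in>I. A (f i))"
  by (induction I rule: infinite_finite_induct) (simp_all add: covec_0 covec_add C_sum)
lemma covec_act: "covec A \<Longrightarrow> covec (\<lambda>v. A (act x v))"
  by (simp add: covec_def act_add_vec act_sc)
lemma covec_plus: "covec A \<Longrightarrow> covec B \<Longrightarrow> covec (\<lambda>v. A v + B v)"
  by (simp add: covec_def algebra_simps)
lemma covec_cmult: "covec A \<Longrightarrow> covec (\<lambda>v. c * A v)"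
  by (simp add: covec_def algebra_simps)

text \<open>Homogeneous elements of parity \<open>p\<close> in the graded dual of the
  module.\<close>

definition hcov :: "nat \<Rightarrow> ('v \<Rightarrow> complex) \<Rightarrow> bool" where
  "hcov p A \<longleftrightarrow> covec A \<and> (\<forall>r<2. r \<noteq> p \<longrightarrow> (\<forall>v\<in>part M r. A v = 0))"

lemma hcov_covec: "hcov p A \<Longrightarrow> covec A"
  by (simp add: hcov_def)

lemma hcovD: "hcov p A \<Longrightarrow> r < 2 \<Longrightarrow> r \<noteq> p \<Longrightarrow> v \<in> part M r \<Longrightarrow> A v = 0"
  by (simp add: hcov_def)

text \<open>Matrix elements without a basis: the \<open>mat_elem\<close> of the theorem are the case
  of a coordinate \<open>A\<close> and a basis vector \<open>v\<close>. The arguments below vary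
  \<open>A\<close> and \<open>v\<close> freely.\<close>

definition tm :: "('v \<Rightarrow> complex) \<Rightarrow> 'v \<Rightarrow> 'n functional" where
  "tm A v = (\<lambda>x. A (act x v))"

lemma tm_linear: "covec A \<Longrightarrow> v \<in> C \<Longrightarrow> linear_functional (tm A v)"
  by (simp add: linear_functional_def tm_def act_add act_scl covec_add covec_sc)

lemma tm_homogeneous:
  "hcov p A \<Longrightarrow> p < 2 \<Longrightarrow> r < 2 \<Longrightarrow> v \<in> part M r \<Longrightarrow> homogeneous_functional ((p + r) mod 2) (tm A v)"
proof -
  assume *: "hcov p A" "p < 2" "r < 2" "v \<in> part M r"
  have "A (act (wrd u) v) = 0" if "wpar u \<noteq> (p + r) mod 2" for u
  proof -
    have "(wpar u + r) mod 2 \<noteq> p"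
      using that * wpar_cases[of u] by (auto simp: less_2_cases_iff)
    then show ?thesis
      using act_word_part[OF *(3,4), of u] hcovD[OF *(1), of "(wpar u + r) mod 2"] by simp
  qed
  then show ?thesis by (simp add: homogeneous_functional_def tm_def)
qed

lemma hcov_act:
  assumes "hcov p A" "p < 2"
  shows "hcov ((wpar u + p) mod 2) (\<lambda>v. A (act (wrd u) v))"
proof -
  have "A (act (wrd u) v) = 0" if "r < 2" "r \<noteq> (wpar u + p) mod 2" "v \<in> part M r" for r v
  proof -
    have "(wpar u + r) mod 2 \<noteq> p"
      using that assms wpar_cases[of u] by (auto simp: less_2_cases_iff)
    then show ?thesis
      using act_word_part[of r v u] that hcovD[OF assms(1), of "(wpar u + r) mod 2"] by simp
  qed
  then show ?thesis
    using assms covec_act by (simp add: hcov_def)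
qed

lemma tm_basic_rels: "covec A \<Longrightarrow> v \<in> C \<Longrightarrow> basic_rels q (\<lambda>u. A (act (wrd u) v))"
  using basic_rels_ideal[OF tm_linear, of A v] by (simp add: tm_def act_ideal covec_0)

definition hbasis :: "'v set \<Rightarrow> bool" where
  "hbasis B \<longleftrightarrow> finite B \<and> B \<subseteq> part M 0 \<union> part M 1 \<and> \<not> V.dependent B \<and> V.span B = C"

abbreviation "cf \<equiv> \<lambda>B b v. V.representation B v b"

lemma hbasis_in_C: "hbasis B \<Longrightarrow> b \<in> B \<Longrightarrow> b \<in> C"
  using V.span_base by (auto simp: hbasis_def)

lemma vpar_less_2 [simp]: "vpar M b < 2"
  by (simp add: vpar_def)

lemma hbasis_part: "hbasis B \<Longrightarrow> b \<in> B \<Longrightarrow> b \<in> part M (vpar M b)"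
  by (auto simp: hbasis_def vpar_def)

lemma hbasis_expand: "hbasis B \<Longrightarrow> v \<in> C \<Longrightarrow> (\<Sum>b\<in>B. sc (cf B b v) b) = v"
  unfolding hbasis_def by (intro V.sum_representation_eq) auto

lemma cf_covec: "hbasis B \<Longrightarrow> covec (cf B b)"
  unfolding hbasis_def covec_def by (auto simp: V.representation_add V.representation_scale)

lemma cf_basis: "hbasis B \<Longrightarrow> b' \<in> B \<Longrightarrow> cf B b b' = (if b = b' then 1 else 0)"
  unfolding hbasis_def by (simp add: V.representation_basis)

lemma covec_expand: "hbasis B \<Longrightarrow> covec A \<Longrightarrow> v \<in> C \<Longrightarrow> A v = (\<Sum>b\<in>B. cf B b v * A b)"
proof -
  assume *: "hbasis B" "covec A" "v \<in> C"
  have "A v = A (\<Sum>b\<in>B. sc (cf B b v) b)"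
    using * by (simp add: hbasis_expand)
  also have "\<dots> = (\<Sum>b\<in>B. cf B b v * A b)"
    using * hbasis_in_C by (subst covec_sum) (auto simp: covec_sc)
  finally show ?thesis .
qed

lemma cf_eqI: "hbasis B \<Longrightarrow> v \<in> C \<Longrightarrow> w \<in> C \<Longrightarrow> (\<And>b. b \<in> B \<Longrightarrow> cf B b v = cf B b w) \<Longrightarrow> v = w"
  by (metis (no_types, lifting) hbasis_expand sum.cong)

text \<open>Subtracting from v in part p its basis terms of parity p leaves the sum of the other
  terms in both parts, hence 0; independence then kills their coefficients.\<close>

lemma cf_hcov:
  assumes B: "hbasis B" and b: "b \<in> B"
  shows "hcov (vpar M b) (cf B b)"
proof -
  define S where "S p = {b \<in> B. vpar M b = p}" for p
  have SB: "S p \<subseteq> B" "finite (S p)" for p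
    using B by (auto simp: S_def hbasis_def)
  have *: "cf B b v = 0" if "p < 2" "p \<noteq> vpar M b" "v \<in> part M p" for p v
  proof -
    have vC: "v \<in> C" using that part_in_C by blast
    have "B = S p \<union> S (1 - p)" "S p \<inter> S (1 - p) = {}"
      using \<open>p < 2\<close> by (auto simp: S_def vpar_def less_2_cases_iff)
    then have "v = (\<Sum>b\<in>S p. sc (cf B b v) b) + (\<Sum>b\<in>S (1 - p). sc (cf B b v) b)"
      using hbasis_expand[OF B vC] SB by (metis sum.union_disjoint)
    then have "(\<Sum>b\<in>S (1 - p). sc (cf B b v) b) = v - (\<Sum>b\<in>S p. sc (cf B b v) b)"
      by (metis add_diff_cancel_left')
    moreover have sums: "(\<Sum>b\<in>S r. sc (cf B b v) b) \<in> part M r" if "r < 2" for r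
      using that hbasis_part[OF B] by (intro V.subspace_sum V.subspace_scale sub_part) (auto simp: S_def)
    ultimately have "(\<Sum>b\<in>S (1 - p). sc (cf B b v) b) \<in> part M p"
      using V.subspace_diff[OF sub_part[OF \<open>p < 2\<close>] \<open>v \<in> part M p\<close> sums[OF \<open>p < 2\<close>]] by simp
    moreover have "(\<Sum>b\<in>S (1 - p). sc (cf B b v) b) \<in> part M (1 - p)"
      using sums[of "1 - p"] by simp
    ultimately have "(\<Sum>b\<in>S (1 - p). sc (cf B b v) b) = 0"
      using part_int \<open>p < 2\<close> by (auto simp: less_2_cases_iff)
    moreover have "b \<in> S (1 - p)"
      using b that by (auto simp: S_def vpar_def less_2_cases_iff split: if_splits)
    ultimately show ?thesis
      using V.independentD[of B "S (1 - p)" "\<lambda>b. cf B b v" b] B SB by (auto simp: hbasis_def)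
  qed
  then show ?thesis
    using cf_covec[OF B] by (simp add: hcov_def)
qed

text \<open>A homogeneous basis of weight vectors, fixed for internal use. The basis in the theorem
  is homogeneous but need not consist of weight vectors.\<close>

definition WB :: "'v set" where
  "WB = (SOME B. hbasis B \<and> (\<forall>b\<in>B. \<exists>\<mu>\<in>weight_lattice. weight_vector q sc M \<mu> b))"

definition wt :: "'v \<Rightarrow> 'n euclid" where
  "wt b = (SOME \<mu>. \<mu> \<in> weight_lattice \<and> weight_vector q sc M \<mu> b)"

lemma WB: "hbasis WB" and wt: "b \<in> WB \<Longrightarrow> wt b \<in> weight_lattice \<and> weight_vector q sc M (wt b) b"
proof -
  have "\<exists>B. hbasis B \<and> (\<forall>b\<in>B. \<exists>\<mu>\<in>weight_lattice. weight_vector q sc M \<mu> b)"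
  proof -
    obtain B where "finite B" "B \<subseteq> part M 0 \<union> part M 1" "\<not> V.dependent B" "V.span B = C"
      "\<forall>b\<in>B. \<exists>\<mu>\<in>weight_lattice. weight_vector q sc M \<mu> b"
      using uqm unfolding uq_module_def by metis
    then show ?thesis by (intro exI[of _ B]) (simp add: hbasis_def)
  qed
  then have *: "hbasis WB \<and> (\<forall>b\<in>WB. \<exists>\<mu>\<in>weight_lattice. weight_vector q sc M \<mu> b)"
    unfolding WB_def by (rule someI_ex)
  then show "hbasis WB" by simp
  show "wt b \<in> weight_lattice \<and> weight_vector q sc M (wt b) b" if "b \<in> WB"
    unfolding wt_def by (rule someI_ex) (use * that in blast)
qed

lemma finite_WB: "finite WB"
  using WB by (simp add: hbasis_def)

lemmas WB_in_C = hbasis_in_C[OF WB]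

text \<open>Weight vectors of the dual for the transposed action, labelled so that a covector of
  weight mu can be nonzero only on vectors of that same weight mu
  (\<open>wcov_weight_vector\<close>).\<close>

definition wcov :: "'n euclid \<Rightarrow> ('v \<Rightarrow> complex) \<Rightarrow> bool" where
  "wcov \<mu> A \<longleftrightarrow> covec A \<and> (\<forall>i. \<forall>v\<in>C. A (act (kk i) v) = qpow q (\<mu> \<bullet> simple_root i) * A v)"

lemma cf_wcov:
  assumes "b \<in> WB"
  shows "wcov (wt b) (cf WB b)"
  unfolding wcov_def
proof (intro conjI allI ballI)
  show "covec (cf WB b)" by (rule cf_covec[OF WB])
  fix i v assume v: "v \<in> C"
  have "cf WB b (act (kk i) v) = (\<Sum>b'\<in>WB. cf WB b' v * cf WB b (act (kk i) b'))"
    by (rule covec_expand[OF WB covec_act[OF cf_covec[OF WB]] v])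
  also have "\<dots> = (\<Sum>b'\<in>WB. if b' = b then cf WB b v * qpow q (wt b \<bullet> simple_root i) else 0)"
  proof (rule sum.cong[OF refl])
    fix b' assume b': "b' \<in> WB"
    then have "act (kk i) b' = sc (qpow q (wt b' \<bullet> simple_root i)) b'"
      using wt by (auto simp: weight_vector_def)
    then have "cf WB b (act (kk i) b') = (if b = b' then qpow q (wt b' \<bullet> simple_root i) else 0)"
      using covec_sc[OF cf_covec[OF WB] WB_in_C[OF b']] cf_basis[OF WB b', of b] by auto
    then show "cf WB b' v * cf WB b (act (kk i) b')
        = (if b' = b then cf WB b v * qpow q (wt b \<bullet> simple_root i) else 0)"
      by auto
  qed
  finally show "cf WB b (act (kk i) v) = qpow q (wt b \<bullet> simple_root i) * cf WB b v"
    using assms finite_WB by simp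
qed

lemma wcov_weight_vector:
  assumes "wcov \<mu> A" "weight_vector q sc M \<nu> v" "v \<in> C" "A v \<noteq> 0" "\<mu> \<in> weight_lattice" "\<nu> \<in> weight_lattice"
  shows "\<mu> = \<nu>"
proof (rule weight_eqI)
  fix i
  have "A (act (kk i) v) = qpow q (\<mu> \<bullet> simple_root i) * A v"
    using assms by (simp add: wcov_def)
  moreover have "A (act (kk i) v) = qpow q (\<nu> \<bullet> simple_root i) * A v"
    using assms covec_sc[of A v] by (simp add: wcov_def weight_vector_def)
  ultimately show "qpow q (\<mu> \<bullet> simple_root i) = qpow q (\<nu> \<bullet> simple_root i)"
    using assms(4) by simp
qed (use assms in auto)

definition wts :: "'n euclid set" where "wts = wt ` WB"

lemma finite_wts: "finite wts" by (simp add: wts_def finite_WB)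
lemma wts_lattice: "\<mu> \<in> wts \<Longrightarrow> \<mu> \<in> weight_lattice" using wt by (auto simp: wts_def)

lemma nonzero_coordinate:
  assumes "v \<in> C" "v \<noteq> 0"
  obtains b where "b \<in> WB" "cf WB b v \<noteq> 0"
proof -
  have "\<not> (\<forall>b\<in>WB. cf WB b v = 0)"
  proof
    assume "\<forall>b\<in>WB. cf WB b v = 0"
    then have "(\<Sum>b\<in>WB. sc (cf WB b v) b) = 0" by simp
    then show False using hbasis_expand[OF WB assms(1)] assms(2) by simp
  qed
  then show ?thesis using that by blast
qed

lemma cf_wt_eq:
  assumes "v \<in> C" "weight_vector q sc M \<mu> v" "\<mu> \<in> weight_lattice" "b \<in> WB" "cf WB b v \<noteq> 0"
  shows "wt b = \<mu>"
  by (rule wcov_weight_vector[OF cf_wcov[OF assms(4)] assms(2,1,5)]) (use wt assms in auto)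

lemma weight_in_wts:
  assumes "v \<in> C" "v \<noteq> 0" "weight_vector q sc M \<mu> v" "\<mu> \<in> weight_lattice"
  shows "\<mu> \<in> wts"
proof -
  obtain b where b: "b \<in> WB" "cf WB b v \<noteq> 0" using nonzero_coordinate assms by blast
  then have "wt b = \<mu>" using cf_wt_eq assms by blast
  then show ?thesis using b by (auto simp: wts_def)
qed

lemma wts_weight_vector:
  assumes "\<mu> \<in> wts"
  obtains b where "b \<in> WB" "b \<noteq> 0" "weight_vector q sc M \<mu> b" "wt b = \<mu>"
proof -
  obtain b where "b \<in> WB" "wt b = \<mu>" using assms by (auto simp: wts_def)
  moreover have "b \<noteq> 0" using \<open>b \<in> WB\<close> WB V.dependent_zero by (auto simp: hbasis_def)
  ultimately show ?thesis using that wt by blast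
qed

text \<open>Covectors separate the points of \<open>C\<close>. In this way the scalar identities of
  \<open>basic_rels\<close> for all \<open>tm A v\<close> become identities between vectors.\<close>

lemma covec_eqI: "v \<in> C \<Longrightarrow> w \<in> C \<Longrightarrow> (\<And>A. covec A \<Longrightarrow> A v = A w) \<Longrightarrow> v = w"
  using cf_eqI[OF WB] cf_covec[OF WB] by blast

lemma act_KI_K: "v \<in> C \<Longrightarrow> act (kinv i) (act (kk i) v) = v"
  and act_K_KI: "v \<in> C \<Longrightarrow> act (kk i) (act (kinv i) v) = v"
proof -
  have "kinv i * kk i - 1 \<in> uq_ideal q" "kk i * kinv i - 1 \<in> uq_ideal q"
    by (rule uq_ideal.rel, auto simp: uq_relations_def)+
  then show "v \<in> C \<Longrightarrow> act (kinv i) (act (kk i) v) = v" "v \<in> C \<Longrightarrow> act (kk i) (act (kinv i) v) = v"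
    using act_ideal by (fastforce simp: act_diff act_mult act_1)+
qed

lemma act_K_X:
  assumes "v \<in> C"
  shows "act (kk i) (act (wrd [XG o' j]) v) =
    sc (qpow q (osg o' * (simple_root i \<bullet> simple_root j))) (act (wrd [XG o' j]) (act (kk i) v))"
proof (rule covec_eqI)
  fix A assume A: "covec A"
  show "A (act (kk i) (act (wrd [XG o' j]) v)) =
    A (sc (qpow q (osg o' * (simple_root i \<bullet> simple_root j))) (act (wrd [XG o' j]) (act (kk i) v)))"
    using basic_rels_K[OF tm_basic_rels[OF A assms], of "[]" i o' j "[]"] A assms
    by (simp add: covec_sc act_Cons[of v _ "[_]"])
qed (use assms in auto)

lemma act_E_F:
  assumes "v \<in> C"
  shows "act (ee i) (act (ff j) v) = sc ((-1) ^ (gpar (EGen i) * gpar (FGen j))) (act (ff j) (act (ee i) v))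
    + (if i = j then sc (1 / (q - inverse q)) (act (kk i) v - act (kinv i) v) else 0)"
proof (rule covec_eqI)
  fix A assume A: "covec A"
  show "A (act (ee i) (act (ff j) v)) = A (sc ((-1) ^ (gpar (EGen i) * gpar (FGen j))) (act (ff j) (act (ee i) v))
    + (if i = j then sc (1 / (q - inverse q)) (act (kk i) v - act (kinv i) v) else 0))"
    using tm_basic_rels[OF A assms, unfolded basic_rels_def, THEN conjunct2, THEN conjunct2, THEN conjunct2,
        rule_format, of "[]" i j "[]"] A assms
    by (cases "i = j") (simp_all add: covec_add covec_diff covec_sc act_Cons[of v _ "[_]"] del: gpar.simps)
qed (use assms in auto)

lemma weight_vector_X:
  assumes "v \<in> C" "weight_vector q sc M \<mu> v" "\<mu> \<in> weight_lattice"
  shows "weight_vector q sc M (\<mu> + osg o' *\<^sub>R simple_root j) (act (wrd [XG o' j]) v)"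
  unfolding weight_vector_def
proof
  fix i
  have "act (kk i) (act (wrd [XG o' j]) v) =
      sc (qpow q (osg o' * (simple_root i \<bullet> simple_root j)) * qpow q (\<mu> \<bullet> simple_root i)) (act (wrd [XG o' j]) v)"
    using assms by (simp add: act_K_X act_sc weight_vector_def)
  also have "qpow q (osg o' * (simple_root i \<bullet> simple_root j)) * qpow q (\<mu> \<bullet> simple_root i)
    = qpow q (osg o' * (simple_root i \<bullet> simple_root j) + \<mu> \<bullet> simple_root i)"
    using assms by (intro qpow_add[symmetric] Ints_mult inner_lattice_Ints simple_root_lattice) auto
  also have "osg o' * (simple_root i \<bullet> simple_root j) + \<mu> \<bullet> simple_root i
    = (\<mu> + osg o' *\<^sub>R simple_root j) \<bullet> simple_root i"
    by (simp add: inner_add_left inner_commute[of "simple_root j"])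
  finally show "act (kk i) (act (wrd [XG o' j]) v)
    = sc (qpow q ((\<mu> + osg o' *\<^sub>R simple_root j) \<bullet> simple_root i)) (act (wrd [XG o' j]) v)" .
qed

lemma weight_vector_KI:
  assumes "v \<in> C" "weight_vector q sc M \<mu> v" "\<mu> \<in> weight_lattice"
  shows "act (kinv i) v = sc (qpow q (- (\<mu> \<bullet> simple_root i))) v"
proof -
  have "v = act (kinv i) (act (kk i) v)" using act_KI_K assms by simp
  also have "\<dots> = sc (qpow q (\<mu> \<bullet> simple_root i)) (act (kinv i) v)"
    using assms by (simp add: weight_vector_def act_sc)
  finally have "sc (inverse (qpow q (\<mu> \<bullet> simple_root i))) v =
      sc (inverse (qpow q (\<mu> \<bullet> simple_root i))) (sc (qpow q (\<mu> \<bullet> simple_root i)) (act (kinv i) v))" by simp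
  then show ?thesis
    using assms by (simp add: qpow_minus inner_lattice_Ints simple_root_lattice)
qed

end

section \<open>Irreducible highest weight modules\<close>

lemma separating_functional:
  fixes scale :: "complex \<Rightarrow> 'a::ab_group_add \<Rightarrow> 'a"
  assumes "vector_space scale" "x \<notin> module.span scale S"
  obtains \<Phi> where "Vector_Spaces.linear scale (*) \<Phi>" "\<And>y. y \<in> S \<Longrightarrow> \<Phi> y = 0" "\<Phi> x = (1::complex)"
proof -
  interpret A: vector_space scale by fact
  interpret vector_space_pair scale "(*) :: complex \<Rightarrow> complex \<Rightarrow> complex"
    by unfold_locales (simp_all add: algebra_simps)
  obtain B where B: "B \<subseteq> S" "A.independent B" "S \<subseteq> A.span B"
    using A.maximal_independent_subset by blast
  have xB: "x \<notin> A.span B"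
    using B(1) assms(2) A.span_mono by blast
  then have "x \<notin> B" using A.span_base by blast
  have "A.independent (insert x B)"
    using B xB by (simp add: A.independent_insert \<open>x \<notin> B\<close>)
  then obtain \<Phi> where \<Phi>: "Vector_Spaces.linear scale (*) \<Phi>" "\<forall>y\<in>insert x B. \<Phi> y = (if y = x then 1 else 0)"
    using linear_independent_extend[of "insert x B" "\<lambda>y. if y = x then 1 else 0"] by blast
  have "\<Phi> y = 0" if "y \<in> B" for y
    using \<Phi>(2) \<open>x \<notin> B\<close> that by auto
  then have "\<Phi> y = 0" if "y \<in> S" for y
    using linear_eq_0_on_span[OF \<Phi>(1), of B y] B that by blast
  then show ?thesis using that \<Phi> by auto
qed

lemma neg_one_power_sq: "(- 1 :: complex) ^ k * (- 1) ^ k = 1"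
  using neg_one_power_cancel[of k 1] by simp

text \<open>Makes finitely supported functions a complex vector space; the coordinate vectors of
  covectors live there in \<open>covec_generated\<close>.\<close>

definition pm_scale :: "complex \<Rightarrow> ('k \<Rightarrow>\<^sub>0 complex) \<Rightarrow> ('k \<Rightarrow>\<^sub>0 complex)" where
  "pm_scale c X = Poly_Mapping.map ((*) c) X"

lemma lookup_pm_scale: "Poly_Mapping.lookup (pm_scale c X) k = c * Poly_Mapping.lookup X k"
  by (simp add: pm_scale_def Poly_Mapping.map.rep_eq when_def)

lemma vector_space_pm_scale: "vector_space pm_scale"
  by unfold_locales (rule poly_mapping_eqI; simp add: lookup_pm_scale lookup_add algebra_simps)+

locale hw_mod = uq_mod q sc M for q sc and M :: "('n::{finite,linorder}, 'v::ab_group_add) supermodule" +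
  fixes l :: "'n euclid" and vp :: 'v
  assumes irred: "irreducible_module sc M" and hwg: "highest_weight_generator q sc M l vp"
    and l_lattice: "l \<in> weight_lattice"
begin

abbreviation "p0 \<equiv> vpar M vp"

lemma vp_part: "vp \<in> part M p0" and vp_nonzero: "vp \<noteq> 0" and vp_E: "act (ee i) vp = 0"
  and vp_weight: "weight_vector q sc M l vp" and C_eq: "C = {act x vp | x. True}"
  using hwg by (auto simp: highest_weight_generator_def vpar_def)

lemma vp_C [simp]: "vp \<in> C"
  using vp_part part_in_C vpar_less_2 by blast

lemma C_obtain: "v \<in> C \<Longrightarrow> \<exists>x. v = act x vp"
  using C_eq by auto

definition hb :: 'v where "hb = (SOME b. b \<in> WB \<and> cf WB b vp \<noteq> 0)"

lemma hb: "hb \<in> WB" "cf WB hb vp \<noteq> 0"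
proof -
  have "\<exists>b. b \<in> WB \<and> cf WB b vp \<noteq> 0"
    using nonzero_coordinate[OF vp_C vp_nonzero] by blast
  from someI_ex[OF this] show "hb \<in> WB" "cf WB hb vp \<noteq> 0" by (auto simp: hb_def)
qed

text \<open>The covector dual to the highest weight vector: the coordinate at a weight basis vector
  that occurs in \<open>vp\<close>, normalized at \<open>vp\<close>.\<close>

definition xi :: "'v \<Rightarrow> complex" where "xi v = cf WB hb v / cf WB hb vp"

lemma xi_vp [simp]: "xi vp = 1"
  using hb by (simp add: xi_def)

lemma xi_covec: "covec xi"
  using cf_covec[OF WB, of hb] by (simp add: covec_def xi_def add_divide_distrib)

lemma xi_hcov: "hcov p0 xi"
proof -
  have "hcov (vpar M hb) (cf WB hb)" by (rule cf_hcov[OF WB hb(1)])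
  moreover from this have "vpar M hb = p0"
    using hcovD[OF _ vpar_less_2 _ vp_part] hb(2) by metis
  ultimately show ?thesis using xi_covec by (simp add: hcov_def xi_def)
qed

lemma xi_wcov: "wcov l xi"
proof -
  have "wt hb = l" using cf_wt_eq[OF vp_C vp_weight l_lattice hb] .
  then show ?thesis using cf_wcov[OF hb(1)] xi_covec by (simp add: wcov_def xi_def)
qed

lemma act_word_vp_X: "A (act (wrd (x @ [XG True i])) vp) = A 0"
  by (simp add: act_append vp_E)

lemma tm_vp_K: "covec A \<Longrightarrow> A (act (wrd (x @ [KGen i])) vp) = qpow q (l \<bullet> simple_root i) * A (act (wrd x) vp)"
  using vp_weight by (simp add: act_append weight_vector_def act_sc covec_sc)

lemma wcov_K: "wcov \<mu> A \<Longrightarrow> v \<in> C \<Longrightarrow> A (act (wrd (KGen i # x)) v) = qpow q (\<mu> \<bullet> simple_root i) * A (act (wrd x) v)"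
  by (simp add: act_Cons[of v "KGen i" x] wcov_def)

lemma extremal_xi: "extremal True l (\<lambda>u. xi (act (wrd u) vp))"
  unfolding extremal_def
  using tm_basic_rels[OF xi_covec vp_C] act_word_vp_X[of xi] tm_vp_K[OF xi_covec] wcov_K[OF xi_wcov vp_C] covec_0[OF xi_covec]
  by (simp add: act_Nil del: XG.simps)


text \<open>As the raising generators kill \<open>z\<close>, x |-> A(x z) satisfies the assumptions
  of \<open>extremal_nonvanishing_word\<close>; so if A is nonzero somewhere on the submodule
  generated by \<open>z\<close>, it is nonzero on a word of lowering generators applied to
  \<open>z\<close>.\<close>

lemma generated_weight:
  assumes z: "z \<in> C" "weight_vector q sc M \<nu> z" "\<nu> \<in> weight_lattice" "\<And>i. act (ee i) z = 0"
    and A: "wcov \<mu> A" "\<mu> \<in> weight_lattice" "A (act x z) \<noteq> 0"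
  obtains js where "A (act (wrd (map FGen js)) z) \<noteq> 0" "\<mu> = \<nu> - (\<Sum>j\<leftarrow>js. simple_root j)"
proof -
  have Ac: "covec A" using A by (simp add: wcov_def)
  have "\<exists>u. A (act (wrd u) z) \<noteq> 0"
  proof (rule ccontr)
    assume "\<nexists>u. A (act (wrd u) z) \<noteq> 0"
    then have "lin_ext (\<lambda>u. A (act (wrd u) z)) x = 0" by (simp add: lin_ext_def)
    then show False
      using linear_functional_lin_ext[OF tm_linear[OF Ac z(1)], of x] A(3) by (simp add: tm_def)
  qed
  then obtain u where u: "A (act (wrd u) z) \<noteq> 0" by blast
  have "\<exists>js. A (act (wrd (map (XG (\<not> True)) js)) z) \<noteq> 0 \<and> \<mu> = \<nu> - osg True *\<^sub>R (\<Sum>j\<leftarrow>js. simple_root j)"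
  proof (rule extremal_nonvanishing_word[where h = "\<lambda>u. A (act (wrd u) z)"])
    show "basic_rels q (\<lambda>u. A (act (wrd u) z))" by (rule tm_basic_rels[OF Ac z(1)])
    show "A (act (wrd (x @ [XG True i])) z) = 0" for x i
      using z by (simp add: act_append covec_0[OF Ac])
    show "A (act (wrd (x @ [KGen i])) z) = qpow q (\<nu> \<bullet> simple_root i) * A (act (wrd x) z)" for x i
      using z by (simp add: act_append weight_vector_def act_sc covec_sc[OF Ac])
    show "A (act (wrd (KGen i # x)) z) = qpow q (\<mu> \<bullet> simple_root i) * A (act (wrd x) z)" for x i
      by (rule wcov_K[OF A(1) z(1)])
  qed (use z A u in auto)
  then obtain js where "A (act (wrd (map (XG False) js)) z) \<noteq> 0" "\<mu> = \<nu> - (\<Sum>j\<leftarrow>js. simple_root j)"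
    by auto
  moreover have "map (XG False) js = map FGen js" by simp
  ultimately show ?thesis using that by metis
qed

lemma wts_le:
  assumes "\<mu> \<in> wts"
  obtains js where "\<mu> = l - (\<Sum>j\<leftarrow>js. simple_root j)"
proof -
  obtain b where b: "b \<in> WB" "wt b = \<mu>" using assms by (auto simp: wts_def)
  obtain x where "b = act x vp" using C_obtain WB_in_C b by blast
  then have "cf WB b (act x vp) \<noteq> 0" using cf_basis[OF WB b(1), of b] by simp
  then show ?thesis
    using generated_weight[OF vp_C vp_weight l_lattice vp_E cf_wcov[OF b(1)]] b that wts_lattice[OF assms] by blast
qed

text \<open>Irreducibility speaks of graded submodules. The one generated by \<open>z\<close> is
  graded because \<open>z\<close> is homogeneous: the even and odd components of x split x
  z.\<close>

lemma cyclic_submodule: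
  assumes "p < 2" "z \<in> part M p" "z \<noteq> 0"
  shows "C = {act x z | x. True}"
proof -
  have zC: "z \<in> C" using assms part_in_C by blast
  let ?N = "{act x z | x. True}"
  have sub: "V.subspace ?N"
  proof (rule V.subspaceI)
    show "0 \<in> ?N" using zC by (intro CollectI exI[of _ 0]) simp
    show "x + y \<in> ?N" if "x \<in> ?N" "y \<in> ?N" for x y
      using that zC by clarsimp (metis act_add)
    show "sc c x \<in> ?N" if "x \<in> ?N" for c x
      using that zC by clarsimp (metis act_scl)
  qed
  have "graded_submodule sc M ?N"
    unfolding graded_submodule_def
  proof (intro conjI allI ballI)
    show "V.subspace ?N" by (rule sub)
    show "act x v \<in> ?N" if "v \<in> ?N" for x v
      using that zC by clarsimp (metis act_mult)
    show "?N = {v + w | v w. v \<in> ?N \<inter> part M 0 \<and> w \<in> ?N \<inter> part M 1}"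
    proof (intro equalityI subsetI)
      fix v assume "v \<in> {v + w | v w. v \<in> ?N \<inter> part M 0 \<and> w \<in> ?N \<inter> part M 1}"
      then show "v \<in> ?N" using V.subspace_add[OF sub] by blast
    next
      fix v assume "v \<in> ?N"
      then obtain x where x: "v = act x z" by blast
      have *: "act (component r x) z \<in> ?N \<inter> part M ((r + p) mod 2)" if "r < 2" for r
        using act_component_part[OF that assms(1,2)] by blast
      have **: "v = act (component 0 x) z + act (component 1 x) z"
        unfolding x using zC by (simp add: component_add_components flip: act_add del: One_nat_def)
      show "v \<in> {v + w | v w. v \<in> ?N \<inter> part M 0 \<and> w \<in> ?N \<inter> part M 1}"
      proof (cases "p = 0")
        case True
        then show ?thesis using *[of 0] *[of 1] ** by auto
      next
        case False
        then have "p = 1" using assms by simp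
        then have "act (component 1 x) z \<in> ?N \<inter> part M 0" "act (component 0 x) z \<in> ?N \<inter> part M 1"
          using *[of 0] *[of 1] by simp_all
        moreover have "v = act (component 1 x) z + act (component 0 x) z"
          using ** by (simp add: add.commute)
        ultimately show ?thesis by blast
      qed
    qed
  qed
  moreover have "?N \<noteq> {0}"
  proof
    assume "?N = {0}"
    moreover have "act 1 z \<in> ?N" by blast
    ultimately show False using assms zC by (simp add: act_1)
  qed
  ultimately show ?thesis using irred by (metis irreducible_module_def)
qed

lemma homogeneous_sum_0:
  assumes "r < 2" "a \<in> part M r" "b \<in> part M (1 - r)" "a + b = 0"
  shows "a = 0 \<and> b = 0"
proof -
  have "a = - b" using assms(4) by (simp add: eq_neg_iff_add_eq_0)
  then have "a \<in> part M (1 - r)" using V.subspace_neg[OF sub_part, of "1 - r" b] assms by simp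
  then have "a = 0" using part_int assms by (auto simp: less_2_cases_iff)
  then show ?thesis using assms by simp
qed

text \<open>\<open>z\<close> and \<open>vp\<close> generate each other, so each of the two weights
  is the other one minus a sum of simple roots, and both sums must be empty.\<close>

lemma primitive_homogeneous_weight:
  assumes z: "p < 2" "z \<in> part M p" "z \<noteq> 0" "\<And>i. act (ee i) z = 0" "weight_vector q sc M \<mu> z" "\<mu> \<in> weight_lattice"
  shows "\<mu> = l"
proof -
  have zC: "z \<in> C" using z part_in_C by blast
  obtain x where "vp = act x z" using cyclic_submodule[OF z(1-3)] vp_C by blast
  then have "xi (act x z) \<noteq> 0" by (metis xi_vp zero_neq_one)
  then obtain js where js: "l = \<mu> - (\<Sum>j\<leftarrow>js. simple_root j)"
    using generated_weight[OF zC z(5,6,4) xi_wcov l_lattice] by blast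
  obtain js' where js': "\<mu> = l - (\<Sum>j\<leftarrow>js'. simple_root j)"
    using wts_le weight_in_wts[OF zC z(3,5,6)] by blast
  have "(\<Sum>j\<leftarrow>js @ js'. simple_root j) = 0" using js js' by (simp add: algebra_simps)
  then have "js @ js' = []" using two_rho_sum_list_pos[of "js @ js'"] by auto
  with js show ?thesis by simp
qed

text \<open>The vectors to which this is applied in Schur's lemma are not known to be homogeneous.
  Their even and odd components are again annihilated by all \<open>e_i\<close> and have the same
  weight.\<close>

lemma primitive_weight:
  assumes z: "z \<in> C" "z \<noteq> 0" "\<And>i. act (ee i) z = 0" "weight_vector q sc M \<mu> z" "\<mu> \<in> weight_lattice"
  shows "\<mu> = l"
proof -
  obtain a b where ab: "a \<in> part M 0" "b \<in> part M 1" "z = a + b" using C_decomp z by blast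
  have C: "a \<in> C" "b \<in> C" using part_in_C[of 0 a] part_in_C[of 1 b] ab by auto
  have e: "act (ee i) a = 0 \<and> act (ee i) b = 0" for i
  proof (rule homogeneous_sum_0)
    show "act (ee i) a + act (ee i) b = 0" using z(3)[of i] ab C by (simp add: act_add_vec)
    show "act (ee i) a \<in> part M (gpar (EGen i))" using act_gen_part[of 0 a "EGen i"] ab by simp
    show "act (ee i) b \<in> part M (1 - gpar (EGen i))" using act_gen_part[of 1 b "EGen i"] ab by (simp split: if_splits)
  qed auto
  have k: "act (kk i) a - sc (qpow q (\<mu> \<bullet> simple_root i)) a = 0 \<and>
      act (kk i) b - sc (qpow q (\<mu> \<bullet> simple_root i)) b = 0" for i
  proof (rule homogeneous_sum_0[of 0])
    show "act (kk i) a - sc (qpow q (\<mu> \<bullet> simple_root i)) a + (act (kk i) b - sc (qpow q (\<mu> \<bullet> simple_root i)) b) = 0"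
    proof -
      have "act (kk i) a + act (kk i) b
          = sc (qpow q (\<mu> \<bullet> simple_root i)) a + sc (qpow q (\<mu> \<bullet> simple_root i)) b"
        using z(4) ab C by (simp add: weight_vector_def act_add_vec V.scale_right_distrib)
      then show ?thesis by (metis add_diff_add diff_self)
    qed
    show "act (kk i) a - sc (qpow q (\<mu> \<bullet> simple_root i)) a \<in> part M 0"
      using act_gen_part[of 0 a "KGen i"] ab by (intro V.subspace_diff V.subspace_scale sub_part) auto
    show "act (kk i) b - sc (qpow q (\<mu> \<bullet> simple_root i)) b \<in> part M (1 - 0)"
      using act_gen_part[of 1 b "KGen i"] ab by (intro V.subspace_diff V.subspace_scale sub_part) auto
  qed auto
  have w: "weight_vector q sc M \<mu> a" "weight_vector q sc M \<mu> b" using k by (auto simp: weight_vector_def)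
  show ?thesis
  proof (cases "a = 0")
    case True
    then have "b \<noteq> 0" using z ab by simp
    then show ?thesis using primitive_homogeneous_weight[of 1 b \<mu>] ab e w z by auto
  next
    case False
    then show ?thesis using primitive_homogeneous_weight[of 0 a \<mu>] ab e w z by auto
  qed
qed

lemma highest_weight_space:
  assumes z: "z \<in> C" "weight_vector q sc M l z"
  shows "z = sc (xi z) vp"
proof (rule cf_eqI[OF WB])
  fix b assume b: "b \<in> WB"
  have cov: "covec (cf WB b)" by (rule cf_covec[OF WB])
  have "cf WB b z = xi z * cf WB b vp"
  proof (cases "wt b = l")
    case False
    then have "cf WB b z = 0" "cf WB b vp = 0"
      using cf_wt_eq[OF z l_lattice b] cf_wt_eq[OF vp_C vp_weight l_lattice b] by auto
    then show ?thesis by simp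
  next
    case True
    \<comment> \<open>This covector has weight \<open>l\<close> and vanishes at \<open>vp\<close>.
      Only the empty word of lowering generators leads from \<open>vp\<close> to weight
      \<open>l\<close>, so it vanishes on the whole module.\<close>
    define A where "A v = cf WB b v - cf WB b vp * xi v" for v
    have A: "wcov l A"
      using cf_wcov[OF b] xi_wcov True by (simp add: wcov_def covec_def A_def algebra_simps)
    have "A (act x vp) = 0" for x
    proof (rule ccontr)
      assume "A (act x vp) \<noteq> 0"
      then obtain js where js: "A (act (wrd (map FGen js)) vp) \<noteq> 0" "l = l - (\<Sum>j\<leftarrow>js. simple_root j)"
        using generated_weight[OF vp_C vp_weight l_lattice vp_E A l_lattice] by blast
      then have "js = []" using two_rho_sum_list_pos[of js] by auto
      then show False using js by (simp add: act_Nil A_def)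
    qed
    then have "A z = 0" using C_obtain z by metis
    then show ?thesis by (simp add: A_def)
  qed
  then show "cf WB b z = cf WB b (sc (xi z) vp)"
    by (simp add: covec_sc[OF cov])
qed (use z in auto)

text \<open>The vectors v with xi(a v) = 0 for all a form a submodule without \<open>vp\<close>. It
  is graded because \<open>xi\<close> is homogeneous, so irreducibility makes it zero.\<close>

lemma xi_act_nonzero:
  assumes "z \<in> C" "z \<noteq> 0"
  obtains a where "xi (act a z) \<noteq> 0"
proof (rule ccontr)
  assume no: "\<not> thesis"
  let ?R = "{v \<in> C. \<forall>a. xi (act a v) = 0}"
  have sub: "V.subspace ?R"
    by (rule V.subspaceI) (auto simp: act_add_vec act_sc covec_add[OF xi_covec] covec_sc[OF xi_covec] covec_0[OF xi_covec])
  have "graded_submodule sc M ?R"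
    unfolding graded_submodule_def
  proof (intro conjI allI ballI)
    show "V.subspace ?R" by (rule sub)
    show "act x v \<in> ?R" if "v \<in> ?R" for x v
      using that by (auto simp flip: act_mult)
    show "?R = {v + w | v w. v \<in> ?R \<inter> part M 0 \<and> w \<in> ?R \<inter> part M 1}"
    proof (intro equalityI subsetI)
      fix v assume "v \<in> {v + w | v w. v \<in> ?R \<inter> part M 0 \<and> w \<in> ?R \<inter> part M 1}"
      then show "v \<in> ?R" using V.subspace_add[OF sub] by blast
    next
      fix v assume v: "v \<in> ?R"
      then obtain a b where ab: "a \<in> part M 0" "b \<in> part M 1" "v = a + b" using C_decomp by blast
      have C: "a \<in> C" "b \<in> C" using part_in_C[of 0 a] part_in_C[of 1 b] ab by auto
      have "xi (act x a) = 0" for x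
      proof -
        have "xi (act (component r x) a) = 0" if "r < 2" for r
        proof (cases "r = p0")
          case True
          have "act (component r x) b \<in> part M ((r + 1) mod 2)"
            using act_component_part[of r 1 b x] ab that by simp
          then have "xi (act (component r x) b) = 0"
            using hcovD[OF xi_hcov, of "(r + 1) mod 2"] True that by (auto simp: less_2_cases_iff)
          moreover have "xi (act (component r x) a) + xi (act (component r x) b) = 0"
            using v ab C by (auto simp: act_add_vec covec_add[OF xi_covec])
          ultimately show ?thesis by simp
        next
          case False
          have "act (component r x) a \<in> part M ((r + 0) mod 2)"
            using act_component_part[of r 0 a x] ab that by simp
          then show ?thesis
            using hcovD[OF xi_hcov, of "r"] False that by auto
        qed
        then have "xi (act (component 0 x) a + act (component 1 x) a) = 0"
          using C by (simp add: covec_add[OF xi_covec])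
        then show ?thesis
          using C by (simp only: component_add_components flip: act_add)
      qed
      then have a: "a \<in> ?R" using C by simp
      then have "v - a \<in> ?R" using V.subspace_diff[OF sub v] by blast
      then have "b \<in> ?R" using ab by simp
      with a ab show "v \<in> {v + w | v w. v \<in> ?R \<inter> part M 0 \<and> w \<in> ?R \<inter> part M 1}" by blast
    qed
  qed
  moreover have "z \<in> ?R" using assms no that by auto
  moreover have "vp \<notin> ?R" using act_1[OF vp_C] by (auto intro!: exI[of _ 1])
  ultimately show False
    using irred assms vp_C by (metis (no_types, lifting) irreducible_module_def singletonD)
qed

text \<open>The covectors xi(a .) span the dual. Otherwise a linear form kills all of them but not
  \<open>A\<close>; in finite dimension such a form is evaluation at a vector z, and z contradicts
  \<open>xi_act_nonzero\<close>. The rule states this as an induction principle.\<close>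

lemma covec_generated:
  assumes gen: "\<And>a. P (\<lambda>v. xi (act a v))"
    and add: "\<And>A B. covec A \<Longrightarrow> covec B \<Longrightarrow> P A \<Longrightarrow> P B \<Longrightarrow> P (\<lambda>v. A v + B v)"
    and scale: "\<And>A c. covec A \<Longrightarrow> P A \<Longrightarrow> P (\<lambda>v. c * A v)"
    and cong: "\<And>A B. P A \<Longrightarrow> (\<And>v. v \<in> C \<Longrightarrow> A v = B v) \<Longrightarrow> P B"
    and A: "covec A"
  shows "P A"
proof -
  interpret PM: vector_space "pm_scale :: complex \<Rightarrow> ('v \<Rightarrow>\<^sub>0 complex) \<Rightarrow> _" by (rule vector_space_pm_scale)
  define r :: "('v \<Rightarrow> complex) \<Rightarrow> ('v \<Rightarrow>\<^sub>0 complex)" where "r A = (\<Sum>b\<in>WB. Poly_Mapping.single b (A b))" for A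
  have lookup_r: "Poly_Mapping.lookup (r A) b = (if b \<in> WB then A b else 0)" for A b
    using finite_WB by (simp add: r_def lookup_sum lookup_single when_def)
  define S where "S = range (\<lambda>a. r (\<lambda>v. xi (act a v)))"
  show ?thesis
  proof (cases "r A \<in> PM.span S")
    case True
    then have "\<exists>B. covec B \<and> P B \<and> r B = r A"
    proof (induction rule: PM.span_induct_alt)
      case base
      have "r (\<lambda>v. xi (act 0 v)) = 0"
        by (rule poly_mapping_eqI) (simp add: lookup_r WB_in_C covec_0[OF xi_covec])
      then show ?case using gen covec_act[OF xi_covec] by blast
    next
      case (step c x y)
      then obtain B a where B: "covec B" "P B" "r B = y" and a: "x = r (\<lambda>v. xi (act a v))" by (auto simp: S_def)
      let ?B = "\<lambda>v. c * xi (act a v) + B v"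
      have "covec ?B" by (intro covec_plus covec_cmult covec_act xi_covec B)
      moreover have "P ?B" by (intro add scale gen covec_cmult covec_act xi_covec B)
      moreover have "r ?B = pm_scale c x + y"
        by (rule poly_mapping_eqI) (simp add: lookup_r lookup_add lookup_pm_scale a flip: B(3))
      ultimately show ?case by blast
    qed
    then obtain B where B: "covec B" "P B" "r B = r A" by blast
    have "B b = A b" if "b \<in> WB" for b
      using that arg_cong[OF B(3), of "\<lambda>X. Poly_Mapping.lookup X b"] by (simp add: lookup_r)
    then have "B v = A v" if "v \<in> C" for v
      using covec_expand[OF WB B(1) that] covec_expand[OF WB A that] by simp
    then show ?thesis using cong B by blast
  next
    case False
    then obtain \<Phi> where \<Phi>: "Vector_Spaces.linear pm_scale (*) \<Phi>" "\<And>y. y \<in> S \<Longrightarrow> \<Phi> y = 0" "\<Phi> (r A) = (1::complex)"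
      using separating_functional[OF vector_space_pm_scale] by metis
    interpret L: Vector_Spaces.linear pm_scale "(*)" \<Phi> by (rule \<Phi>(1))
    \<comment> \<open>The vector whose evaluation is the linear form: its coordinates are the values
      of the form at the dual basis.\<close>
    define z where "z = (\<Sum>b\<in>WB. sc (\<Phi> (Poly_Mapping.single b 1)) b)"
    have zC: "z \<in> C" unfolding z_def by (intro C_sum C_sc WB_in_C)
    have ev: "B z = \<Phi> (r B)" if "covec B" for B
    proof -
      have "B z = (\<Sum>b\<in>WB. \<Phi> (Poly_Mapping.single b 1) * B b)"
        unfolding z_def using WB_in_C by (subst covec_sum[OF that]) (auto simp: covec_sc[OF that])
      also have "\<dots> = (\<Sum>b\<in>WB. \<Phi> (Poly_Mapping.single b (B b)))"
      proof (rule sum.cong[OF refl])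
        fix b
        have "Poly_Mapping.single b (B b) = pm_scale (B b) (Poly_Mapping.single b 1)"
          by (rule poly_mapping_eqI) (simp add: lookup_pm_scale lookup_single when_def)
        then show "\<Phi> (Poly_Mapping.single b 1) * B b = \<Phi> (Poly_Mapping.single b (B b))"
          by (simp add: L.scale)
      qed
      finally show ?thesis by (simp add: r_def L.sum)
    qed
    have "z \<noteq> 0" using ev[OF A] \<Phi>(3) covec_0[OF A] by auto
    then obtain a where "xi (act a z) \<noteq> 0" using xi_act_nonzero zC by blast
    moreover have "xi (act a z) = 0"
      using ev[OF covec_act[OF xi_covec], of a] \<Phi>(2) by (simp add: S_def)
    ultimately show ?thesis by simp
  qed
qed


text \<open>The linear form B |-> gamma(v', B) is evaluation at a vector z, and invariance transfers
  the properties of v' to z: it is killed by all \<open>e_i\<close> and has weight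
  \<open>l'\<close>. Hence z = 0, or z is a multiple of v' in the same module. The exponent
  \<open>\<epsilon>\<close> is 1 for pairings that acquire a sign when an odd generator is moved
  across.\<close>

lemma schur_pairing:
  fixes \<gamma> :: "'v \<Rightarrow> ('v \<Rightarrow> complex) \<Rightarrow> complex"
  assumes M': "hw_mod q sc M' l' v'"
    and add: "\<And>v w B. v \<in> mcarrier M' \<Longrightarrow> w \<in> mcarrier M' \<Longrightarrow> covec B \<Longrightarrow> \<gamma> (v + w) B = \<gamma> v B + \<gamma> w B"
    and scale: "\<And>c v B. v \<in> mcarrier M' \<Longrightarrow> covec B \<Longrightarrow> \<gamma> (sc c v) B = c * \<gamma> v B"
    and expand: "\<And>v B. v \<in> mcarrier M' \<Longrightarrow> covec B \<Longrightarrow> \<gamma> v B = (\<Sum>b\<in>WB. B b * \<gamma> v (cf WB b))"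
    and inv: "\<And>g p r v B. p < 2 \<Longrightarrow> r < 2 \<Longrightarrow> v \<in> part M' p \<Longrightarrow> hcov r B \<Longrightarrow>
      \<gamma> (action M' (wrd [g]) v) B = (-1) ^ (\<epsilon> * gpar g) * \<gamma> v (\<lambda>w. B (act (wrd [g]) w))"
  shows "l' \<noteq> l \<Longrightarrow> v \<in> mcarrier M' \<Longrightarrow> r < 2 \<Longrightarrow> hcov r B \<Longrightarrow> \<gamma> v B = 0"
    and "M' = M \<Longrightarrow> \<exists>c. \<forall>v\<in>C. \<forall>r<2. \<forall>B. hcov r B \<longrightarrow> \<gamma> v B = c * (-1) ^ (\<epsilon> * r) * B v"
proof -
  interpret M': hw_mod q sc M' l' v' by (rule M')
  define z where "z = (\<Sum>b\<in>WB. sc (\<gamma> v' (cf WB b)) b)"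
  have zC: "z \<in> C" unfolding z_def by (intro C_sum C_sc WB_in_C)
  have ev: "\<gamma> v' B = B z" if "covec B" for B
  proof -
    have "B z = (\<Sum>b\<in>WB. B b * \<gamma> v' (cf WB b))"
      unfolding z_def using WB_in_C by (subst covec_sum[OF that]) (auto simp: covec_sc[OF that] mult.commute)
    then show ?thesis using expand[OF M'.vp_C that] by simp
  qed
  have word: "\<gamma> (M'.act (wrd x) v') B = (-1) ^ (\<epsilon> * wpar x) * B (act (wrd x) z)" if "r < 2" "hcov r B" for x r B
    using that
  proof (induction x arbitrary: r B)
    case Nil
    then show ?case using ev hcov_covec zC by (auto simp: M'.act_Nil act_Nil)
  next
    case (Cons g x)
    have p: "M'.act (wrd x) v' \<in> part M' ((wpar x + M'.p0) mod 2)"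
      using M'.act_word_part M'.vp_part M'.vpar_less_2 by blast
    have "hcov ((wpar [g] + r) mod 2) (\<lambda>w. B (act (wrd [g]) w))"
      by (rule hcov_act[OF Cons.prems(2,1)])
    then have IH: "\<gamma> (M'.act (wrd x) v') (\<lambda>w. B (act (wrd [g]) w))
        = (-1) ^ (\<epsilon> * wpar x) * B (act (wrd [g]) (act (wrd x) z))"
      by (intro Cons.IH) auto
    have "\<gamma> (M'.act (wrd (g # x)) v') B = (-1) ^ (\<epsilon> * gpar g) * \<gamma> (M'.act (wrd x) v') (\<lambda>w. B (act (wrd [g]) w))"
      unfolding M'.act_Cons[OF M'.vp_C, of g x] by (rule inv[OF _ Cons.prems(1) p Cons.prems(2)]) simp
    then show ?case
      unfolding IH by (simp add: act_Cons[OF zC, of g x] neg_one_wpar_append)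
  qed
  have zero: "\<gamma> 0 B = 0" if "covec B" for B
    using scale[of 0 B 0] that by simp
  have sum: "\<gamma> (\<Sum>u\<in>I. sc (f u) (h u)) B = (\<Sum>u\<in>I. f u * \<gamma> (h u) B)"
    if "covec B" "\<And>u. h u \<in> mcarrier M'" for B I f and h :: "'n gen list \<Rightarrow> 'v"
    by (induction I rule: infinite_finite_induct) (simp_all add: zero add scale that M'.C_sum)
  have act': "M'.act x v' = (\<Sum>u\<in>Poly_Mapping.keys x. sc (Poly_Mapping.lookup x u) (M'.act (wrd u) v'))" for x
    using arg_cong[OF falg_sum_words[of x], of "\<lambda>x. M'.act x v'"] by (simp add: M'.act_sum M'.act_scl)
  have e: "act (ee i) z = 0" for i
  proof (rule cf_eqI[OF WB])
    fix b assume b: "b \<in> WB"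
    note cov = cf_covec[OF WB, of b]
    have "\<gamma> (M'.act (ee i) v') (cf WB b) = (-1) ^ (\<epsilon> * wpar [EGen i]) * cf WB b (act (ee i) z)"
      by (rule word[OF vpar_less_2 cf_hcov[OF WB b]])
    then show "cf WB b (act (ee i) z) = cf WB b 0"
      using zero[OF cov] by (simp add: M'.vp_E covec_0[OF cov])
  qed (use zC in auto)
  have wz: "weight_vector q sc M l' z"
    unfolding weight_vector_def
  proof (rule allI, rule cf_eqI[OF WB])
    fix i b assume b: "b \<in> WB"
    note cov = cf_covec[OF WB, of b]
    have "\<gamma> (M'.act (kk i) v') (cf WB b) = (-1) ^ (\<epsilon> * wpar [KGen i]) * cf WB b (act (kk i) z)"
      by (rule word[OF vpar_less_2 cf_hcov[OF WB b]])
    then show "cf WB b (act (kk i) z) = cf WB b (sc (qpow q (l' \<bullet> simple_root i)) z)"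
      using M'.vp_weight ev[OF cov] zC
      by (simp add: weight_vector_def scale[OF M'.vp_C cov] covec_sc[OF cov] wpar_Cons)
  qed (use zC in auto)
  { assume ne: "l' \<noteq> l" and v: "v \<in> mcarrier M'" and r: "r < 2" and B: "hcov r B"
    have z0: "z = 0" using primitive_weight[OF zC _ e wz M'.l_lattice] ne by blast
    obtain x where x: "v = M'.act x v'" using M'.C_obtain v by blast
    have "\<gamma> (M'.act (wrd u) v') B = 0" for u
      using word[OF r B, of u] covec_0[OF hcov_covec[OF B]] by (simp add: z0)
    then show "\<gamma> v B = 0"
      by (subst x, subst act', subst sum[OF hcov_covec[OF B]]) auto }
  { assume MM: "M' = M"
    have vp: "vp \<in> mcarrier M'" "weight_vector q sc M' l vp" "vp \<noteq> 0" "\<And>i. M'.act (ee i) vp = 0"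
      using MM vp_weight vp_nonzero vp_E by auto
    have l: "l = l'" using M'.primitive_weight[OF vp(1,3,4,2) l_lattice] .
    have v': "v' \<in> C" "weight_vector q sc M l v'" using MM M'.vp_C M'.vp_weight l by simp_all
    define c where "c = xi z / xi v'"
    have v'xi: "v' = sc (xi v') vp" by (rule highest_weight_space[OF v'])
    then have "xi v' \<noteq> 0" using M'.vp_nonzero by (metis V.scale_zero_left)
    then have z: "z = sc c v'"
      using highest_weight_space[OF zC] wz l v'xi by (metis V.scale_scale c_def nonzero_divide_eq_eq)
    \<comment> \<open>B sees only words u with [u] + p0 = r modulo 2, so (-1)^(epsilon [u]) splits
      into a factor that depends on r and one that joins the constant.\<close>
    show "\<exists>c. \<forall>v\<in>C. \<forall>r<2. \<forall>B. hcov r B \<longrightarrow> \<gamma> v B = c * (-1) ^ (\<epsilon> * r) * B v"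
    proof (intro exI[of _ "c * (-1) ^ (\<epsilon> * M'.p0)"] ballI allI impI)
      fix v r B assume v: "v \<in> C" and r: "r < 2" and B: "hcov r B"
      note cov = hcov_covec[OF B]
      obtain x where x: "v = M'.act x v'" using M'.C_obtain v MM by blast
      have w: "\<gamma> (M'.act (wrd u) v') B = c * (-1) ^ (\<epsilon> * M'.p0) * (-1) ^ (\<epsilon> * r) * B (act (wrd u) v')" for u
      proof (cases "(wpar u + M'.p0) mod 2 = r")
        case True
        have "(-1 :: complex) ^ (\<epsilon> * M'.p0) * (-1) ^ (\<epsilon> * r) = (-1) ^ (\<epsilon> * wpar u)"
          using wpar_cases[of u] M'.vpar_less_2[of v'] r
          by (auto simp: less_2_cases_iff True[symmetric] neg_one_power_sq)
        then show ?thesis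
          using word[OF r B, of u] v'(1) by (simp add: z act_sc covec_sc[OF cov] ac_simps)
      next
        case False
        have "act (wrd u) v' \<in> part M ((wpar u + M'.p0) mod 2)"
          using M'.act_word_part[OF M'.vpar_less_2 M'.vp_part, of u] MM by simp
        then have "B (act (wrd u) v') = 0"
          using hcovD[OF B _ False] by simp
        then show ?thesis
          using word[OF r B, of u] v'(1) by (simp add: z act_sc covec_sc[OF cov])
      qed
      have "\<gamma> v B = (\<Sum>u\<in>Poly_Mapping.keys x. Poly_Mapping.lookup x u * \<gamma> (M'.act (wrd u) v') B)"
        by (subst x, subst act', subst sum[OF cov]) auto
      also have "\<dots> = c * (-1) ^ (\<epsilon> * M'.p0) * (-1) ^ (\<epsilon> * r) *
          (\<Sum>u\<in>Poly_Mapping.keys x. Poly_Mapping.lookup x u * B (act (wrd u) v'))"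
        by (simp add: w sum_distrib_left ac_simps)
      also have "(\<Sum>u\<in>Poly_Mapping.keys x. Poly_Mapping.lookup x u * B (act (wrd u) v')) = B v"
        using linear_functional_lin_ext[OF tm_linear[OF cov v'(1)], of x] MM by (simp add: tm_def lin_ext_def x)
      finally show "\<gamma> v B = c * (-1) ^ (\<epsilon> * M'.p0) * (-1) ^ (\<epsilon> * r) * B v" .
    qed }
qed

end

section \<open>Matrix elements in Hopf subalgebras of the finite dual\<close>

lemma linear_component:
  assumes "linear_functional h"
  shows "h (component p x) = lin_ext (\<lambda>u. if wpar u = p then h (wrd u) else 0) x"
  using linear_functional_lin_ext[OF assms, of "component p x"] by (simp add: component_lin_ext)

lemma linear_sum_words:
  assumes "linear_functional f"
  shows "f (a * x) = (\<Sum>u\<in>Poly_Mapping.keys a. Poly_Mapping.lookup a u * f (wrd u * x))"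
    and "f (x * a) = (\<Sum>u\<in>Poly_Mapping.keys a. Poly_Mapping.lookup a u * f (x * wrd u))"
  using linear_functional_lin_ext[OF linear_functional_right_translate[OF assms, of x], of a]
    linear_functional_lin_ext[OF linear_functional_left_translate[OF assms, of x], of a]
  by (simp_all add: lin_ext_def)

lemma counit_odd: "wpar u \<noteq> 0 \<Longrightarrow> counit (wrd u) = 0"
proof (induction u)
  case (Cons g u)
  then show ?case by (cases g) (auto simp: counit_wrd wpar_Cons)
qed simp

locale hopf_sub = generic_q q for q +
  fixes H :: "'n::{finite,linorder} functional set"
  assumes hopf: "hopf_subalgebra q H"
begin

lemma H_linear: "f \<in> H \<Longrightarrow> linear_functional f"
  using hopf by (auto simp: hopf_subalgebra_def finite_dual_def)

lemma H_ideal: "f \<in> H \<Longrightarrow> x \<in> uq_ideal q \<Longrightarrow> f x = 0"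
  using hopf by (fastforce simp: hopf_subalgebra_def finite_dual_def)

lemma H_basic_rels: "f \<in> H \<Longrightarrow> basic_rels q (\<lambda>u. f (wrd u))"
  by (intro basic_rels_ideal H_linear H_ideal)

lemma H_add: "f \<in> H \<Longrightarrow> g \<in> H \<Longrightarrow> (\<lambda>x. f x + g x) \<in> H"
  and H_cmult: "f \<in> H \<Longrightarrow> (\<lambda>x. c * f x) \<in> H"
  and H_component: "f \<in> H \<Longrightarrow> p \<in> {0, 1} \<Longrightarrow> functional_component p f \<in> H"
  and H_counit: "counit \<in> H"
  and H_fmult: "f \<in> H \<Longrightarrow> g \<in> H \<Longrightarrow> fmult f g \<in> H"
  and H_coproduct: "f \<in> H \<Longrightarrow> \<exists>L. set L \<subseteq> H \<times> H \<and> is_fcoproduct f L"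
  using hopf unfolding hopf_subalgebra_def by blast+

lemma H_zero: "(\<lambda>x. 0) \<in> H"
  using H_cmult[OF H_counit, of 0] by simp

lemma H_sum: "(\<And>i. i \<in> I \<Longrightarrow> f i \<in> H) \<Longrightarrow> (\<lambda>x. \<Sum>i\<in>I. f i x) \<in> H"
  by (induction I rule: infinite_finite_induct) (simp_all add: H_zero H_add)

lemma H_sum_list: "(\<And>i. i \<in> set I \<Longrightarrow> f i \<in> H) \<Longrightarrow> (\<lambda>x. \<Sum>i\<leftarrow>I. f i x) \<in> H"
  by (induction I) (simp_all add: H_zero H_add)

text \<open>The coproduct formula carries a sign in the parity of the free argument. Closure under
  parity components absorbs it when a functional is translated.\<close>

lemma H_twist:
  assumes "f \<in> H"
  shows "(\<lambda>x. f (component 0 x) + c * f (component 1 x)) \<in> H"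
  using H_add[OF H_component[OF assms, of 0] H_cmult[OF H_component[OF assms, of 1]]]
  by (simp add: functional_component_def)

lemma H_left_translate_word:
  assumes f: "f \<in> H"
  shows "(\<lambda>x. f (wrd a * x)) \<in> H"
proof -
  obtain L where L: "set L \<subseteq> H \<times> H" "is_fcoproduct f L" using H_coproduct[OF f] by blast
  define F :: "'n functional \<times> 'n functional \<Rightarrow> 'n functional" where "F = (\<lambda>(g, h) x. g (wrd a) * (h (component 0 x) + (-1) ^ wpar a * h (component 1 x)))"
  have FH: "(\<lambda>x. \<Sum>i\<leftarrow>L. F i x) \<in> H"
    using L(1) by (intro H_sum_list) (auto simp: F_def simp del: One_nat_def intro!: H_cmult H_twist)
  have "(\<lambda>x. f (wrd a * x)) = (\<lambda>x. \<Sum>i\<leftarrow>L. F i x)"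
  proof (rule linear_functional_eqI[OF linear_functional_left_translate[OF H_linear[OF f]] H_linear[OF FH]])
    fix u
    have "F i (wrd u) = (case i of (g, h) \<Rightarrow> (-1) ^ (wpar a * wpar u) * g (wrd a) * h (wrd u))" if "i \<in> set L" for i
    proof -
      obtain g h where i: "i = (g, h)" by force
      have h: "linear_functional h" using L(1) that i H_linear by auto
      show ?thesis
        using wpar_cases[of u] by (auto simp: i F_def linear_component[OF h])
    qed
    then have "(\<Sum>i\<leftarrow>L. F i (wrd u)) = (\<Sum>(g, h)\<leftarrow>L. (-1) ^ (wpar a * wpar u) * g (wrd a) * h (wrd u))"
      by (intro arg_cong[where f = sum_list] map_cong) auto
    then show "f (wrd a * wrd u) = (\<Sum>i\<leftarrow>L. F i (wrd u))"
      using L(2) by (simp add: is_fcoproduct_def)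
  qed
  with FH show ?thesis by simp
qed

lemma H_right_translate_word:
  assumes f: "f \<in> H"
  shows "(\<lambda>x. f (x * wrd a)) \<in> H"
proof -
  obtain L where L: "set L \<subseteq> H \<times> H" "is_fcoproduct f L" using H_coproduct[OF f] by blast
  define F :: "'n functional \<times> 'n functional \<Rightarrow> 'n functional" where "F = (\<lambda>(g, h) x. h (wrd a) * (g (component 0 x) + (-1) ^ wpar a * g (component 1 x)))"
  have FH: "(\<lambda>x. \<Sum>i\<leftarrow>L. F i x) \<in> H"
    using L(1) by (intro H_sum_list) (auto simp: F_def simp del: One_nat_def intro!: H_cmult H_twist)
  have "(\<lambda>x. f (x * wrd a)) = (\<lambda>x. \<Sum>i\<leftarrow>L. F i x)"
  proof (rule linear_functional_eqI[OF linear_functional_right_translate[OF H_linear[OF f]] H_linear[OF FH]])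
    fix u
    have "F i (wrd u) = (case i of (g, h) \<Rightarrow> (-1) ^ (wpar u * wpar a) * g (wrd u) * h (wrd a))" if "i \<in> set L" for i
    proof -
      obtain g h where i: "i = (g, h)" by force
      have h: "linear_functional g" using L(1) that i H_linear by auto
      show ?thesis
        using wpar_cases[of u] by (auto simp: i F_def linear_component[OF h])
    qed
    then have "(\<Sum>i\<leftarrow>L. F i (wrd u)) = (\<Sum>(g, h)\<leftarrow>L. (-1) ^ (wpar u * wpar a) * g (wrd u) * h (wrd a))"
      by (intro arg_cong[where f = sum_list] map_cong) auto
    then show "f (wrd u * wrd a) = (\<Sum>i\<leftarrow>L. F i (wrd u))"
      using L(2) by (simp add: is_fcoproduct_def)
  qed
  with FH show ?thesis by simp
qed

lemma H_left_translate: "f \<in> H \<Longrightarrow> (\<lambda>x. f (a * x)) \<in> H"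
  by (subst linear_sum_words(1)[OF H_linear]) (auto intro!: H_sum H_cmult H_left_translate_word)

lemma H_right_translate: "f \<in> H \<Longrightarrow> (\<lambda>x. f (x * a)) \<in> H"
  by (subst linear_sum_words(2)[OF H_linear]) (auto intro!: H_sum H_cmult H_right_translate_word)

lemma extremal_counit: "extremal True 0 (\<lambda>u :: 'n gen list. counit (wrd u))"
  using H_basic_rels[OF H_counit] by (simp add: extremal_def counit_wrd)

text \<open>In each of the two terms of the coproduct of \<open>e_i\<close> one factor is translated
  by \<open>e_i\<close> on the right and vanishes; \<open>k_i\<close> is group-like, so weights
  add.\<close>

lemma extremal_fmult:
  assumes f: "f \<in> H" "extremal True l (\<lambda>u. f (wrd u))" and g: "g \<in> H" "extremal True m (\<lambda>u. g (wrd u))"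
    and lm: "l \<in> weight_lattice" "m \<in> weight_lattice"
  shows "extremal True (l + m) (\<lambda>u. fmult f g (wrd u))"
proof -
  have q: "qpow q ((l + m) \<bullet> simple_root i) = qpow q (l \<bullet> simple_root i) * qpow q (m \<bullet> simple_root i)" for i
    using lm by (simp add: inner_add_left qpow_add inner_lattice_Ints simple_root_lattice)
  show ?thesis
    using f(2) g(2) H_basic_rels[OF H_fmult[OF f(1) g(1)]] unfolding extremal_def
    by (simp add: fmult_wrd fm_snoc_EF fm_snoc_K fm_Cons_K fm_cmult_left fm_cmult_right fm_Nil q)
qed

end

section \<open>Placing all matrix elements of a module in a Hopf subalgebra\<close>

context uq_mod
begin

lemma tm_expand:
  assumes B: "hbasis B" and A: "covec A" and v: "v \<in> C"
  shows "tm A v = (\<lambda>x. \<Sum>b\<in>B. \<Sum>b'\<in>B. (A b * cf B b' v) * tm (cf B b) b' x)"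
proof
  fix x
  have "tm A v x = (\<Sum>b\<in>B. cf B b (act x v) * A b)"
    unfolding tm_def using v by (intro covec_expand[OF B A]) auto
  also have "\<dots> = (\<Sum>b\<in>B. (\<Sum>b'\<in>B. cf B b' v * cf B b (act x b')) * A b)"
    using covec_expand[OF B covec_act[OF cf_covec[OF B]] v] by simp
  finally show "tm A v x = (\<Sum>b\<in>B. \<Sum>b'\<in>B. (A b * cf B b' v) * tm (cf B b) b' x)"
    by (simp add: tm_def sum_distrib_left sum_distrib_right ac_simps)
qed

lemma tm_in_hopf_sub:
  assumes "hopf_sub q H" "hbasis B" "\<And>b b'. b \<in> B \<Longrightarrow> b' \<in> B \<Longrightarrow> tm (cf B b) b' \<in> H" "covec A" "v \<in> C"
  shows "tm A v \<in> H"
proof -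
  interpret hopf_sub q H by fact
  show ?thesis
    unfolding tm_expand[OF assms(2,4,5)] by (intro H_sum H_cmult assms(3))
qed

end

context hw_mod
begin

text \<open>By uniqueness \<open>f\<close> is the matrix element of \<open>xi\<close> and
  \<open>vp\<close>. Its two-sided translates are x |-> xi(a x b vp), and these give everything
  because \<open>vp\<close> generates the module and \<open>xi\<close> the dual.\<close>

lemma tm_in_hopf_sub_extremal:
  assumes "hopf_sub q H" and f: "f \<in> H" "extremal True l (\<lambda>u. f (wrd u))" and A: "covec A" "v \<in> C"
  shows "tm A v \<in> H"
proof -
  interpret hopf_sub q H by fact
  have "(\<lambda>u. f (wrd u)) = (\<lambda>u. xi (act (wrd u) vp))"
    by (rule extremal_unique[OF f(2) extremal_xi l_lattice])
  then have fxi: "f = tm xi vp"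
    by (intro linear_functional_eqI[OF H_linear[OF f(1)] tm_linear[OF xi_covec vp_C]])
       (simp add: tm_def fun_eq_iff)
  have "\<forall>v\<in>C. tm A v \<in> H"
  proof (rule covec_generated[OF _ _ _ _ A(1)])
    fix a
    show "\<forall>v\<in>C. tm (\<lambda>v. xi (act a v)) v \<in> H"
    proof
      fix v assume "v \<in> C"
      then obtain b where b: "v = act b vp" using C_obtain by blast
      have "tm (\<lambda>v. xi (act a v)) v = (\<lambda>x. f (a * (x * b)))"
        by (simp add: tm_def fxi b act_mult fun_eq_iff)
      also have "\<dots> \<in> H"
        using H_right_translate[OF H_left_translate[OF f(1), of a], of b] .
      finally show "tm (\<lambda>v. xi (act a v)) v \<in> H" .
    qed
  next
    fix A B assume "\<forall>v\<in>C. tm A v \<in> H" "\<forall>v\<in>C. tm B v \<in> H"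
    then show "\<forall>v\<in>C. tm (\<lambda>v. A v + B v) v \<in> H"
      using H_add by (auto simp: tm_def)
  next
    fix A c assume "\<forall>v\<in>C. tm A v \<in> H"
    then show "\<forall>v\<in>C. tm (\<lambda>v. c * A v) v \<in> H"
      using H_cmult by (auto simp: tm_def)
  next
    fix A B assume "\<forall>v\<in>C. tm A v \<in> H" and eq: "\<And>v. v \<in> C \<Longrightarrow> A v = B v"
    moreover have "tm B v = tm A v" if "v \<in> C" for v
      using that by (simp add: tm_def eq)
    ultimately show "\<forall>v\<in>C. tm B v \<in> H" by simp
  qed
  with A show ?thesis by blast
qed

end

section \<open>Quantum minors of the vector representation\<close>

lemma upward_induct [case_names first step]:
  fixes j :: "'n::{finite,linorder}"
  assumes "P (Min UNIV)" "\<And>i. i \<noteq> Max UNIV \<Longrightarrow> P i \<Longrightarrow> P (nxt i)"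
  shows "P j"
proof (rule ccontr)
  assume "\<not> P j"
  define i where "i = Min {i. \<not> P i}"
  have "i \<in> {i. \<not> P i}"
    unfolding i_def using \<open>\<not> P j\<close> by (intro Min_in) auto
  then have i: "\<not> P i" by simp
  have least: "i \<le> k" if "\<not> P k" for k
    unfolding i_def using that by (intro Min_le) auto
  have "i \<noteq> Min UNIV" using assms(1) i by metis
  then have "Min UNIV < i" by (simp add: less_le)
  then have ne: "{..<i} \<noteq> {}" by auto
  define p where "p = Max {..<i}"
  have p: "p < i" using Max_in[OF _ ne] by (simp add: p_def)
  then have pM: "p \<noteq> Max UNIV" using le_last[of i] by auto
  have "nxt p \<le> i" using nxt_le[OF p] .
  moreover have "\<not> nxt p < i"
  proof
    assume "nxt p < i"
    then have "nxt p \<le> p" unfolding p_def by (intro Max_ge) auto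
    then show False using less_nxt[OF pM] by simp
  qed
  ultimately have "nxt p = i" by simp
  moreover have "P p" using least[of p] p by force
  ultimately show False using assms(2)[OF pM] i by simp
qed

lemma sorted_list_of_set_insert_max:
  assumes "finite A" "\<forall>a\<in>A. a < m"
  shows "sorted_list_of_set (insert m A) = sorted_list_of_set A @ [m]"
proof -
  have "m \<notin> A" using assms by auto
  then show ?thesis
    using assms by (simp add: sorted_insort_is_snoc less_imp_le)
qed

lemma nxt_inj: "i \<noteq> Max UNIV \<Longrightarrow> j \<noteq> Max UNIV \<Longrightarrow> nxt i = nxt j \<Longrightarrow> (i::'n::{finite,linorder}) = j"
  using less_nxt[of i] less_nxt[of j] nxt_le[of i j] nxt_le[of j i] by (metis leD neqE)

lemma eps_inner_simple_root:
  "eps c \<bullet> simple_root i = (if c = i then 1 else if i \<noteq> Max UNIV \<and> c = nxt i then -1 else 0)"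
  using less_nxt[of i] by (auto simp: inner_simple_root eps_nth)

lemma nxt_neq_first: "i \<noteq> Max UNIV \<Longrightarrow> nxt i \<noteq> Min (UNIV :: 'n::{finite,linorder} set)"
  using less_nxt[of i] Min_le[of UNIV i] by (metis UNIV_I finite leD)

lemma lattice_sum: "(\<And>x. x \<in> S \<Longrightarrow> f x \<in> weight_lattice) \<Longrightarrow> sum f S \<in> weight_lattice"
  by (induction S rule: infinite_finite_induct) (simp_all add: lattice_0 lattice_add)

lemma fm_if:
  "fm (\<lambda>a. if P then f a else 0) g u = (if P then fm f g u else 0)"
  "fm f (\<lambda>b. if P then g b else 0) u = (if P then fm f g u else 0)"
  by simp_all

definition fundamental_weight :: "'n::{finite,linorder} \<Rightarrow> 'n euclid" where
  "fundamental_weight k = (\<Sum>c\<le>k. eps c)"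

lemma fundamental_weight_nth: "fundamental_weight k $ i = (if i \<le> k then 1 else 0)"
  by (simp add: fundamental_weight_def eps_nth)

lemma fundamental_weight_lattice: "fundamental_weight k \<in> weight_lattice"
  by (simp add: weight_lattice_iff fundamental_weight_nth)

section \<open>The vectors of weight eps_1, ..., eps_n in the vector representation\<close>

locale vector_rep = hw_mod q sc M "eps (Min UNIV)" vp + hopf_sub q H
  for q sc and M :: "('n::{finite,linorder}, 'v::ab_group_add) supermodule" and vp and H :: "'n functional set" +
  assumes tm_H: "covec A \<Longrightarrow> v \<in> C \<Longrightarrow> tm A v \<in> H"
begin

text \<open>The vector f_(c-1) ... f_1 \<open>vp\<close>, of weight \<open>eps c\<close>. The letter
  f_n does not occur, so all of them have the parity of \<open>vp\<close>.\<close>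

definition vc :: "'n \<Rightarrow> 'v" where
  "vc c = act (wrd (map FGen (rev (sorted_list_of_set {..<c})))) vp"

lemma vc_C [simp]: "vc c \<in> C"
  by (simp add: vc_def)

lemma vc_first: "vc (Min UNIV) = vp"
proof -
  have "{..<Min UNIV :: 'n} = {}" by (auto simp: not_less)
  then show ?thesis by (simp add: vc_def act_Nil)
qed

lemma vc_nxt: "c \<noteq> Max UNIV \<Longrightarrow> vc (nxt c) = act (ff c) (vc c)"
proof -
  assume c: "c \<noteq> Max UNIV"
  have "{..<nxt c} = insert c {..<c}"
    using less_nxt[OF c] nxt_le[of c] by (auto simp: not_le[symmetric])
  moreover have "sorted_list_of_set (insert c {..<c}) = sorted_list_of_set {..<c} @ [c]"
    by (rule sorted_list_of_set_insert_max) auto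
  ultimately have "sorted_list_of_set {..<nxt c} = sorted_list_of_set {..<c} @ [c]"
    by (simp only:)
  then show ?thesis by (simp add: vc_def act_Cons[of vp "FGen c"])
qed

lemma vc_part: "vc c \<in> part M p0"
proof -
  have *: "(\<Sum>g\<leftarrow>map FGen js. gpar g) = 0" if "\<forall>j\<in>set js. j < c" for js
    using that le_last[of c] by (induction js) auto
  have "wpar (map FGen (rev (sorted_list_of_set {..<c}))) = 0"
    unfolding wpar_def by (subst *) auto
  then show ?thesis
    unfolding vc_def using act_word_part[OF vpar_less_2 vp_part, of "map FGen (rev (sorted_list_of_set {..<c}))"]
    by simp
qed

lemma vc_weight: "weight_vector q sc M (eps c) (vc c)"
proof (induction c rule: upward_induct)
  case first
  then show ?case using vp_weight by (simp add: vc_first)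
next
  case (step i)
  have "weight_vector q sc M (eps i + osg False *\<^sub>R simple_root i) (act (wrd [XG False i]) (vc i))"
    by (rule weight_vector_X[OF vc_C step(2) eps_lattice])
  moreover have "eps i + osg False *\<^sub>R simple_root i = eps (nxt i)"
    using step(1) by (simp add: simple_root_nxt)
  ultimately show ?case using step(1) by (simp add: vc_nxt)
qed

lemma K_diff_vc:
  "act (kk i) (vc c) - act (kinv i) (vc c) =
     (if eps c \<bullet> simple_root i = 1 then sc (q - inverse q) (vc c)
      else if eps c \<bullet> simple_root i = 0 then 0 else act (kk i) (vc c) - act (kinv i) (vc c))"
  using vc_weight[of c] weight_vector_KI[OF vc_C vc_weight eps_lattice, of i c]
  by (simp add: weight_vector_def qpow_minus qpow_1 V.scale_left_diff_distrib)

text \<open>For j > c the vector f_j v_c is killed by every \<open>e_i\<close>, and its weight has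
  coordinate -1 at j, so it is not the highest weight and the vector is 0. Computing e_i on v_(c+1)
  = f_c v_c needs this vanishing at the index preceding c, which is why the statement carries a
  clause about predecessors.\<close>

lemma vc_E_F:
  "act (ee i) (vc c) = (if i \<noteq> Max UNIV \<and> nxt i = c then vc i else 0) \<and> (\<forall>j>c. act (ff j) (vc c) = 0) \<and>
     (\<forall>i. i \<noteq> Max UNIV \<and> nxt i = c \<longrightarrow> (\<forall>j>i. act (ff j) (vc i) = 0))"
proof -
  define E where "E c \<longleftrightarrow> (\<forall>i. act (ee i) (vc c) = (if i \<noteq> Max UNIV \<and> nxt i = c then vc i else 0))" for c
  define F where "F c \<longleftrightarrow> (\<forall>j>c. act (ff j) (vc c) = 0)" for c
  have EF: "F c" if E: "E c" and F: "\<And>i. i \<noteq> Max UNIV \<Longrightarrow> nxt i = c \<Longrightarrow> F i" for c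
    unfolding F_def
  proof (intro allI impI)
    fix j assume j: "c < j"
    define z where "z = act (ff j) (vc c)"
    have zC: "z \<in> C" by (simp add: z_def)
    have "act (ee i) z = 0" for i
    proof -
      have "act (ff j) (act (ee i) (vc c)) = 0"
      proof (cases "i \<noteq> Max UNIV \<and> nxt i = c")
        case True
        then have "i < j" using less_nxt[of i] j by auto
        then show ?thesis using True E F[of i] by (simp add: E_def F_def)
      next
        case False
        then show ?thesis using E by (auto simp: E_def)
      qed
      moreover have "i = j \<Longrightarrow> act (kk i) (vc c) - act (kinv i) (vc c) = 0"
        using j less_nxt[of j] by (subst K_diff_vc) (auto simp: eps_inner_simple_root)
      ultimately show ?thesis
        unfolding z_def by (subst act_E_F[OF vc_C]) (simp add: V.scale_right_diff_distrib)
    qed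
    moreover have w: "weight_vector q sc M (eps c + osg False *\<^sub>R simple_root j) z"
      unfolding z_def using weight_vector_X[OF vc_C vc_weight eps_lattice, where o' = False] by simp
    moreover have "eps c + osg False *\<^sub>R simple_root j \<in> weight_lattice"
      by (intro lattice_add lattice_scaleR eps_lattice simple_root_lattice) simp
    moreover have "eps c + osg False *\<^sub>R simple_root j \<noteq> eps (Min UNIV)"
    proof
      assume *: "eps c + osg False *\<^sub>R simple_root j = eps (Min UNIV)"
      have "c \<noteq> j" using j by simp
      then have "(eps c + osg False *\<^sub>R simple_root j) $ j = -1"
        using less_nxt[of j] by (simp add: simple_root_nxt eps_nth) (metis less_irrefl)
      moreover have "eps (Min UNIV :: 'n) $ j \<ge> 0" by (simp add: eps_nth)
      ultimately show False unfolding * by simp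
    qed
    ultimately show "act (ff j) (vc c) = 0"
      using primitive_weight[OF zC] unfolding z_def by blast
  qed
  have E_nxt: "E (nxt c)" if c: "c \<noteq> Max UNIV" and E: "E c" and F: "\<And>i. i \<noteq> Max UNIV \<Longrightarrow> nxt i = c \<Longrightarrow> F i" for c
    unfolding E_def
  proof
    fix i
    have "act (ff c) (act (ee i) (vc c)) = 0"
    proof (cases "i \<noteq> Max UNIV \<and> nxt i = c")
      case True
      then have "i < c" using less_nxt[of i] by auto
      then show ?thesis using True E F[of i] by (simp add: E_def F_def)
    next
      case False
      then show ?thesis using E by (auto simp: E_def)
    qed
    moreover have "sc (1 / (q - inverse q)) (act (kk c) (vc c) - act (kinv c) (vc c)) = vc c"
      using q_diff_nonzero by (subst K_diff_vc) (simp add: eps_inner_simple_root)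
    ultimately show "act (ee i) (vc (nxt c)) = (if i \<noteq> Max UNIV \<and> nxt i = nxt c then vc i else 0)"
      using nxt_inj[OF c, of i] c by (simp add: vc_nxt act_E_F del: gpar.simps) metis
  qed
  have "E c \<and> F c \<and> (\<forall>i. i \<noteq> Max UNIV \<and> nxt i = c \<longrightarrow> F i)"
  proof (induction c rule: upward_induct)
    case first
    have "E (Min UNIV)" using nxt_neq_first by (auto simp: E_def vc_first vp_E)
    then show ?case using EF nxt_neq_first by blast
  next
    case (step c)
    then have "E (nxt c)" using E_nxt by blast
    moreover have "F i" if "i \<noteq> Max UNIV" "nxt i = nxt c" for i
      using nxt_inj[OF that(1) step(1) that(2)] step(2) by simp
    ultimately show ?case using EF by blast
  qed
  then show ?thesis by (auto simp: E_def F_def)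
qed

lemma vc_E: "act (ee i) (vc c) = (if i \<noteq> Max UNIV \<and> nxt i = c then vc i else 0)"
  using vc_E_F by blast

lemma vc_nonzero: "vc c \<noteq> 0"
proof (induction c rule: upward_induct)
  case first
  then show ?case using vp_nonzero by (simp add: vc_first)
next
  case (step i)
  then have "act (ee i) (vc (nxt i)) = vc i" by (simp add: vc_E)
  then show ?case using step(2) by auto
qed

definition vb :: "'n \<Rightarrow> 'v" where "vb r = (SOME b. b \<in> WB \<and> cf WB b (vc r) \<noteq> 0)"

lemma vb: "vb r \<in> WB" "cf WB (vb r) (vc r) \<noteq> 0"
proof -
  have "\<exists>b. b \<in> WB \<and> cf WB b (vc r) \<noteq> 0"
    using nonzero_coordinate[OF vc_C vc_nonzero] by blast
  from someI_ex[OF this] show "vb r \<in> WB" "cf WB (vb r) (vc r) \<noteq> 0" by (auto simp: vb_def)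
qed

text \<open>A normalized coordinate, as for \<open>xi\<close>. Being of weight \<open>eps r\<close>,
  it kills the other \<open>vc c\<close>.\<close>

definition xv :: "'n \<Rightarrow> 'v \<Rightarrow> complex" where "xv r v = cf WB (vb r) v / cf WB (vb r) (vc r)"

lemma xv_covec: "covec (xv r)"
  using cf_covec[OF WB, of "vb r"] by (simp add: covec_def xv_def add_divide_distrib)

lemma xv_hcov: "hcov p0 (xv r)"
proof -
  have "hcov (vpar M (vb r)) (cf WB (vb r))" by (rule cf_hcov[OF WB vb(1)])
  moreover from this have "vpar M (vb r) = p0"
    using hcovD[OF _ vpar_less_2 _ vc_part] vb(2) by metis
  ultimately show ?thesis using xv_covec by (simp add: hcov_def xv_def)
qed

lemma xv_wcov: "wcov (eps r) (xv r)"
proof -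
  have "wt (vb r) = eps r" using cf_wt_eq[OF vc_C vc_weight eps_lattice vb] .
  then show ?thesis using cf_wcov[OF vb(1)] xv_covec by (simp add: wcov_def xv_def)
qed

lemma eps_eq_iff: "eps r = eps c \<longleftrightarrow> r = c"
  by (metis eps_nth zero_neq_one)

lemma xv_vc: "xv r (vc c) = (if r = c then 1 else 0)"
  using vb(2)[of r] wcov_weight_vector[OF xv_wcov vc_weight vc_C _ eps_lattice eps_lattice, of r c]
  by (auto simp: xv_def eps_eq_iff)

abbreviation "T r c \<equiv> tm (xv r) (vc c)"

lemma T_H: "T r c \<in> H"
  by (rule tm_H[OF xv_covec vc_C])

lemma T_even: "wpar u \<noteq> 0 \<Longrightarrow> T r c (wrd u) = 0"
  using tm_homogeneous[OF xv_hcov vpar_less_2 vpar_less_2 vc_part, of r c]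
  by (simp add: homogeneous_functional_def mult_2[symmetric])

lemma T_snoc_K: "T r c (wrd (x @ [KGen i])) = qpow q (eps c \<bullet> simple_root i) * T r c (wrd x)"
  using vc_weight[of c] by (simp add: tm_def act_append weight_vector_def act_sc covec_sc[OF xv_covec])

lemma T_Cons_K: "T r c (wrd (KGen i # x)) = qpow q (eps r \<bullet> simple_root i) * T r c (wrd x)"
  unfolding tm_def by (rule wcov_K[OF xv_wcov vc_C])

lemma T_snoc_E: "T r c (wrd (x @ [EGen i])) = (if i \<noteq> Max UNIV \<and> nxt i = c then T r i (wrd x) else 0)"
  by (simp add: tm_def act_append vc_E covec_0[OF xv_covec])

lemma T_Nil: "T r c (wrd []) = (if r = c then 1 else 0)"
  by (simp add: tm_def act_Nil xv_vc)

text \<open>\<open>minor rs S\<close> is the matrix element, for the tensor product of the covectors \<open>xv r\<close> over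
  \<open>rs\<close>, of the quantum antisymmetrization of the tensor product of the \<open>vc c\<close>, \<open>c \<in> S\<close>.  For
  \<open>S = {..k}\<close> this antisymmetrization is annihilated by all \<open>e\<^sub>i\<close>.\<close>

definition inv_sign :: "'n set \<Rightarrow> 'n \<Rightarrow> complex" where
  "inv_sign S c = (- 1 / q) ^ card {c' \<in> S. c < c'}"

primrec minor :: "'n list \<Rightarrow> 'n set \<Rightarrow> 'n functional" where
  "minor [] S = counit"
| "minor (r # rs) S = (\<lambda>x. \<Sum>c\<in>S. inv_sign S c * fmult (minor rs (S - {c})) (T r c) x)"

lemma minor_H: "minor rs S \<in> H"
  by (induction rs arbitrary: S) (simp_all add: H_counit H_sum H_cmult H_fmult T_H)

lemma minor_Cons: "minor (r # rs) S (wrd u) =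
    (\<Sum>c\<in>S. inv_sign S c * fm (\<lambda>u. minor rs (S - {c}) (wrd u)) (\<lambda>u. T r c (wrd u)) u)"
  by (simp add: fmult_wrd)

lemma minor_even: "wpar u \<noteq> 0 \<Longrightarrow> minor rs S (wrd u) = 0"
proof (induction rs arbitrary: S u)
  case (Cons r rs)
  have "fm (\<lambda>u. minor rs (S - {c}) (wrd u)) (\<lambda>u. T r c (wrd u)) u = 0" for c
    by (rule fm_homogeneous[of 0 _ 0]) (use Cons T_even in auto)
  then show ?case by (simp only: minor_Cons mult_zero_right sum.neutral_const)
qed (simp add: counit_odd)

lemma minor_Cons_K:
  "minor rs S (wrd (KGen i # x)) = qpow q ((\<Sum>r\<leftarrow>rs. eps r) \<bullet> simple_root i) * minor rs S (wrd x)"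
proof (induction rs arbitrary: S x)
  case (Cons r rs)
  have "qpow q ((\<Sum>r\<leftarrow>r # rs. eps r) \<bullet> simple_root i)
      = qpow q (eps r \<bullet> simple_root i) * qpow q ((\<Sum>r\<leftarrow>rs. eps r) \<bullet> simple_root i)"
    by (simp add: inner_add_left qpow_add inner_lattice_Ints simple_root_lattice eps_lattice lattice_sum_list)
  then show ?case
    unfolding minor_Cons by (simp add: fm_Cons_K Cons.IH T_Cons_K fm_cmult_left fm_cmult_right sum_distrib_left ac_simps)
qed (simp add: counit_wrd)

lemma minor_snoc_K:
  "card S = length rs \<Longrightarrow>
   minor rs S (wrd (x @ [KGen i])) = qpow q ((\<Sum>c\<in>S. eps c) \<bullet> simple_root i) * minor rs S (wrd x)"
proof (induction rs arbitrary: S x)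
  case (Cons r rs)
  have "inv_sign S c * fm (\<lambda>u. minor rs (S - {c}) (wrd u)) (\<lambda>u. T r c (wrd u)) (x @ [KGen i]) =
    qpow q ((\<Sum>c\<in>S. eps c) \<bullet> simple_root i) *
      (inv_sign S c * fm (\<lambda>u. minor rs (S - {c}) (wrd u)) (\<lambda>u. T r c (wrd u)) x)" if "c \<in> S" for c
  proof -
    have "(\<Sum>c\<in>S. eps c) = eps c + (\<Sum>c\<in>S - {c}. eps c)"
      using that by (simp add: sum.remove)
    then have "qpow q ((\<Sum>c\<in>S. eps c) \<bullet> simple_root i)
      = qpow q (eps c \<bullet> simple_root i) * qpow q ((\<Sum>c\<in>S - {c}. eps c) \<bullet> simple_root i)"
      by (simp add: inner_add_left qpow_add inner_lattice_Ints simple_root_lattice eps_lattice lattice_sum)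
    then show ?thesis
      using Cons that by (simp add: fm_snoc_K T_snoc_K fm_cmult_left fm_cmult_right ac_simps)
  qed
  then show ?case
    unfolding minor_Cons sum_distrib_left by (rule sum.cong[OF refl])
qed (simp add: counit_wrd)

text \<open>No index lies between i and its successor, so exchanging one for the other changes no
  comparison with the remaining elements.\<close>

lemma inv_sign_swap:
  assumes i: "i \<noteq> Max UNIV" and S: "nxt i \<in> S" "i \<notin> S"
  shows "c \<in> S \<Longrightarrow> c \<noteq> nxt i \<Longrightarrow> inv_sign (insert i (S - {nxt i})) c = inv_sign S c"
    and "inv_sign (insert i (S - {nxt i})) i = inv_sign S (nxt i)"
proof -
  let ?S = "insert i (S - {nxt i})"
  note le = less_nxt[OF i] nxt_le[of i]
  assume c: "c \<in> S" "c \<noteq> nxt i"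
  then have "c \<noteq> i" using S by auto
  show "inv_sign ?S c = inv_sign S c"
  proof (cases "c < i")
    case True
    then have eq: "{c' \<in> ?S. c < c'} = insert i ({c' \<in> S. c < c'} - {nxt i})" using le by auto
    have mem: "nxt i \<in> {c' \<in> S. c < c'}" "i \<notin> {c' \<in> S. c < c'}" using S True le by auto
    have "card {c' \<in> ?S. c < c'} = Suc (card ({c' \<in> S. c < c'} - {nxt i}))"
      unfolding eq using mem by (intro card_insert_disjoint) auto
    also have "\<dots> = card {c' \<in> S. c < c'}"
      by (rule card_Suc_Diff1) (use mem in auto)
    finally have "card {c' \<in> ?S. c < c'} = card {c' \<in> S. c < c'}" .
    then show ?thesis by (simp add: inv_sign_def)
  next
    case False
    then have "i < c" using \<open>c \<noteq> i\<close> by simp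
    then have "nxt i < c" using le(2)[of c] c(2) by simp
    then have "{c' \<in> ?S. c < c'} = {c' \<in> S. c < c'}" using \<open>i < c\<close> by auto
    then show ?thesis by (simp add: inv_sign_def)
  qed
next
  note le = less_nxt[OF i] nxt_le[of i]
  have "{c' \<in> insert i (S - {nxt i}). i < c'} = {c' \<in> S. nxt i < c'}"
    using le S by (auto simp: le_less)
  then show "inv_sign (insert i (S - {nxt i})) i = inv_sign S (nxt i)"
    by (simp add: inv_sign_def)
qed

text \<open>The origin of the constant -1/q: since \<open>k_i\<close> multiplies v_i by q, this
  ratio makes the two surviving terms in \<open>minor_snoc_E\<close> cancel.\<close>

lemma inv_sign_adjacent:
  assumes i: "i \<noteq> Max UNIV" and S: "nxt i \<in> S"
  shows "inv_sign S i = - inv_sign S (nxt i) / q"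
proof -
  have "{c' \<in> S. i < c'} = insert (nxt i) {c' \<in> S. nxt i < c'}"
    using less_nxt[OF i] nxt_le[of i] S by (auto simp: le_less)
  then show ?thesis by (simp add: inv_sign_def)
qed

text \<open>\<open>e_i\<close> acts on a tensor product by replacing v_(i+1) by v_i in one factor.
  If i is absent from \<open>S\<close>, the terms reassemble to the minor for the changed set; if it
  is present, antisymmetry gives 0.\<close>

lemma minor_snoc_E:
  "card S = length rs \<Longrightarrow>
   minor rs S (wrd (x @ [EGen i])) =
     (if i \<noteq> Max UNIV \<and> nxt i \<in> S \<and> i \<notin> S then minor rs (insert i (S - {nxt i})) (wrd x) else 0)"
proof (induction rs arbitrary: S x)
  case Nil
  then show ?case by (simp add: counit_wrd)
next
  case (Cons r rs)
  define G where "G S' c = fm (\<lambda>u. minor rs S' (wrd u)) (\<lambda>u. T r c (wrd u)) x" for S' c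
  define j where "j = nxt i"
  have step_term: "fm (\<lambda>u. minor rs (S - {c}) (wrd u)) (\<lambda>u. T r c (wrd u)) (x @ [EGen i]) =
     (if i \<noteq> Max UNIV \<and> j \<in> S - {c} \<and> i \<notin> S - {c}
      then qpow q (eps c \<bullet> simple_root i) * G (insert i (S - {c} - {j})) c else 0)
     + (if i \<noteq> Max UNIV \<and> j = c then G (S - {c}) i else 0)" if c: "c \<in> S" for c
  proof -
    have "card (S - {c}) = length rs" using Cons.prems c by simp
    note IH = Cons.IH[OF this]
    have even: "(-1) ^ (gpar (EGen i) * wpar a) * minor rs (S - {c}) (wrd a) = minor rs (S - {c}) (wrd a)" for a
      by (cases "wpar a = 0") (simp_all add: minor_even)
    show ?thesis
      by (simp only: fm_snoc_EF is_EF.simps lgr.simps lgl.simps append_Nil2 IH T_snoc_K T_snoc_E G_def j_def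
            fm_cmult_right even fm_if if_distrib[of "(*) _"] mult_zero_right)
  qed
  have minor_G: "minor (r # rs) S' (wrd x) = (\<Sum>c\<in>S'. inv_sign S' c * G (S' - {c}) c)" for S'
    by (simp add: minor_Cons G_def del: minor.simps)
  have lhs: "minor (r # rs) S (wrd (x @ [EGen i])) = (\<Sum>c\<in>S. inv_sign S c *
     ((if i \<noteq> Max UNIV \<and> j \<in> S - {c} \<and> i \<notin> S - {c}
      then qpow q (eps c \<bullet> simple_root i) * G (insert i (S - {c} - {j})) c else 0)
     + (if i \<noteq> Max UNIV \<and> j = c then G (S - {c}) i else 0)))"
    unfolding minor_Cons by (rule sum.cong[OF refl]) (simp only: step_term)
  show ?case
  proof (cases "i \<noteq> Max UNIV \<and> j \<in> S")
    case False
    then show ?thesis unfolding lhs j_def[symmetric] by (auto intro!: sum.neutral)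
  next
    case True
    then have iM: "i \<noteq> Max UNIV" and jS: "j \<in> S" by auto
    have ij: "i < j" using less_nxt[OF iM] by (simp add: j_def)
    show ?thesis
    proof (cases "i \<in> S")
      case False
      have "minor (r # rs) S (wrd (x @ [EGen i])) =
        (\<Sum>c\<in>S - {j}. inv_sign S c * (qpow q (eps c \<bullet> simple_root i) * G (insert i (S - {c} - {j})) c))
         + inv_sign S j * G (S - {j}) i"
        unfolding lhs using jS iM False
        by (subst sum.remove[OF _ jS]) (auto simp: add.commute intro!: sum.cong split: if_splits)
      also have "(\<Sum>c\<in>S - {j}. inv_sign S c * (qpow q (eps c \<bullet> simple_root i) * G (insert i (S - {c} - {j})) c))
        = (\<Sum>c\<in>S - {j}. inv_sign (insert i (S - {j})) c * G (insert i (S - {j}) - {c}) c)"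
      proof (rule sum.cong[OF refl])
        fix c assume c: "c \<in> S - {j}"
        then have "eps c \<bullet> simple_root i = 0" using False by (auto simp: eps_inner_simple_root j_def)
        moreover have "inv_sign (insert i (S - {j})) c = inv_sign S c"
          unfolding j_def by (rule inv_sign_swap(1)[OF iM]) (use c jS False in \<open>auto simp: j_def\<close>)
        moreover have "insert i (S - {j}) - {c} = insert i (S - {c} - {j})"
          using c False by auto
        ultimately show "inv_sign S c * (qpow q (eps c \<bullet> simple_root i) * G (insert i (S - {c} - {j})) c)
            = inv_sign (insert i (S - {j})) c * G (insert i (S - {j}) - {c}) c" by simp
      qed
      also have "inv_sign S j * G (S - {j}) i = inv_sign (insert i (S - {j})) i * G (insert i (S - {j}) - {i}) i"
        using inv_sign_swap(2)[OF iM, of S] jS False by (simp add: j_def)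
      also have "(\<Sum>c\<in>S - {j}. inv_sign (insert i (S - {j})) c * G (insert i (S - {j}) - {c}) c)
          + inv_sign (insert i (S - {j})) i * G (insert i (S - {j}) - {i}) i
          = minor (r # rs) (insert i (S - {j})) (wrd x)"
        unfolding minor_G using False by (subst sum.insert) (auto simp: add.commute)
      finally show ?thesis using True False by (simp add: j_def del: minor.simps)
    next
      \<comment> \<open>Either v_i is the last factor, where \<open>k_i\<close> yields q while
        \<open>e_i\<close> acts on the earlier ones, or v_(i+1) is last and \<open>e_i\<close> turns
        it into v_i. Both give \<open>G (S - {j}) i\<close>, with opposite coefficients.\<close>
      case iS: True
      have "minor (r # rs) S (wrd (x @ [EGen i])) =
        (\<Sum>c\<in>S. (if c = i then inv_sign S i * (q * G (S - {j}) i) else 0)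
             + (if c = j then inv_sign S j * G (S - {j}) i else 0))"
        unfolding lhs
      proof (rule sum.cong[OF refl])
        fix c assume "c \<in> S"
        have "insert i (S - {i} - {j}) = S - {j}" using iS ij by auto
        then show "inv_sign S c * ((if i \<noteq> Max UNIV \<and> j \<in> S - {c} \<and> i \<notin> S - {c}
            then qpow q (eps c \<bullet> simple_root i) * G (insert i (S - {c} - {j})) c else 0)
            + (if i \<noteq> Max UNIV \<and> j = c then G (S - {c}) i else 0))
          = (if c = i then inv_sign S i * (q * G (S - {j}) i) else 0)
             + (if c = j then inv_sign S j * G (S - {j}) i else 0)"
          using iM jS iS ij by (auto simp: eps_inner_simple_root qpow_1)
      qed
      also have "\<dots> = inv_sign S i * (q * G (S - {j}) i) + inv_sign S j * G (S - {j}) i"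
        using iS jS by (simp add: sum.distrib)
      also have "\<dots> = 0"
        using inv_sign_adjacent[OF iM, of S] jS q_nonzero by (simp add: j_def)
      finally show ?thesis using iS by (simp del: minor.simps)
    qed
  qed
qed

text \<open>At 1 the matrix of the \<open>T r c\<close> is the identity, so only c = r survives in
  each expansion. The rows are listed in decreasing order, hence c is the maximum of the current set
  and its \<open>inv_sign\<close> is 1.\<close>

lemma minor_Nil: "minor (rev (sorted_list_of_set S)) S (wrd []) = 1"
proof -
  have "finite S" by simp
  then show ?thesis
  proof (induction S rule: finite_linorder_max_induct)
    case empty
    then show ?case by (simp add: counit_wrd)
  next
    case (insert m A)
    have mA: "m \<notin> A" using insert by auto
    have sl: "sorted_list_of_set (insert m A) = sorted_list_of_set A @ [m]"
      using insert by (intro sorted_list_of_set_insert_max)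
    have "minor (m # rev (sorted_list_of_set A)) (insert m A) (wrd [])
      = (\<Sum>c\<in>insert m A. if c = m then inv_sign (insert m A) m else 0)"
      unfolding minor_Cons
    proof (rule sum.cong[OF refl])
      fix c assume "c \<in> insert m A"
      show "inv_sign (insert m A) c * fm (\<lambda>u. minor (rev (sorted_list_of_set A)) (insert m A - {c}) (wrd u))
          (\<lambda>u. T m c (wrd u)) [] = (if c = m then inv_sign (insert m A) m else 0)"
        using insert mA by (simp add: fm_Nil T_Nil)
    qed
    also have "\<dots> = 1"
    proof -
      have e: "{c' \<in> insert m A. m < c'} = {}" using insert by auto
      have "inv_sign (insert m A) m = 1" unfolding inv_sign_def e by simp
      then show ?thesis using insert(1) by simp
    qed
    finally show ?case by (simp add: sl del: minor.simps)
  qed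
qed

text \<open>An initial segment that contains the successor of i contains i, so
  \<open>minor_snoc_E\<close> always falls into its zero case.\<close>

lemma extremal_minor:
  "extremal True (fundamental_weight k) (\<lambda>u. minor (rev (sorted_list_of_set {..k})) {..k} (wrd u))"
proof -
  let ?rs = "rev (sorted_list_of_set {..k})"
  have sum: "(\<Sum>r\<leftarrow>?rs. eps r) = fundamental_weight k"
    unfolding fundamental_weight_def by (subst sum_list_distinct_conv_sum_set) auto
  have no: "\<not> (i \<noteq> Max UNIV \<and> nxt i \<in> {..k} \<and> i \<notin> {..k})" for i
    using less_nxt[of i] by (auto dest: less_le_trans less_imp_le)
  have "minor ?rs {..k} (wrd (x @ [EGen i])) = 0" for x i
    using minor_snoc_E[of "{..k}" ?rs x i] unfolding if_not_P[OF no] by simp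
  moreover have "minor ?rs {..k} (wrd (x @ [KGen i])) = qpow q (fundamental_weight k \<bullet> simple_root i) * minor ?rs {..k} (wrd x)" for x i
    using minor_snoc_K[of "{..k}" ?rs x i] by (simp add: fundamental_weight_def)
  moreover have "minor ?rs {..k} (wrd (KGen i # x)) = qpow q (fundamental_weight k \<bullet> simple_root i) * minor ?rs {..k} (wrd x)" for x i
    using minor_Cons_K[of ?rs "{..k}" i x] sum by simp
  ultimately show ?thesis
    using H_basic_rels[OF minor_H] minor_Nil by (simp add: extremal_def)
qed

lemma dominant_extremal:
  assumes "\<mu> \<in> dominant_weights"
  shows "\<exists>f\<in>H. extremal True \<mu> (\<lambda>u. f (wrd u))"
  using assms
proof (induction "nat \<lfloor>\<Sum>i\<in>UNIV. \<mu> $ i\<rfloor>" arbitrary: \<mu> rule: less_induct)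
  case less
  have dom: "\<And>i. \<mu> $ i \<in> \<int>" "\<And>i j. i \<le> j \<Longrightarrow> \<mu> $ j \<le> \<mu> $ i" "\<And>i. \<mu> $ i \<ge> 0"
    using less.prems by (auto simp: dominant_weights_iff)
  show ?case
  proof (cases "\<mu> = 0")
    case True
    then show ?thesis using extremal_counit H_counit by blast
  next
    case False
    define Kp where "Kp = {k. \<mu> $ k > 0}"
    have "\<exists>k. \<mu> $ k \<noteq> 0" using False by (auto simp: vec_eq_iff)
    then have ne: "Kp \<noteq> {}" using dom(3) by (auto simp: Kp_def less_le)
    \<comment> \<open>The last nonzero part of the partition. Lowering the parts up to
      \<open>k\<close> by one keeps a partition, and what is split off is the weight of a
      minor.\<close>
    define k where "k = Max Kp"
    have k: "\<mu> $ k > 0" using Max_in[OF _ ne] by (simp add: k_def Kp_def)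
    have above: "\<mu> $ j = 0" if "k < j" for j
    proof (rule ccontr)
      assume "\<mu> $ j \<noteq> 0"
      then have "j \<in> Kp" using dom(3)[of j] by (simp add: Kp_def)
      then have "j \<le> k" unfolding k_def by (intro Max_ge) auto
      then show False using that by simp
    qed
    have ge1: "\<mu> $ i \<ge> 1" if "i \<le> k" for i
    proof -
      have "\<mu> $ i > 0" using dom(2)[OF that] k by simp
      then show ?thesis using dom(1)[of i] by (auto elim!: Ints_cases)
    qed
    define \<nu> where "\<nu> = \<mu> - fundamental_weight k"
    have \<nu>: "\<nu> $ i = \<mu> $ i - (if i \<le> k then 1 else 0)" for i
      by (simp add: \<nu>_def fundamental_weight_nth)
    have \<nu>dom: "\<nu> \<in> dominant_weights"
      unfolding dominant_weights_iff
    proof (intro conjI allI impI)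
      show "\<nu> $ i \<in> \<int>" for i using dom(1)[of i] by (simp add: \<nu>)
      show "0 \<le> \<nu> $ i" for i using dom(3)[of i] ge1[of i] by (simp add: \<nu>)
      show "\<nu> $ j \<le> \<nu> $ i" if "i \<le> j" for i j
        using that dom(2)[OF that] ge1[of i] above[of j] by (auto simp: \<nu> not_le)
    qed
    have "(\<Sum>i\<in>UNIV. \<nu> $ i) < (\<Sum>i\<in>UNIV. \<mu> $ i)"
      by (rule sum_strict_mono_ex1) (auto simp: \<nu> intro!: bexI[of _ k])
    moreover have "(\<Sum>i\<in>UNIV. \<nu> $ i) \<in> \<int>" "(\<Sum>i\<in>UNIV. \<mu> $ i) \<in> \<int>"
      using dom(1) \<nu>dom by (auto intro!: Ints_sum simp: dominant_weights_iff)
    moreover have "(\<Sum>i\<in>UNIV. \<nu> $ i) \<ge> 0"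
      using \<nu>dom by (auto intro!: sum_nonneg simp: dominant_weights_iff)
    ultimately have "nat \<lfloor>\<Sum>i\<in>UNIV. \<nu> $ i\<rfloor> < nat \<lfloor>\<Sum>i\<in>UNIV. \<mu> $ i\<rfloor>"
      by (auto elim!: Ints_cases)
    from less.hyps[OF this \<nu>dom] obtain f where f: "f \<in> H" "extremal True \<nu> (\<lambda>u. f (wrd u))" by blast
    have "extremal True (\<nu> + fundamental_weight k)
        (\<lambda>u. fmult f (minor (rev (sorted_list_of_set {..k})) {..k}) (wrd u))"
      using \<nu>dom by (intro extremal_fmult f minor_H extremal_minor fundamental_weight_lattice)
        (simp add: dominant_weights_def)
    then show ?thesis
      using H_fmult[OF f(1) minor_H] by (auto simp: \<nu>_def)
  qed
qed

end

section \<open>The antipode and the Haar functional\<close>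

lemma fantipode_linear:
  assumes "linear_functional f"
  shows "fantipode f = lin_ext (\<lambda>u. f (antipode_word u))"
proof
  fix x
  have sum: "f (\<Sum>u\<in>S. scl (h u) * y u) = (\<Sum>u\<in>S. h u * f (y u))" for S h y
    by (induction S rule: infinite_finite_induct)
       (use assms linear_functional_0[OF assms] in \<open>simp_all add: linear_functional_def\<close>)
  show "fantipode f x = lin_ext (\<lambda>u. f (antipode_word u)) x"
    by (simp add: fantipode_def antipode_def sum lin_ext_def)
qed

lemma antipode_word_append:
  "antipode_word (u @ v) = scl ((-1) ^ (wpar u * wpar v)) * antipode_word v * antipode_word u"
proof (induction u)
  case Nil
  then show ?case by (simp add: scl_1)
next
  case (Cons g u)
  have move: "x * (scl c * y) = scl c * (x * y)" for c and x y :: "'a falg"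
    by (simp only: mult.assoc[symmetric] scl_commute[of x])
  define a :: complex where "a = (-1) ^ (gpar g * wpar u)"
  define b :: complex where "b = (-1) ^ (gpar g * wpar v)"
  define c :: complex where "c = (-1) ^ (wpar u * wpar v)"
  let ?R = "antipode_word v * (antipode_word u * antipode_gen g)"
  have "antipode_word ((g # u) @ v) = scl (a * b) * (scl c * ?R)"
    by (simp only: append_Cons antipode_word.simps Cons neg_one_wpar_append a_def b_def c_def mult.assoc)
  also have "\<dots> = scl (b * c) * (scl a * ?R)"
    by (simp only: mult.assoc[symmetric] scl_mult) (simp only: ac_simps)
  also have "scl a * ?R = antipode_word v * antipode_word (g # u)"
    by (simp only: antipode_word.simps a_def mult.assoc move)
  finally show ?case
    by (simp only: b_def c_def neg_one_wpar_append mult.assoc)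
qed

lemma wpar_single [simp]: "wpar [g] = gpar g"
  by (simp add: wpar_Cons)

text \<open>\<open>coproduct_decomposable T f\<close>: the coproduct of \<open>f\<close> is a finite sum of tensors of homogeneous
  elements of \<open>T\<close>; here \<open>f(uv) = \<Sum> F\<^sub>1(u) F\<^sub>2(v)\<close> without the sign of \<^const>\<open>is_fcoproduct\<close>.\<close>

definition coproduct_decomposable ::
  "'n::{finite,linorder} functional set \<Rightarrow> 'n functional \<Rightarrow> bool" where
  "coproduct_decomposable T f \<longleftrightarrow> (\<exists>(N::nat) F1 F2 p r.
     (\<forall>i<N. F1 i \<in> T \<and> F2 i \<in> T \<and> p i < 2 \<and> r i < 2 \<and>
        homogeneous_functional (p i) (F1 i) \<and> homogeneous_functional (r i) (F2 i)) \<and>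
     (\<forall>u v. f (wrd (u @ v)) = (\<Sum>i<N. F1 i (wrd u) * F2 i (wrd v))))"

lemma coproduct_decomposableI:
  fixes F1 F2 :: "'b \<Rightarrow> 'n::{finite,linorder} functional"
  assumes "finite S"
    "\<And>i. i \<in> S \<Longrightarrow> F1 i \<in> T \<and> F2 i \<in> T \<and> p i < 2 \<and> r i < 2 \<and>
        homogeneous_functional (p i) (F1 i) \<and> homogeneous_functional (r i) (F2 i)"
    "\<And>u v. f (wrd (u @ v)) = (\<Sum>i\<in>S. F1 i (wrd u) * F2 i (wrd v))"
  shows "coproduct_decomposable T f"
proof -
  obtain h where h: "bij_betw h {0..<card S} S"
    using ex_bij_betw_nat_finite[OF assms(1)] by blast
  have hS: "i < card S \<Longrightarrow> h i \<in> S" for i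
    using h by (auto simp: bij_betw_def)
  have "(\<Sum>i<card S. F1 (h i) (wrd u) * F2 (h i) (wrd v)) = (\<Sum>i\<in>S. F1 i (wrd u) * F2 i (wrd v))" for u v
    using sum.reindex_bij_betw[OF h, of "\<lambda>i. F1 i (wrd u) * F2 i (wrd v)"] by (simp add: atLeast0LessThan)
  then show ?thesis
    unfolding coproduct_decomposable_def using assms(2)[OF hS] assms(3)
    by (intro exI[of _ "card S"] exI[of _ "\<lambda>i. F1 (h i)"] exI[of _ "\<lambda>i. F2 (h i)"]
          exI[of _ "\<lambda>i. p (h i)"] exI[of _ "\<lambda>i. r (h i)"]) simp
qed

text \<open>The coproduct of a product is the product of the coproducts. With decompositions written
  without signs, what remains is the sign for exchanging \<open>f1 i\<close> and
  \<open>g2 j\<close>.\<close>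

lemma fm_append:
  assumes f: "\<And>u v. f (u @ v) = (\<Sum>i\<in>I. f1 i u * f2 i v)"
    and g: "\<And>u v. g (u @ v) = (\<Sum>j\<in>J. g1 j u * g2 j v)"
    and f1: "\<And>i u. i \<in> I \<Longrightarrow> wpar u \<noteq> p i \<Longrightarrow> f1 i u = 0"
    and g2: "\<And>j v. j \<in> J \<Longrightarrow> wpar v \<noteq> r j \<Longrightarrow> g2 j v = 0"
  shows "fm f g (u @ v) = (\<Sum>i\<in>I. \<Sum>j\<in>J. (-1) ^ (p i * r j) * fm (f1 i) (g1 j) u * fm (f2 i) (g2 j) v)"
proof -
  \<comment> \<open>All sign factors at once, compared by running through the parities of the four
    words.\<close>
  have sg: "(-1::complex) ^ (b * c) * ((-1) ^ (wpar (y @ z) * wpar (w @ x)) * (P * Q)) =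
      (-1) ^ (wpar w * wpar z) * ((-1) ^ (b * wpar w) * ((-1) ^ (wpar z * c) * (P * Q)))"
    if "b = wpar y" "c = wpar x" for w x y z :: "'a gen list" and b c P Q
    using wpar_cases[of y] wpar_cases[of x] wpar_cases[of w] wpar_cases[of z] that
    by (auto simp: neg_one_wpar_append)
  have "(-1) ^ (wpar b * wpar c) * ((-1) ^ (wpar (b @ d) * wpar (a @ c)) * f (a @ c) * g (b @ d)) =
      (\<Sum>i\<in>I. \<Sum>j\<in>J. ((-1) ^ (p i * r j) * ((-1) ^ (wpar b * wpar a) * f1 i a * g1 j b)) *
         ((-1) ^ (wpar d * wpar c) * f2 i c * g2 j d))" for a b c d
  proof -
    have "(-1) ^ (wpar b * wpar c) * ((-1) ^ (wpar (b @ d) * wpar (a @ c)) * f (a @ c) * g (b @ d)) =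
      (\<Sum>i\<in>I. \<Sum>j\<in>J. (-1) ^ (wpar b * wpar c) * ((-1) ^ (wpar (b @ d) * wpar (a @ c)) *
         ((f1 i a * f2 i c) * (g1 j b * g2 j d))))"
      unfolding f g mult.assoc sum_product by (simp only: sum_distrib_left mult.assoc)
    also have "\<dots> = (\<Sum>i\<in>I. \<Sum>j\<in>J. ((-1) ^ (p i * r j) * ((-1) ^ (wpar b * wpar a) * f1 i a * g1 j b)) *
         ((-1) ^ (wpar d * wpar c) * f2 i c * g2 j d))"
    proof (intro sum.cong refl)
      fix i j assume ij: "i \<in> I" "j \<in> J"
      show "(-1) ^ (wpar b * wpar c) * ((-1) ^ (wpar (b @ d) * wpar (a @ c)) *
         ((f1 i a * f2 i c) * (g1 j b * g2 j d)))
        = ((-1) ^ (p i * r j) * ((-1) ^ (wpar b * wpar a) * f1 i a * g1 j b)) *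
         ((-1) ^ (wpar d * wpar c) * f2 i c * g2 j d)"
      proof (cases "wpar a = p i \<and> wpar d = r j")
        case True
        then show ?thesis
          by (subst sg[OF refl refl]) (simp add: ac_simps)
      next
        case False
        then have "f1 i a = 0 \<or> g2 j d = 0" using f1 g2 ij by blast
        then show ?thesis by auto
      qed
    qed
    finally show ?thesis .
  qed
  then have "fm f g (u @ v) = Dev (\<lambda>a b. Dev (\<lambda>c d. \<Sum>i\<in>I. \<Sum>j\<in>J.
      ((-1) ^ (p i * r j) * ((-1) ^ (wpar b * wpar a) * f1 i a * g1 j b)) *
         ((-1) ^ (wpar d * wpar c) * f2 i c * g2 j d)) v) u"
    unfolding fm_def Dev_append by simp
  also have "\<dots> = (\<Sum>i\<in>I. \<Sum>j\<in>J. Dev (\<lambda>a b.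
      ((-1) ^ (p i * r j) * ((-1) ^ (wpar b * wpar a) * f1 i a * g1 j b)) * fm (f2 i) (g2 j) v) u)"
    unfolding Dev_sum Dev_cmult fm_def ..
  also have "\<dots> = (\<Sum>i\<in>I. \<Sum>j\<in>J. (-1) ^ (p i * r j) * fm (f1 i) (g1 j) u * fm (f2 i) (g2 j) v)"
  proof (intro sum.cong refl)
    fix i j
    have "Dev (\<lambda>a b. ((-1) ^ (p i * r j) * ((-1) ^ (wpar b * wpar a) * f1 i a * g1 j b)) * fm (f2 i) (g2 j) v) u
      = Dev (\<lambda>a b. ((-1) ^ (p i * r j) * fm (f2 i) (g2 j) v) * ((-1) ^ (wpar b * wpar a) * f1 i a * g1 j b)) u"
      by (simp add: ac_simps)
    then show "Dev (\<lambda>a b. ((-1) ^ (p i * r j) * ((-1) ^ (wpar b * wpar a) * f1 i a * g1 j b)) * fm (f2 i) (g2 j) v) u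
      = (-1) ^ (p i * r j) * fm (f1 i) (g1 j) u * fm (f2 i) (g2 j) v"
      by (simp add: Dev_cmult fm_def)
  qed
  finally show ?thesis .
qed

lemma homogeneous_fmult:
  assumes "homogeneous_functional p f" "homogeneous_functional r g"
  shows "homogeneous_functional ((p + r) mod 2) (fmult f g)"
  unfolding homogeneous_functional_def fmult_wrd
  using assms by (auto intro!: fm_homogeneous simp: homogeneous_functional_def)

locale haar_alg =
  fixes T :: "'n::{finite,linorder} functional set" and I :: "'n functional \<Rightarrow> complex"
  assumes haar: "haar_functional T I"
    and T_add: "f \<in> T \<Longrightarrow> g \<in> T \<Longrightarrow> (\<lambda>x. f x + g x) \<in> T"
    and T_cmult: "f \<in> T \<Longrightarrow> (\<lambda>x. c * f x) \<in> T"
    and T_fmult: "f \<in> T \<Longrightarrow> g \<in> T \<Longrightarrow> fmult f g \<in> T"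
    and T_counit: "counit \<in> T"
begin

lemma I_add: "f \<in> T \<Longrightarrow> g \<in> T \<Longrightarrow> I (\<lambda>x. f x + g x) = I f + I g"
  and I_cmult: "f \<in> T \<Longrightarrow> I (\<lambda>x. c * f x) = c * I f"
  and I_odd: "f \<in> T \<Longrightarrow> homogeneous_functional 1 f \<Longrightarrow> I f = 0"
  and I_counit: "I counit = 1"
  using haar unfolding haar_functional_def by blast+

lemma I_fcoproduct:
  "f \<in> T \<Longrightarrow> set L \<subseteq> T \<times> T \<Longrightarrow> is_fcoproduct f L \<Longrightarrow> (\<Sum>(g, h)\<leftarrow>L. I g * h x) = I f * counit x"
  "f \<in> T \<Longrightarrow> set L \<subseteq> T \<times> T \<Longrightarrow> is_fcoproduct f L \<Longrightarrow> (\<Sum>(g, h)\<leftarrow>L. g x * I h) = I f * counit x"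
  using haar unfolding haar_functional_def by blast+

lemma T_zero: "(\<lambda>x. 0) \<in> T"
  using T_cmult[OF T_counit, of 0] by simp

lemma I_zero: "I (\<lambda>x. 0) = 0"
  using I_cmult[OF T_counit, of 0] by simp

lemma T_sum: "(\<And>i. i \<in> S \<Longrightarrow> f i \<in> T) \<Longrightarrow> (\<lambda>x. \<Sum>i\<in>S. f i x) \<in> T"
  by (induction S rule: infinite_finite_induct) (simp_all add: T_zero T_add)

lemma I_sum: "(\<And>i. i \<in> S \<Longrightarrow> f i \<in> T) \<Longrightarrow> I (\<lambda>x. \<Sum>i\<in>S. f i x) = (\<Sum>i\<in>S. I (f i))"
  by (induction S rule: infinite_finite_induct) (simp_all add: I_zero I_add T_sum)

text \<open>Translating \<open>F\<close> amounts to evaluating one leg of its coproduct, so the Haar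
  property gives the counit. The sign demanded by \<open>is_fcoproduct\<close> is put into the
  coefficients; it disappears under the integral, which vanishes on odd functionals.\<close>

lemma haar_invariance:
  assumes S: "finite S" and F: "F \<in> T" "linear_functional F"
    and PQ: "\<And>k. k \<in> S \<Longrightarrow> P k \<in> T \<and> Q k \<in> T \<and> linear_functional (P k) \<and> linear_functional (Q k) \<and>
      homogeneous_functional (p k) (P k) \<and> homogeneous_functional (r k) (Q k) \<and> p k < 2 \<and> r k < 2"
    and cop: "\<And>u v. F (wrd (u @ v)) = (\<Sum>k\<in>S. c k * P k (wrd u) * Q k (wrd v))"
  shows "I (\<lambda>x. F (x * wrd v)) = counit (wrd v) * I F"
    and "I (\<lambda>x. F (wrd u * x)) = counit (wrd u) * I F"
proof -
  obtain xs where xs: "set xs = S" "distinct xs" using finite_distinct_list[OF S] by blast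
  define L where "L = map (\<lambda>k. (\<lambda>x. (c k * (-1) ^ (p k * r k)) * P k x, Q k)) xs"
  have LT: "set L \<subseteq> T \<times> T" using PQ xs by (auto simp: L_def intro!: T_cmult)
  have sumL: "(\<Sum>(g, h)\<leftarrow>L. G g h) = (\<Sum>k\<in>S. G (\<lambda>x. (c k * (-1) ^ (p k * r k)) * P k x) (Q k))" for G :: "_ \<Rightarrow> _ \<Rightarrow> complex"
    unfolding L_def using xs by (simp add: o_def sum_list_distinct_conv_sum_set)
  have cL: "is_fcoproduct F L"
    unfolding is_fcoproduct_def
  proof (intro allI)
    fix a b
    have "c k * P k (wrd a) * Q k (wrd b) =
      (-1) ^ (wpar a * wpar b) * ((c k * (-1) ^ (p k * r k)) * P k (wrd a)) * Q k (wrd b)" if "k \<in> S" for k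
    proof (cases "wpar a = p k \<and> wpar b = r k")
      case True
      have "(-1 :: complex) ^ (p k * r k) * (-1) ^ (p k * r k) = 1" by (rule neg_one_power_sq)
      then show ?thesis using True by (simp add: ac_simps)
    next
      case False
      then have "P k (wrd a) = 0 \<or> Q k (wrd b) = 0"
        using PQ[OF that] by (auto simp: homogeneous_functional_def)
      then show ?thesis by auto
    qed
    then show "F (wrd a * wrd b) = (\<Sum>(g, h)\<leftarrow>L. (-1) ^ (wpar a * wpar b) * g (wrd a) * h (wrd b))"
      unfolding sumL wrd_mult cop by (intro sum.cong) auto
  qed
  have IP: "I (\<lambda>x. (c k * (-1) ^ (p k * r k)) * P k x) = c k * I (P k)" if "k \<in> S" for k
    using PQ[OF that] I_odd[of "P k"] I_cmult[of "P k"] by (cases "p k = 0") (auto simp: less_2_cases_iff)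
  have IQ: "(-1) ^ (p k * r k) * I (Q k) = I (Q k)" if "k \<in> S" for k
    using PQ[OF that] I_odd[of "Q k"] by (cases "r k = 0") (auto simp: less_2_cases_iff)
  have linsum: "linear_functional (\<lambda>x. \<Sum>k\<in>S. d k * R k x)"
    if "\<And>k. k \<in> S \<Longrightarrow> linear_functional (R k)" for d R
    using that by (simp add: linear_functional_def distrib_left sum.distrib sum_distrib_left ac_simps)
  show "I (\<lambda>x. F (x * wrd v)) = counit (wrd v) * I F"
  proof -
    have "(\<lambda>x. F (x * wrd v)) = (\<lambda>x. \<Sum>k\<in>S. (c k * Q k (wrd v)) * P k x)"
      by (rule linear_functional_eqI[OF linear_functional_right_translate[OF F(2)] linsum])
         (use PQ in \<open>auto simp: wrd_mult cop ac_simps\<close>)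
    then have "I (\<lambda>x. F (x * wrd v)) = (\<Sum>k\<in>S. I (\<lambda>x. (c k * Q k (wrd v)) * P k x))"
      using PQ by (simp add: I_sum T_cmult)
    also have "\<dots> = (\<Sum>k\<in>S. I (\<lambda>x. (c k * (-1) ^ (p k * r k)) * P k x) * Q k (wrd v))"
    proof (intro sum.cong refl)
      fix k assume k: "k \<in> S"
      show "I (\<lambda>x. (c k * Q k (wrd v)) * P k x) = I (\<lambda>x. (c k * (-1) ^ (p k * r k)) * P k x) * Q k (wrd v)"
        unfolding IP[OF k] using PQ[OF k] by (subst I_cmult) auto
    qed
    also have "\<dots> = I F * counit (wrd v)"
      using I_fcoproduct(1)[OF F(1) LT cL, of "wrd v"] unfolding sumL .
    finally show ?thesis by (simp add: mult.commute)
  qed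
  show "I (\<lambda>x. F (wrd u * x)) = counit (wrd u) * I F"
  proof -
    have "(\<lambda>x. F (wrd u * x)) = (\<lambda>x. \<Sum>k\<in>S. (c k * P k (wrd u)) * Q k x)"
      by (rule linear_functional_eqI[OF linear_functional_left_translate[OF F(2)] linsum])
         (use PQ in \<open>auto simp: wrd_mult cop ac_simps\<close>)
    then have "I (\<lambda>x. F (wrd u * x)) = (\<Sum>k\<in>S. (c k * P k (wrd u)) * I (Q k))"
      using PQ by (simp add: I_sum T_cmult I_cmult)
    also have "\<dots> = (\<Sum>k\<in>S. (c k * (-1) ^ (p k * r k) * P k (wrd u)) * I (Q k))"
    proof (intro sum.cong refl)
      fix k assume "k \<in> S"
      from IQ[OF this] have "c k * P k (wrd u) * ((-1) ^ (p k * r k) * I (Q k)) = c k * P k (wrd u) * I (Q k)" by simp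
      then show "(c k * P k (wrd u)) * I (Q k) = (c k * (-1) ^ (p k * r k) * P k (wrd u)) * I (Q k)"
        by (simp add: ac_simps)
    qed
    also have "\<dots> = I F * counit (wrd u)"
      using I_fcoproduct(2)[OF F(1) LT cL, of "wrd u"] unfolding sumL .
    finally show ?thesis by (simp add: mult.commute)
  qed
qed

lemma haar_product_invariance:
  assumes f: "f \<in> T" "coproduct_decomposable T f" and g: "g \<in> T" "coproduct_decomposable T g"
  shows "I (\<lambda>x. fmult f g (x * wrd v)) = counit (wrd v) * I (fmult f g)"
    and "I (\<lambda>x. fmult f g (wrd u * x)) = counit (wrd u) * I (fmult f g)"
proof -
  obtain N :: nat and F1 F2 p r where F: "\<forall>i<N. F1 i \<in> T \<and> F2 i \<in> T \<and> p i < 2 \<and> r i < 2 \<and>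
        homogeneous_functional (p i) (F1 i) \<and> homogeneous_functional (r i) (F2 i)"
     "\<And>u v. f (wrd (u @ v)) = (\<Sum>i<N. F1 i (wrd u) * F2 i (wrd v))"
    using f(2) unfolding coproduct_decomposable_def by blast
  obtain N' :: nat and G1 G2 p' r' where G: "\<forall>i<N'. G1 i \<in> T \<and> G2 i \<in> T \<and> p' i < 2 \<and> r' i < 2 \<and>
        homogeneous_functional (p' i) (G1 i) \<and> homogeneous_functional (r' i) (G2 i)"
     "\<And>u v. g (wrd (u @ v)) = (\<Sum>i<N'. G1 i (wrd u) * G2 i (wrd v))"
    using g(2) unfolding coproduct_decomposable_def by blast
  define S where "S = {..<N} \<times> {..<N'}"
  define c where "c = (\<lambda>k :: nat \<times> nat. (-1 :: complex) ^ (p (fst k) * r' (snd k)))"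
  define P where "P = (\<lambda>k :: nat \<times> nat. fmult (F1 (fst k)) (G1 (snd k)))"
  define Q where "Q = (\<lambda>k :: nat \<times> nat. fmult (F2 (fst k)) (G2 (snd k)))"
  have PQ: "P k \<in> T \<and> Q k \<in> T \<and> linear_functional (P k) \<and> linear_functional (Q k) \<and>
      homogeneous_functional ((p (fst k) + p' (snd k)) mod 2) (P k) \<and>
      homogeneous_functional ((r (fst k) + r' (snd k)) mod 2) (Q k) \<and>
      (p (fst k) + p' (snd k)) mod 2 < 2 \<and> (r (fst k) + r' (snd k)) mod 2 < 2" if "k \<in> S" for k
    using F(1) G(1) that by (auto simp: P_def Q_def S_def T_fmult fmult_linear homogeneous_fmult)
  have cop: "fmult f g (wrd (u @ v)) = (\<Sum>k\<in>S. c k * P k (wrd u) * Q k (wrd v))" for u v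
  proof -
    have "fmult f g (wrd (u @ v)) = (\<Sum>i<N. \<Sum>j<N'. (-1) ^ (p i * r' j) *
        fm (\<lambda>u. F1 i (wrd u)) (\<lambda>u. G1 j (wrd u)) u * fm (\<lambda>u. F2 i (wrd u)) (\<lambda>u. G2 j (wrd u)) v)"
      unfolding fmult_wrd
      by (rule fm_append) (use F G in \<open>auto simp: homogeneous_functional_def\<close>)
    then show ?thesis
      by (simp add: S_def c_def P_def Q_def fmult_wrd sum.cartesian_product case_prod_unfold)
  qed
  have "finite S" by (simp add: S_def)
  from haar_invariance[OF this T_fmult[OF f(1) g(1)] fmult_linear PQ cop]
  show "I (\<lambda>x. fmult f g (x * wrd v)) = counit (wrd v) * I (fmult f g)"
    "I (\<lambda>x. fmult f g (wrd u * x)) = counit (wrd u) * I (fmult f g)" by blast+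
qed

end

section \<open>Matrix elements composed with the antipode\<close>

context uq_mod
begin

abbreviation "sa u v \<equiv> act (antipode_word u) v"

lemma sa_Nil [simp]: "v \<in> C \<Longrightarrow> sa [] v = v"
  by (simp add: act_1)

lemma sa_append: "v \<in> C \<Longrightarrow> sa (x @ y) v = sc ((-1) ^ (wpar x * wpar y)) (sa y (sa x v))"
  by (simp only: antipode_word_append mult.assoc act_scl) (simp only: act_mult)

lemma sa_K: "sa [KGen i] v = act (kinv i) v" "sa [KInvGen i] v = act (kk i) v"
  by (simp_all add: scl_1)

text \<open>The antipode axiom for X -> X (x) lgr X + lgl X (x) X gives S(X) = - S(lgl X) X S(lgr
  X), which covers \<open>e_i\<close> and \<open>f_i\<close> at once.\<close>

lemma sa_EF:
  assumes "is_EF X" "v \<in> C"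
  shows "sa [X] v = - sa (lgl X) (act (wrd [X]) (sa (lgr X) v))"
  using assms by (cases X) (simp_all add: scl_1 act_uminus act_mult act_1)

lemma lg_inverse:
  assumes "v \<in> C"
  shows "act (wrd (lgr X)) (sa (lgr X) v) = v" "sa (lgr X) (act (wrd (lgr X)) v) = v"
    "act (wrd (lgl X)) (sa (lgl X) v) = v" "sa (lgl X) (act (wrd (lgl X)) v) = v"
  using assms by (cases X; simp add: scl_1 act_1 act_Nil act_KI_K act_K_KI)+

lemma sa_gen_part: "p < 2 \<Longrightarrow> v \<in> part M p \<Longrightarrow> sa [g] v \<in> part M ((gpar g + p) mod 2)"
proof -
  assume *: "p < 2" "v \<in> part M p"
  then have v: "v \<in> C" using part_in_C by blast
  have neg: "- w \<in> part M r" if "w \<in> part M r" "r < 2" for w r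
    using V.subspace_neg[OF sub_part] that by blast
  show ?thesis
  proof (cases g)
    case (EGen i)
    have "act (wrd [EGen i, KInvGen i]) v \<in> part M ((gpar g + p) mod 2)"
      using act_word_part[OF *, of "[EGen i, KInvGen i]"] EGen by (simp add: wpar_Cons)
    then show ?thesis
      using neg v EGen by (simp add: scl_1 act_uminus wrd_mult)
  next
    case (FGen i)
    have "act (wrd [KGen i, FGen i]) v \<in> part M ((gpar g + p) mod 2)"
      using act_word_part[OF *, of "[KGen i, FGen i]"] FGen by (simp add: wpar_Cons)
    then show ?thesis
      using neg v FGen by (simp add: scl_1 act_uminus wrd_mult)
  qed (use act_word_part[OF *, of "[KGen _]"] act_word_part[OF *, of "[KInvGen _]"] in \<open>simp_all add: scl_1\<close>)
qed

lemma sa_part: "p < 2 \<Longrightarrow> v \<in> part M p \<Longrightarrow> sa u v \<in> part M ((wpar u + p) mod 2)"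
proof (induction u arbitrary: p v)
  case Nil
  then show ?case using part_in_C by (simp add: act_1)
next
  case (Cons g u)
  have v: "v \<in> C" using Cons part_in_C by blast
  have "sa u (sa [g] v) \<in> part M ((wpar u + (gpar g + p) mod 2) mod 2)"
    by (intro Cons.IH sa_gen_part Cons.prems) simp
  then have "sa (g # u) v \<in> part M ((wpar u + (gpar g + p) mod 2) mod 2)"
    using sa_append[OF v, of "[g]" u] by (simp add: V.subspace_scale[OF sub_part])
  moreover have "(wpar u + (gpar g + p) mod 2) mod 2 = (wpar (g # u) + p) mod 2"
    by (simp add: wpar_Cons mod_simps ac_simps)
  ultimately show ?case by (simp only:)
qed

definition sm :: "('v \<Rightarrow> complex) \<Rightarrow> 'v \<Rightarrow> 'n functional" where
  "sm B u = fantipode (tm B u)"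

lemma sm_eq: "covec B \<Longrightarrow> u \<in> C \<Longrightarrow> sm B u = lin_ext (\<lambda>x. B (sa x u))"
  by (simp add: sm_def fantipode_linear[OF tm_linear]) (simp add: tm_def)

lemma sm_wrd: "covec B \<Longrightarrow> u \<in> C \<Longrightarrow> sm B u (wrd x) = B (sa x u)"
  by (simp add: sm_eq)

lemma sm_linear: "covec B \<Longrightarrow> u \<in> C \<Longrightarrow> linear_functional (sm B u)"
  by (simp add: sm_eq linear_functional_lin_ext_words)

lemma sa_odd:
  assumes "hcov p B" "p < 2" "r < 2" "u \<in> part M r" "wpar x \<noteq> (p + r) mod 2"
  shows "B (sa x u) = 0"
proof -
  have "(wpar x + r) mod 2 \<noteq> p"
    using assms wpar_cases[of x] by (auto simp: less_2_cases_iff)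
  then show ?thesis
    using sa_part[OF assms(3,4), of x] hcovD[OF assms(1), of "(wpar x + r) mod 2"] by simp
qed

lemma act_odd:
  assumes "hcov p B" "p < 2" "r < 2" "u \<in> part M r" "wpar x \<noteq> (p + r) mod 2"
  shows "B (act (wrd x) u) = 0"
  using tm_homogeneous[OF assms(1-4)] assms(5) by (simp add: homogeneous_functional_def tm_def)

lemma sm_homogeneous:
  assumes "hcov p B" "p < 2" "r < 2" "u \<in> part M r"
  shows "homogeneous_functional ((p + r) mod 2) (sm B u)"
  using sa_odd[OF assms] sm_wrd[OF hcov_covec[OF assms(1)] part_in_C[OF assms(3,4)]]
  by (simp add: homogeneous_functional_def)

lemma hcov_sa:
  assumes "hcov p A" "p < 2"
  shows "hcov ((wpar u + p) mod 2) (\<lambda>v. A (sa u v))"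
proof -
  have "A (sa u v) = 0" if "r < 2" "r \<noteq> (wpar u + p) mod 2" "v \<in> part M r" for r v
    by (rule sa_odd[OF assms that(1,3)])
       (use that assms wpar_cases[of u] in \<open>auto simp: less_2_cases_iff\<close>)
  then show ?thesis
    using assms covec_act by (simp add: hcov_def)
qed

lemma WB_part: "b \<in> WB \<Longrightarrow> b \<in> part M (vpar M b)"
  by (rule hbasis_part[OF WB])

lemma tm_decomposable:
  assumes "\<And>A v. covec A \<Longrightarrow> v \<in> C \<Longrightarrow> tm A v \<in> T" "hcov p A" "p < 2" "r < 2" "v \<in> part M r"
  shows "coproduct_decomposable T (tm A v)"
proof (rule coproduct_decomposableI[OF finite_WB])
  have v: "v \<in> C" using assms part_in_C by blast
  show "tm A b \<in> T \<and> tm (cf WB b) v \<in> T \<and> (p + vpar M b) mod 2 < 2 \<and> (vpar M b + r) mod 2 < 2 \<and>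
     homogeneous_functional ((p + vpar M b) mod 2) (tm A b) \<and>
     homogeneous_functional ((vpar M b + r) mod 2) (tm (cf WB b) v)" if "b \<in> WB" for b
    using that assms v WB_in_C WB_part hcov_covec cf_hcov[OF WB] cf_covec[OF WB]
    by (auto intro!: tm_homogeneous)
  show "tm A v (wrd (x @ y)) = (\<Sum>b\<in>WB. tm A b (wrd x) * tm (cf WB b) v (wrd y))" for x y
    using covec_expand[OF WB covec_act[OF hcov_covec[OF assms(2)]], of "act (wrd y) v" "wrd x"] v
    by (simp add: tm_def act_append mult.commute)
qed

text \<open>S reverses products, so the inserted basis vector receives S(x) first. The sign
  (-1)^([x][y]) may be replaced by \<open>\<sigma> b\<close>, because a nonzero term determines the
  parities of x and y from \<open>b\<close>.\<close>

lemma sm_decomposable: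
  assumes T: "\<And>A v. covec A \<Longrightarrow> v \<in> C \<Longrightarrow> sm A v \<in> T"
    and Tc: "\<And>f c. f \<in> T \<Longrightarrow> (\<lambda>x. c * f x) \<in> T"
    and B: "hcov p B" "p < 2" and u: "r < 2" "u \<in> part M r"
  shows "coproduct_decomposable T (sm B u)"
proof (rule coproduct_decomposableI[OF finite_WB])
  have uC: "u \<in> C" using u part_in_C by blast
  note cov = hcov_covec[OF B(1)]
  define \<sigma> :: "'v \<Rightarrow> complex" where "\<sigma> b = (-1) ^ (((vpar M b + r) mod 2) * ((p + vpar M b) mod 2))" for b
  have hom: "homogeneous_functional k (\<lambda>x. c * f x)" if "homogeneous_functional k f" for k c and f :: "'n functional"
    using that by (auto simp: homogeneous_functional_def)
  show "(\<lambda>x. \<sigma> b * sm (cf WB b) u x) \<in> T \<and> sm B b \<in> T \<and> (vpar M b + r) mod 2 < 2 \<and> (p + vpar M b) mod 2 < 2 \<and>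
     homogeneous_functional ((vpar M b + r) mod 2) (\<lambda>x. \<sigma> b * sm (cf WB b) u x) \<and>
     homogeneous_functional ((p + vpar M b) mod 2) (sm B b)" if "b \<in> WB" for b
    using that B u uC WB_in_C WB_part cov cf_hcov[OF WB] cf_covec[OF WB]
    by (auto intro!: sm_homogeneous hom T Tc)
  show "sm B u (wrd (x @ y)) = (\<Sum>b\<in>WB. \<sigma> b * sm (cf WB b) u (wrd x) * sm B b (wrd y))" for x y
  proof -
    have "sm B u (wrd (x @ y)) = (-1) ^ (wpar x * wpar y) * B (sa y (sa x u))"
      using uC by (simp add: sm_wrd[OF cov] sa_append covec_sc[OF cov])
    also have "B (sa y (sa x u)) = (\<Sum>b\<in>WB. cf WB b (sa x u) * B (sa y b))"
      using covec_expand[OF WB covec_act[OF cov], of "sa x u"] uC by simp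
    also have "(-1) ^ (wpar x * wpar y) * \<dots> = (\<Sum>b\<in>WB. \<sigma> b * sm (cf WB b) u (wrd x) * sm B b (wrd y))"
      unfolding sum_distrib_left
    proof (rule sum.cong[OF refl])
      fix b assume b: "b \<in> WB"
      have s: "sm (cf WB b) u (wrd x) = cf WB b (sa x u)" "sm B b (wrd y) = B (sa y b)"
        by (simp_all add: sm_wrd cf_covec[OF WB] uC cov WB_in_C[OF b])
      show "(-1) ^ (wpar x * wpar y) * (cf WB b (sa x u) * B (sa y b)) =
          \<sigma> b * sm (cf WB b) u (wrd x) * sm B b (wrd y)"
      proof (cases "wpar x = (vpar M b + r) mod 2 \<and> wpar y = (p + vpar M b) mod 2")
        case True
        then show ?thesis unfolding s \<sigma>_def by simp
      next
        case False
        then have "cf WB b (sa x u) = 0 \<or> B (sa y b) = 0"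
          using sa_odd[OF cf_hcov[OF WB b] vpar_less_2 u, of x] sa_odd[OF B vpar_less_2 WB_part[OF b], of y]
          by blast
        then show ?thesis unfolding s by auto
      qed
    qed
    finally show ?thesis .
  qed
qed

end

section \<open>Bilinearity of the convolution product and parity signs\<close>

lemma fmult_add_left: "fmult (\<lambda>x. f x + f' x) g = (\<lambda>x. fmult f g x + fmult f' g x)"
  by (rule ext) (simp add: fmult_lin_ext flip: lin_ext_fun_add fm_add_left)

lemma fmult_add_right: "fmult f (\<lambda>x. g x + g' x) = (\<lambda>x. fmult f g x + fmult f g' x)"
  by (rule ext) (simp add: fmult_lin_ext flip: lin_ext_fun_add fm_add_right)

lemma fmult_cmult_left: "fmult (\<lambda>x. c * f x) g = (\<lambda>x. c * fmult f g x)"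
  by (rule ext) (simp add: fmult_lin_ext flip: lin_ext_fun_mult fm_cmult_left)

lemma fmult_cmult_right: "fmult f (\<lambda>x. c * g x) = (\<lambda>x. c * fmult f g x)"
  by (rule ext) (simp add: fmult_lin_ext flip: lin_ext_fun_mult fm_cmult_right)

lemma fmult_zero_left: "fmult (\<lambda>x. 0) g = (\<lambda>x. 0)"
  using fmult_cmult_left[of 0 "\<lambda>x. 0" g] by simp

lemma fmult_zero_right: "fmult f (\<lambda>x. 0) = (\<lambda>x. 0)"
  using fmult_cmult_right[of f 0 "\<lambda>x. 0"] by simp

lemma fmult_sum_left: "fmult (\<lambda>x. \<Sum>i\<in>S. f i x) g = (\<lambda>x. \<Sum>i\<in>S. fmult (f i) g x)"
  by (induction S rule: infinite_finite_induct) (simp_all add: fmult_zero_left fmult_add_left)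

lemma fmult_sum_right: "fmult f (\<lambda>x. \<Sum>i\<in>S. g i x) = (\<lambda>x. \<Sum>i\<in>S. fmult f (g i) x)"
  by (induction S rule: infinite_finite_induct) (simp_all add: fmult_zero_right fmult_add_right)

lemma fm_twist_left:
  fixes f g :: "'n::{finite,linorder} gen list \<Rightarrow> complex"
  assumes "\<And>a. wpar a \<noteq> p \<Longrightarrow> f a = 0"
  shows "fm (\<lambda>a. (-1) ^ (k * wpar a) * f a) g u = (-1) ^ (k * p) * fm f g u"
proof -
  have "(\<lambda>a. (-1) ^ (k * wpar a) * f a) = (\<lambda>a. (-1) ^ (k * p) * f a)"
  proof
    fix a show "(-1) ^ (k * wpar a) * f a = (-1) ^ (k * p) * f a"
      using assms by (cases "wpar a = p") auto
  qed
  then show ?thesis by (simp add: fm_cmult_left)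
qed

lemma fm_twist_right:
  fixes f g :: "'n::{finite,linorder} gen list \<Rightarrow> complex"
  assumes "\<And>a. wpar a \<noteq> p \<Longrightarrow> g a = 0"
  shows "fm f (\<lambda>a. (-1) ^ (k * wpar a) * g a) u = (-1) ^ (k * p) * fm f g u"
proof -
  have "(\<lambda>a. (-1) ^ (k * wpar a) * g a) = (\<lambda>a. (-1) ^ (k * p) * g a)"
  proof
    fix a show "(-1) ^ (k * wpar a) * g a = (-1) ^ (k * p) * g a"
      using assms by (cases "wpar a = p") auto
  qed
  then show ?thesis by (simp add: fm_cmult_right)
qed

lemma counit_EF: "is_EF X \<Longrightarrow> counit (wrd [X]) = 0"
  by (cases X) (auto simp: counit_wrd)

lemma counit_not_EF: "\<not> is_EF X \<Longrightarrow> counit (wrd [X]) = 1"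
  by (cases X) (auto simp: counit_wrd)

context uq_mod
begin

text \<open>For both kinds of generators the composite is k_i X k_i^(-1) = S^2(X), in the
  arrangement in which it turns up when X is moved across an integral.\<close>

lemma lg_conjugate:
  assumes "w \<in> C"
  shows "act (wrd (lgr (XG o' i))) (sa (lgl (XG o' i)) (act (wrd [XG o' i]) (sa (lgr (XG o' i)) (act (wrd (lgl (XG o' i))) w))))
    = sc (qpow q (osg o' * (simple_root i \<bullet> simple_root i))) (act (wrd [XG o' i]) w)"
  using assms act_K_X[of "act (kinv i) w" i o' i]
  by (cases o') (simp_all add: act_Nil act_1 scl_1 act_K_KI)

lemma lg_part: "p < 2 \<Longrightarrow> v \<in> part M p \<Longrightarrow> act (wrd (lgr X)) v \<in> part M p"
  "p < 2 \<Longrightarrow> v \<in> part M p \<Longrightarrow> act (wrd (lgl X)) v \<in> part M p"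
  "p < 2 \<Longrightarrow> v \<in> part M p \<Longrightarrow> sa (lgr X) v \<in> part M p"
  "p < 2 \<Longrightarrow> v \<in> part M p \<Longrightarrow> sa (lgl X) v \<in> part M p"
  using act_word_part[of p v "lgr X"] act_word_part[of p v "lgl X"] sa_part[of p v "lgr X"] sa_part[of p v "lgl X"]
  by simp_all

lemma lg_hcov: "p < 2 \<Longrightarrow> hcov p A \<Longrightarrow> hcov p (\<lambda>w. A (act (wrd (lgr X)) w))"
  "p < 2 \<Longrightarrow> hcov p A \<Longrightarrow> hcov p (\<lambda>w. A (act (wrd (lgl X)) w))"
  "p < 2 \<Longrightarrow> hcov p A \<Longrightarrow> hcov p (\<lambda>w. A (sa (lgr X) w))"
  "p < 2 \<Longrightarrow> hcov p A \<Longrightarrow> hcov p (\<lambda>w. A (sa (lgl X) w))"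
  using hcov_act[of p A "lgr X"] hcov_act[of p A "lgl X"] hcov_sa[of p A "lgr X"] hcov_sa[of p A "lgl X"]
  by simp_all

lemma tm_cong: "(\<And>w. w \<in> C \<Longrightarrow> A w = A' w) \<Longrightarrow> v \<in> C \<Longrightarrow> tm A v = tm A' v"
  by (simp add: tm_def)

lemma sm_cong: "(\<And>w. w \<in> C \<Longrightarrow> A w = A' w) \<Longrightarrow> v \<in> C \<Longrightarrow> sm A v = sm A' v"
  by (simp add: sm_def tm_cong[of A A'])

lemma tm_sum_covec: "tm (\<lambda>w. \<Sum>i\<in>S. c i * A i w) v = (\<lambda>x. \<Sum>i\<in>S. c i * tm (A i) v x)"
  by (simp add: tm_def)

lemma sm_sum_covec: "sm (\<lambda>w. \<Sum>i\<in>S. c i * A i w) v = (\<lambda>x. \<Sum>i\<in>S. c i * sm (A i) v x)"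
  by (simp add: sm_def fantipode_def tm_def)

lemma tm_add_vec: "covec A \<Longrightarrow> v \<in> C \<Longrightarrow> w \<in> C \<Longrightarrow> tm A (v + w) = (\<lambda>x. tm A v x + tm A w x)"
  by (simp add: tm_def act_add_vec covec_add)

lemma tm_sc_vec: "covec A \<Longrightarrow> v \<in> C \<Longrightarrow> tm A (sc c v) = (\<lambda>x. c * tm A v x)"
  by (simp add: tm_def act_sc covec_sc)

lemma sm_add_vec: "covec A \<Longrightarrow> v \<in> C \<Longrightarrow> w \<in> C \<Longrightarrow> sm A (v + w) = (\<lambda>x. sm A v x + sm A w x)"
  by (simp add: sm_def fantipode_def tm_add_vec)

lemma sm_sc_vec: "covec A \<Longrightarrow> v \<in> C \<Longrightarrow> sm A (sc c v) = (\<lambda>x. c * sm A v x)"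
  by (simp add: sm_def fantipode_def tm_sc_vec)

end

section \<open>Integrals of products of a matrix element and the antipode of one\<close>

locale haar_pair = M: uq_mod q sc M + N: uq_mod q sc N + haar_alg T I
  for q sc and M N :: "('n::{finite,linorder}, 'v::ab_group_add) supermodule" and T I +
  assumes tm_T: "M.covec A \<Longrightarrow> v \<in> mcarrier M \<Longrightarrow> M.tm A v \<in> T"
    and sm_T: "N.covec B \<Longrightarrow> u \<in> mcarrier N \<Longrightarrow> N.sm B u \<in> T"
begin

definition G1 :: "('v \<Rightarrow> complex) \<Rightarrow> 'v \<Rightarrow> ('v \<Rightarrow> complex) \<Rightarrow> 'v \<Rightarrow> complex" where
  "G1 A v B u = I (fmult (M.tm A v) (N.sm B u))"

definition G2 :: "('v \<Rightarrow> complex) \<Rightarrow> 'v \<Rightarrow> ('v \<Rightarrow> complex) \<Rightarrow> 'v \<Rightarrow> complex" where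
  "G2 B u A v = I (fmult (N.sm B u) (M.tm A v))"

lemma G_cong:
  assumes "\<And>w. w \<in> M.C \<Longrightarrow> A w = A' w" "\<And>w. w \<in> N.C \<Longrightarrow> B w = B' w" "v \<in> M.C" "u \<in> N.C"
  shows "G1 A v B u = G1 A' v B' u" "G2 B u A v = G2 B' u A' v"
  using M.tm_cong[of A A' v] N.sm_cong[of B B' u] assms by (simp_all add: G1_def G2_def)

lemma G_sum_A:
  assumes "\<And>i. i \<in> S \<Longrightarrow> M.covec (A i)" "v \<in> M.C" "N.covec B" "u \<in> N.C"
  shows "G1 (\<lambda>w. \<Sum>i\<in>S. c i * A i w) v B u = (\<Sum>i\<in>S. c i * G1 (A i) v B u)"
    "G2 B u (\<lambda>w. \<Sum>i\<in>S. c i * A i w) v = (\<Sum>i\<in>S. c i * G2 B u (A i) v)"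
  using assms by (simp_all add: G1_def G2_def M.tm_sum_covec fmult_sum_left fmult_sum_right fmult_cmult_left
     fmult_cmult_right I_sum I_cmult T_cmult T_fmult tm_T sm_T)

lemma G_sum_B:
  assumes "\<And>i. i \<in> S \<Longrightarrow> N.covec (B i)" "u \<in> N.C" "M.covec A" "v \<in> M.C"
  shows "G1 A v (\<lambda>w. \<Sum>i\<in>S. c i * B i w) u = (\<Sum>i\<in>S. c i * G1 A v (B i) u)"
    "G2 (\<lambda>w. \<Sum>i\<in>S. c i * B i w) u A v = (\<Sum>i\<in>S. c i * G2 (B i) u A v)"
  using assms by (simp_all add: G1_def G2_def N.sm_sum_covec fmult_sum_left fmult_sum_right fmult_cmult_left
     fmult_cmult_right I_sum I_cmult T_cmult T_fmult tm_T sm_T)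

lemma G_cmult_B:
  assumes "N.covec B" "u \<in> N.C" "M.covec A" "v \<in> M.C"
  shows "G1 A v (\<lambda>w. c * B w) u = c * G1 A v B u" "G2 (\<lambda>w. c * B w) u A v = c * G2 B u A v"
  using G_sum_B[of "{()}" "\<lambda>_. B" u A v "\<lambda>_. c"] assms by simp_all

lemma G_vec:
  assumes "N.covec B" "M.covec A" "v \<in> M.C" "v' \<in> M.C" "u \<in> N.C" "u' \<in> N.C"
  shows "G1 A (v + v') B u = G1 A v B u + G1 A v' B u" "G2 B u A (v + v') = G2 B u A v + G2 B u A v'"
    "G1 A (sc c v) B u = c * G1 A v B u" "G2 B u A (sc c v) = c * G2 B u A v"
    "G1 A v B (u + u') = G1 A v B u + G1 A v B u'" "G2 B (u + u') A v = G2 B u A v + G2 B u' A v"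
    "G1 A v B (sc c u) = c * G1 A v B u" "G2 B (sc c u) A v = c * G2 B u A v"
  using assms by (simp_all add: G1_def G2_def M.tm_add_vec M.tm_sc_vec N.sm_add_vec N.sm_sc_vec
     fmult_add_left fmult_add_right fmult_cmult_left fmult_cmult_right I_add I_cmult T_fmult tm_T sm_T)

lemma G_expand_A:
  assumes "M.covec A" "v \<in> M.C" "N.covec B" "u \<in> N.C"
  shows "G1 A v B u = (\<Sum>b\<in>M.WB. A b * G1 (M.cf M.WB b) v B u)"
    "G2 B u A v = (\<Sum>b\<in>M.WB. A b * G2 B u (M.cf M.WB b) v)"
proof -
  have "A w = (\<Sum>b\<in>M.WB. A b * M.cf M.WB b w)" if "w \<in> M.C" for w
    using M.covec_expand[OF M.WB assms(1) that] by (simp add: mult.commute)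
  then have "G1 A v B u = G1 (\<lambda>w. \<Sum>b\<in>M.WB. A b * M.cf M.WB b w) v B u"
      "G2 B u A v = G2 B u (\<lambda>w. \<Sum>b\<in>M.WB. A b * M.cf M.WB b w) v"
    using assms by (intro G_cong; simp)+
  then show "G1 A v B u = (\<Sum>b\<in>M.WB. A b * G1 (M.cf M.WB b) v B u)"
    "G2 B u A v = (\<Sum>b\<in>M.WB. A b * G2 B u (M.cf M.WB b) v)"
    using assms M.cf_covec[OF M.WB] by (simp_all add: G_sum_A)
qed

lemma G_expand_B:
  assumes "M.covec A" "v \<in> M.C" "N.covec B" "u \<in> N.C"
  shows "G1 A v B u = (\<Sum>b\<in>N.WB. B b * G1 A v (N.cf N.WB b) u)"
    "G2 B u A v = (\<Sum>b\<in>N.WB. B b * G2 (N.cf N.WB b) u A v)"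
proof -
  have "B w = (\<Sum>b\<in>N.WB. B b * N.cf N.WB b w)" if "w \<in> N.C" for w
    using N.covec_expand[OF N.WB assms(3) that] by (simp add: mult.commute)
  then have "G1 A v B u = G1 A v (\<lambda>w. \<Sum>b\<in>N.WB. B b * N.cf N.WB b w) u"
      "G2 B u A v = G2 (\<lambda>w. \<Sum>b\<in>N.WB. B b * N.cf N.WB b w) u A v"
    using assms by (intro G_cong; simp)+
  then show "G1 A v B u = (\<Sum>b\<in>N.WB. B b * G1 A v (N.cf N.WB b) u)"
    "G2 B u A v = (\<Sum>b\<in>N.WB. B b * G2 (N.cf N.WB b) u A v)"
    using assms N.cf_covec[OF N.WB] by (simp_all add: G_sum_B)
qed

text \<open>Equal parities make the two signs cancel; different parities make the product odd and
  the integral zero.\<close>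

lemma sign_absorb:
  assumes "homogeneous_functional p f" "homogeneous_functional r g" "p < 2" "r < 2" "f \<in> T" "g \<in> T"
  shows "(-1) ^ (k * p) * (-1) ^ (k * r) * I (fmult f g) = I (fmult f g)"
proof (cases "p = r")
  case True
  then show ?thesis by (simp add: neg_one_power_sq)
next
  case False
  then have "(p + r) mod 2 = 1" using assms by (auto simp: less_2_cases_iff)
  then have "I (fmult f g) = 0"
    using homogeneous_fmult[OF assms(1,2)] I_odd[OF T_fmult[OF assms(5,6)]] by simp
  then show ?thesis by simp
qed

context
  fixes A v B u pa pv pb pu
  assumes A: "M.hcov pa A" "pa < 2" and v: "v \<in> part M pv" "pv < 2"
    and B: "N.hcov pb B" "pb < 2" and u: "u \<in> part N pu" "pu < 2"
begin

lemma Ac: "M.covec A" and vC [simp]: "v \<in> M.C" and Bc: "N.covec B" and uC [simp]: "u \<in> N.C"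
  using A v B u M.hcov_covec N.hcov_covec M.part_in_C N.part_in_C by blast+

lemma tmT: "M.tm A v \<in> T" "coproduct_decomposable T (M.tm A v)"
  using tm_T[OF Ac vC] M.tm_decomposable[OF tm_T A v(2,1)] by blast+

lemma smT: "N.sm B u \<in> T" "coproduct_decomposable T (N.sm B u)"
  using sm_T[OF Bc uC] N.sm_decomposable[OF sm_T T_cmult B u(2,1)] by blast+

lemma tw: "M.tm A v (wrd x) = A (M.act (wrd x) v)"
  by (simp add: M.tm_def)

lemma sw: "N.sm B u (wrd x) = B (N.sa x u)"
  by (rule N.sm_wrd[OF Bc uC])

lemma sw_append: "N.sm B u (wrd (x @ y)) = (-1) ^ (wpar x * wpar y) * B (N.sa y (N.sa x u))"
  by (simp add: sw N.sa_append N.covec_sc[OF Bc])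

lemma sw_Cons: "N.sm B u (wrd (X # y)) = (-1) ^ (gpar X * wpar y) * B (N.sa y (N.sa [X] u))"
  using sw_append[of "[X]" y] by simp

lemma tw_Cons: "M.tm A v (wrd (X # y)) = A (M.act (wrd [X]) (M.act (wrd y) v))"
  by (simp add: tw M.act_Cons[of v X y])

lemma tw_append: "M.tm A v (wrd (x @ y)) = A (M.act (wrd x) (M.act (wrd y) v))"
  by (simp add: tw M.act_append)

text \<open>Translating the product by \<open>X\<close> integrates to the counit of
  \<open>X\<close>, which is 0, and the coproduct of \<open>X\<close> splits the translate into two
  terms. In the names of these lemmas R and L give the side of the translation, 1 and 2 the order of
  the factors.\<close>

lemma raw_R1:
  assumes X: "is_EF X"
  shows "G1 A (M.act (wrd [X]) v) (\<lambda>w. B (N.sa (lgr X) w)) u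
    + G1 A (M.act (wrd (lgl X)) v) (\<lambda>w. B (N.sa [X] w)) u = 0"
proof -
  let ?k = "gpar X"
  let ?v1 = "M.act (wrd [X]) v" and ?v2 = "M.act (wrd (lgl X)) v"
  let ?B1 = "\<lambda>w. B (N.sa (lgr X) w)" and ?B2 = "\<lambda>w. B (N.sa [X] w)"
  let ?r2 = "((?k + pb) mod 2 + pu) mod 2" and ?p2 = "(pa + pv) mod 2"
  \<comment> \<open>The signs for \<open>X\<close> passing each of the two factors; under the
    integral they vanish by \<open>sign_absorb\<close>.\<close>
  define s :: complex where "s = (-1) ^ (?k * ?p2) * (-1) ^ (?k * ?r2)"
  have cov: "N.covec ?B1" "N.covec ?B2" by (intro N.covec_act Bc)+
  have hB2: "N.hcov ((?k + pb) mod 2) ?B2" using N.hcov_sa[OF B, of "[X]"] by simp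
  have hv2: "?v2 \<in> part M pv" by (rule M.lg_part(2)[OF v(2,1)])
  have "(\<lambda>x. fmult (M.tm A v) (N.sm B u) (x * wrd [X])) =
    (\<lambda>x. fmult (M.tm A ?v1) (N.sm ?B1 u) x + s * fmult (M.tm A ?v2) (N.sm ?B2 u) x)"
  proof (rule linear_functional_eqI)
    fix x
    have "fmult (M.tm A v) (N.sm B u) (wrd x * wrd [X]) =
      fm (\<lambda>a. A (M.act (wrd a) ?v1)) (\<lambda>b. ?B1 (N.sa b u)) x
      + fm (\<lambda>a. (-1) ^ (?k * wpar a) * A (M.act (wrd a) ?v2)) (\<lambda>b. (-1) ^ (?k * wpar b) * ?B2 (N.sa b u)) x"
      unfolding wrd_mult fmult_wrd fm_snoc_EF[OF X] tw_append sw_append by (simp add: mult.commute)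
    also have "fm (\<lambda>a. (-1) ^ (?k * wpar a) * A (M.act (wrd a) ?v2)) (\<lambda>b. (-1) ^ (?k * wpar b) * ?B2 (N.sa b u)) x
      = s * fm (\<lambda>a. A (M.act (wrd a) ?v2)) (\<lambda>b. ?B2 (N.sa b u)) x"
      using fm_twist_left[of ?p2 "\<lambda>a. A (M.act (wrd a) ?v2)" ?k]
        fm_twist_right[of ?r2 "\<lambda>b. ?B2 (N.sa b u)" _ ?k]
        M.act_odd[OF A v(2) hv2] N.sa_odd[OF hB2 _ u(2,1)] by (simp add: s_def)
    finally show "fmult (M.tm A v) (N.sm B u) (wrd x * wrd [X]) =
      fmult (M.tm A ?v1) (N.sm ?B1 u) (wrd x) + s * fmult (M.tm A ?v2) (N.sm ?B2 u) (wrd x)"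
      unfolding fmult_wrd N.sm_wrd[OF cov(1) uC] N.sm_wrd[OF cov(2) uC] M.tm_def .
  qed (intro linear_functional_right_translate linear_functional_add linear_functional_cmult fmult_linear)+
  then have "I (fmult (M.tm A ?v1) (N.sm ?B1 u)) + s * I (fmult (M.tm A ?v2) (N.sm ?B2 u)) = 0"
    using haar_product_invariance(1)[OF tmT smT, of "[X]"] counit_EF[OF X] tm_T[OF Ac] sm_T[OF cov(1) uC] sm_T[OF cov(2) uC]
    by (simp add: I_add I_cmult T_fmult T_cmult)
  moreover have "s * I (fmult (M.tm A ?v2) (N.sm ?B2 u)) = I (fmult (M.tm A ?v2) (N.sm ?B2 u))"
    unfolding s_def by (rule sign_absorb) (use M.tm_homogeneous[OF A v(2) hv2] N.sm_homogeneous[OF hB2 _ u(2,1)]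
      tm_T[OF Ac] sm_T[OF cov(2) uC] in auto)
  ultimately show ?thesis by (simp only: G1_def)
qed

lemma raw_L1:
  assumes X: "is_EF X"
  shows "G1 (\<lambda>w. A (M.act (wrd [X]) w)) v B (N.sa (lgr X) u)
    + (-1) ^ gpar X * G1 (\<lambda>w. A (M.act (wrd (lgl X)) w)) v B (N.sa [X] u) = 0"
proof -
  let ?k = "gpar X"
  let ?u1 = "N.sa (lgr X) u" and ?u2 = "N.sa [X] u"
  let ?A1 = "\<lambda>w. A (M.act (wrd [X]) w)" and ?A2 = "\<lambda>w. A (M.act (wrd (lgl X)) w)"
  let ?r1 = "(pb + pu) mod 2" and ?r2 = "(pb + (?k + pu) mod 2) mod 2"
  define s1 :: complex where "s1 = (-1) ^ (?k * ?r1)"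
  define s2 :: complex where "s2 = (-1) ^ (?k * ?r2)"
  have cov: "M.covec ?A1" "M.covec ?A2" by (intro M.covec_act Ac)+
  have hu: "?u1 \<in> part N pu" "?u2 \<in> part N ((?k + pu) mod 2)"
    using N.lg_part(3)[OF u(2,1)] N.sa_gen_part[OF u(2,1)] by blast+
  have "(\<lambda>x. fmult (M.tm A v) (N.sm B u) (wrd [X] * x)) =
    (\<lambda>x. s1 * fmult (M.tm ?A1 v) (N.sm B ?u1) x + s2 * fmult (M.tm ?A2 v) (N.sm B ?u2) x)"
  proof (rule linear_functional_eqI)
    fix x
    have "fmult (M.tm A v) (N.sm B u) (wrd [X] * wrd x) =
      fm (\<lambda>a. ?A1 (M.act (wrd a) v)) (\<lambda>b. (-1) ^ (?k * wpar b) * B (N.sa b ?u1)) x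
      + fm (\<lambda>a. ?A2 (M.act (wrd a) v)) (\<lambda>b. (-1) ^ (?k * wpar b) * B (N.sa b ?u2)) x"
      unfolding wrd_mult fmult_wrd append_Cons append_Nil fm_Cons_EF[OF X] tw_append tw_Cons sw_append sw_Cons by simp
    also have "\<dots> = s1 * fm (\<lambda>a. ?A1 (M.act (wrd a) v)) (\<lambda>b. B (N.sa b ?u1)) x
      + s2 * fm (\<lambda>a. ?A2 (M.act (wrd a) v)) (\<lambda>b. B (N.sa b ?u2)) x"
      using fm_twist_right[of ?r1 "\<lambda>b. B (N.sa b ?u1)" _ ?k] fm_twist_right[of ?r2 "\<lambda>b. B (N.sa b ?u2)" _ ?k]
        N.sa_odd[OF B u(2) hu(1)] N.sa_odd[OF B _ hu(2)] by (simp add: s1_def s2_def)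
    finally show "fmult (M.tm A v) (N.sm B u) (wrd [X] * wrd x) =
      s1 * fmult (M.tm ?A1 v) (N.sm B ?u1) (wrd x) + s2 * fmult (M.tm ?A2 v) (N.sm B ?u2) (wrd x)"
      unfolding fmult_wrd using uC by (simp only: N.sm_wrd[OF Bc] N.act_C M.tm_def)
  qed (intro linear_functional_left_translate linear_functional_add linear_functional_cmult fmult_linear)+
  then have "s1 * I (fmult (M.tm ?A1 v) (N.sm B ?u1)) + s2 * I (fmult (M.tm ?A2 v) (N.sm B ?u2)) = 0"
    using haar_product_invariance(2)[OF tmT smT, of "[X]"] counit_EF[OF X] tm_T[OF cov(1) vC] tm_T[OF cov(2) vC] sm_T[OF Bc]
    by (simp add: I_add I_cmult T_fmult T_cmult)
  then have "s1 * (s1 * I (fmult (M.tm ?A1 v) (N.sm B ?u1)) + s2 * I (fmult (M.tm ?A2 v) (N.sm B ?u2))) = 0"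
    by simp
  moreover have "s1 * s1 = 1" by (simp add: s1_def neg_one_power_sq)
  \<comment> \<open>The vectors \<open>u\<close> and \<open>N.sa [X] u\<close> differ in parity by
    that of \<open>X\<close>, which is all that remains of the two signs.\<close>
  moreover have "s1 * s2 = (-1) ^ ?k"
    using gpar_cases[of X] B(2) u(2) unfolding s1_def s2_def by (auto simp: less_2_cases_iff)
  ultimately show ?thesis
    by (simp add: G1_def distrib_left flip: mult.assoc)
qed

lemma raw_R2:
  assumes X: "is_EF X"
  shows "(-1) ^ gpar X * G2 (\<lambda>w. B (N.sa [X] w)) u A (M.act (wrd (lgr X)) v)
    + G2 (\<lambda>w. B (N.sa (lgl X) w)) u A (M.act (wrd [X]) v) = 0"
proof -
  let ?k = "gpar X"
  let ?v1 = "M.act (wrd (lgr X)) v" and ?v2 = "M.act (wrd [X]) v"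
  let ?B1 = "\<lambda>w. B (N.sa [X] w)" and ?B2 = "\<lambda>w. B (N.sa (lgl X) w)"
  let ?r1 = "((?k + pb) mod 2 + pu) mod 2" and ?r2 = "(pb + pu) mod 2"
  define s1 :: complex where "s1 = (-1) ^ (?k * ?r1)"
  define s2 :: complex where "s2 = (-1) ^ (?k * ?r2)"
  have cov: "N.covec ?B1" "N.covec ?B2" by (intro N.covec_act Bc)+
  have hB: "N.hcov ((?k + pb) mod 2) ?B1" "N.hcov pb ?B2"
    using N.hcov_sa[OF B, of "[X]"] N.lg_hcov(4)[OF B(2,1)] by simp_all
  have "(\<lambda>x. fmult (N.sm B u) (M.tm A v) (x * wrd [X])) =
    (\<lambda>x. s1 * fmult (N.sm ?B1 u) (M.tm A ?v1) x + s2 * fmult (N.sm ?B2 u) (M.tm A ?v2) x)"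
  proof (rule linear_functional_eqI)
    fix x
    have "fmult (N.sm B u) (M.tm A v) (wrd x * wrd [X]) =
      fm (\<lambda>a. (-1) ^ (?k * wpar a) * ?B1 (N.sa a u)) (\<lambda>b. A (M.act (wrd b) ?v1)) x
      + fm (\<lambda>a. (-1) ^ (?k * wpar a) * ?B2 (N.sa a u)) (\<lambda>b. A (M.act (wrd b) ?v2)) x"
      unfolding wrd_mult fmult_wrd fm_snoc_EF[OF X] tw_append sw_append by (simp add: mult.commute)
    also have "\<dots> = s1 * fm (\<lambda>a. ?B1 (N.sa a u)) (\<lambda>b. A (M.act (wrd b) ?v1)) x
      + s2 * fm (\<lambda>a. ?B2 (N.sa a u)) (\<lambda>b. A (M.act (wrd b) ?v2)) x"
      using fm_twist_left[of ?r1 "\<lambda>b. ?B1 (N.sa b u)" ?k] fm_twist_left[of ?r2 "\<lambda>b. ?B2 (N.sa b u)" ?k]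
        N.sa_odd[OF hB(1) _ u(2,1)] N.sa_odd[OF hB(2) B(2) u(2,1)] by (simp add: s1_def s2_def)
    finally show "fmult (N.sm B u) (M.tm A v) (wrd x * wrd [X]) =
      s1 * fmult (N.sm ?B1 u) (M.tm A ?v1) (wrd x) + s2 * fmult (N.sm ?B2 u) (M.tm A ?v2) (wrd x)"
      unfolding fmult_wrd N.sm_wrd[OF cov(1) uC] N.sm_wrd[OF cov(2) uC] M.tm_def .
  qed (intro linear_functional_right_translate linear_functional_add linear_functional_cmult fmult_linear)+
  then have "s1 * I (fmult (N.sm ?B1 u) (M.tm A ?v1)) + s2 * I (fmult (N.sm ?B2 u) (M.tm A ?v2)) = 0"
    using haar_product_invariance(1)[OF smT tmT, of "[X]"] counit_EF[OF X] tm_T[OF Ac] sm_T[OF cov(1) uC] sm_T[OF cov(2) uC]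
    by (simp add: I_add I_cmult T_fmult T_cmult)
  then have "s2 * (s1 * I (fmult (N.sm ?B1 u) (M.tm A ?v1)) + s2 * I (fmult (N.sm ?B2 u) (M.tm A ?v2))) = 0"
    by simp
  moreover have "s2 * s2 = 1" by (simp add: s2_def neg_one_power_sq)
  moreover have "s2 * s1 = (-1) ^ ?k"
    using gpar_cases[of X] B(2) u(2) unfolding s1_def s2_def by (auto simp: less_2_cases_iff)
  ultimately show ?thesis
    by (simp add: G2_def distrib_left flip: mult.assoc)
qed

lemma raw_L2:
  assumes X: "is_EF X"
  shows "G2 B (N.sa [X] u) (\<lambda>w. A (M.act (wrd (lgr X)) w)) v
    + G2 B (N.sa (lgl X) u) (\<lambda>w. A (M.act (wrd [X]) w)) v = 0"
proof -
  let ?k = "gpar X"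
  let ?u1 = "N.sa [X] u" and ?u2 = "N.sa (lgl X) u"
  let ?A1 = "\<lambda>w. A (M.act (wrd (lgr X)) w)" and ?A2 = "\<lambda>w. A (M.act (wrd [X]) w)"
  let ?r1 = "(pb + (?k + pu) mod 2) mod 2" and ?p1 = "(pa + pv) mod 2"
  define s :: complex where "s = (-1) ^ (?k * ?r1) * (-1) ^ (?k * ?p1)"
  have cov: "M.covec ?A1" "M.covec ?A2" by (intro M.covec_act Ac)+
  have hA: "M.hcov pa ?A1" by (rule M.lg_hcov(1)[OF A(2,1)])
  have hu: "?u1 \<in> part N ((?k + pu) mod 2)"
    using N.sa_gen_part[OF u(2,1)] by blast
  have "(\<lambda>x. fmult (N.sm B u) (M.tm A v) (wrd [X] * x)) =
    (\<lambda>x. s * fmult (N.sm B ?u1) (M.tm ?A1 v) x + fmult (N.sm B ?u2) (M.tm ?A2 v) x)"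
  proof (rule linear_functional_eqI)
    fix x
    have "fmult (N.sm B u) (M.tm A v) (wrd [X] * wrd x) =
      fm (\<lambda>a. (-1) ^ (?k * wpar a) * B (N.sa a ?u1)) (\<lambda>b. (-1) ^ (?k * wpar b) * ?A1 (M.act (wrd b) v)) x
      + fm (\<lambda>a. B (N.sa a ?u2)) (\<lambda>b. ?A2 (M.act (wrd b) v)) x"
      unfolding wrd_mult fmult_wrd append_Cons append_Nil fm_Cons_EF[OF X] tw_append tw_Cons sw_append sw_Cons by simp
    also have "fm (\<lambda>a. (-1) ^ (?k * wpar a) * B (N.sa a ?u1)) (\<lambda>b. (-1) ^ (?k * wpar b) * ?A1 (M.act (wrd b) v)) x
      = s * fm (\<lambda>a. B (N.sa a ?u1)) (\<lambda>b. ?A1 (M.act (wrd b) v)) x"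
      using fm_twist_left[of ?r1 "\<lambda>b. B (N.sa b ?u1)" ?k] fm_twist_right[of ?p1 "\<lambda>b. ?A1 (M.act (wrd b) v)" _ ?k]
        N.sa_odd[OF B _ hu] M.act_odd[OF hA A(2) v(2,1)] by (simp add: s_def)
    finally show "fmult (N.sm B u) (M.tm A v) (wrd [X] * wrd x) =
      s * fmult (N.sm B ?u1) (M.tm ?A1 v) (wrd x) + fmult (N.sm B ?u2) (M.tm ?A2 v) (wrd x)"
      unfolding fmult_wrd using uC by (simp only: N.sm_wrd[OF Bc] N.act_C M.tm_def)
  qed (intro linear_functional_left_translate linear_functional_add linear_functional_cmult fmult_linear)+
  then have "s * I (fmult (N.sm B ?u1) (M.tm ?A1 v)) + I (fmult (N.sm B ?u2) (M.tm ?A2 v)) = 0"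
    using haar_product_invariance(2)[OF smT tmT, of "[X]"] counit_EF[OF X] tm_T[OF cov(1) vC] tm_T[OF cov(2) vC] sm_T[OF Bc]
    by (simp add: I_add I_cmult T_fmult T_cmult)
  moreover have "s * I (fmult (N.sm B ?u1) (M.tm ?A1 v)) = I (fmult (N.sm B ?u1) (M.tm ?A1 v))"
    unfolding s_def by (rule sign_absorb) (use M.tm_homogeneous[OF hA A(2) v(2,1)] N.sm_homogeneous[OF B _ hu]
      tm_T[OF cov(1) vC] sm_T[OF Bc] in auto)
  ultimately show ?thesis by (simp only: G2_def)
qed

lemma raw_K:
  assumes g: "\<not> is_EF g"
  shows "G1 A (M.act (wrd [g]) v) (\<lambda>w. B (N.sa [g] w)) u = G1 A v B u" (is ?R1)
    "G1 (\<lambda>w. A (M.act (wrd [g]) w)) v B (N.sa [g] u) = G1 A v B u" (is ?L1)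
    "G2 (\<lambda>w. B (N.sa [g] w)) u A (M.act (wrd [g]) v) = G2 B u A v" (is ?R2)
    "G2 B (N.sa [g] u) (\<lambda>w. A (M.act (wrd [g]) w)) v = G2 B u A v" (is ?L2)
proof -
  have gp: "gpar g = 0" by (rule gpar_not_EF[OF g])
  have cov: "N.covec (\<lambda>w. B (N.sa [g] w))" "M.covec (\<lambda>w. A (M.act (wrd [g]) w))"
    by (intro N.covec_act Bc M.covec_act Ac)+
  have "(\<lambda>x. fmult (M.tm A v) (N.sm B u) (x * wrd [g])) =
      fmult (M.tm A (M.act (wrd [g]) v)) (N.sm (\<lambda>w. B (N.sa [g] w)) u)"
    by (rule linear_functional_eqI)
       (simp_all add: linear_functional_right_translate fmult_linear wrd_mult fmult_wrd fm_snoc_K[OF g] tw_append sw_append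
          gp N.sm_wrd[OF cov(1) uC] M.tm_def M.act_append del: antipode_word.simps)
  then show ?R1
    using haar_product_invariance(1)[OF tmT smT, of "[g]"] counit_not_EF[OF g] by (simp add: G1_def)
  have "(\<lambda>x. fmult (N.sm B u) (M.tm A v) (x * wrd [g])) =
      fmult (N.sm (\<lambda>w. B (N.sa [g] w)) u) (M.tm A (M.act (wrd [g]) v))"
    by (rule linear_functional_eqI)
       (simp_all add: linear_functional_right_translate fmult_linear wrd_mult fmult_wrd fm_snoc_K[OF g] tw_append sw_append
          gp N.sm_wrd[OF cov(1) uC] M.tm_def M.act_append del: antipode_word.simps)
  then show ?R2
    using haar_product_invariance(1)[OF smT tmT, of "[g]"] counit_not_EF[OF g] by (simp add: G2_def)
  have "(\<lambda>x. fmult (M.tm A v) (N.sm B u) (wrd [g] * x)) =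
      fmult (M.tm (\<lambda>w. A (M.act (wrd [g]) w)) v) (N.sm B (N.sa [g] u))"
  proof (rule linear_functional_eqI)
    fix x
    show "fmult (M.tm A v) (N.sm B u) (wrd [g] * wrd x) = fmult (M.tm (\<lambda>w. A (M.act (wrd [g]) w)) v) (N.sm B (N.sa [g] u)) (wrd x)"
      unfolding wrd_mult append_Cons append_Nil fmult_wrd fm_Cons_K[OF g] tw_Cons sw_Cons
      using uC by (simp add: gp N.sm_wrd[OF Bc] M.tm_def del: antipode_word.simps)
  qed (simp_all add: linear_functional_left_translate fmult_linear)
  then show ?L1
    using haar_product_invariance(2)[OF tmT smT, of "[g]"] counit_not_EF[OF g] by (simp add: G1_def)
  have "(\<lambda>x. fmult (N.sm B u) (M.tm A v) (wrd [g] * x)) =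
      fmult (N.sm B (N.sa [g] u)) (M.tm (\<lambda>w. A (M.act (wrd [g]) w)) v)"
  proof (rule linear_functional_eqI)
    fix x
    show "fmult (N.sm B u) (M.tm A v) (wrd [g] * wrd x) = fmult (N.sm B (N.sa [g] u)) (M.tm (\<lambda>w. A (M.act (wrd [g]) w)) v) (wrd x)"
      unfolding wrd_mult append_Cons append_Nil fmult_wrd fm_Cons_K[OF g] tw_Cons sw_Cons
      using uC by (simp add: gp N.sm_wrd[OF Bc] M.tm_def del: antipode_word.simps)
  qed (simp_all add: linear_functional_left_translate fmult_linear)
  then show ?L2
    using haar_product_invariance(2)[OF smT tmT, of "[g]"] counit_not_EF[OF g] by (simp add: G2_def)
qed

lemma raw_lg:
  assumes w: "a = lgr X \<or> a = lgl X"
  shows "G1 A (M.act (wrd a) v) (\<lambda>w. B (N.sa a w)) u = G1 A v B u"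
    "G1 (\<lambda>w. A (M.act (wrd a) w)) v B (N.sa a u) = G1 A v B u"
    "G2 (\<lambda>w. B (N.sa a w)) u A (M.act (wrd a) v) = G2 B u A v"
    "G2 B (N.sa a u) (\<lambda>w. A (M.act (wrd a) w)) v = G2 B u A v"
proof -
  consider "a = []" | g where "a = [g]" "\<not> is_EF g"
    using w by (cases X) auto
  note c = this
  show "G1 A (M.act (wrd a) v) (\<lambda>w. B (N.sa a w)) u = G1 A v B u"
    using c by cases (auto simp: M.act_Nil N.act_1 raw_K simp del: antipode_word.simps(2) intro!: G_cong)
  show "G1 (\<lambda>w. A (M.act (wrd a) w)) v B (N.sa a u) = G1 A v B u"
    using c by cases (auto simp: M.act_Nil N.act_1 raw_K simp del: antipode_word.simps(2) intro!: G_cong)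
  show "G2 (\<lambda>w. B (N.sa a w)) u A (M.act (wrd a) v) = G2 B u A v"
    using c by cases (auto simp: M.act_Nil N.act_1 raw_K simp del: antipode_word.simps(2) intro!: G_cong)
  show "G2 B (N.sa a u) (\<lambda>w. A (M.act (wrd a) w)) v = G2 B u A v"
    using c by cases (auto simp: M.act_Nil N.act_1 raw_K simp del: antipode_word.simps(2) intro!: G_cong)
qed

end

end

section \<open>Invariant pairings of irreducible modules\<close>

text \<open>The eigenvalues of S^2 on the generators, equally those of conjugation by K_{2
  rho}.\<close>

fun qgen :: "complex \<Rightarrow> 'n::{finite,linorder} gen \<Rightarrow> complex" where
  "qgen q (EGen i) = qpow q (simple_root i \<bullet> simple_root i)"
| "qgen q (FGen i) = qpow q (- (simple_root i \<bullet> simple_root i))"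
| "qgen q _ = 1"

lemma qgen_XG: "qgen q (XG o' i) = qpow q (osg o' * (simple_root i \<bullet> simple_root i))"
  by (cases o') simp_all

lemma EF_cases: "is_EF X \<Longrightarrow> \<exists>o' i. X = XG o' i"
  by (cases X) (metis XG.simps is_EF.simps)+

context haar_pair
begin

context
  fixes A v B u pa pv pb pu
  assumes A: "M.hcov pa A" "pa < 2" and v: "v \<in> part M pv" "pv < 2"
    and B: "N.hcov pb B" "pb < 2" and u: "u \<in> part N pu" "pu < 2"
begin

lemma G_neg_B:
  assumes "N.covec B'"
  shows "v' \<in> M.C \<Longrightarrow> G1 A v' (\<lambda>w. - B' w) u = - G1 A v' B' u"
    "v' \<in> M.C \<Longrightarrow> G2 (\<lambda>w. - B' w) u A v' = - G2 B' u A v'"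
  using G_cmult_B[OF assms(1) uC[OF A v B u] Ac[OF A v B u], of v' "-1"] by simp_all

text \<open>\<open>raw_R1\<close> is applied to \<open>B\<close> composed with \<open>lgr X\<close>,
  so that S(lgr X) cancels in the first term. In the second, moving \<open>lgl X\<close> across
  completes S^2(X) on the side of \<open>B\<close>, whence the power of q.\<close>

lemma G1_right:
  assumes X: "is_EF X"
  shows "G1 A (M.act (wrd [X]) v) B u = qgen q X * G1 A v (\<lambda>w. B (N.act (wrd [X]) w)) u"
proof -
  note C = vC[OF A v B u] uC[OF A v B u] Ac[OF A v B u] Bc[OF A v B u]
  obtain o' i where oi: "X = XG o' i" using EF_cases[OF X] by blast
  let ?B1 = "\<lambda>w. B (N.act (wrd (lgr X)) w)"
  let ?B2 = "\<lambda>w. B (N.act (wrd (lgr X)) (N.sa (lgl X) (N.act (wrd [X]) (N.sa (lgr X) w))))"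
  let ?B3 = "\<lambda>w. ?B2 (N.act (wrd (lgl X)) w)"
  have h1: "N.hcov pb ?B1" by (rule N.lg_hcov(1)[OF B(2,1)])
  have "N.hcov ((gpar X + pb) mod 2) (\<lambda>w. B (N.act (wrd (lgr X)) (N.sa (lgl X) (N.act (wrd [X]) w))))"
    using N.hcov_act[OF N.lg_hcov(4)[OF B(2) h1] B(2), of "[X]"] by simp
  from N.lg_hcov(3)[OF _ this] have h2: "N.hcov ((gpar X + pb) mod 2) ?B2" by simp
  from N.lg_hcov(2)[OF _ h2] have h3: "N.hcov ((gpar X + pb) mod 2) ?B3" by simp
  have "G1 A (M.act (wrd [X]) v) (\<lambda>w. ?B1 (N.sa (lgr X) w)) u
      + G1 A (M.act (wrd (lgl X)) v) (\<lambda>w. ?B1 (N.sa [X] w)) u = 0"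
    by (rule raw_R1[OF A v h1 B(2) u X])
  moreover have "G1 A (M.act (wrd [X]) v) (\<lambda>w. ?B1 (N.sa (lgr X) w)) u = G1 A (M.act (wrd [X]) v) B u"
    by (rule G_cong) (use C in \<open>simp_all add: N.lg_inverse\<close>)
  moreover have "G1 A (M.act (wrd (lgl X)) v) (\<lambda>w. ?B1 (N.sa [X] w)) u
      = G1 A (M.act (wrd (lgl X)) v) (\<lambda>w. - ?B2 w) u"
    by (rule G_cong) (use C X in \<open>simp_all add: N.sa_EF N.act_uminus_vec N.covec_uminus del: antipode_word.simps\<close>)
  moreover have "\<dots> = - G1 A (M.act (wrd (lgl X)) v) ?B2 u"
    by (rule G_neg_B) (use C h2 N.hcov_covec in auto)
  moreover have "G1 A (M.act (wrd (lgl X)) v) ?B2 u = G1 A (M.act (wrd (lgl X)) v) (\<lambda>w. ?B3 (N.sa (lgl X) w)) u"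
    by (rule G_cong) (use C in \<open>simp_all add: N.lg_inverse\<close>)
  moreover have "\<dots> = G1 A v ?B3 u"
    by (rule raw_lg(1)[OF A v h3 _ u]) auto
  moreover have "\<dots> = G1 A v (\<lambda>w. qgen q X * B (N.act (wrd [X]) w)) u"
    by (rule G_cong) (use C in \<open>simp_all add: oi N.lg_conjugate N.covec_sc qgen_XG\<close>)
  moreover have "\<dots> = qgen q X * G1 A v (\<lambda>w. B (N.act (wrd [X]) w)) u"
    using C by (intro G_cmult_B N.covec_act) auto
  ultimately show ?thesis by simp
qed

lemma G1_left:
  assumes X: "is_EF X"
  shows "G1 (\<lambda>w. A (M.act (wrd [X]) w)) v B u = (-1) ^ gpar X * G1 A v B (N.act (wrd [X]) u)"
proof -
  note C = vC[OF A v B u] uC[OF A v B u] Ac[OF A v B u] Bc[OF A v B u]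
  let ?u1 = "N.act (wrd (lgr X)) u"
  have p1: "?u1 \<in> part N pu" by (rule N.lg_part(1)[OF u(2,1)])
  have pX: "N.act (wrd [X]) u \<in> part N ((gpar X + pu) mod 2)"
    by (rule N.act_gen_part[OF u(2,1)])
  have "G1 (\<lambda>w. A (M.act (wrd [X]) w)) v B (N.sa (lgr X) ?u1)
    + (-1) ^ gpar X * G1 (\<lambda>w. A (M.act (wrd (lgl X)) w)) v B (N.sa [X] ?u1) = 0"
    by (rule raw_L1[OF A v B p1 u(2) X])
  moreover have "N.sa (lgr X) ?u1 = u" using C by (simp add: N.lg_inverse)
  moreover have "N.sa [X] ?u1 = sc (-1) (N.sa (lgl X) (N.act (wrd [X]) u))"
    using C X by (simp add: N.sa_EF N.lg_inverse del: antipode_word.simps)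
  moreover have "G1 (\<lambda>w. A (M.act (wrd (lgl X)) w)) v B (sc (-1) (N.sa (lgl X) (N.act (wrd [X]) u)))
    = - G1 (\<lambda>w. A (M.act (wrd (lgl X)) w)) v B (N.sa (lgl X) (N.act (wrd [X]) u))"
    using C G_vec(7)[OF C(4) M.covec_act[OF C(3)] C(1) C(1), where u = "N.sa (lgl X) (N.act (wrd [X]) u)" and c = "-1"] by simp
  moreover have "G1 (\<lambda>w. A (M.act (wrd (lgl X)) w)) v B (N.sa (lgl X) (N.act (wrd [X]) u))
    = G1 A v B (N.act (wrd [X]) u)"
    by (rule raw_lg(2)[OF A v B pX]) auto
  ultimately show ?thesis by simp
qed

text \<open>With the factors in this order \<open>B\<close> is composed with \<open>lgl X\<close>;
  everything cancels without producing S^2, and only the sign of \<open>raw_R2\<close>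
  stays.\<close>

lemma G2_right:
  assumes X: "is_EF X"
  shows "G2 B u A (M.act (wrd [X]) v) = (-1) ^ gpar X * G2 (\<lambda>w. B (N.act (wrd [X]) w)) u A v"
proof -
  note C = vC[OF A v B u] uC[OF A v B u] Ac[OF A v B u] Bc[OF A v B u]
  let ?B1 = "\<lambda>w. B (N.act (wrd (lgl X)) w)"
  let ?BX = "\<lambda>w. B (N.act (wrd [X]) w)"
  let ?B2 = "\<lambda>w. ?BX (N.sa (lgr X) w)"
  have h1: "N.hcov pb ?B1" by (rule N.lg_hcov(2)[OF B(2,1)])
  have hX: "N.hcov ((gpar X + pb) mod 2) ?BX"
    using N.hcov_act[OF B, of "[X]"] by simp
  from N.lg_hcov(3)[OF _ this] have h2: "N.hcov ((gpar X + pb) mod 2) ?B2" by simp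
  have "(-1) ^ gpar X * G2 (\<lambda>w. ?B1 (N.sa [X] w)) u A (M.act (wrd (lgr X)) v)
      + G2 (\<lambda>w. ?B1 (N.sa (lgl X) w)) u A (M.act (wrd [X]) v) = 0"
    by (rule raw_R2[OF A v h1 B(2) u X])
  moreover have "G2 (\<lambda>w. ?B1 (N.sa (lgl X) w)) u A (M.act (wrd [X]) v) = G2 B u A (M.act (wrd [X]) v)"
    by (rule G_cong) (use C in \<open>simp_all add: N.lg_inverse\<close>)
  moreover have "G2 (\<lambda>w. ?B1 (N.sa [X] w)) u A (M.act (wrd (lgr X)) v)
      = G2 (\<lambda>w. - ?B2 w) u A (M.act (wrd (lgr X)) v)"
    by (rule G_cong) (use C X in \<open>simp_all add: N.sa_EF N.act_uminus_vec N.covec_uminus N.lg_inverse del: antipode_word.simps\<close>)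
  moreover have "\<dots> = - G2 ?B2 u A (M.act (wrd (lgr X)) v)"
    by (rule G_neg_B) (use C h2 N.hcov_covec in auto)
  moreover have "G2 ?B2 u A (M.act (wrd (lgr X)) v) = G2 ?BX u A v"
    by (rule raw_lg(3)[OF A v hX _ u]) auto
  ultimately show ?thesis by simp
qed

lemma G2_left:
  assumes X: "is_EF X"
  shows "G2 B u (\<lambda>w. A (M.act (wrd [X]) w)) v = qgen q X * G2 B (N.act (wrd [X]) u) A v"
proof -
  note C = vC[OF A v B u] uC[OF A v B u] Ac[OF A v B u] Bc[OF A v B u]
  obtain o' i where oi: "X = XG o' i" using EF_cases[OF X] by blast
  let ?u1 = "N.act (wrd (lgl X)) u"
  let ?y = "N.sa (lgl X) (N.act (wrd [X]) (N.sa (lgr X) ?u1))"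
  let ?z = "N.act (wrd (lgr X)) ?y"
  have p1: "?u1 \<in> part N pu" by (rule N.lg_part(2)[OF u(2,1)])
  have "N.act (wrd [X]) (N.sa (lgr X) ?u1) \<in> part N ((gpar X + pu) mod 2)"
    by (rule N.act_gen_part[OF u(2) N.lg_part(3)[OF u(2) p1]])
  from N.lg_part(1)[OF _ N.lg_part(4)[OF _ this]]
  have pz: "?z \<in> part N ((gpar X + pu) mod 2)" by simp
  have "G2 B (N.sa [X] ?u1) (\<lambda>w. A (M.act (wrd (lgr X)) w)) v
    + G2 B (N.sa (lgl X) ?u1) (\<lambda>w. A (M.act (wrd [X]) w)) v = 0"
    by (rule raw_L2[OF A v B p1 u(2) X])
  moreover have "N.sa (lgl X) ?u1 = u" using C by (simp add: N.lg_inverse)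
  moreover have "N.sa [X] ?u1 = sc (-1) (N.sa (lgr X) ?z)"
    using C X by (simp add: N.sa_EF N.lg_inverse del: antipode_word.simps)
  moreover have "G2 B (sc (-1) (N.sa (lgr X) ?z)) (\<lambda>w. A (M.act (wrd (lgr X)) w)) v
    = - G2 B (N.sa (lgr X) ?z) (\<lambda>w. A (M.act (wrd (lgr X)) w)) v"
    using C G_vec(8)[OF C(4) M.covec_act[OF C(3)] C(1) C(1), where u = "N.sa (lgr X) ?z" and c = "-1"] by simp
  moreover have "G2 B (N.sa (lgr X) ?z) (\<lambda>w. A (M.act (wrd (lgr X)) w)) v = G2 B ?z A v"
    by (rule raw_lg(4)[OF A v B pz]) auto
  moreover have "?z = sc (qgen q X) (N.act (wrd [X]) u)"
    using C by (simp add: oi N.lg_conjugate qgen_XG)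
  moreover have "G2 B (sc (qgen q X) (N.act (wrd [X]) u)) A v = qgen q X * G2 B (N.act (wrd [X]) u) A v"
    using C G_vec(8)[OF C(4,3,1,1), of "N.act (wrd [X]) u"] by simp
  ultimately show ?thesis by simp
qed

lemma G_K:
  assumes g: "\<not> is_EF g"
  shows "G1 A (M.act (wrd [g]) v) B u = G1 A v (\<lambda>w. B (N.act (wrd [g]) w)) u"
    "G1 (\<lambda>w. A (M.act (wrd [g]) w)) v B u = G1 A v B (N.act (wrd [g]) u)"
    "G2 B u A (M.act (wrd [g]) v) = G2 (\<lambda>w. B (N.act (wrd [g]) w)) u A v"
    "G2 B u (\<lambda>w. A (M.act (wrd [g]) w)) v = G2 B (N.act (wrd [g]) u) A v"
proof -
  note C = vC[OF A v B u] uC[OF A v B u] Ac[OF A v B u] Bc[OF A v B u]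
  have inv: "N.act (wrd [g]) (N.sa [g] w) = w" "N.sa [g] (N.act (wrd [g]) w) = w" if "w \<in> N.C" for w
    using g that by (cases g; simp add: scl_1 N.act_K_KI N.act_KI_K)+
  have hB: "N.hcov pb (\<lambda>w. B (N.act (wrd [g]) w))"
    using N.hcov_act[OF B, of "[g]"] B by (simp add: gpar_not_EF[OF g])
  have pu': "N.act (wrd [g]) u \<in> part N pu"
    using N.act_gen_part[OF u(2,1), of g] u by (simp add: gpar_not_EF[OF g])
  have "G1 A (M.act (wrd [g]) v) B u = G1 A (M.act (wrd [g]) v) (\<lambda>w. B (N.act (wrd [g]) (N.sa [g] w))) u"
    by (rule G_cong) (use C inv in \<open>simp_all del: antipode_word.simps\<close>)
  also have "\<dots> = G1 A v (\<lambda>w. B (N.act (wrd [g]) w)) u" by (rule raw_K(1)[OF A v hB B(2) u g])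
  finally show "G1 A (M.act (wrd [g]) v) B u = G1 A v (\<lambda>w. B (N.act (wrd [g]) w)) u" .
  have "G2 B u A (M.act (wrd [g]) v) = G2 (\<lambda>w. B (N.act (wrd [g]) (N.sa [g] w))) u A (M.act (wrd [g]) v)"
    by (rule G_cong) (use C inv in \<open>simp_all del: antipode_word.simps\<close>)
  also have "\<dots> = G2 (\<lambda>w. B (N.act (wrd [g]) w)) u A v" by (rule raw_K(3)[OF A v hB B(2) u g])
  finally show "G2 B u A (M.act (wrd [g]) v) = G2 (\<lambda>w. B (N.act (wrd [g]) w)) u A v" .
  show "G1 (\<lambda>w. A (M.act (wrd [g]) w)) v B u = G1 A v B (N.act (wrd [g]) u)"
    using raw_K(2)[OF A v B pu' u(2) g] inv(2)[OF C(2)] by (simp del: antipode_word.simps)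
  show "G2 B u (\<lambda>w. A (M.act (wrd [g]) w)) v = G2 B (N.act (wrd [g]) u) A v"
    using raw_K(4)[OF A v B pu' u(2) g] inv(2)[OF C(2)] by (simp del: antipode_word.simps)
qed

text \<open>The four invariance laws. The eigenvalue of S^2 enters for (v, B) in \<open>G1\<close>
  and for (A, u) in \<open>G2\<close>; the other two pairs carry the parity sign instead.\<close>

lemma G_gen:
  shows "G1 A (M.act (wrd [g]) v) B u = qgen q g * G1 A v (\<lambda>w. B (N.act (wrd [g]) w)) u"
    "G1 (\<lambda>w. A (M.act (wrd [g]) w)) v B u = (-1) ^ gpar g * G1 A v B (N.act (wrd [g]) u)"
    "G2 B u A (M.act (wrd [g]) v) = (-1) ^ gpar g * G2 (\<lambda>w. B (N.act (wrd [g]) w)) u A v"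
    "G2 B u (\<lambda>w. A (M.act (wrd [g]) w)) v = qgen q g * G2 B (N.act (wrd [g]) u) A v"
proof -
  have "qgen q g = 1" if "\<not> is_EF g" using that by (cases g) auto
  then show "G1 A (M.act (wrd [g]) v) B u = qgen q g * G1 A v (\<lambda>w. B (N.act (wrd [g]) w)) u"
    "G1 (\<lambda>w. A (M.act (wrd [g]) w)) v B u = (-1) ^ gpar g * G1 A v B (N.act (wrd [g]) u)"
    "G2 B u A (M.act (wrd [g]) v) = (-1) ^ gpar g * G2 (\<lambda>w. B (N.act (wrd [g]) w)) u A v"
    "G2 B u (\<lambda>w. A (M.act (wrd [g]) w)) v = qgen q g * G2 B (N.act (wrd [g]) u) A v"
    using G1_right G1_left G2_right G2_left G_K gpar_not_EF[of g] by (cases "is_EF g"; simp)+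
qed

end

end

text \<open>A product of powers of the \<open>k\<^sub>i\<close> acts on vectors of weight \<open>\<mu>\<close> by \<open>q\<close> to the power
  \<open>(\<kappa>, \<mu>)\<close> for a fixed weight \<open>\<kappa>\<close>.\<close>

definition kvec :: "('n::{finite,linorder} \<Rightarrow> int) \<Rightarrow> 'n euclid" where
  "kvec m = (\<Sum>i\<leftarrow>sorted_list_of_set UNIV. of_int (m i) *\<^sub>R simple_root i)"

definition kword :: "('n::{finite,linorder} \<Rightarrow> int) \<Rightarrow> 'n gen list" where
  "kword m = concat (map (\<lambda>i. replicate (nat \<bar>m i\<bar>) (if m i \<ge> 0 then KGen i else KInvGen i)) (sorted_list_of_set UNIV))"

lemma wrd_power: "wrd [g] ^ n = wrd (replicate n g)"
proof (induction n)
  case (Suc n)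
  then show ?case by (simp add: wrd_mult)
qed (simp add: wrd_Nil)

lemma kpow_word: "kpow i k = wrd (replicate (nat \<bar>k\<bar>) (if k \<ge> 0 then KGen i else KInvGen i))"
  by (auto simp: kpow_def wrd_power)

lemma kword_eq: "prod_list (map (\<lambda>i. kpow i (m i)) (sorted_list_of_set UNIV)) = wrd (kword m)"
proof -
  have "prod_list (map (\<lambda>i. kpow i (m i)) xs)
      = wrd (concat (map (\<lambda>i. replicate (nat \<bar>m i\<bar>) (if m i \<ge> 0 then KGen i else KInvGen i)) xs))" for xs
    by (induction xs) (simp_all add: wrd_Nil kpow_word flip: wrd_mult)
  then show ?thesis by (simp add: kword_def)
qed

lemma kword_not_EF: "g \<in> set (kword m) \<Longrightarrow> \<not> is_EF g"
  by (auto simp: kword_def split: if_splits)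

lemma wpar_not_EF: "(\<And>g. g \<in> set w \<Longrightarrow> \<not> is_EF g) \<Longrightarrow> wpar w = 0"
  by (induction w) (auto simp: wpar_Cons gpar_not_EF)

lemma kvec_lattice: "kvec m \<in> weight_lattice"
  unfolding kvec_def by (intro lattice_sum_list lattice_scaleR simple_root_lattice) auto

context uq_mod
begin

lemma sa_kword:
  assumes "\<And>g. g \<in> set w \<Longrightarrow> \<not> is_EF g" "v \<in> C"
  shows "sa w (act (wrd w) v) = v"
  using assms(1)
proof (induction w)
  case Nil
  then show ?case using assms by (simp add: act_Nil act_1)
next
  case (Cons g w)
  have g: "\<not> is_EF g" using Cons.prems by simp
  have inv: "sa [g] (act (wrd [g]) y) = y" if "y \<in> C" for y
    using g that by (cases g) (simp_all add: scl_1 act_K_KI act_KI_K)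
  have "sa (g # w) (act (wrd (g # w)) v) = sa w (sa [g] (act (wrd [g]) (act (wrd w) v)))"
    using sa_append[of "act (wrd (g # w)) v" "[g]" w] assms(2)
    by (simp add: act_Cons[OF assms(2), of g w] gpar_not_EF[OF g] del: antipode_word.simps)
  then show ?case using Cons inv assms(2) by simp
qed

lemma act_kword:
  assumes v: "v \<in> C" "weight_vector q sc M \<mu> v" "\<mu> \<in> weight_lattice"
  shows "act (wrd (kword m)) v = sc (qpow q (kvec m \<bullet> \<mu>)) v"
proof -
  have int: "x * (\<mu> \<bullet> simple_root i) \<in> \<int>" if "x \<in> \<int>" for x i
    using that v(3) by (intro Ints_mult inner_lattice_Ints simple_root_lattice)
  have rep: "act (wrd (replicate n g)) v = sc (qpow q (real n * x)) v"
    if "act (wrd [g]) v = sc (qpow q x) v" "x \<in> \<int>" for n g x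
  proof (induction n)
    case 0
    then show ?case using v by (simp add: act_Nil)
  next
    case (Suc n)
    have "real (Suc n) * x = x + real n * x" by (simp add: algebra_simps)
    then show ?case
      using Suc that v by (simp add: act_Cons[of v g] act_sc qpow_add mult.commute del: of_nat_Suc)
  qed
  have one: "act (wrd (replicate (nat \<bar>k\<bar>) (if k \<ge> 0 then KGen i else KInvGen i))) v
      = sc (qpow q (of_int k * (\<mu> \<bullet> simple_root i))) v" for k i
  proof (cases "k \<ge> 0")
    case True
    then show ?thesis
      using rep[of "KGen i" "\<mu> \<bullet> simple_root i" "nat k"] v int[of 1 i] by (simp add: weight_vector_def)
  next
    case False
    then show ?thesis
      using rep[of "KInvGen i" "- (\<mu> \<bullet> simple_root i)" "nat \<bar>k\<bar>"] weight_vector_KI[OF v, of i] int[of "-1" i] by simp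
  qed
  have "act (wrd (concat (map (\<lambda>i. replicate (nat \<bar>m i\<bar>) (if m i \<ge> 0 then KGen i else KInvGen i)) xs))) v
      = sc (qpow q ((\<Sum>i\<leftarrow>xs. of_int (m i) *\<^sub>R simple_root i) \<bullet> \<mu>)) v" for xs
  proof (induction xs)
    case Nil
    then show ?case using v by (simp add: act_Nil)
  next
    case (Cons i xs)
    have "(\<Sum>i\<leftarrow>xs. of_int (m i) *\<^sub>R simple_root i) \<bullet> \<mu> \<in> \<int>"
      using v by (intro inner_lattice_Ints lattice_sum_list lattice_scaleR simple_root_lattice) auto
    then show ?case
      using Cons v one[of "m i" i] int[of "of_int (m i)" i]
      by (simp add: act_append act_sc inner_add_left inner_add_right qpow_add inner_commute mult.commute)
  qed
  then show ?thesis by (simp add: kword_def kvec_def)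
qed

lemma covec_ext_WB:
  assumes "covec A" "covec B" "\<And>b. b \<in> WB \<Longrightarrow> A b = B b" "v \<in> C"
  shows "A v = B v"
  using covec_expand[OF WB assms(1,4)] covec_expand[OF WB assms(2,4)] assms(3) by simp

text \<open>\<open>is_K2rho\<close> speaks of the \<open>e_i\<close> only, and it controls the
  exponent (kvec m, alpha_i) only where \<open>e_i\<close> acts nontrivially. If the exponent is the
  right one, weights settle both \<open>e_i\<close> and \<open>f_i\<close>; otherwise both act as
  0.\<close>

lemma kword_X_commute:
  assumes K: "\<And>v. v \<in> C \<Longrightarrow> act (wrd (kword m)) (act (ee i) v)
      = sc (qpow q (two_rho \<bullet> simple_root i)) (act (ee i) (act (wrd (kword m)) v))"
    and v: "v \<in> C"
  shows "act (wrd (kword m)) (act (wrd [XG o' i]) v) = sc (qgen q (XG o' i)) (act (wrd [XG o' i]) (act (wrd (kword m)) v))"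
proof -
  have basis: "act (wrd (kword m)) (act (wrd [XG o' i]) b) = sc (qgen q (XG o' i)) (act (wrd [XG o' i]) (act (wrd (kword m)) b))"
    if b: "b \<in> WB" for b
  proof -
    have bC: "b \<in> C" by (rule WB_in_C[OF b])
    have wb: "weight_vector q sc M (wt b) b" "wt b \<in> weight_lattice" using wt[OF b] by auto
    have lat: "wt b + osg o'' *\<^sub>R simple_root i \<in> weight_lattice" for o''
      by (intro lattice_add wb lattice_scaleR simple_root_lattice) simp
    have KX: "act (wrd (kword m)) (act (wrd [XG o'' i]) b)
        = sc (qpow q (osg o'' * (kvec m \<bullet> simple_root i)) * qpow q (kvec m \<bullet> wt b)) (act (wrd [XG o'' i]) b)" for o''
    proof -
      have "kvec m \<bullet> (wt b + osg o'' *\<^sub>R simple_root i) = osg o'' * (kvec m \<bullet> simple_root i) + kvec m \<bullet> wt b"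
        by (simp add: inner_add_right)
      then show ?thesis
        using act_kword[OF _ weight_vector_X[OF bC wb] lat] bC wb
        by (simp add: qpow_add inner_lattice_Ints kvec_lattice simple_root_lattice)
    qed
    have rhs: "act (wrd (kword m)) b = sc (qpow q (kvec m \<bullet> wt b)) b" by (rule act_kword[OF bC wb])
    show ?thesis
    proof (cases "kvec m \<bullet> simple_root i = simple_root i \<bullet> simple_root i")
      case True
      then show ?thesis using bC by (simp only: KX rhs act_sc qgen_XG V.scale_scale)
    next
      case False
      \<comment> \<open>A nonzero vector e_i b' would let the eigenvalue of K be computed in two
        ways and fix the exponent.\<close>
      have e0: "act (ee i) b' = 0" if b': "b' \<in> WB" for b'
      proof (rule ccontr)
        assume ne: "act (ee i) b' \<noteq> 0"
        have b'C: "b' \<in> C" by (rule WB_in_C[OF b'])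
        have wb': "weight_vector q sc M (wt b') b'" "wt b' \<in> weight_lattice" using wt[OF b'] by auto
        have w: "weight_vector q sc M (wt b' + simple_root i) (act (ee i) b')"
          using weight_vector_X[OF b'C wb', of True i] by simp
        have "act (wrd (kword m)) (act (ee i) b') = sc (qpow q (kvec m \<bullet> (wt b' + simple_root i))) (act (ee i) b')"
          using act_kword[OF _ w lattice_add[OF wb'(2) simple_root_lattice]] b'C by simp
        moreover have "act (wrd (kword m)) (act (ee i) b')
          = sc (qpow q (two_rho \<bullet> simple_root i) * qpow q (kvec m \<bullet> wt b')) (act (ee i) b')"
          using K[OF b'C] act_kword[OF b'C wb'] b'C by (simp add: act_sc)
        ultimately have "qpow q (kvec m \<bullet> (wt b' + simple_root i)) = qpow q (two_rho \<bullet> simple_root i) * qpow q (kvec m \<bullet> wt b')"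
          using ne by (metis V.scale_right_imp_eq)
        also have "\<dots> = qpow q (two_rho \<bullet> simple_root i + kvec m \<bullet> wt b')"
          using wb' by (simp add: qpow_add inner_lattice_Ints kvec_lattice two_rho_lattice simple_root_lattice)
        finally have "kvec m \<bullet> (wt b' + simple_root i) = two_rho \<bullet> simple_root i + kvec m \<bullet> wt b'"
          using wb' by (intro qpow_inj Ints_add inner_lattice_Ints lattice_add kvec_lattice two_rho_lattice simple_root_lattice)
        then show False using False by (simp add: inner_add_right two_rho_simple_root)
      qed
      have e: "act (ee i) y = 0" if y: "y \<in> C" for y
      proof (rule covec_eqI)
        fix A assume A: "covec A"
        show "A (act (ee i) y) = A 0"
          using covec_expand[OF WB covec_act[OF A] y, of "ee i"] e0 by (simp add: covec_0[OF A])
      qed (use y in auto)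
      \<comment> \<open>With e_i = 0 the relation for e_i f_i makes \<open>k_i\<close> equal to its
        inverse, so every weight is orthogonal to alpha_i. Then f_i, which shifts weights by
        -alpha_i, must vanish as well.\<close>
      have zero_wt: "\<nu> \<bullet> simple_root i = 0" if "weight_vector q sc M \<nu> y" "y \<in> C" "y \<noteq> 0" "\<nu> \<in> weight_lattice" for \<nu> y
      proof -
        have "act (ee i) (act (ff i) y) = 0" "act (ee i) y = 0" using e that by auto
        then have "sc (1 / (q - inverse q)) (act (kk i) y - act (kinv i) y) = 0"
          using act_E_F[OF that(2), of i i] by simp
        then have "act (kk i) y = act (kinv i) y" using q_diff_nonzero by simp
        then have "sc (qpow q (\<nu> \<bullet> simple_root i)) y = sc (qpow q (- (\<nu> \<bullet> simple_root i))) y"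
          using that weight_vector_KI[OF that(2,1,4), of i] by (simp add: weight_vector_def)
        then have "qpow q (\<nu> \<bullet> simple_root i) = qpow q (- (\<nu> \<bullet> simple_root i))"
          using that(3) by (metis V.scale_right_imp_eq)
        then have "\<nu> \<bullet> simple_root i = - (\<nu> \<bullet> simple_root i)"
          using that(4) by (intro qpow_inj) (auto intro: inner_lattice_Ints simple_root_lattice)
        then show ?thesis by simp
      qed
      have "act (wrd [XG o' i]) b = 0"
      proof (rule ccontr)
        assume ne: "act (wrd [XG o' i]) b \<noteq> 0"
        have "b \<noteq> 0" using ne by auto
        then have "wt b \<bullet> simple_root i = 0" using zero_wt[OF wb(1) bC] wb(2) by simp
        moreover have "(wt b + osg o' *\<^sub>R simple_root i) \<bullet> simple_root i = 0"
          using zero_wt[OF weight_vector_X[OF bC wb] _ ne lat] bC by simp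
        ultimately have "osg o' * (simple_root i \<bullet> simple_root i) = 0"
          by (simp add: inner_add_left)
        then show False using simple_root_norm_pos[of i] by (cases o') auto
      qed
      then show ?thesis using bC by (simp add: rhs act_sc)
    qed
  qed
  show ?thesis
  proof (rule covec_eqI)
    fix A assume A: "covec A"
    have "A (act (wrd (kword m)) (act (wrd [XG o' i]) v))
        = (\<lambda>v. qgen q (XG o' i) * A (act (wrd [XG o' i]) (act (wrd (kword m)) v))) v"
    proof (rule covec_ext_WB[OF _ _ _ v])
      show "covec (\<lambda>v. A (act (wrd (kword m)) (act (wrd [XG o' i]) v)))"
        by (rule covec_act[OF covec_act[OF A]])
      show "covec (\<lambda>v. qgen q (XG o' i) * A (act (wrd [XG o' i]) (act (wrd (kword m)) v)))"
        by (intro covec_cmult covec_act[OF covec_act[OF A]])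
      show "A (act (wrd (kword m)) (act (wrd [XG o' i]) b)) = qgen q (XG o' i) * A (act (wrd [XG o' i]) (act (wrd (kword m)) b))"
        if "b \<in> WB" for b
        unfolding basis[OF that] using WB_in_C[OF that] by (simp add: covec_sc[OF A])
    qed
    then show "A (act (wrd (kword m)) (act (wrd [XG o' i]) v))
        = A (sc (qgen q (XG o' i)) (act (wrd [XG o' i]) (act (wrd (kword m)) v)))"
      using v by (simp add: covec_sc[OF A])
  qed (use v in auto)
qed

end

section \<open>Conjugation by K_{2 rho} and the antipode axiom on modules\<close>

context uq_mod
begin

lemma act_kword_sa:
  assumes "\<And>g. g \<in> set w \<Longrightarrow> \<not> is_EF g" "v \<in> C"
  shows "act (wrd w) (sa w v) = v"
  using assms
proof (induction w arbitrary: v)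
  case Nil
  then show ?case by (simp add: act_Nil act_1)
next
  case (Cons g w)
  have g: "\<not> is_EF g" using Cons.prems by simp
  have inv: "act (wrd [g]) (sa [g] v) = v"
    using g Cons.prems(2) by (cases g) (simp_all add: scl_1 act_K_KI act_KI_K)
  have "sa (g # w) v = sa w (sa [g] v)"
    using sa_append[OF Cons.prems(2), of "[g]" w] by (simp add: gpar_not_EF[OF g] del: antipode_word.simps)
  then have "act (wrd (g # w)) (sa (g # w) v) = act (wrd [g]) (act (wrd w) (sa w (sa [g] v)))"
    using Cons.prems(2) act_Cons[of "sa w (sa [g] v)" g w] by (simp del: antipode_word.simps)
  then show ?case using Cons inv by (simp del: antipode_word.simps)
qed

lemma act_not_EF_weight:
  assumes "\<not> is_EF g" "b \<in> WB"
  shows "\<exists>c. act (wrd [g]) b = sc c b"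
  using assms(1) wt[OF assms(2)] weight_vector_KI[OF WB_in_C[OF assms(2)], of "wt b"]
  by (cases g) (auto simp: weight_vector_def)

lemma act_eqI_WB:
  assumes "\<And>b. b \<in> WB \<Longrightarrow> act x b = act y b" "v \<in> C"
  shows "act x v = act y v"
proof (rule covec_eqI)
  fix A assume A: "covec A"
  show "A (act x v) = A (act y v)"
    using covec_ext_WB[OF covec_act[OF A, of x] covec_act[OF A, of y] _ assms(2)] assms(1) by simp
qed (use assms in auto)

lemma kword_gen_commute:
  assumes K: "is_K2rho q (wrd (kword m))" and v: "v \<in> C"
  shows "act (wrd (kword m)) (act (wrd [g]) v) = sc (qgen q g) (act (wrd [g]) (act (wrd (kword m)) v))"
proof (cases "is_EF g")
  case True
  then obtain o' i where oi: "g = XG o' i" using EF_cases by blast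
  have E: "act (wrd (kword m)) (act (ee i) v)
      = sc (qpow q (two_rho \<bullet> simple_root i)) (act (ee i) (act (wrd (kword m)) v))" if "v \<in> C" for v
  proof -
    have "wrd (kword m) * ee i - scl (qpow q (two_rho \<bullet> simple_root i)) * ee i * wrd (kword m) \<in> uq_ideal q"
      using K by (simp add: is_K2rho_def)
    from act_ideal[OF this that]
    have "act (wrd (kword m) * ee i) v = act (scl (qpow q (two_rho \<bullet> simple_root i)) * (ee i * wrd (kword m))) v"
      unfolding mult.assoc act_diff[OF that] by simp
    then show ?thesis
      unfolding act_scl[OF that] unfolding act_mult[OF that] .
  qed
  show ?thesis unfolding oi by (rule kword_X_commute[OF E v])
next
  case False
  have q: "qgen q g = 1" using False by (cases g) auto
  have "act (wrd (kword m) * wrd [g]) v = act (wrd [g] * wrd (kword m)) v"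
  proof (rule act_eqI_WB[OF _ v])
    fix b assume b: "b \<in> WB"
    obtain c where c: "act (wrd [g]) b = sc c b" using act_not_EF_weight[OF False b] by blast
    obtain d where d: "act (wrd (kword m)) b = sc d b"
      using act_kword[OF WB_in_C[OF b]] wt[OF b] by blast
    show "act (wrd (kword m) * wrd [g]) b = act (wrd [g] * wrd (kword m)) b"
      using WB_in_C[OF b] by (simp add: act_mult c d act_sc mult.commute)
  qed
  then show ?thesis using v by (simp add: act_mult q)
qed

lemma kword_sa_commute:
  assumes K: "is_K2rho q (wrd (kword m))" and v: "v \<in> C"
  shows "act (wrd [g]) (sa (kword m) v) = sc (qgen q g) (sa (kword m) (act (wrd [g]) v))"
proof -
  have nEF: "\<And>g. g \<in> set (kword m) \<Longrightarrow> \<not> is_EF g" by (rule kword_not_EF)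
  have "act (wrd (kword m)) (act (wrd [g]) (sa (kword m) v)) = sc (qgen q g) (act (wrd [g]) v)"
    using kword_gen_commute[OF K, of "sa (kword m) v" g] act_kword_sa[OF nEF v] v by simp
  then have "sa (kword m) (act (wrd (kword m)) (act (wrd [g]) (sa (kword m) v)))
      = sc (qgen q g) (sa (kword m) (act (wrd [g]) v))"
    using v by (simp add: act_sc)
  then show ?thesis using sa_kword[OF nEF] v by simp
qed

lemma wpar_kword [simp]: "wpar (kword m) = 0"
  by (rule wpar_not_EF) (rule kword_not_EF)

text \<open>The antipode axiom a_(1) S(a_(2)) = eps(a) on a module. Letters are appended on the
  right because S then puts both contributions of the new letter next to each other in the middle,
  where they cancel.\<close>

lemma antipode_right:
  assumes A: "covec A" and v: "v \<in> C"
  shows "Dev (\<lambda>a b. A (act (wrd a) (sa b v))) x = counit (wrd x) * A v"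
proof (induction x rule: rev_induct)
  case Nil
  then show ?case using v by (simp add: act_Nil act_1 counit_wrd)
next
  case (snoc X x)
  show ?case
  proof (cases "is_EF X")
    case True
    have "Dev (\<lambda>a b. A (act (wrd a) (sa b v))) (x @ [X]) = Dev (\<lambda>a b. 0) x"
      unfolding Dev_append Dev_Cons_EF[OF True] Dev_Nil append_Nil2
    proof (intro arg_cong[where f = "\<lambda>\<phi>. Dev \<phi> x"] ext)
      fix a b
      have y: "sa b v \<in> C" using v by simp
      have "sa (b @ lgr X) v = sa (lgr X) (sa b v)"
        using sa_append[OF v, of b "lgr X"] by simp
      moreover have "sa (b @ [X]) v = sc ((-1) ^ (wpar b * gpar X)) (- sa (lgl X) (act (wrd [X]) (sa (lgr X) (sa b v))))"
        using sa_append[OF v, of b "[X]"] sa_EF[OF True y] by (simp del: antipode_word.simps)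
      moreover have "act (wrd (a @ lgl X)) (sa (lgl X) (act (wrd [X]) (sa (lgr X) (sa b v))))
          = act (wrd a) (act (wrd [X]) (sa (lgr X) (sa b v)))"
        using y by (simp add: act_append lg_inverse)
      ultimately show "(-1) ^ (wpar b * wpar [X]) * A (act (wrd (a @ [X])) (sa (b @ lgr X) v)) +
          (-1) ^ (gpar X * wpar []) * ((-1) ^ (wpar b * wpar (lgl X)) * A (act (wrd (a @ lgl X)) (sa (b @ [X]) v))) = 0"
        using y by (simp add: act_append[of _ a "[X]"] act_sc act_uminus_vec covec_sc[OF A] covec_uminus[OF A] act_append
            del: antipode_word.simps)
    qed
    then show ?thesis using counit_EF[OF True] by (simp add: counit_wrd)
  next
    case False
    have "Dev (\<lambda>a b. A (act (wrd a) (sa b v))) (x @ [X]) = Dev (\<lambda>a b. A (act (wrd a) (sa b v))) x"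
      unfolding Dev_append Dev_Cons_K[OF False] Dev_Nil
    proof (intro arg_cong[where f = "\<lambda>\<phi>. Dev \<phi> x"] ext)
      fix a b
      have y: "sa b v \<in> C" using v by simp
      have "sa (b @ [X]) v = sa [X] (sa b v)"
        using sa_append[OF v, of b "[X]"] by (simp add: gpar_not_EF[OF False] del: antipode_word.simps)
      moreover have "act (wrd [X]) (sa [X] (sa b v)) = sa b v"
        using act_kword_sa[of "[X]" "sa b v"] False y by simp
      ultimately show "(-1) ^ (wpar b * wpar [X]) * A (act (wrd (a @ [X])) (sa (b @ [X]) v)) = A (act (wrd a) (sa b v))"
        using y by (simp add: act_append[of _ a "[X]"] gpar_not_EF[OF False] del: antipode_word.simps)
    qed
    then show ?thesis using snoc counit_not_EF[OF False] by (simp add: counit_wrd)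
  qed
qed

text \<open>The identity of \<open>antipode_right\<close> with a basis and its dual inserted between
  the two actions; the explicit signs undo those of the convolution product.\<close>

lemma antipode_pairing:
  assumes B: "hbasis B" and A: "hcov pa A" "pa < 2" and u: "u \<in> part M pu" "pu < 2"
  shows "(\<lambda>x. \<Sum>b\<in>B. (-1) ^ (((pa + vpar M b) mod 2) * ((vpar M b + pu) mod 2)) * fmult (tm A b) (sm (cf B b) u) x)
    = (\<lambda>x. A u * counit x)"
proof (rule linear_functional_eqI)
  have uC: "u \<in> C" using u part_in_C by blast
  note Ac = hcov_covec[OF A(1)]
  fix x
  have "(\<Sum>b\<in>B. (-1) ^ (((pa + vpar M b) mod 2) * ((vpar M b + pu) mod 2)) * fmult (tm A b) (sm (cf B b) u) (wrd x))
    = (\<Sum>b\<in>B. Dev (\<lambda>a b'. cf B b (sa b' u) * A (act (wrd a) b)) x)"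
  proof (rule sum.cong[OF refl])
    fix b assume b: "b \<in> B"
    have bC: "b \<in> C" by (rule hbasis_in_C[OF B b])
    have sw: "sm (cf B b) u (wrd y) = cf B b (sa y u)" for y by (rule sm_wrd[OF cf_covec[OF B] uC])
    have "(-1) ^ (((pa + vpar M b) mod 2) * ((vpar M b + pu) mod 2)) * ((-1) ^ (wpar b' * wpar a) * A (act (wrd a) b) * cf B b (sa b' u))
       = cf B b (sa b' u) * A (act (wrd a) b)" for a b'
    proof (cases "wpar a = (pa + vpar M b) mod 2 \<and> wpar b' = (vpar M b + pu) mod 2")
      case True
      show ?thesis
        unfolding True[THEN conjunct1, symmetric] True[THEN conjunct2, symmetric]
        by (subst mult.commute[of "wpar b'" "wpar a"])
           (simp only: mult.assoc neg_one_power_cancel mult.commute[of "A _"])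
    next
      case False
      then have "A (act (wrd a) b) = 0 \<or> cf B b (sa b' u) = 0"
        using act_odd[OF A vpar_less_2 hbasis_part[OF B b], of a] sa_odd[OF cf_hcov[OF B b] vpar_less_2 u(2,1), of b']
        by blast
      then show ?thesis by auto
    qed
    then show "(-1) ^ (((pa + vpar M b) mod 2) * ((vpar M b + pu) mod 2)) * fmult (tm A b) (sm (cf B b) u) (wrd x)
      = Dev (\<lambda>a b'. cf B b (sa b' u) * A (act (wrd a) b)) x"
      unfolding fmult_wrd fm_def sw tm_def by (simp only: flip: Dev_cmult)
  qed
  also have "\<dots> = Dev (\<lambda>a b'. \<Sum>b\<in>B. cf B b (sa b' u) * A (act (wrd a) b)) x"
    by (simp only: Dev_sum)
  also have "(\<lambda>a b'. \<Sum>b\<in>B. cf B b (sa b' u) * A (act (wrd a) b)) = (\<lambda>a b'. A (act (wrd a) (sa b' u)))"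
    using covec_expand[OF B covec_act[OF Ac]] uC by (simp add: fun_eq_iff)
  also have "Dev (\<lambda>a b'. A (act (wrd a) (sa b' u))) x = counit (wrd x) * A u"
    by (rule antipode_right[OF Ac uC])
  finally show "(\<Sum>b\<in>B. (-1) ^ (((pa + vpar M b) mod 2) * ((vpar M b + pu) mod 2)) * fmult (tm A b) (sm (cf B b) u) (wrd x))
     = A u * counit (wrd x)" by simp
next
  have lin: "linear_functional (\<lambda>x. \<Sum>b\<in>S. c b * f b x)" if "\<And>b. linear_functional (f b)" for S and c :: "'v \<Rightarrow> complex" and f :: "'v \<Rightarrow> 'n functional"
    using that by (simp add: linear_functional_def distrib_left sum.distrib sum_distrib_left ac_simps)
  show "linear_functional (\<lambda>x. \<Sum>b\<in>B. (-1) ^ (((pa + vpar M b) mod 2) * ((vpar M b + pu) mod 2)) * fmult (tm A b) (sm (cf B b) u) x)"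
    by (rule lin) (rule fmult_linear)
qed (intro linear_functional_cmult counit_linear)

end

section \<open>Schur's lemma for the Haar integrals\<close>

locale haar_irr = haar_pair q sc M N T I + MH: hw_mod q sc M l vp + NH: hw_mod q sc N lN vN
  for q sc and M N :: "('n::{finite,linorder}, 'v::ab_group_add) supermodule" and T I l vp lN vN +
  fixes m :: "'n \<Rightarrow> int"
  assumes K: "is_K2rho q (wrd (kword m))"
begin

abbreviation "K \<equiv> wrd (kword m)"

lemma nEF: "g \<in> set (kword m) \<Longrightarrow> \<not> is_EF g"
  by (rule kword_not_EF)

lemma hcov_K:
  "N.hcov r B \<Longrightarrow> r < 2 \<Longrightarrow> N.hcov r (\<lambda>w. B (N.act K w))"
  "N.hcov r B \<Longrightarrow> r < 2 \<Longrightarrow> N.hcov r (\<lambda>w. B (N.sa (kword m) w))"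
  using N.hcov_act[of r B "kword m"] N.hcov_sa[of r B "kword m"] by simp_all

lemma part_K: "r < 2 \<Longrightarrow> u \<in> part N r \<Longrightarrow> N.act K u \<in> part N r"
  using N.act_word_part[of r u "kword m"] by simp

lemma G1_schur_vB:
  assumes A: "M.hcov pa A" "pa < 2" and u: "u \<in> part N pu" "pu < 2"
  shows "l \<noteq> lN \<Longrightarrow> v \<in> M.C \<Longrightarrow> r < 2 \<Longrightarrow> N.hcov r B \<Longrightarrow> G1 A v B u = 0"
    and "M = N \<Longrightarrow> \<exists>c. \<forall>v\<in>N.C. \<forall>r<2. \<forall>B. N.hcov r B \<longrightarrow> G1 A v B u = c * B (N.act K v)"
proof -
  have uC: "u \<in> N.C" using u N.part_in_C by blast
  note Ac = M.hcov_covec[OF A(1)]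
  \<comment> \<open>Composing \<open>B\<close> with S(K_{2 rho}) compensates the eigenvalue of S^2
    in \<open>G_gen\<close>, so that \<open>\<gamma>\<close> is strictly invariant (exponent
    0).\<close>
  define \<gamma> where "\<gamma> v B = G1 A v (\<lambda>w. B (N.sa (kword m) w)) u" for v B
  note Bc = N.covec_act[where x = "antipode_word (kword m)"]
  have add: "\<gamma> (v + w) B = \<gamma> v B + \<gamma> w B" if "v \<in> M.C" "w \<in> M.C" "N.covec B" for v w B
    unfolding \<gamma>_def by (rule G_vec(1)[OF Bc[OF that(3)] Ac that(1,2) uC uC])
  have scale: "\<gamma> (sc c v) B = c * \<gamma> v B" if "v \<in> M.C" "N.covec B" for c v B
    unfolding \<gamma>_def by (rule G_vec(3)[OF Bc[OF that(2)] Ac that(1,1) uC uC])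
  have expand: "\<gamma> v B = (\<Sum>b\<in>N.WB. B b * \<gamma> v (N.cf N.WB b))" if "v \<in> M.C" "N.covec B" for v B
  proof -
    have "\<gamma> v B = G1 A v (\<lambda>w. \<Sum>b\<in>N.WB. B b * N.cf N.WB b (N.sa (kword m) w)) u"
      unfolding \<gamma>_def
      by (rule G_cong) (use that uC N.covec_expand[OF N.WB that(2)] in \<open>simp_all add: mult.commute\<close>)
    also have "\<dots> = (\<Sum>b\<in>N.WB. B b * \<gamma> v (N.cf N.WB b))"
      unfolding \<gamma>_def by (rule G_sum_B(1)) (use that uC Ac Bc N.cf_covec[OF N.WB] in auto)
    finally show ?thesis .
  qed
  have inv: "\<gamma> (M.act (wrd [g]) v) B = (-1) ^ (0 * gpar g) * \<gamma> v (\<lambda>w. B (N.act (wrd [g]) w))"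
    if "p < 2" "r < 2" "v \<in> part M p" "N.hcov r B" for g p r v B
  proof -
    have vC: "v \<in> M.C" using that M.part_in_C by blast
    note cov = N.hcov_covec[OF that(4)]
    have "\<gamma> (M.act (wrd [g]) v) B = qgen q g * G1 A v (\<lambda>w. B (N.sa (kword m) (N.act (wrd [g]) w))) u"
      unfolding \<gamma>_def by (rule G_gen(1)[OF A that(3,1) hcov_K(2)[OF that(4,2)] that(2) u])
    also have "\<dots> = G1 A v (\<lambda>w. qgen q g * B (N.sa (kword m) (N.act (wrd [g]) w))) u"
      by (rule G_cmult_B(1)[symmetric]) (use vC uC Ac cov in \<open>auto intro!: N.covec_act[OF N.covec_act]\<close>)
    also have "\<dots> = G1 A v (\<lambda>w. B (N.act (wrd [g]) (N.sa (kword m) w))) u"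
      by (rule G_cong) (use vC uC in \<open>simp_all add: N.kword_sa_commute[OF K] N.covec_sc[OF cov]\<close>)
    finally show ?thesis by (simp add: \<gamma>_def)
  qed
  have schur1: "\<gamma> v B = 0" if "l \<noteq> lN" "v \<in> M.C" "r < 2" "N.hcov r B" for v r B
    by (rule NH.schur_pairing(1)[where \<gamma> = \<gamma> and \<epsilon> = 0, OF MH.hw_mod_axioms _ _ _ _ that];
        (rule add scale expand inv; assumption))
  have schur2: "\<exists>c. \<forall>v\<in>N.C. \<forall>r<2. \<forall>B. N.hcov r B \<longrightarrow> \<gamma> v B = c * (-1) ^ (0 * r) * B v" if "M = N"
    by (rule NH.schur_pairing(2)[where \<gamma> = \<gamma> and \<epsilon> = 0, OF MH.hw_mod_axioms _ _ _ _ that];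
        (rule add scale expand inv; assumption))
  have \<gamma>K: "G1 A v B u = \<gamma> v (\<lambda>w. B (N.act K w))" if "v \<in> M.C" for v B
    unfolding \<gamma>_def by (rule G_cong) (use that uC N.act_kword_sa[OF nEF] in auto)
  show "G1 A v B u = 0" if "l \<noteq> lN" "v \<in> M.C" "r < 2" "N.hcov r B"
    unfolding \<gamma>K[OF that(2)] by (rule schur1[OF that(1,2,3) hcov_K(1)[OF that(4,3)]])
  show "\<exists>c. \<forall>v\<in>N.C. \<forall>r<2. \<forall>B. N.hcov r B \<longrightarrow> G1 A v B u = c * B (N.act K v)" if MN: "M = N"
  proof -
    obtain c where c: "\<forall>v\<in>N.C. \<forall>r<2. \<forall>B. N.hcov r B \<longrightarrow> \<gamma> v B = c * (-1) ^ (0 * r) * B v"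
      using schur2[OF MN] by blast
    show ?thesis
    proof (intro exI[of _ c] ballI allI impI)
      fix v r B assume *: "v \<in> N.C" "r < 2" "N.hcov r B"
      have "\<gamma> v (\<lambda>w. B (N.act K w)) = c * (-1) ^ (0 * r) * B (N.act K v)"
        using c *(1,2) hcov_K(1)[OF *(3,2)] by blast
      then show "G1 A v B u = c * B (N.act K v)"
        using \<gamma>K[of v B] *(1) MN by simp
    qed
  qed
qed

lemma G1_schur_uA:
  assumes B: "N.hcov pb B" "pb < 2" and v: "v \<in> part M pv" "pv < 2" and NM: "N = M"
  shows "\<exists>c. \<forall>u\<in>M.C. \<forall>r<2. \<forall>A. M.hcov r A \<longrightarrow> G1 A v B u = c * (-1) ^ r * A u"
proof -
  have vC: "v \<in> M.C" using v M.part_in_C by blast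
  note Bc = N.hcov_covec[OF B(1)]
  define \<gamma> where "\<gamma> u A = G1 A v B u" for u A
  have "\<exists>c. \<forall>u\<in>M.C. \<forall>r<2. \<forall>A. M.hcov r A \<longrightarrow> \<gamma> u A = c * (-1) ^ (1 * r) * A u"
  proof (rule MH.schur_pairing(2)[where \<gamma> = \<gamma> and \<epsilon> = 1, OF NH.hw_mod_axioms _ _ _ _ NM])
    show "\<gamma> (u + u') A = \<gamma> u A + \<gamma> u' A" if "u \<in> N.C" "u' \<in> N.C" "M.covec A" for u u' A
      unfolding \<gamma>_def by (rule G_vec(5)[OF Bc that(3) vC vC that(1,2)])
    show "\<gamma> (sc c u) A = c * \<gamma> u A" if "u \<in> N.C" "M.covec A" for c u A
      unfolding \<gamma>_def by (rule G_vec(7)[OF Bc that(2) vC vC that(1,1)])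
    show "\<gamma> u A = (\<Sum>b\<in>M.WB. A b * \<gamma> u (M.cf M.WB b))" if "u \<in> N.C" "M.covec A" for u A
      unfolding \<gamma>_def by (rule G_expand_A(1)[OF that(2) vC Bc that(1)])
    show "\<gamma> (N.act (wrd [g]) u) A = (-1) ^ (1 * gpar g) * \<gamma> u (\<lambda>w. A (M.act (wrd [g]) w))"
      if "p < 2" "r < 2" "u \<in> part N p" "M.hcov r A" for g p r u A
      using G_gen(2)[OF that(4,2) v B that(3,1), of g] neg_one_power_cancel[of "gpar g"] by (simp add: \<gamma>_def)
  qed
  then show ?thesis by (simp add: \<gamma>_def)
qed

lemma G2_schur_vB:
  assumes A: "M.hcov pa A" "pa < 2" and u: "u \<in> part N pu" "pu < 2"
  shows "l \<noteq> lN \<Longrightarrow> v \<in> M.C \<Longrightarrow> r < 2 \<Longrightarrow> N.hcov r B \<Longrightarrow> G2 B u A v = 0"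
    and "M = N \<Longrightarrow> \<exists>c. \<forall>v\<in>N.C. \<forall>r<2. \<forall>B. N.hcov r B \<longrightarrow> G2 B u A v = c * (-1) ^ (1 * r) * B v"
proof -
  have uC: "u \<in> N.C" using u N.part_in_C by blast
  note Ac = M.hcov_covec[OF A(1)]
  define \<gamma> where "\<gamma> v B = G2 B u A v" for v B
  have add: "\<gamma> (v + w) B = \<gamma> v B + \<gamma> w B" if "v \<in> M.C" "w \<in> M.C" "N.covec B" for v w B
    unfolding \<gamma>_def by (rule G_vec(2)[OF that(3) Ac that(1,2) uC uC])
  have scale: "\<gamma> (sc c v) B = c * \<gamma> v B" if "v \<in> M.C" "N.covec B" for c v B
    unfolding \<gamma>_def by (rule G_vec(4)[OF that(2) Ac that(1,1) uC uC])
  have expand: "\<gamma> v B = (\<Sum>b\<in>N.WB. B b * \<gamma> v (N.cf N.WB b))" if "v \<in> M.C" "N.covec B" for v B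
    unfolding \<gamma>_def by (rule G_expand_B(2)[OF Ac that uC])
  have inv: "\<gamma> (M.act (wrd [g]) v) B = (-1) ^ (1 * gpar g) * \<gamma> v (\<lambda>w. B (N.act (wrd [g]) w))"
    if "p < 2" "r < 2" "v \<in> part M p" "N.hcov r B" for g p r v B
    using G_gen(3)[OF A that(3,1,4,2) u, of g] by (simp add: \<gamma>_def)
  have schur1: "\<gamma> v B = 0" if "l \<noteq> lN" "v \<in> M.C" "r < 2" "N.hcov r B" for v r B
    by (rule NH.schur_pairing(1)[where \<gamma> = \<gamma> and \<epsilon> = 1, OF MH.hw_mod_axioms _ _ _ _ that];
        (rule add scale expand inv; assumption))
  have schur2: "\<exists>c. \<forall>v\<in>N.C. \<forall>r<2. \<forall>B. N.hcov r B \<longrightarrow> \<gamma> v B = c * (-1) ^ (1 * r) * B v" if "M = N"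
    by (rule NH.schur_pairing(2)[where \<gamma> = \<gamma> and \<epsilon> = 1, OF MH.hw_mod_axioms _ _ _ _ that];
        (rule add scale expand inv; assumption))
  show "G2 B u A v = 0" if "l \<noteq> lN" "v \<in> M.C" "r < 2" "N.hcov r B"
    using schur1[OF that] unfolding \<gamma>_def .
  show "\<exists>c. \<forall>v\<in>N.C. \<forall>r<2. \<forall>B. N.hcov r B \<longrightarrow> G2 B u A v = c * (-1) ^ (1 * r) * B v" if "M = N"
    using schur2[OF that] unfolding \<gamma>_def .
qed

lemma G2_schur_uA:
  assumes B: "N.hcov pb B" "pb < 2" and v: "v \<in> part M pv" "pv < 2" and NM: "N = M"
  shows "\<exists>c. \<forall>u\<in>M.C. \<forall>r<2. \<forall>A. M.hcov r A \<longrightarrow> G2 B (N.act K u) A v = c * A u"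
proof -
  have vC: "v \<in> M.C" using v M.part_in_C by blast
  note Bc = N.hcov_covec[OF B(1)]
  define \<gamma> where "\<gamma> u A = G2 B (N.act K u) A v" for u A
  have "\<exists>c. \<forall>u\<in>M.C. \<forall>r<2. \<forall>A. M.hcov r A \<longrightarrow> \<gamma> u A = c * (-1) ^ (0 * r) * A u"
  proof (rule MH.schur_pairing(2)[where \<gamma> = \<gamma> and \<epsilon> = 0, OF NH.hw_mod_axioms _ _ _ _ NM])
    show "\<gamma> (u + u') A = \<gamma> u A + \<gamma> u' A" if "u \<in> N.C" "u' \<in> N.C" "M.covec A" for u u' A
      unfolding \<gamma>_def N.act_add_vec[OF that(1,2)]
      by (rule G_vec(6)[OF Bc that(3) vC vC]) (use that in auto)
    show "\<gamma> (sc c u) A = c * \<gamma> u A" if "u \<in> N.C" "M.covec A" for c u A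
      unfolding \<gamma>_def N.act_sc[OF that(1)]
      using G_vec(8)[OF Bc that(2) vC vC, of "N.act K u" "N.act K u"] that by simp
    show "\<gamma> u A = (\<Sum>b\<in>M.WB. A b * \<gamma> u (M.cf M.WB b))" if "u \<in> N.C" "M.covec A" for u A
      unfolding \<gamma>_def using that by (intro G_expand_A(2)[OF that(2) vC Bc]) simp
    show "\<gamma> (N.act (wrd [g]) u) A = (-1) ^ (0 * gpar g) * \<gamma> u (\<lambda>w. A (M.act (wrd [g]) w))"
      if "p < 2" "r < 2" "u \<in> part N p" "M.hcov r A" for g p r u A
    proof -
      have uC: "u \<in> N.C" using that N.part_in_C by blast
      have "\<gamma> (N.act (wrd [g]) u) A = qgen q g * G2 B (N.act (wrd [g]) (N.act K u)) A v"
        unfolding \<gamma>_def N.kword_gen_commute[OF K uC]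
        using G_vec(8)[OF Bc M.hcov_covec[OF that(4)] vC vC, of _ "N.act (wrd [g]) (N.act K u)"] uC by simp
      then show ?thesis
        using G_gen(4)[OF that(4,2) v B part_K[OF that(1,3)] that(1), of g] by (simp add: \<gamma>_def)
    qed
  qed
  then show ?thesis by (simp add: \<gamma>_def)
qed

text \<open>For fixed (A, u) the integral is d B(K v); for v = \<open>vp\<close> and B =
  \<open>xi\<close> it is a multiple of (-1)^[A] A(u). Comparing at this point determines d, since K
  acts on \<open>vp\<close> by a nonzero scalar.\<close>

lemma G1_form:
  assumes NM: "N = M"
  shows "\<exists>c. \<forall>A pa B pb u pu. \<forall>v\<in>M.C. pa < 2 \<and> pb < 2 \<and> pu < 2 \<and> M.hcov pa A \<and> N.hcov pb B \<and> u \<in> part M pu \<longrightarrow>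
    G1 A v B u = c * (-1) ^ pa * A u * B (M.act K v)"
proof -
  have xiN: "N.hcov MH.p0 MH.xi" using MH.xi_hcov NM by simp
  obtain c where c: "\<forall>u\<in>M.C. \<forall>r<2. \<forall>A. M.hcov r A \<longrightarrow> G1 A vp MH.xi u = c * (-1) ^ r * A u"
    using G1_schur_uA[OF xiN M.vpar_less_2 MH.vp_part M.vpar_less_2 NM] by blast
  define \<kappa> where "\<kappa> = MH.xi (M.act K vp)"
  have \<kappa>: "\<kappa> \<noteq> 0"
    unfolding \<kappa>_def M.act_kword[OF MH.vp_C MH.vp_weight MH.l_lattice] by (simp add: M.covec_sc[OF MH.xi_covec])
  show ?thesis
  proof (intro exI[of _ "c / \<kappa>"] allI ballI impI)
    fix A pa B pb u pu v
    assume v: "v \<in> M.C" and h: "pa < 2 \<and> pb < 2 \<and> pu < 2 \<and> M.hcov pa A \<and> N.hcov pb B \<and> u \<in> part M pu"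
    then have h': "M.hcov pa A" "pa < 2" "u \<in> part N pu" "pu < 2" "N.hcov pb B" "pb < 2" "u \<in> M.C"
      using NM M.part_in_C by auto
    obtain d where d: "\<forall>v\<in>N.C. \<forall>r<2. \<forall>B. N.hcov r B \<longrightarrow> G1 A v B u = d * B (N.act K v)"
      using G1_schur_vB(2)[OF h'(1-4) NM[symmetric]] by blast
    have "G1 A vp MH.xi u = d * \<kappa>"
      using d xiN NM MH.vp_C unfolding \<kappa>_def by (metis M.vpar_less_2)
    moreover have "G1 A vp MH.xi u = c * (-1) ^ pa * A u" using c h' by blast
    ultimately have "d = c / \<kappa> * (-1) ^ pa * A u" using \<kappa> by (simp add: field_simps)
    moreover have "G1 A v B u = d * B (M.act K v)" using d h' v NM by auto
    ultimately show "G1 A v B u = c / \<kappa> * (-1) ^ pa * A u * B (M.act K v)" by simp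
  qed
qed

text \<open>Glued like \<open>G1_form\<close>. Here the eigenvalue of S^2 belongs to the pair (A,
  u), so the inverse of K appears next to \<open>A\<close>.\<close>

lemma G2_form:
  assumes NM: "N = M"
  shows "\<exists>c. \<forall>A pa B pb u pu. \<forall>v\<in>M.C. pa < 2 \<and> pb < 2 \<and> pu < 2 \<and> M.hcov pa A \<and> N.hcov pb B \<and> u \<in> part M pu \<longrightarrow>
    G2 B u A v = c * (-1) ^ pb * B v * A (M.sa (kword m) u)"
proof -
  have xiN: "N.hcov MH.p0 MH.xi" using MH.xi_hcov NM by simp
  obtain c where c: "\<forall>u\<in>M.C. \<forall>r<2. \<forall>A. M.hcov r A \<longrightarrow> G2 MH.xi (N.act K u) A vp = c * A u"
    using G2_schur_uA[OF xiN M.vpar_less_2 MH.vp_part M.vpar_less_2 NM] by blast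
  show ?thesis
  proof (intro exI[of _ "c * (-1) ^ MH.p0"] allI ballI impI)
    fix A pa B pb u pu v
    assume v: "v \<in> M.C" and h: "pa < 2 \<and> pb < 2 \<and> pu < 2 \<and> M.hcov pa A \<and> N.hcov pb B \<and> u \<in> part M pu"
    then have h': "M.hcov pa A" "pa < 2" "u \<in> part N pu" "pu < 2" "N.hcov pb B" "pb < 2" "u \<in> M.C"
      using NM M.part_in_C by auto
    obtain d where d: "\<forall>v\<in>N.C. \<forall>r<2. \<forall>B. N.hcov r B \<longrightarrow> G2 B u A v = d * (-1) ^ (1 * r) * B v"
      using G2_schur_vB(2)[OF h'(1-4) NM[symmetric]] by blast
    have "G2 MH.xi u A vp = d * (-1) ^ (1 * MH.p0) * MH.xi vp"
      using d xiN NM MH.vp_C by (metis M.vpar_less_2)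
    moreover have "G2 MH.xi u A vp = c * A (M.sa (kword m) u)"
    proof -
      have "N.act K (M.sa (kword m) u) = u"
        using M.act_kword_sa[OF nEF h'(7)] NM by simp
      then show ?thesis using c h' by (metis M.act_C)
    qed
    ultimately have "d * (-1) ^ MH.p0 = c * A (M.sa (kword m) u)" by simp
    then have "(-1) ^ MH.p0 * ((-1) ^ MH.p0 * d) = (-1) ^ MH.p0 * (c * A (M.sa (kword m) u))"
      by (simp add: mult.commute)
    then have "d = c * (-1) ^ MH.p0 * A (M.sa (kword m) u)" unfolding neg_one_power_cancel by simp
    moreover have "G2 B u A v = d * (-1) ^ pb * B v" using d h' v NM by auto
    ultimately show "G2 B u A v = c * (-1) ^ MH.p0 * (-1) ^ pb * B v * A (M.sa (kword m) u)" by simp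
  qed
qed

end

section \<open>Symmetry of the weights\<close>

context generic_q
begin

text \<open>The quantum integer [x].\<close>

definition br :: "real \<Rightarrow> complex" where
  "br x = (qpow q x - qpow q (- x)) / (q - inverse q)"

text \<open>For u of weight nu killed by X, the factor in X Y^s u = const Y^(s-1) u, where Y is the
  opposite generator: \<open>a\<close> is (nu, alpha_i) up to the direction, \<open>b\<close> =
  (alpha_i, alpha_i), and \<open>\<sigma>\<close> = -1 for the odd root.\<close>

primrec string_coeff :: "complex \<Rightarrow> real \<Rightarrow> real \<Rightarrow> nat \<Rightarrow> complex" where
  "string_coeff \<sigma> a b 0 = 0"
| "string_coeff \<sigma> a b (Suc s) = \<sigma> * string_coeff \<sigma> a b s + br (a - real s * b)"

lemma br_eq:
  "br (of_int k - real n) = (q powi k / q ^ n - q ^ n / q powi k) / (q - inverse q)"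
proof -
  have "of_int k - real n = (of_int (k - int n) :: real)" by simp
  then have "qpow q (of_int k - real n) = q powi (k - int n)" by (simp only: qpow_def floor_of_int)
  then have 1: "qpow q (of_int k - real n) = q powi k / q ^ n"
    using power_int_diff[of q k "int n"] q_nonzero by simp
  have "- (of_int k - real n) = (of_int (int n - k) :: real)" by simp
  then have "qpow q (- (of_int k - real n)) = q powi (int n - k)" by (simp only: qpow_def floor_of_int)
  then have 2: "qpow q (- (of_int k - real n)) = q ^ n / q powi k"
    using power_int_diff[of q "int n" k] q_nonzero by simp
  show ?thesis unfolding br_def 1 2 ..
qed

text \<open>The familiar [s][k+1-s] of quantum sl(2).\<close>

lemma string_coeff_even:
  "string_coeff 1 (of_int k) 2 s * (q - inverse q)\<^sup>2
    = (q ^ s - inverse (q ^ s)) * (q powi k * q / q ^ s - q ^ s / (q powi k * q))"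
proof (induction s)
  case (Suc s)
  define A where "A = q powi k"
  define S where "S = q ^ s"
  have nz: "A \<noteq> 0" "S \<noteq> 0" using q_nonzero by (simp_all add: A_def S_def)
  have b: "br (of_int k - real s * 2) = (A / S\<^sup>2 - S\<^sup>2 / A) / (q - inverse q)"
    using br_eq[of k "2 * s"] by (simp add: A_def S_def power_mult mult.commute power2_eq_square flip: power_mult_distrib)
  have "string_coeff 1 (of_int k) 2 (Suc s) * (q - inverse q)\<^sup>2 =
    (S - inverse S) * (A * q / S - S / (A * q)) + (A / S\<^sup>2 - S\<^sup>2 / A) * (q - inverse q)"
    unfolding string_coeff.simps b using Suc q_diff_nonzero
    by (simp add: distrib_right A_def S_def power2_eq_square)
  also have "\<dots> = (q * S - inverse (q * S)) * (A * q / (q * S) - q * S / (A * q))"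
    using nz q_nonzero by (simp add: field_simps power2_eq_square)
  finally show ?case by (simp add: A_def S_def)
qed simp

text \<open>Because of the alternating signs the closed form factors only after the parity of
  \<open>s\<close> is fixed, as in \<open>string_coeff_zero\<close>.\<close>

lemma string_coeff_odd:
  "string_coeff (-1) (of_int k) 1 s * ((q - inverse q) * (1 + q))
    = - ((-1) ^ s * (q powi k * q - inverse (q powi k))) - (q ^ s / q powi k - q powi k * q / q ^ s)"
proof (induction s)
  case 0
  then show ?case by (simp add: field_simps)
next
  case (Suc s)
  define A where "A = q powi k"
  define S where "S = q ^ s"
  define \<epsilon> :: complex where "\<epsilon> = (-1) ^ s"
  have nz: "A \<noteq> 0" "S \<noteq> 0" using q_nonzero by (simp_all add: A_def S_def)
  have b: "br (of_int k - real s * 1) = (A / S - S / A) / (q - inverse q)"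
    using br_eq[of k s] by (simp add: A_def S_def)
  have "string_coeff (-1) (of_int k) 1 (Suc s) * ((q - inverse q) * (1 + q)) =
    - (string_coeff (-1) (of_int k) 1 s * ((q - inverse q) * (1 + q))) + (A / S - S / A) * (1 + q)"
  proof -
    define D where "D = q - inverse q"
    define x where "x = A / S - S / A"
    have "D \<noteq> 0" using q_diff_nonzero by (simp add: D_def)
    then show ?thesis
      unfolding string_coeff.simps b D_def[symmetric] x_def[symmetric] by (simp add: left_diff_distrib)
  qed
  also have "\<dots> = (\<epsilon> * (A * q - inverse A)) + (S / A - A * q / S) + (A / S - S / A) * (1 + q)"
    unfolding Suc by (simp add: A_def S_def \<epsilon>_def)
  also have "\<dots> = - (- \<epsilon> * (A * q - inverse A)) - (q * S / A - A * q / (q * S))"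
    using nz q_nonzero by (simp add: field_simps)
  finally show ?case by (simp add: A_def S_def \<epsilon>_def)
qed

lemma power_eq_powi_iff: "q powi j = q powi k \<longleftrightarrow> j = k"
  using qpow_inj[of "of_int j" "of_int k"] by (auto simp: qpow_def)

text \<open>A zero coefficient is an equation between powers of q, and since q is generic it can be
  read off the exponents: s = k + 1 for an even root, s = 2 k + 1 for the odd one.\<close>

lemma string_coeff_zero:
  assumes "string_coeff \<sigma> (of_int k) b s = 0" "s > 0" "\<sigma> = 1 \<and> b = 2 \<or> \<sigma> = -1 \<and> b = 1"
  shows "b * (real s - 1) = 2 * of_int k"
  using assms(3)
proof
  define A where "A = q powi k"
  define S where "S = q ^ s"
  have nz: "A \<noteq> 0" "S \<noteq> 0" using q_nonzero by (simp_all add: A_def S_def)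
  have S2: "S\<^sup>2 \<noteq> 1" "S \<noteq> 1"
    using q_generic[of "s * 2"] q_generic[of s] assms(2) by (simp_all add: S_def flip: power_mult)
  have Spow: "S = q powi int s" by (simp add: S_def)
  { assume c: "\<sigma> = 1 \<and> b = 2"
    have "(S - inverse S) * (A * q / S - S / (A * q)) = 0"
      using string_coeff_even[of k s] assms(1) c by (simp add: A_def S_def)
    moreover have "S - inverse S \<noteq> 0" using S2 nz by (auto simp: field_simps power2_eq_square)
    ultimately have "A * q / S - S / (A * q) = 0" by simp
    then have "A * q * (A * q) = S * S" using nz q_nonzero by (simp add: field_simps)
    then have "q powi (k + 1 + (k + 1)) = q powi (int s + int s)"
      unfolding Spow A_def by (simp only: power_int_add[OF disjI1[OF q_nonzero]] power_int_1_right)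
    then have "k + 1 + (k + 1) = int s + int s" by (simp only: power_eq_powi_iff)
    then have "int s - 1 = k" by simp
    then show ?thesis using c by auto }
  { assume c: "\<sigma> = -1 \<and> b = 1"
    have eq: "- ((-1) ^ s * (A * q - inverse A)) - (S / A - A * q / S) = 0"
      using string_coeff_odd[of k s] assms(1) c by (simp add: A_def S_def)
    have key: "A * A * q * (A * A * q) = S * S \<Longrightarrow> int s = 2 * k + 1"
    proof -
      assume "A * A * q * (A * A * q) = S * S"
      then have "q powi (k + k + 1 + (k + k + 1)) = q powi (int s + int s)"
        unfolding Spow A_def by (simp only: power_int_add[OF disjI1[OF q_nonzero]] power_int_1_right)
      then have "k + k + 1 + (k + k + 1) = int s + int s" by (simp only: power_eq_powi_iff)
      then show ?thesis by simp
    qed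
    have "int s = 2 * k + 1"
    proof (cases "even s")
      case True
      \<comment> \<open>For even s the closed form factors in this way up to a unit, and S is not 1.
        The remaining equation determines A A q only up to sign; squaring makes it one between
        powers of q.\<close>
      have "(S - 1) * (A * A * q + S) = - (A * S) * (- (A * q - inverse A) - (S / A - A * q / S))"
        using nz by (simp add: field_simps)
      also have "\<dots> = 0" using eq True by simp
      finally have "(S - 1) * (A * A * q + S) = 0" .
      then have "A * A * q = - S" using S2(2) by (simp add: eq_neg_iff_add_eq_0)
      then show ?thesis by (intro key) simp
    next
      case False
      have "(S + 1) * (S - A * A * q) = - (A * S) * ((A * q - inverse A) - (S / A - A * q / S))"
        using nz by (simp add: field_simps)
      also have "\<dots> = 0" using eq False by simp
      finally have "(S + 1) * (S - A * A * q) = 0" .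
      moreover have "S + 1 \<noteq> 0"
      proof
        assume "S + 1 = 0"
        then have "S = - 1" by (simp only: eq_neg_iff_add_eq_0)
        then show False using S2(1) by simp
      qed
      ultimately have "A * A * q = S" by simp
      then show ?thesis by (intro key) simp
    qed
    then have "of_int (int s) = (of_int (2 * k + 1) :: real)" by (simp only:)
    then have "real s - 1 = 2 * of_int k" by simp
    then show ?thesis using c by simp }
qed

end

section \<open>Strings for a simple root and reflections of the weights\<close>

context uq_mod
begin

abbreviation "sgnEF i \<equiv> (-1 :: complex) ^ gpar (EGen i)"

lemma X_Y_weight:
  assumes "w \<in> C" "weight_vector q sc M \<mu> w" "\<mu> \<in> weight_lattice"
  shows "act (wrd [XG o' i]) (act (wrd [XG (\<not> o') i]) w) =
    sc (sgnEF i) (act (wrd [XG (\<not> o') i]) (act (wrd [XG o' i]) w)) +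
    sc ((if o' then 1 else sgnEF i) * br (osg o' * (\<mu> \<bullet> simple_root i))) w"
proof -
  have s: "sgnEF i * sgnEF i = 1" by (rule neg_one_power_sq)
  have s': "(-1) ^ (gpar (EGen i) * gpar (FGen i)) = sgnEF i" by simp
  have K: "sc (1 / (q - inverse q)) (act (kk i) w - act (kinv i) w) = sc (br (\<mu> \<bullet> simple_root i)) w"
    using assms weight_vector_KI[OF assms, of i]
    by (simp add: weight_vector_def br_def diff_divide_distrib V.scale_left_diff_distrib V.scale_right_diff_distrib)
  have EF: "act (ee i) (act (ff i) w) = sc (sgnEF i) (act (ff i) (act (ee i) w)) + sc (br (\<mu> \<bullet> simple_root i)) w"
    using act_E_F[OF assms(1), of i i] unfolding s' by (simp only: K if_True simp_thms)
  have FE: "act (ff i) (act (ee i) w) = sc (sgnEF i) (act (ee i) (act (ff i) w)) + sc (sgnEF i * br (- (\<mu> \<bullet> simple_root i))) w"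
  proof -
    have "sc (sgnEF i) (act (ee i) (act (ff i) w)) = sc (sgnEF i * sgnEF i) (act (ff i) (act (ee i) w))
        + sc (sgnEF i * br (\<mu> \<bullet> simple_root i)) w"
      unfolding EF by (simp add: V.scale_right_distrib del: gpar.simps)
    moreover have "br (- (\<mu> \<bullet> simple_root i)) = - br (\<mu> \<bullet> simple_root i)"
      by (simp add: br_def diff_divide_distrib)
    ultimately show ?thesis unfolding s by (simp del: gpar.simps)
  qed
  show ?thesis using EF FE by (cases o') (simp_all del: gpar.simps)
qed

definition Xpow :: "bool \<Rightarrow> 'n \<Rightarrow> nat \<Rightarrow> 'v \<Rightarrow> 'v" where
  "Xpow o' i s v = act (wrd (replicate s (XG o' i))) v"

lemma Xpow_0: "v \<in> C \<Longrightarrow> Xpow o' i 0 v = v"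
  by (simp add: Xpow_def act_Nil)

lemma Xpow_Suc: "v \<in> C \<Longrightarrow> Xpow o' i (Suc s) v = act (wrd [XG o' i]) (Xpow o' i s v)"
  by (simp add: Xpow_def act_Cons[of v "XG o' i"])

lemma Xpow_C [simp]: "v \<in> C \<Longrightarrow> Xpow o' i s v \<in> C"
  by (simp add: Xpow_def)

lemma Xpow_weight:
  assumes "v \<in> C" "weight_vector q sc M \<mu> v" "\<mu> \<in> weight_lattice"
  shows "weight_vector q sc M (\<mu> + (osg o' * real s) *\<^sub>R simple_root i) (Xpow o' i s v)
    \<and> \<mu> + (osg o' * real s) *\<^sub>R simple_root i \<in> weight_lattice"
proof (induction s)
  case 0
  then show ?case using assms by (simp add: Xpow_0)
next
  case (Suc s)
  have e: "\<mu> + (osg o' * real (Suc s)) *\<^sub>R simple_root i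
      = (\<mu> + (osg o' * real s) *\<^sub>R simple_root i) + osg o' *\<^sub>R simple_root i"
    by (simp add: algebra_simps flip: scaleR_add_left)
  show ?case
    unfolding e Xpow_Suc[OF assms(1)]
    using weight_vector_X[OF Xpow_C[OF assms(1)] conjunct1[OF Suc] conjunct2[OF Suc], of o' i]
      lattice_add[OF conjunct2[OF Suc] lattice_scaleR[OF simple_root_lattice osg_Ints]] by blast
qed

text \<open>Nonzero powers would give infinitely many different weights.\<close>

lemma Xpow_vanish:
  assumes "v \<in> C" "weight_vector q sc M \<mu> v" "\<mu> \<in> weight_lattice" "v \<noteq> 0"
  obtains t where "Xpow o' i t v \<noteq> 0" "Xpow o' i (Suc t) v = 0" "\<And>j. j \<le> t \<Longrightarrow> Xpow o' i j v \<noteq> 0"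
proof -
  have "\<exists>s. Xpow o' i s v = 0"
  proof (rule ccontr)
    assume no: "\<nexists>s. Xpow o' i s v = 0"
    let ?f = "\<lambda>s. \<mu> + (osg o' * real s) *\<^sub>R simple_root i"
    have "range ?f \<subseteq> wts"
      using no Xpow_weight[OF assms(1-3)] assms(1) by (auto intro!: weight_in_wts[of "Xpow o' i _ v"])
    then have "finite (range ?f)" using finite_wts finite_subset by blast
    moreover have "inj ?f"
    proof (rule injI)
      fix x y assume "?f x = ?f y"
      then have "(osg o' * real x) * (simple_root i \<bullet> simple_root i) = (osg o' * real y) * (simple_root i \<bullet> simple_root i)"
        by (metis add_left_cancel inner_scaleR_left)
      then show "x = y" using simple_root_norm_pos[of i] by (auto simp: osg_def split: if_splits)
    qed
    ultimately show False using finite_imageD by blast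
  qed
  define s where "s = (LEAST s. Xpow o' i s v = 0)"
  have s: "Xpow o' i s v = 0" unfolding s_def using \<open>\<exists>s. Xpow o' i s v = 0\<close> by (rule LeastI_ex)
  have less: "Xpow o' i j v \<noteq> 0" if "j < s" for j using not_less_Least[of j] that by (auto simp: s_def)
  have "s \<noteq> 0" using s assms by (cases s) (auto simp: Xpow_0)
  then obtain t where "s = Suc t" by (cases s) auto
  then show ?thesis using that[of t] s less by auto
qed

text \<open>Going down from \<open>u\<close>, let Y^r u be the last nonzero vector. Applying X to
  Y^(r+1) u = 0 shows that the coefficient with index r + 1 vanishes, and this fixes r.\<close>

lemma rank_one_string:
  assumes u: "u \<in> C" "weight_vector q sc M \<nu> u" "\<nu> \<in> weight_lattice" "u \<noteq> 0" and X: "act (wrd [XG o' i]) u = 0"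
  obtains r where "(simple_root i \<bullet> simple_root i) * real r = 2 * (osg o' * (\<nu> \<bullet> simple_root i))"
    "\<And>j. j \<le> r \<Longrightarrow> \<nu> - (osg o' * real j) *\<^sub>R simple_root i \<in> wts"
proof -
  define \<sigma> where "\<sigma> = sgnEF i"
  define \<eta> where "\<eta> = (if o' then 1 else \<sigma>)"
  define b where "b = simple_root i \<bullet> simple_root i"
  define a where "a = osg o' * (\<nu> \<bullet> simple_root i)"
  have "\<nu> \<bullet> simple_root i \<in> \<int>" using u by (intro inner_lattice_Ints simple_root_lattice)
  then have "a \<in> \<int>" by (simp add: a_def osg_def)
  then obtain k where k: "a = of_int k" by (elim Ints_cases)
  have \<sigma>b: "\<sigma> = 1 \<and> b = 2 \<or> \<sigma> = -1 \<and> b = 1" by (auto simp: \<sigma>_def b_def simple_root_norm)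
  have \<eta>: "\<eta> \<noteq> 0" by (simp add: \<eta>_def \<sigma>_def)
  have step: "act (wrd [XG o' i]) (Xpow (\<not> o') i (Suc s) u) = sc (\<eta> * string_coeff \<sigma> a b (Suc s)) (Xpow (\<not> o') i s u)" for s
  proof (induction s)
    case 0
    then show ?case
      using X_Y_weight[OF u(1-3), of o' i] u X by (simp add: Xpow_Suc Xpow_0 \<sigma>_def \<eta>_def a_def del: gpar.simps)
  next
    case (Suc s)
    let ?w = "Xpow (\<not> o') i (Suc s) u"
    have wC: "?w \<in> C" using u by simp
    note w = Xpow_weight[OF u(1-3), of "\<not> o'" "Suc s" i]
    have wt: "osg o' * ((\<nu> + (osg (\<not> o') * real (Suc s)) *\<^sub>R simple_root i) \<bullet> simple_root i) = a - real (Suc s) * b"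
      by (simp add: a_def b_def inner_add_left algebra_simps) (simp add: osg_def)
    have "act (wrd [XG o' i]) (Xpow (\<not> o') i (Suc (Suc s)) u) =
       sc \<sigma> (act (wrd [XG (\<not> o') i]) (act (wrd [XG o' i]) ?w)) + sc (\<eta> * br (a - real (Suc s) * b)) ?w"
      unfolding Xpow_Suc[OF u(1), of "\<not> o'" i "Suc s"]
      using X_Y_weight[OF wC conjunct1[OF w] conjunct2[OF w], of o' i] unfolding wt \<sigma>_def \<eta>_def .
    also have "act (wrd [XG (\<not> o') i]) (act (wrd [XG o' i]) ?w) = sc (\<eta> * string_coeff \<sigma> a b (Suc s)) ?w"
      unfolding Suc using u by (simp add: act_sc Xpow_Suc del: string_coeff.simps)
    also have "sc \<sigma> (sc (\<eta> * string_coeff \<sigma> a b (Suc s)) ?w) + sc (\<eta> * br (a - real (Suc s) * b)) ?w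
       = sc (\<eta> * string_coeff \<sigma> a b (Suc (Suc s))) ?w"
      by (simp add: distrib_left ac_simps flip: V.scale_left_distrib)
    finally show ?case .
  qed
  obtain r where r: "Xpow (\<not> o') i r u \<noteq> 0" "Xpow (\<not> o') i (Suc r) u = 0"
    "\<And>j. j \<le> r \<Longrightarrow> Xpow (\<not> o') i j u \<noteq> 0"
    using Xpow_vanish[OF u] by metis
  have "sc (\<eta> * string_coeff \<sigma> a b (Suc r)) (Xpow (\<not> o') i r u) = 0"
    unfolding step[symmetric] r(2) by simp
  then have "string_coeff \<sigma> (of_int k) b (Suc r) = 0"
    using r(1) \<eta> by (simp only: V.scale_eq_0_iff k mult_eq_0_iff simp_thms)
  from string_coeff_zero[OF this _ \<sigma>b] have "b * real r = 2 * a" by (simp add: k)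
  moreover have "\<nu> - (osg o' * real j) *\<^sub>R simple_root i \<in> wts" if "j \<le> r" for j
    using weight_in_wts[OF _ r(3)[OF that]] Xpow_weight[OF u(1-3), of "\<not> o'" j i] u(1) by simp
  ultimately show ?thesis using that by (simp add: b_def a_def)
qed

definition reflect :: "'n \<Rightarrow> 'n euclid \<Rightarrow> 'n euclid" where
  "reflect i \<mu> = \<mu> - (2 * (\<mu> \<bullet> simple_root i) / (simple_root i \<bullet> simple_root i)) *\<^sub>R simple_root i"

text \<open>Starting at \<open>\<mu>\<close>, t steps lead to the end of the alpha_i-string; from
  there rank one theory provides r steps back, all through weights. The mirror image of
  \<open>\<mu>\<close> is r - t steps from the end.\<close>

lemma wts_reflect:
  assumes "\<mu> \<in> wts"
  shows "reflect i \<mu> \<in> wts"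
proof -
  obtain v where v: "v \<in> WB" "v \<noteq> 0" "weight_vector q sc M \<mu> v" using wts_weight_vector[OF assms] by metis
  have vC: "v \<in> C" by (rule WB_in_C[OF v(1)])
  have lat: "\<mu> \<in> weight_lattice" by (rule wts_lattice[OF assms])
  \<comment> \<open>The direction is chosen so that \<open>\<mu>\<close> lies on the nonnegative
    side of the string, which guarantees t <= r.\<close>
  define o' where "o' \<longleftrightarrow> \<mu> \<bullet> simple_root i \<ge> 0"
  have nonneg: "osg o' * (\<mu> \<bullet> simple_root i) \<ge> 0" by (auto simp: o'_def osg_def)
  have sq: "osg o' * osg o' = 1" by (simp add: osg_def)
  define b where "b = simple_root i \<bullet> simple_root i"
  have b: "b > 0" unfolding b_def by (rule simple_root_norm_pos)
  obtain t where t: "Xpow o' i t v \<noteq> 0" "Xpow o' i (Suc t) v = 0"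
    using Xpow_vanish[OF vC v(3) lat v(2)] by metis
  define \<nu> where "\<nu> = \<mu> + (osg o' * real t) *\<^sub>R simple_root i"
  have "weight_vector q sc M \<nu> (Xpow o' i t v)" "\<nu> \<in> weight_lattice"
    using Xpow_weight[OF vC v(3) lat, of o' t i] by (auto simp: \<nu>_def)
  moreover have "act (wrd [XG o' i]) (Xpow o' i t v) = 0" using t(2) vC by (simp add: Xpow_Suc)
  ultimately obtain r where r: "b * real r = 2 * (osg o' * (\<nu> \<bullet> simple_root i))"
    "\<And>j. j \<le> r \<Longrightarrow> \<nu> - (osg o' * real j) *\<^sub>R simple_root i \<in> wts"
    using rank_one_string[of "Xpow o' i t v" \<nu> o' i] t(1) vC unfolding b_def by (metis Xpow_C)
  have "osg o' * (\<nu> \<bullet> simple_root i) = osg o' * (\<mu> \<bullet> simple_root i) + (osg o' * osg o') * (real t * b)"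
    by (simp add: \<nu>_def b_def inner_add_left algebra_simps)
  then have rb: "b * real r = 2 * (osg o' * (\<mu> \<bullet> simple_root i)) + b * (2 * real t)"
    using r(1) unfolding sq by simp
  then have "b * real r \<ge> b * (2 * real t)" using nonneg by simp
  then have "real r \<ge> 2 * real t" using b by simp
  then have tr: "t \<le> r" by simp
  have "\<nu> - (osg o' * real (r - t)) *\<^sub>R simple_root i = reflect i \<mu>"
  proof -
    have "real r = 2 * (osg o' * (\<mu> \<bullet> simple_root i)) / b + 2 * real t"
      using rb b by (simp add: field_simps)
    then have "osg o' * real t - osg o' * real (r - t) = - (2 * ((osg o' * osg o') * (\<mu> \<bullet> simple_root i)) / b)"
      using tr by (simp add: of_nat_diff algebra_simps)
    then have e: "osg o' * real t - osg o' * real (r - t) = - (2 * (\<mu> \<bullet> simple_root i) / b)"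
      unfolding sq by simp
    have "\<nu> - (osg o' * real (r - t)) *\<^sub>R simple_root i
      = \<mu> + (osg o' * real t - osg o' * real (r - t)) *\<^sub>R simple_root i"
      by (simp add: \<nu>_def scaleR_diff_left)
    then show ?thesis unfolding e by (simp add: reflect_def b_def)
  qed
  then show ?thesis using r(2)[of "r - t"] by simp
qed

lemma reflect_nth:
  "reflect i \<mu> $ k = (if i = Max UNIV then (if k = i then - \<mu> $ k else \<mu> $ k)
     else if k = i then \<mu> $ nxt i else if k = nxt i then \<mu> $ i else \<mu> $ k)"
proof (cases "i = Max UNIV")
  case True
  have "reflect i \<mu> = \<mu> - (2 * (\<mu> $ i)) *\<^sub>R eps i"
    using True unfolding reflect_def simple_root_norm unfolding inner_simple_root by (simp add: simple_root_nxt)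
  then show ?thesis using True by (auto simp: eps_nth)
next
  case False
  have "reflect i \<mu> = \<mu> - (\<mu> $ i - \<mu> $ nxt i) *\<^sub>R (eps i - eps (nxt i))"
    using False unfolding reflect_def simple_root_norm unfolding inner_simple_root by (simp add: simple_root_nxt)
  then show ?thesis using False less_nxt[OF False] by (auto simp: eps_nth)
qed

text \<open>The last reflection changes the sign of the last coordinate and the others swap
  neighbours, so the sign change at i is a conjugate of the one at the next index.\<close>

lemma wts_flip: "\<mu> \<in> wts \<Longrightarrow> (\<chi> k. if k = j then - \<mu> $ k else \<mu> $ k) \<in> wts"
proof (induction j arbitrary: \<mu> rule: downward_induct)
  case last
  have "(\<chi> k. if k = Max UNIV then - \<mu> $ k else \<mu> $ k) = reflect (Max UNIV) \<mu>"
    by (simp add: vec_eq_iff reflect_nth)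
  then show ?case using wts_reflect[OF last] by simp
next
  case (step i)
  let ?\<nu> = "reflect i \<mu>"
  have "(\<chi> k. if k = nxt i then - ?\<nu> $ k else ?\<nu> $ k) \<in> wts"
    by (rule step.IH) (rule wts_reflect[OF step.prems])
  then have "reflect i (\<chi> k. if k = nxt i then - ?\<nu> $ k else ?\<nu> $ k) \<in> wts" by (rule wts_reflect)
  moreover have "reflect i (\<chi> k. if k = nxt i then - ?\<nu> $ k else ?\<nu> $ k) = (\<chi> k. if k = i then - \<mu> $ k else \<mu> $ k)"
    using step.hyps less_nxt[OF step.hyps] by (auto simp: vec_eq_iff reflect_nth)
  ultimately show ?case by simp
qed

lemma wts_uminus: "\<mu> \<in> wts \<Longrightarrow> - \<mu> \<in> wts"
proof -
  assume \<mu>: "\<mu> \<in> wts"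
  have "(\<chi> k. if k \<in> F then - \<mu> $ k else \<mu> $ k) \<in> wts" if "finite F" for F
    using that
  proof (induction F)
    case empty
    have "(\<chi> k. if k \<in> {} then - \<mu> $ k else \<mu> $ k) = \<mu>" by (simp add: vec_eq_iff)
    then show ?case using \<mu> by simp
  next
    case (insert j F)
    let ?\<nu> = "\<chi> k. if k \<in> F then - \<mu> $ k else \<mu> $ k"
    have "(\<chi> k. if k = j then - ?\<nu> $ k else ?\<nu> $ k) \<in> wts" by (rule wts_flip[OF insert.IH])
    moreover have "(\<chi> k. if k = j then - ?\<nu> $ k else ?\<nu> $ k) = (\<chi> k. if k \<in> insert j F then - \<mu> $ k else \<mu> $ k)"
      using insert.hyps by (auto simp: vec_eq_iff)
    ultimately show ?case by simp
  qed
  from this[of UNIV] have "(\<chi> k. - \<mu> $ k) \<in> wts" by simp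
  moreover have "(\<chi> k. - \<mu> $ k) = - \<mu>" by (simp add: vec_eq_iff)
  ultimately show ?thesis by simp
qed

end

section \<open>The antipode on weight vectors and on extremal matrix elements\<close>

context uq_mod
begin

lemma sa_E_weight:
  assumes "z \<in> C" "weight_vector q sc M \<mu> z" "\<mu> \<in> weight_lattice"
  shows "sa [EGen i] z = sc (- qpow q (- (\<mu> \<bullet> simple_root i))) (act (ee i) z)"
  using assms weight_vector_KI[OF assms, of i] by (simp add: scl_1 act_uminus act_mult act_sc)

lemma sa_F_weight:
  assumes "z \<in> C" "weight_vector q sc M \<mu> z" "\<mu> \<in> weight_lattice"
  shows "sa [FGen i] z = sc (- qpow q ((\<mu> - simple_root i) \<bullet> simple_root i)) (act (ff i) z)"
  using assms weight_vector_X[OF assms, of False i]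
  by (simp add: scl_1 act_uminus act_mult act_sc weight_vector_def)

lemma sa_K_weight:
  assumes "z \<in> C" "weight_vector q sc M \<mu> z" "\<mu> \<in> weight_lattice"
  shows "sa [KGen i] z = sc (qpow q (- (\<mu> \<bullet> simple_root i))) z" "sa [KInvGen i] z = sc (qpow q (\<mu> \<bullet> simple_root i)) z"
  using assms weight_vector_KI[OF assms, of i] by (simp_all add: scl_1 weight_vector_def)

lemma sa_two: "z \<in> C \<Longrightarrow> sa [g, h] z = sc ((-1) ^ (gpar g * gpar h)) (sa [h] (sa [g] z))"
  using sa_append[of z "[g]" "[h]"] by (simp del: antipode_word.simps)

lemma sa_K_X_weight:
  assumes "z \<in> C" "weight_vector q sc M \<mu> z" "\<mu> \<in> weight_lattice"
  shows "sa [KGen i, XG o' j] z = sc (qpow q (osg o' * (simple_root i \<bullet> simple_root j))) (sa [XG o' j, KGen i] z)"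
proof -
  have lat: "\<mu> + osg o' *\<^sub>R simple_root j \<in> weight_lattice"
    by (intro lattice_add assms lattice_scaleR simple_root_lattice) simp
  have ints: "\<mu> \<bullet> simple_root i \<in> \<int>" "simple_root i \<bullet> simple_root j \<in> \<int>"
    using assms by (auto intro: inner_lattice_Ints simple_root_lattice)
  have "\<exists>c. sa [XG o' j] z = sc c (act (wrd [XG o' j]) z)"
  proof (cases o')
    case True
    then show ?thesis using sa_E_weight[OF assms, of j] by (intro exI) (simp only: XG.simps)
  next
    case False
    then show ?thesis using sa_F_weight[OF assms, of j] by (intro exI) (simp only: XG.simps)
  qed
  then obtain c where c: "sa [XG o' j] z = sc c (act (wrd [XG o' j]) z)" by blast
  note w = weight_vector_X[OF assms, of o' j]
  have "sa [KGen i, XG o' j] z = sc (qpow q (- (\<mu> \<bullet> simple_root i)) * c) (act (wrd [XG o' j]) z)"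
    using assms(1) by (simp add: sa_two sa_K_weight[OF assms] act_sc c del: antipode_word.simps)
  moreover have "sa [XG o' j, KGen i] z = sc (c * qpow q (- ((\<mu> + osg o' *\<^sub>R simple_root j) \<bullet> simple_root i))) (act (wrd [XG o' j]) z)"
    using assms(1) by (simp add: sa_two c act_sc sa_K_weight[OF _ w lat] del: antipode_word.simps)
  moreover have "qpow q (- (\<mu> \<bullet> simple_root i))
      = qpow q (osg o' * (simple_root i \<bullet> simple_root j)) * qpow q (- ((\<mu> + osg o' *\<^sub>R simple_root j) \<bullet> simple_root i))"
  proof -
    have "- (\<mu> \<bullet> simple_root i) = osg o' * (simple_root i \<bullet> simple_root j) + - ((\<mu> + osg o' *\<^sub>R simple_root j) \<bullet> simple_root i)"
      by (simp add: inner_add_left inner_commute[of "simple_root j"])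
    moreover have "(\<mu> + osg o' *\<^sub>R simple_root j) \<bullet> simple_root i \<in> \<int>"
      using lat by (intro inner_lattice_Ints simple_root_lattice)
    ultimately show ?thesis using ints by (metis Ints_minus Ints_mult osg_Ints qpow_add)
  qed
  ultimately show ?thesis by (simp add: ac_simps del: antipode_word.simps)
qed

text \<open>On weight vectors S(e_i) and S(f_j) are e_i and f_j up to powers of q. Both orders lead
  to the same power P, which is 1 for i = j, so the relation is inherited, with S exchanging
  \<open>k_i\<close> and its inverse.\<close>

lemma sa_E_F_weight:
  assumes "z \<in> C" "weight_vector q sc M \<mu> z" "\<mu> \<in> weight_lattice"
  shows "sa [EGen i, FGen j] z = sc ((-1) ^ (gpar (EGen i) * gpar (FGen j))) (sa [FGen j, EGen i] z)
    + (if i = j then sc (1 / (q - inverse q)) (sa [KGen i] z - sa [KInvGen i] z) else 0)"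
proof -
  define s :: complex where "s = (-1) ^ (gpar (EGen i) * gpar (FGen j))"
  have s': "(-1) ^ (gpar (FGen j) * gpar (EGen i)) = s" by (simp add: s_def mult.commute)
  have ss: "s * s = 1" by (simp add: s_def neg_one_power_sq)
  have lat: "\<mu> + simple_root i \<in> weight_lattice" "\<mu> - simple_root j \<in> weight_lattice"
    using assms by (auto intro: lattice_add lattice_diff simple_root_lattice)
  have wE: "weight_vector q sc M (\<mu> + simple_root i) (act (ee i) z)"
    and wF: "weight_vector q sc M (\<mu> - simple_root j) (act (ff j) z)"
    using weight_vector_X[OF assms, of True i] weight_vector_X[OF assms, of False j] by simp_all
  define P where "P = qpow q (- (\<mu> \<bullet> simple_root i)) * qpow q ((\<mu> + simple_root i - simple_root j) \<bullet> simple_root j)"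
  have P': "qpow q ((\<mu> - simple_root j) \<bullet> simple_root j) * qpow q (- ((\<mu> - simple_root j) \<bullet> simple_root i)) = P"
  proof -
    have "- (\<mu> \<bullet> simple_root i) + (\<mu> + simple_root i - simple_root j) \<bullet> simple_root j
      = (\<mu> - simple_root j) \<bullet> simple_root j + - ((\<mu> - simple_root j) \<bullet> simple_root i)"
      by (simp add: inner_add_left inner_diff_left inner_commute[of "simple_root j" "simple_root i"])
    moreover have "(\<mu> + simple_root i - simple_root j) \<bullet> simple_root j \<in> \<int>" "\<mu> \<bullet> simple_root i \<in> \<int>"
      "(\<mu> - simple_root j) \<bullet> simple_root j \<in> \<int>" "(\<mu> - simple_root j) \<bullet> simple_root i \<in> \<int>"
      using lat assms by (auto intro!: inner_lattice_Ints lattice_diff simple_root_lattice)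
    ultimately show ?thesis unfolding P_def by (metis Ints_minus qpow_add)
  qed
  have Pii: "i = j \<Longrightarrow> P = 1"
    using inner_lattice_Ints[OF assms(3) simple_root_lattice, of i] by (simp add: P_def qpow_minus)
  have EF: "sa [EGen i, FGen j] z = sc (s * P) (act (ff j) (act (ee i) z))"
    using assms(1) by (simp add: sa_two sa_E_weight[OF assms] sa_F_weight[OF _ wE lat(1)] act_sc act_uminus_vec P_def
        del: antipode_word.simps gpar.simps flip: s_def)
  have FE: "sa [FGen j, EGen i] z = sc (s * P) (act (ee i) (act (ff j) z))"
    using assms(1) by (simp add: sa_two s' sa_F_weight[OF assms] sa_E_weight[OF _ wF lat(2)] act_sc act_uminus_vec P'
        del: antipode_word.simps gpar.simps)
  have ef: "act (ee i) (act (ff j) z) = sc s (act (ff j) (act (ee i) z)) + (if i = j then sc (br (\<mu> \<bullet> simple_root i)) z else 0)"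
    using act_E_F[OF assms(1), of i j] weight_vector_KI[OF assms, of i] assms(2)
    by (cases "i = j") (simp_all add: s_def weight_vector_def br_def diff_divide_distrib V.scale_left_diff_distrib V.scale_right_diff_distrib
        del: gpar.simps)
  have K: "sc (1 / (q - inverse q)) (sa [KGen i] z - sa [KInvGen i] z) = sc (- br (\<mu> \<bullet> simple_root i)) z"
    unfolding sa_K_weight[OF assms]
    by (simp add: br_def diff_divide_distrib flip: V.scale_left_diff_distrib)
  show ?thesis
  proof (cases "i = j")
    case True
    have "sc s (sa [FGen j, EGen i] z) = sc (s * P) (act (ff j) (act (ee i) z)) + sc (br (\<mu> \<bullet> simple_root i)) z"
      unfolding FE ef using True Pii[OF True] ss by (simp add: V.scale_right_distrib flip: mult.assoc)
    then show ?thesis unfolding s_def[symmetric] EF using True K by (simp del: antipode_word.simps)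
  next
    case False
    have "s * (s * P) * s = s * P" using ss by (simp add: ac_simps) 
    then show ?thesis unfolding s_def[symmetric] EF FE ef using False by simp
  qed
qed

text \<open>The antipode is defined on the free algebra; its compatibility with these relations is
  verified on weight vectors, which span. The sign \<open>\<tau>\<close> from splitting S of a
  product depends only on parities, and all words in one relation have equal parity, so it factors
  out.\<close>

lemma sa_basic_rels:
  assumes B: "covec B" and u: "u \<in> C"
  shows "basic_rels q (\<lambda>x. B (sa x u))"
proof -
  define \<tau> :: "'n gen list \<Rightarrow> 'n gen list \<Rightarrow> nat \<Rightarrow> complex"
    where "\<tau> x y p = (-1) ^ (wpar x * ((p + wpar y) mod 2)) * (-1) ^ (p * wpar y)" for x y p
  have lift: "B (sa (x @ w @ y) u) = \<tau> x y (wpar w) * B (sa y (sa w (sa x u)))" for x w y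
    using u by (simp add: sa_append[of u x "w @ y"] sa_append[of "sa x u" w y] act_sc covec_sc[OF B] \<tau>_def wpar_append)
  have on_weights: "A (sa w z) = (\<Sum>k<n. c k * A (sa (w' k) z))"
    if "covec A" "z \<in> C" "\<And>z \<mu>. z \<in> C \<Longrightarrow> weight_vector q sc M \<mu> z \<Longrightarrow> \<mu> \<in> weight_lattice \<Longrightarrow>
      A (sa w z) = (\<Sum>k<n. c k * A (sa (w' k) z))" for A z w c w' and n :: nat
  proof (rule covec_ext_WB[OF covec_act[OF that(1)] _ _ that(2)])
    show "covec (\<lambda>z. \<Sum>k<n. c k * A (sa (w' k) z))"
      using covec_act[OF that(1)]
      by (simp add: covec_def sum.distrib distrib_left sum_distrib_left ac_simps act_add_vec act_sc)
    show "A (sa w b) = (\<Sum>k<n. c k * A (sa (w' k) b))" if "b \<in> WB" for b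
      using that wt[OF that] WB_in_C \<open>\<And>z \<mu>. z \<in> C \<Longrightarrow> weight_vector q sc M \<mu> z \<Longrightarrow> \<mu> \<in> weight_lattice \<Longrightarrow>
      A (sa w z) = (\<Sum>k<n. c k * A (sa (w' k) z))\<close> by blast
  qed
  have KX: "B (sa (x @ KGen i # XG o' j # y) u) =
      qpow q (osg o' * (simple_root i \<bullet> simple_root j)) * B (sa (x @ XG o' j # KGen i # y) u)" for x y i j o'
  proof -
    define A where "A = (\<lambda>z. B (sa y z))"
    have A: "covec A" unfolding A_def by (rule covec_act[OF B])
    have "A (sa [KGen i, XG o' j] (sa x u)) =
        (\<Sum>k<(1::nat). qpow q (osg o' * (simple_root i \<bullet> simple_root j)) * A (sa [XG o' j, KGen i] (sa x u)))"
      by (rule on_weights[OF A]) (use u in \<open>simp_all add: sa_K_X_weight covec_sc[OF A] del: antipode_word.simps\<close>)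
    then show ?thesis
      using lift[of x "[KGen i, XG o' j]" y] lift[of x "[XG o' j, KGen i]" y]
      by (simp add: A_def wpar_Cons del: antipode_word.simps)
  qed
  have EF: "B (sa (x @ EGen i # FGen j # y) u) =
        (-1) ^ (gpar (EGen i) * gpar (FGen j)) * B (sa (x @ FGen j # EGen i # y) u) +
        (if i = j then (B (sa (x @ KGen i # y) u) - B (sa (x @ KInvGen i # y) u)) / (q - inverse q) else 0)" for x y i j
  proof -
    define A where "A = (\<lambda>z. B (sa y z))"
    define s :: complex where "s = (-1) ^ (gpar (EGen i) * gpar (FGen j))"
    define D where "D = (if i = j then 1 / (q - inverse q) else 0)"
    have A: "covec A" unfolding A_def by (rule covec_act[OF B])
    define c where "c k = (if k = 0 then s else if k = 1 then D else - D)" for k :: nat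
    define w' where "w' k = (if k = 0 then [FGen j, EGen i] else if k = 1 then [KGen i] else [KInvGen i])" for k :: nat
    have three: "{..<3} = {0, 1, 2 :: nat}" by auto
    have "A (sa [EGen i, FGen j] (sa x u)) = (\<Sum>k<3. c k * A (sa (w' k) (sa x u)))"
    proof (rule on_weights[OF A])
      fix z \<mu> assume z: "z \<in> C" "weight_vector q sc M \<mu> z" "\<mu> \<in> weight_lattice"
      show "A (sa [EGen i, FGen j] z) = (\<Sum>k<3. c k * A (sa (w' k) z))"
        unfolding sa_E_F_weight[OF z] s_def[symmetric] three using z(1)
        by (cases "i = j") (simp_all add: c_def w'_def D_def covec_add[OF A] covec_sc[OF A] covec_diff[OF A] diff_divide_distrib
            del: antipode_word.simps)
    qed (use u in auto)
    then have e: "B (sa y (sa [EGen i, FGen j] (sa x u))) = s * B (sa y (sa [FGen j, EGen i] (sa x u))) +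
        D * B (sa y (sa [KGen i] (sa x u))) - D * B (sa y (sa [KInvGen i] (sa x u)))"
      unfolding three by (simp add: c_def w'_def A_def del: antipode_word.simps)
    have wp: "wpar [EGen i, FGen j] = wpar [FGen j, EGen i]" by (simp add: wpar_Cons)
    note e' = arg_cong[OF e, of "\<lambda>c. \<tau> x y (wpar [EGen i, FGen j]) * c"]
    have l1: "B (sa (x @ EGen i # FGen j # y) u) =
        \<tau> x y (wpar [EGen i, FGen j]) * B (sa y (sa [EGen i, FGen j] (sa x u)))"
      using lift[of x "[EGen i, FGen j]" y] by (simp del: antipode_word.simps)
    have l2: "B (sa (x @ FGen j # EGen i # y) u) =
        \<tau> x y (wpar [EGen i, FGen j]) * B (sa y (sa [FGen j, EGen i] (sa x u)))"
      using lift[of x "[FGen j, EGen i]" y] unfolding wp by (simp del: antipode_word.simps)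
    show ?thesis
    proof (cases "i = j")
      case True
      have "wpar [EGen i, FGen j] = 0" using True by (simp add: wpar_Cons)
      then have l3: "B (sa (x @ KGen i # y) u) = \<tau> x y (wpar [EGen i, FGen j]) * B (sa y (sa [KGen i] (sa x u)))"
        and l4: "B (sa (x @ KInvGen i # y) u) = \<tau> x y (wpar [EGen i, FGen j]) * B (sa y (sa [KInvGen i] (sa x u)))"
        using lift[of x "[KGen i]" y] lift[of x "[KInvGen i]" y] by (simp_all add: wpar_Cons del: antipode_word.simps)
      show ?thesis
        unfolding s_def[symmetric] l1 l2 l3 l4 e' using True
        by (simp add: D_def algebra_simps diff_divide_distrib del: antipode_word.simps)
    next
      case False
      then show ?thesis
        unfolding s_def[symmetric] l1 l2 e' by (simp add: D_def del: antipode_word.simps)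
    qed
  qed
  have KI: "B (sa (x @ KInvGen i # KGen i # y) u) = B (sa (x @ y) u)" for x y i
  proof -
    have "sa [KInvGen i, KGen i] z = z" if "z \<in> C" for z
      using that by (simp add: sa_two sa_K act_KI_K del: antipode_word.simps)
    then show ?thesis
      using lift[of x "[KInvGen i, KGen i]" y] lift[of x "[]" y] u by (simp add: wpar_Cons act_1 del: antipode_word.simps(2))
  qed
  show ?thesis
    unfolding basic_rels_def
    using KI KX[of _ _ True] KX[of _ _ False] EF by (simp del: antipode_word.simps gpar.simps)
qed

lemma wcov_KI: "wcov \<mu> A \<Longrightarrow> \<mu> \<in> weight_lattice \<Longrightarrow> v \<in> C \<Longrightarrow> A (act (kinv i) v) = qpow q (- (\<mu> \<bullet> simple_root i)) * A v"
proof -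
  assume *: "wcov \<mu> A" "\<mu> \<in> weight_lattice" "v \<in> C"
  have "A v = A (act (kk i) (act (kinv i) v))" using * by (simp add: act_K_KI)
  also have "\<dots> = qpow q (\<mu> \<bullet> simple_root i) * A (act (kinv i) v)" using * by (simp add: wcov_def)
  finally show ?thesis using * by (simp add: qpow_minus inner_lattice_Ints simple_root_lattice)
qed

lemma wcov_X:
  assumes "wcov \<mu> A" "\<mu> \<in> weight_lattice"
  shows "wcov (\<mu> - osg o' *\<^sub>R simple_root j) (\<lambda>v. A (act (wrd [XG o' j]) v))"
  unfolding wcov_def
proof (intro conjI allI ballI)
  have Ac: "covec A" using assms by (simp add: wcov_def)
  show "covec (\<lambda>v. A (act (wrd [XG o' j]) v))" by (rule covec_act[OF Ac])
  fix i v assume v: "v \<in> C"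
  let ?c = "osg o' * (simple_root i \<bullet> simple_root j)"
  have c: "?c \<in> \<int>" by (intro Ints_mult inner_lattice_Ints simple_root_lattice) simp
  have m: "\<mu> \<bullet> simple_root i \<in> \<int>" by (intro inner_lattice_Ints simple_root_lattice assms)
  have "qpow q ?c * A (act (wrd [XG o' j]) (act (kk i) v)) = A (act (kk i) (act (wrd [XG o' j]) v))"
    using v by (simp add: act_K_X covec_sc[OF Ac])
  also have "\<dots> = qpow q (\<mu> \<bullet> simple_root i) * A (act (wrd [XG o' j]) v)"
    using assms v by (simp add: wcov_def)
  finally have "A (act (wrd [XG o' j]) (act (kk i) v)) = qpow q (- ?c) * qpow q (\<mu> \<bullet> simple_root i) * A (act (wrd [XG o' j]) v)"
    unfolding qpow_minus[OF c] by (simp add: field_simps)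
  also have "qpow q (- ?c) * qpow q (\<mu> \<bullet> simple_root i) = qpow q (- ?c + \<mu> \<bullet> simple_root i)"
    using c m by (intro qpow_add[symmetric]) auto
  also have "- ?c + \<mu> \<bullet> simple_root i = (\<mu> - osg o' *\<^sub>R simple_root j) \<bullet> simple_root i"
    by (simp add: inner_diff_left inner_commute[of "simple_root j"])
  finally show "A (act (wrd [XG o' j]) (act (kk i) v))
    = qpow q ((\<mu> - osg o' *\<^sub>R simple_root j) \<bullet> simple_root i) * A (act (wrd [XG o' j]) v)" .
qed

lemma wcov_not_weight:
  assumes "wcov \<mu> A" "\<mu> \<in> weight_lattice" "\<mu> \<notin> wts" "v \<in> C"
  shows "A v = 0"
proof -
  have Ac: "covec A" using assms by (simp add: wcov_def)
  have "A b = 0" if "b \<in> WB" for b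
  proof (rule ccontr)
    assume "A b \<noteq> 0"
    then have "\<mu> = wt b"
      using wcov_weight_vector[OF assms(1) _ WB_in_C[OF that] _ assms(2)] wt[OF that] by blast
    then show False using assms(3) that by (auto simp: wts_def)
  qed
  then show ?thesis using covec_expand[OF WB Ac assms(4)] by simp
qed

lemma extremal_tm:
  assumes A: "wcov \<mu> A" "\<mu> \<in> weight_lattice" and v: "v \<in> C" "weight_vector q sc M \<mu> v" "A v = 1"
    "\<And>i. act (wrd [XG o' i]) v = 0"
  shows "extremal o' \<mu> (\<lambda>x. A (act (wrd x) v))"
proof -
  have Ac: "covec A" using A by (simp add: wcov_def)
  show ?thesis
    unfolding extremal_def
  proof (intro conjI allI)
    show "basic_rels q (\<lambda>x. A (act (wrd x) v))" by (rule tm_basic_rels[OF Ac v(1)])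
    show "A (act (wrd (x @ [XG o' i])) v) = 0" for x i
      using v by (simp add: act_append covec_0[OF Ac])
    show "A (act (wrd (x @ [KGen i])) v) = qpow q (\<mu> \<bullet> simple_root i) * A (act (wrd x) v)" for x i
      using v by (simp add: act_append weight_vector_def act_sc covec_sc[OF Ac])
    show "A (act (wrd (KGen i # x)) v) = qpow q (\<mu> \<bullet> simple_root i) * A (act (wrd x) v)" for x i
      using A v by (simp add: act_Cons[of v "KGen i" x] wcov_def)
  qed (use v in \<open>simp add: act_Nil\<close>)
qed


text \<open>The antipode negates the weight and exchanges the two arguments: vanishing under X on
  the right now means that \<open>A\<close> composed with X is 0. This holds because that covector
  would have a weight outside \<open>wts\<close>.\<close>

lemma extremal_sm:
  assumes A: "wcov \<mu> A" "\<mu> \<in> weight_lattice" and v: "v \<in> C" "weight_vector q sc M \<mu> v" "A v = 1"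
    and X: "\<And>i. \<mu> - osg o' *\<^sub>R simple_root i \<notin> wts"
  shows "extremal o' (- \<mu>) (\<lambda>x. A (sa x v))"
proof -
  have Ac: "covec A" using A by (simp add: wcov_def)
  have AX: "A (act (wrd [XG o' i]) y) = 0" if "y \<in> C" for y i
    by (rule wcov_not_weight[OF wcov_X[OF A] _ X that]) (intro lattice_diff lattice_scaleR A simple_root_lattice osg_Ints)
  have ASX: "A (sa [XG o' i] y) = 0" if "y \<in> C" for y i
  proof (cases o')
    case True
    then show ?thesis
      using AX[of "act (kinv i) y" i] that by (simp add: scl_1 act_uminus act_mult covec_uminus[OF Ac])
  next
    case False
    then have "A (act (kk i) (act (ff i) y)) = 0"
      using AX[of y i] that A by (simp add: wcov_def)
    then show ?thesis
      using False that by (simp add: scl_1 act_uminus act_mult covec_uminus[OF Ac])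
  qed
  show ?thesis
    unfolding extremal_def
  proof (intro conjI allI)
    show "basic_rels q (\<lambda>x. A (sa x v))" by (rule sa_basic_rels[OF Ac v(1)])
    show "A (sa (x @ [XG o' i]) v) = 0" for x i
      using ASX[of "sa x v" i] v by (simp add: sa_append covec_sc[OF Ac] del: antipode_word.simps)
    show "A (sa (x @ [KGen i]) v) = qpow q (- \<mu> \<bullet> simple_root i) * A (sa x v)" for x i
      using v wcov_KI[OF A] by (simp add: sa_append covec_sc[OF Ac] sa_K del: antipode_word.simps)
    show "A (sa (KGen i # x) v) = qpow q (- \<mu> \<bullet> simple_root i) * A (sa x v)" for x i
      using v sa_append[OF v(1), of "[KGen i]" x] sa_K_weight[OF v(1,2) A(2), of i]
      by (simp add: act_sc covec_sc[OF Ac] del: antipode_word.simps)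
  qed (use v in \<open>simp add: act_1\<close>)
qed

end

section \<open>Highest and lowest weight vectors\<close>

context hw_mod
begin

lemma l_wts: "l \<in> wts"
  using weight_in_wts[OF vp_C vp_nonzero vp_weight l_lattice] .

lemma above_l: "l + simple_root i \<notin> wts"
proof
  assume "l + simple_root i \<in> wts"
  then obtain js where "l + simple_root i = l - (\<Sum>j\<leftarrow>js. simple_root j)" using wts_le by blast
  then have "(\<Sum>j\<leftarrow>i # js. simple_root j) = 0" by (simp add: algebra_simps)
  then show False using two_rho_sum_list_pos[of "i # js"] by simp
qed

lemma below_minus_l: "- l - simple_root i \<notin> wts"
  using wts_uminus[of "- l - simple_root i"] above_l[of i] by (auto simp: algebra_simps)

lemma sum_simple_root_coords: "(\<Sum>k\<in>UNIV. simple_root i $ k) = (if i = Max UNIV then 1 else 0)"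
  by (simp add: simple_root_nxt eps_nth sum_subtractf)

lemma wpar_F_word: "wpar (map FGen js) = length (filter (\<lambda>j. j = Max UNIV) js) mod 2"
  by (induction js) (auto simp: wpar_Cons mod_simps)

lemma sum_list_simple_root_coords:
  "(\<Sum>k\<in>UNIV. (\<Sum>j\<leftarrow>js. simple_root j) $ k) = real (length (filter (\<lambda>j. j = Max UNIV) js))"
  by (induction js) (simp_all add: sum.distrib sum_simple_root_coords)

text \<open>Both equations between functionals come from \<open>extremal_unique\<close>: the first
  two sides are extremal for the highest weight \<open>l\<close>, the other two for the lowest
  weight \<open>- l\<close>.\<close>

lemma lowest_weight_vector:
  obtains z where "z \<in> WB" "weight_vector q sc M (- l) z" "wt z = - l" "vpar M z = p0"
    "tm xi vp = sm (cf WB z) z" "sm xi vp = tm (cf WB z) z"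
proof -
  obtain z where z: "z \<in> WB" "z \<noteq> 0" "weight_vector q sc M (- l) z" "wt z = - l"
    using wts_weight_vector[OF wts_uminus[OF l_wts]] by metis
  have zC: "z \<in> C" by (rule WB_in_C[OF z(1)])
  have lat: "- l \<in> weight_lattice" by (rule lattice_uminus[OF l_lattice])
  have zeta: "wcov (- l) (cf WB z)" using cf_wcov[OF z(1)] z(4) by simp
  have zz: "cf WB z z = 1" using cf_basis[OF WB z(1), of z] by simp
  note cov = cf_covec[OF WB, of z]
  have Fz: "act (wrd [XG False i]) z = 0" for i
  proof (rule ccontr)
    assume "act (wrd [XG False i]) z \<noteq> 0"
    then have "- l + osg False *\<^sub>R simple_root i \<in> wts"
      using zC by (intro weight_in_wts[OF _ _ weight_vector_X[OF zC z(3) lat]] lattice_add lattice_scaleR lat simple_root_lattice) auto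
    then show False using below_minus_l[of i] by simp
  qed
  have "extremal True (- (- l)) (\<lambda>x. cf WB z (sa x z))"
    by (rule extremal_sm[OF zeta lat zC z(3) zz]) (use below_minus_l in simp)
  then have "(\<lambda>x. cf WB z (sa x z)) = (\<lambda>x. xi (act (wrd x) vp))"
    using extremal_unique[OF _ extremal_xi l_lattice] by simp
  then have 1: "tm xi vp = sm (cf WB z) z"
    by (intro linear_functional_eqI[OF tm_linear[OF xi_covec vp_C] sm_linear[OF cov zC]])
       (simp add: tm_def sm_wrd[OF cov zC] fun_eq_iff)
  have "extremal False (- l) (\<lambda>x. xi (sa x vp))"
    by (rule extremal_sm[OF xi_wcov l_lattice vp_C vp_weight xi_vp]) (use above_l in simp)
  moreover have "extremal False (- l) (\<lambda>x. cf WB z (act (wrd x) z))"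
    by (rule extremal_tm[OF zeta lat zC z(3) zz Fz])
  ultimately have "(\<lambda>x. xi (sa x vp)) = (\<lambda>x. cf WB z (act (wrd x) z))"
    by (rule extremal_unique[OF _ _ lat])
  then have 2: "sm xi vp = tm (cf WB z) z"
    by (intro linear_functional_eqI[OF sm_linear[OF xi_covec vp_C] tm_linear[OF cov zC]])
       (simp add: tm_def sm_wrd[OF xi_covec vp_C] fun_eq_iff)
  obtain x where "z = act x vp" using C_obtain[OF zC] by blast
  then have "cf WB z (act x vp) \<noteq> 0" using zz by simp
  then obtain js where js: "cf WB z (act (wrd (map FGen js)) vp) \<noteq> 0" "- l = l - (\<Sum>j\<leftarrow>js. simple_root j)"
    using generated_weight[OF vp_C vp_weight l_lattice vp_E zeta lat] by blast
  \<comment> \<open>Descending from \<open>l\<close> to \<open>- l\<close> uses simple roots with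
    sum 2 l. Summing coordinates counts the copies of alpha_n, so the odd letter f_n occurs an even
    number of times.\<close>
  have even: "wpar (map FGen js) = 0"
  proof -
    have "(\<Sum>j\<leftarrow>js. simple_root j) = l + l" using js(2) by (simp add: algebra_simps)
    then have "real (length (filter (\<lambda>j. j = Max UNIV) js)) = 2 * (\<Sum>k\<in>UNIV. l $ k)"
      unfolding sum_list_simple_root_coords[symmetric] by (simp add: sum_distrib_left)
    moreover have "(\<Sum>k\<in>UNIV. l $ k) \<in> \<int>" using l_lattice by (auto intro!: Ints_sum simp: weight_lattice_iff)
    ultimately obtain m :: int where "real (length (filter (\<lambda>j. j = Max UNIV) js)) = 2 * of_int m" by (auto elim: Ints_cases)
    then have "int (length (filter (\<lambda>j. j = Max UNIV) js)) = 2 * m" by linarith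
    then have "even (length (filter (\<lambda>j. j = Max UNIV) js))" by presburger
    then show ?thesis unfolding wpar_F_word by simp
  qed
  have "act (wrd (map FGen js)) vp \<in> part M p0"
    using act_word_part[OF vpar_less_2 vp_part, of "map FGen js"] even by simp
  then have "vpar M z = p0"
    using hcovD[OF cf_hcov[OF WB z(1)] vpar_less_2] js(1) by metis
  with that z 1 2 show ?thesis by blast
qed

end

section \<open>Orthogonality relations\<close>

context haar_irr
begin

lemma G_forms:
  assumes NM: "N = M" and Bs: "M.hbasis Bs"
  shows "\<exists>c. c * (\<Sum>b\<in>Bs. (-1) ^ vpar M b * M.cf Bs b (M.act K b)) = 1 \<and>
    (\<forall>A pa B pb u pu. \<forall>v\<in>M.C. pa < 2 \<and> pb < 2 \<and> pu < 2 \<and> M.hcov pa A \<and> M.hcov pb B \<and> u \<in> part M pu \<longrightarrow>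
      I (fmult (M.tm A v) (M.sm B u)) = c * (-1) ^ pa * A u * B (M.act K v) \<and>
      I (fmult (M.sm B u) (M.tm A v)) = c * (-1) ^ pb * B v * A (M.sa (kword m) u))"
proof -
  have sm: "N.sm = M.sm" and hc: "N.hcov = M.hcov" using NM by simp_all
  obtain c where c: "\<forall>A pa B pb u pu. \<forall>v\<in>M.C. pa < 2 \<and> pb < 2 \<and> pu < 2 \<and> M.hcov pa A \<and> M.hcov pb B \<and> u \<in> part M pu \<longrightarrow>
    I (fmult (M.tm A v) (M.sm B u)) = c * (-1) ^ pa * A u * B (M.act K v)"
    using G1_form[OF NM] unfolding G1_def sm hc by blast
  obtain c' where c': "\<forall>A pa B pb u pu. \<forall>v\<in>M.C. pa < 2 \<and> pb < 2 \<and> pu < 2 \<and> M.hcov pa A \<and> M.hcov pb B \<and> u \<in> part M pu \<longrightarrow>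
    I (fmult (M.sm B u) (M.tm A v)) = c' * (-1) ^ pb * B v * A (M.sa (kword m) u)"
    using G2_form[OF NM] unfolding G2_def sm hc by blast
  \<comment> \<open>Integrating \<open>antipode_pairing\<close> for \<open>xi\<close> and
    \<open>vp\<close> gives 1 on one side and c times the supertrace of K on the other.\<close>
  have cSD: "c * (\<Sum>b\<in>Bs. (-1) ^ vpar M b * M.cf Bs b (M.act K b)) = 1"
  proof -
    let ?s = "\<lambda>b. (-1 :: complex) ^ (((MH.p0 + vpar M b) mod 2) * ((vpar M b + MH.p0) mod 2))"
    have term1: "I (fmult (M.tm MH.xi b) (M.sm (M.cf Bs b) vp)) = c * (-1) ^ MH.p0 * M.cf Bs b (M.act K b)"
      if "b \<in> Bs" for b
      using c M.hbasis_in_C[OF Bs that] MH.xi_hcov M.cf_hcov[OF Bs that] MH.vp_part MH.xi_vp M.vpar_less_2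
      by (metis mult.right_neutral)
    have inT: "fmult (M.tm MH.xi b) (M.sm (M.cf Bs b) vp) \<in> T" if "b \<in> Bs" for b
      using M.hbasis_in_C[OF Bs that] NM
      by (intro T_fmult tm_T MH.xi_covec) (use sm_T[of "M.cf Bs b" vp] M.cf_covec[OF Bs] in auto)
    have "I (\<lambda>x. \<Sum>b\<in>Bs. ?s b * fmult (M.tm MH.xi b) (M.sm (M.cf Bs b) vp) x) = I (\<lambda>x. MH.xi vp * counit x)"
      by (simp only: M.antipode_pairing[OF Bs MH.xi_hcov M.vpar_less_2 MH.vp_part M.vpar_less_2])
    then have "(\<Sum>b\<in>Bs. ?s b * I (fmult (M.tm MH.xi b) (M.sm (M.cf Bs b) vp))) = 1"
      using inT by (simp add: I_sum I_cmult T_cmult T_counit I_counit)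
    then have "(\<Sum>b\<in>Bs. ?s b * (c * (-1) ^ MH.p0 * M.cf Bs b (M.act K b))) = 1"
      by (simp add: term1 del: neg_one_power_mod)
    moreover have "?s b * (c * (-1) ^ MH.p0 * M.cf Bs b (M.act K b)) = c * ((-1) ^ vpar M b * M.cf Bs b (M.act K b))" for b
      using M.vpar_less_2[of vp] M.vpar_less_2[of b] by (auto simp: less_2_cases_iff)
    ultimately show ?thesis by (simp only: sum_distrib_left)
  qed
  \<comment> \<open>By \<open>lowest_weight_vector\<close> one functional is a product in both
    orders: tm times sm at the highest weight, sm times tm at the lowest. The first form gives c and
    the second c', each with the factor q^(kvec m, l): K at weight l, and its inverse at weight
    -l.\<close>
  have "c = c'"
  proof -
    obtain z where z: "z \<in> M.WB" "weight_vector q sc M (- l) z" "M.wt z = - l" "vpar M z = MH.p0"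
      "M.tm MH.xi vp = M.sm (M.cf M.WB z) z" "M.sm MH.xi vp = M.tm (M.cf M.WB z) z"
      using MH.lowest_weight_vector by blast
    let ?\<zeta> = "M.cf M.WB z"
    have zC: "z \<in> M.C" by (rule M.WB_in_C[OF z(1)])
    have \<zeta>: "M.hcov MH.p0 ?\<zeta>" "M.covec ?\<zeta>" "?\<zeta> z = 1"
      using M.cf_hcov[OF M.WB z(1)] M.cf_covec[OF M.WB] M.cf_basis[OF M.WB z(1), of z] z(4) by simp_all
    have zp: "z \<in> part M MH.p0" using M.WB_part[OF z(1)] z(4) by simp
    have lat: "- l \<in> weight_lattice" by (rule lattice_uminus[OF MH.l_lattice])
    have "I (fmult (M.tm MH.xi vp) (M.sm MH.xi vp)) = c * (-1) ^ MH.p0 * MH.xi vp * MH.xi (M.act K vp)"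
      using c MH.xi_hcov MH.vp_part M.vpar_less_2 MH.vp_C by blast
    moreover have "I (fmult (M.sm ?\<zeta> z) (M.tm ?\<zeta> z)) = c' * (-1) ^ MH.p0 * ?\<zeta> z * ?\<zeta> (M.sa (kword m) z)"
      using c' \<zeta>(1) zp M.vpar_less_2 zC by blast
    moreover have "MH.xi (M.act K vp) = qpow q (kvec m \<bullet> l)"
      unfolding M.act_kword[OF MH.vp_C MH.vp_weight MH.l_lattice] by (simp add: M.covec_sc[OF MH.xi_covec])
    moreover have "?\<zeta> (M.sa (kword m) z) = qpow q (kvec m \<bullet> l)"
    proof -
      have int: "kvec m \<bullet> l \<in> \<int>" by (intro inner_lattice_Ints kvec_lattice MH.l_lattice)
      have "z = M.sa (kword m) (M.act K z)" using M.sa_kword[OF nEF zC] by simp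
      also have "\<dots> = sc (qpow q (kvec m \<bullet> - l)) (M.sa (kword m) z)"
        using zC by (simp add: M.act_kword[OF zC z(2) lat] M.act_sc)
      finally have "?\<zeta> z = qpow q (kvec m \<bullet> - l) * ?\<zeta> (M.sa (kword m) z)"
        using M.covec_sc[OF \<zeta>(2)] zC by (metis M.act_C)
      then show ?thesis using \<zeta>(3) int M.qpow_minus[OF int] by (simp add: field_simps)
    qed
    ultimately show ?thesis using z(5,6) \<zeta>(3) by simp
  qed
  show ?thesis
  proof (rule exI[of _ c], rule conjI[OF cSD], intro allI ballI impI conjI)
    fix A pa B pb u pu v
    assume *: "v \<in> M.C" "pa < 2 \<and> pb < 2 \<and> pu < 2 \<and> M.hcov pa A \<and> M.hcov pb B \<and> u \<in> part M pu"
    show "I (fmult (M.tm A v) (M.sm B u)) = c * (-1) ^ pa * A u * B (M.act K v)"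
      using c * by blast
    show "I (fmult (M.sm B u) (M.tm A v)) = c * (-1) ^ pb * B v * A (M.sa (kword m) u)"
      using c' * \<open>c = c'\<close> by blast
  qed
qed

end

section \<open>From covectors back to the chosen bases\<close>

lemma hw_mod_exists:
  assumes "generic_q q" "vector_space sc" "irreducible_highest_weight q sc M l" "l \<in> weight_lattice"
  obtains v where "hw_mod q sc M l v"
proof -
  obtain v where "highest_weight_generator q sc M l v"
    using assms(3) by (auto simp: irreducible_highest_weight_def)
  then have "hw_mod q sc M l v"
    using assms by (intro hw_mod.intro uq_mod.intro uq_mod_axioms.intro hw_mod_axioms.intro)
      (auto simp: irreducible_highest_weight_def)
  then show ?thesis by (rule that)
qed

lemma (in uq_mod) homogeneous_basis_hbasis: "homogeneous_basis sc M d w \<Longrightarrow> hbasis (w ` {1..d})"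
  by (simp add: homogeneous_basis_def hbasis_def)

lemma (in uq_mod) mat_elem_tm: "mat_elem sc M d w i j = tm (cf (w ` {1..d}) (w i)) (w j)"
  by (simp add: mat_elem_def tm_def)

lemma eps_first_dominant: "eps (Min (UNIV :: 'n::{finite,linorder} set)) \<in> dominant_weights"
proof -
  have "eps (Min UNIV :: 'n) $ j \<le> eps (Min UNIV :: 'n) $ i" if "i \<le> j" for i j :: 'n
  proof (cases "j = Min UNIV")
    case True
    then have "i = Min UNIV" using that by (intro antisym) (auto intro: Min_le)
    then show ?thesis using True by simp
  qed (simp add: eps_nth)
  then show ?thesis by (simp add: dominant_weights_iff eps_nth)
qed

lemma Tq_closed:
  "f \<in> Tq q sc V d w \<Longrightarrow> g \<in> Tq q sc V d w \<Longrightarrow> (\<lambda>x. f x + g x) \<in> Tq q sc V d w"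
  "f \<in> Tq q sc V d w \<Longrightarrow> (\<lambda>x. c * f x) \<in> Tq q sc V d w"
  "f \<in> Tq q sc V d w \<Longrightarrow> g \<in> Tq q sc V d w \<Longrightarrow> fmult f g \<in> Tq q sc V d w"
  "counit \<in> Tq q sc V d w"
  "f \<in> Tq q sc V d w \<Longrightarrow> fantipode f \<in> Tq q sc V d w"
  unfolding Tq_def hopf_subalgebra_def by blast+

lemma haar_alg_Tq:
  assumes "haar_functional (Tq q sc V d w) I"
  shows "haar_alg (Tq q sc V d w) I"
  by (unfold_locales; (rule assms | rule Tq_closed; assumption))

text \<open>\<open>Tq\<close> is an intersection, so the argument runs in an arbitrary Hopf
  subalgebra with the vector matrix elements. It contains an extremal functional for every dominant
  weight, hence all matrix elements of the irreducible modules.\<close>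

lemma tm_in_Tq:
  fixes V M :: "('n::{finite,linorder}, 'v::ab_group_add) supermodule"
  assumes V: "hw_mod q sc V (eps (Min UNIV)) vV" and basis: "homogeneous_basis sc V d w"
    and M: "hw_mod q sc M l vM" and l: "l \<in> dominant_weights"
    and A: "uq_mod.covec sc M A" and v: "v \<in> mcarrier M"
  shows "uq_mod.tm M A v \<in> Tq q sc V d w"
  unfolding Tq_def
proof (rule InterI, clarsimp)
  interpret V: hw_mod q sc V "eps (Min UNIV)" vV by (rule V)
  interpret M: hw_mod q sc M l vM by (rule M)
  fix H assume H: "hopf_subalgebra q H" "\<forall>i\<in>{Suc 0..d}. \<forall>j\<in>{Suc 0..d}. mat_elem sc V d w i j \<in> H"
  interpret H: hopf_sub q H by unfold_locales (rule H(1))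
  have "V.tm A v \<in> H" if "V.covec A" "v \<in> V.C" for A v
    by (rule V.tm_in_hopf_sub[OF H.hopf_sub_axioms V.homogeneous_basis_hbasis[OF basis] _ that])
       (use H(2) in \<open>auto simp: V.mat_elem_tm\<close>)
  then interpret VH: vector_rep q sc V vV H by unfold_locales
  obtain f where "f \<in> H" "V.extremal True l (\<lambda>u. f (wrd u))" using VH.dominant_extremal[OF l] by blast
  then show "M.tm A v \<in> H"
    using M.tm_in_hopf_sub_extremal[OF H.hopf_sub_axioms _ _ A v] by blast
qed

theorem lemma1:
  fixes q :: complex
    and sc :: "complex \<Rightarrow> 'v::ab_group_add \<Rightarrow> 'v"
    and W :: "'n::{finite,linorder} euclid \<Rightarrow> ('n, 'v) supermodule"
    and d :: "'n euclid \<Rightarrow> nat"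
    and w :: "'n euclid \<Rightarrow> nat \<Rightarrow> 'v"
    and K :: "'n falg"
    and haar :: "'n functional \<Rightarrow> complex"
    and t t' :: "'n euclid \<Rightarrow> nat \<Rightarrow> nat \<Rightarrow> 'n functional"
    and p :: "'n euclid \<Rightarrow> nat \<Rightarrow> nat"
  assumes t: "\<And>l. t l = mat_elem sc (W l) (d l) (w l)"
    and t': "\<And>l. t' l = dual_mat_elem sc (W l) (d l) (w l)"
    and p: "\<And>l i. p l i = vpar (W l) (w l i)"
    and q_nonzero: "q \<noteq> 0"
    and q_generic: "\<And>m::nat. m > 0 \<Longrightarrow> q ^ m \<noteq> 1"
    and ambient: "vector_space sc"
    and W: "\<And>l. l \<in> dominant_weights \<Longrightarrow> irreducible_highest_weight q sc (W l) l"
    and W_vector: "\<exists>v\<in>part (W (eps (Min UNIV))) 0.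
          highest_weight_generator q sc (W (eps (Min UNIV))) (eps (Min UNIV)) v"
    and basis: "\<And>l. l \<in> dominant_weights \<Longrightarrow> homogeneous_basis sc (W l) (d l) (w l)"
    and K: "is_K2rho q K"
    and haar: "haar_functional
          (Tq q sc (W (eps (Min UNIV))) (d (eps (Min UNIV))) (w (eps (Min UNIV)))) haar"
    and haar_t: "\<And>l i j. l \<in> dominant_weights \<Longrightarrow> l \<noteq> 0 \<Longrightarrow> i \<in> {1..d l} \<Longrightarrow> j \<in> {1..d l} \<Longrightarrow>
          haar (t l i j) = 0"
  shows "\<forall>l\<in>dominant_weights. \<forall>m\<in>dominant_weights.
     \<forall>i\<in>{1..d l}. \<forall>j\<in>{1..d l}. \<forall>r\<in>{1..d m}. \<forall>s\<in>{1..d m}.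
       haar (fmult (t l i j) (t' m r s)) * (-1) ^ (p l j * p m r + p l i + p l j)
         = (if l = m \<and> i = r then t l s j K / SDq sc (W l) (d l) (w l) K else 0) \<and>
       haar (fmult (t' l i j) (t m r s)) * (-1) ^ (p l j * p m r)
         = (if l = m \<and> j = s then t' l i r K / SDq sc (W l) (d l) (w l) K else 0)"
proof (intro ballI conjI)
  fix l m i j r s
  assume l: "l \<in> dominant_weights" and m: "m \<in> dominant_weights"
    and i: "i \<in> {1..d l}" and j: "j \<in> {1..d l}" and r: "r \<in> {1..d m}" and s: "s \<in> {1..d m}"
  have gq: "generic_q q" by unfold_locales (use q_nonzero q_generic in auto)
  have lat: "l \<in> weight_lattice" "m \<in> weight_lattice" "eps (Min UNIV :: 'n) \<in> weight_lattice"
    using l m eps_first_dominant by (auto simp: dominant_weights_def)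
  obtain vl where vl: "hw_mod q sc (W l) l vl" using hw_mod_exists[OF gq ambient W[OF l] lat(1)] by blast
  obtain vm where vm: "hw_mod q sc (W m) m vm" using hw_mod_exists[OF gq ambient W[OF m] lat(2)] by blast
  obtain vV where vV: "hw_mod q sc (W (eps (Min UNIV))) (eps (Min UNIV)) vV"
    using hw_mod_exists[OF gq ambient W[OF eps_first_dominant] lat(3)] by blast
  let ?T = "Tq q sc (W (eps (Min UNIV))) (d (eps (Min UNIV))) (w (eps (Min UNIV)))"
  note inT = tm_in_Tq[OF vV basis[OF eps_first_dominant]]
  interpret L: hw_mod q sc "W l" l vl by (rule vl)
  interpret R: hw_mod q sc "W m" m vm by (rule vm)
  interpret HA: haar_alg ?T haar by (rule haar_alg_Tq[OF haar])
  obtain km where km: "K = wrd (kword km)" using K by (auto simp: is_K2rho_def kword_eq)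
  have K': "is_K2rho q (wrd (kword km))" using K unfolding km .
  have smT: "R.sm B u \<in> ?T" if "R.covec B" "u \<in> R.C" for B u
    unfolding R.sm_def by (rule Tq_closed(5)[OF inT[OF vm m that]])
  have smTl: "L.sm B u \<in> ?T" if "L.covec B" "u \<in> L.C" for B u
    unfolding L.sm_def by (rule Tq_closed(5)[OF inT[OF vl l that]])
  define bl where "bl = w l ` {1..d l}"
  define bm where "bm = w m ` {1..d m}"
  have hbl: "L.hbasis bl" unfolding bl_def by (rule L.homogeneous_basis_hbasis[OF basis[OF l]])
  have hbm: "R.hbasis bm" unfolding bm_def by (rule R.homogeneous_basis_hbasis[OF basis[OF m]])
  have injl: "inj_on (w l) {1..d l}" using basis[OF l] by (simp add: homogeneous_basis_def)
  have wl: "k \<in> {1..d l} \<Longrightarrow> w l k \<in> bl" for k by (simp add: bl_def)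
  have wm: "k \<in> {1..d m} \<Longrightarrow> w m k \<in> bm" for k by (simp add: bm_def)
  have tl: "t l a b = L.tm (L.cf bl (w l a)) (w l b)" for a b by (simp add: t L.mat_elem_tm bl_def)
  have tm: "t m a b = R.tm (R.cf bm (w m a)) (w m b)" for a b by (simp add: t R.mat_elem_tm bm_def)
  have dl: "t' l a b = (\<lambda>x. (-1) ^ (p l b * (p l b + p l a)) * L.sm (L.cf bl (w l b)) (w l a) x)" for a b
    by (simp add: t' p dual_mat_elem_def L.mat_elem_tm L.sm_def bl_def)
  have dm: "t' m a b = (\<lambda>x. (-1) ^ (p m b * (p m b + p m a)) * R.sm (R.cf bm (w m b)) (w m a) x)" for a b
    by (simp add: t' p dual_mat_elem_def R.mat_elem_tm R.sm_def bm_def)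
  note covs = L.cf_covec[OF hbl] R.cf_covec[OF hbm] L.hbasis_in_C[OF hbl] R.hbasis_in_C[OF hbm]
  have h1: "haar (fmult (t l i j) (t' m r s)) = (-1) ^ (p m s * (p m s + p m r)) *
      haar (fmult (L.tm (L.cf bl (w l i)) (w l j)) (R.sm (R.cf bm (w m s)) (w m r)))"
    unfolding tl dm fmult_cmult_right
    by (intro HA.I_cmult HA.T_fmult inT[OF vl l] smT covs wl wm i j r s)
  have h2: "haar (fmult (t' l i j) (t m r s)) = (-1) ^ (p l j * (p l j + p l i)) *
      haar (fmult (L.sm (L.cf bl (w l j)) (w l i)) (R.tm (R.cf bm (w m r)) (w m s)))"
    unfolding tm dl fmult_cmult_left
    by (intro HA.I_cmult HA.T_fmult inT[OF vm m] smTl covs wl wm i j r s)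
  have plp: "L.hcov (p l a) (L.cf bl (w l a)) \<and> w l a \<in> part (W l) (p l a) \<and> p l a < 2" if "a \<in> {1..d l}" for a
    using L.cf_hcov[OF hbl wl[OF that]] L.hbasis_part[OF hbl wl[OF that]] by (simp add: p)
  have pmp: "R.hcov (p m a) (R.cf bm (w m a)) \<and> w m a \<in> part (W m) (p m a) \<and> p m a < 2" if "a \<in> {1..d m}" for a
    using R.cf_hcov[OF hbm wm[OF that]] R.hbasis_part[OF hbm wm[OF that]] by (simp add: p)
  show "haar (fmult (t l i j) (t' m r s)) * (-1) ^ (p l j * p m r + p l i + p l j)
      = (if l = m \<and> i = r then t l s j K / SDq sc (W l) (d l) (w l) K else 0)"
    and "haar (fmult (t' l i j) (t m r s)) * (-1) ^ (p l j * p m r)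
      = (if l = m \<and> j = s then t' l i r K / SDq sc (W l) (d l) (w l) K else 0)"
  proof -
    have "(haar (fmult (t l i j) (t' m r s)) * (-1) ^ (p l j * p m r + p l i + p l j)
      = (if l = m \<and> i = r then t l s j K / SDq sc (W l) (d l) (w l) K else 0)) \<and>
      (haar (fmult (t' l i j) (t m r s)) * (-1) ^ (p l j * p m r)
      = (if l = m \<and> j = s then t' l i r K / SDq sc (W l) (d l) (w l) K else 0))"
    proof (cases "l = m")
      case False
      interpret P1: haar_irr q sc "W l" "W m" ?T haar l vl m vm km
        by unfold_locales (use inT[OF vl l] smT K' in auto)
      \<comment> \<open>In the second integral the matrix element comes from \<open>W m\<close> and
        the antipode from \<open>W l\<close>, so the two modules exchange roles.\<close>
      interpret P2: haar_irr q sc "W m" "W l" ?T haar m vm l vl km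
        by unfold_locales (use inT[OF vm m] smTl K' in auto)
      have "haar (fmult (L.tm (L.cf bl (w l i)) (w l j)) (R.sm (R.cf bm (w m s)) (w m r))) = 0"
        using P1.G1_schur_vB(1)[of "p l i" "L.cf bl (w l i)" "w m r" "p m r" "w l j" "p m s" "R.cf bm (w m s)"]
          plp[OF i] pmp[OF r] pmp[OF s] False covs(3)[OF wl[OF j]] by (simp add: P1.G1_def)
      moreover have "haar (fmult (L.sm (L.cf bl (w l j)) (w l i)) (R.tm (R.cf bm (w m r)) (w m s))) = 0"
        using P2.G2_schur_vB(1)[of "p m r" "R.cf bm (w m r)" "w l i" "p l i" "w m s" "p l j" "L.cf bl (w l j)"]
          plp[OF i] plp[OF j] pmp[OF r] False covs(4)[OF wm[OF s]] by (simp add: P2.G2_def)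
      ultimately show ?thesis unfolding h1 h2 using False by simp
    next
      case True
      interpret P: haar_irr q sc "W l" "W l" ?T haar l vl l vl km
        by unfold_locales (use inT[OF vl l] smTl K' in auto)
      have bml: "bm = bl" using True by (simp add: bm_def bl_def)
      obtain c where c1: "c * (\<Sum>b\<in>bl. (-1) ^ vpar (W l) b * L.cf bl b (L.act K b)) = 1"
        and c2: "\<And>A pa B pb u pu v. v \<in> L.C \<Longrightarrow> pa < 2 \<and> pb < 2 \<and> pu < 2 \<and> L.hcov pa A \<and> L.hcov pb B \<and> u \<in> part (W l) pu \<Longrightarrow>
          haar (fmult (L.tm A v) (L.sm B u)) = c * (-1) ^ pa * A u * B (L.act K v) \<and>
          haar (fmult (L.sm B u) (L.tm A v)) = c * (-1) ^ pb * B v * A (L.sa (kword km) u)"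
        using P.G_forms[OF refl hbl] unfolding km by blast
      have SD: "SDq sc (W l) (d l) (w l) K = (\<Sum>b\<in>bl. (-1) ^ vpar (W l) b * L.cf bl b (L.act K b))"
        unfolding SDq_def L.mat_elem_tm bl_def L.tm_def sum.reindex[OF injl] by simp
      \<comment> \<open>The product with c being 1 also shows that the superdimension is not
        0.\<close>
      have cSD: "c = 1 / SDq sc (W l) (d l) (w l) K"
        using c1 unfolding SD[symmetric] by (metis nonzero_eq_divide_eq mult_zero_right zero_neq_one)
      have r': "r \<in> {1..d l}" and s': "s \<in> {1..d l}" using r s True by simp_all
      have wir: "L.cf bl (w l i) (w l r) = (if i = r then 1 else 0)"
        using L.cf_basis[OF hbl wl[OF r'], of "w l i"] inj_onD[OF injl _ i r'] by auto
      have wjs: "L.cf bl (w l j) (w l s) = (if j = s then 1 else 0)"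
        using L.cf_basis[OF hbl wl[OF s'], of "w l j"] inj_onD[OF injl _ j s'] by auto
      have tsj: "t l s j K = L.cf bl (w l s) (L.act K (w l j))" by (simp add: tl L.tm_def)
      have tir: "t' l i r K = (-1) ^ (p l r * (p l r + p l i)) * L.cf bl (w l r) (L.sa (kword km) (w l i))"
        unfolding dl km using L.sm_wrd[OF covs(1) covs(3)[OF wl[OF i]]] by simp
      \<comment> \<open>K is even, so a coefficient between vectors of different parity vanishes. In
        the remaining case p l s = p l j, and the sign of the dual matrix element, the (-1)^[A] of
        the integral and the sign in the claim multiply to 1.\<close>
      have sj0: "L.cf bl (w l s) (L.act K (w l j)) = 0" if "p l s \<noteq> p l j"
        using L.hcovD[of "p l s" "L.cf bl (w l s)" "p l j"] plp[OF s'] plp[OF j] that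
          L.act_word_part[of "p l j" "w l j" "kword km"] by (simp add: km)
      have ri0: "L.cf bl (w l r) (L.sa (kword km) (w l i)) = 0" if "p l r \<noteq> p l i"
        using L.hcovD[of "p l r" "L.cf bl (w l r)" "p l i"] plp[OF r'] plp[OF i] that
          L.sa_part[of "p l i" "w l i" "kword km"] by simp
      have g1: "haar (fmult (L.tm (L.cf bl (w l i)) (w l j)) (L.sm (L.cf bl (w l s)) (w l r)))
          = c * (-1) ^ p l i * L.cf bl (w l i) (w l r) * L.cf bl (w l s) (L.act K (w l j))"
        using c2[OF covs(3)[OF wl[OF j]]] plp[OF i] plp[OF s'] plp[OF r'] by blast
      have g2: "haar (fmult (L.sm (L.cf bl (w l j)) (w l i)) (L.tm (L.cf bl (w l r)) (w l s)))
          = c * (-1) ^ p l j * L.cf bl (w l j) (w l s) * L.cf bl (w l r) (L.sa (kword km) (w l i))"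
        using c2[OF covs(3)[OF wl[OF s']]] plp[OF i] plp[OF j] plp[OF r'] by blast
      have "haar (fmult (t l i j) (t' m r s)) * (-1) ^ (p l j * p m r + p l i + p l j)
        = (if i = r then t l s j K / SDq sc (W l) (d l) (w l) K else 0)"
        unfolding True[symmetric] unfolding h1[unfolded True[symmetric] bml] g1 wir tsj
        using sj0 plp[OF i] plp[OF j] plp[OF s'] by (cases "p l s = p l j") (auto simp: cSD less_2_cases_iff)
      moreover have "haar (fmult (t' l i j) (t m r s)) * (-1) ^ (p l j * p m r)
        = (if j = s then t' l i r K / SDq sc (W l) (d l) (w l) K else 0)"
        unfolding True[symmetric] unfolding h2[unfolded True[symmetric] bml] g2 wjs tir
        using ri0 plp[OF i] plp[OF j] plp[OF r'] by (cases "p l r = p l i") (auto simp: cSD less_2_cases_iff)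
      ultimately show ?thesis using True by simp
    qed
    then show "haar (fmult (t l i j) (t' m r s)) * (-1) ^ (p l j * p m r + p l i + p l j)
      = (if l = m \<and> i = r then t l s j K / SDq sc (W l) (d l) (w l) K else 0)"
      "haar (fmult (t' l i j) (t m r s)) * (-1) ^ (p l j * p m r)
      = (if l = m \<and> j = s then t' l i r K / SDq sc (W l) (d l) (w l) K else 0)" by blast+
  qed
qed

end
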